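(* Let $n,\bar n \geq 0$ be integers, let $A \in GL_n(\mathbb{Q})$ and $\bar A \in GL_{\bar n}(\mathbb{Q})$, and let $L \leq \mathbb{Z}^n \cap A^{-1}(\mathbb{Z}^n)$ and $\bar L \leq \mathbb{Z}^{\bar n} \cap \bar A^{-1}(\mathbb{Z}^{\bar n})$ be finite index subgroups. Then $G(A,L) \cong G(\bar A,\bar L)$ if and only if $n = \bar n$ and at least one of the following three conditions holds: (i) there exists a matrix $B \in GL_n(\mathbb{Z})$ such that either $\bar A = BAB^{-1}$ and $\bar L = BL$, or $\bar A = BA^{-1}B^{-1}$ and $\bar L = BAL$; (ii) $L = \mathbb{Z}^n$ or $AL = \mathbb{Z}^n$; $\bar L = \mathbb{Z}^n$ or $\bar A\bar L = \mathbb{Z}^n$; and there exists a matrix $B \in GL_n(\mathbb{Q})$ such that $\bar A = BA^{\varepsilon}B^{-1}$ for some $\varepsilon \in \{\pm 1\}$ and $\bigcup_{j \in \mathbb{Z}} A^j(\mathbb{Z}^n) = \bigcup_{j \in \mathbb{Z}} A^jB^{-1}(\mathbb{Z}^n)$; (iii) $n \geq 1$, $L = AL = \bar L = \bar A\bar L = \mathbb{Z}^n$, and there exists a matrix $C \in GL_{n-1}(\mathbb{Z})$ of finite order $m < \infty$ such that $A$ and $\bar A$ are conjugate in $GL_n(\mathbb{Z})$ to $\begin{pmatrix} 1 & \mathbf{0}^T \\ \mathbf{u} & C \end{pmatrix}$ and $\begin{pmatrix} 1 & \mathbf{0}^T \\ \mathbf{u} & C^q \end{pmatrix}$, respectively,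 for some $\mathbf{u} \in \mathbb{Z}^{n-1}$ and some $q \in \mathbb{Z}$ with $\gcd(q,m) = 1$.
   Context: For $n \geq 0$, $A \in GL_n(\mathbb{Q})$ and a finite index subgroup $L$ of $\mathbb{Z}^n \cap A^{-1}(\mathbb{Z}^n)$, the Leary--Minasyan group $G(A,L)$ is the group with presentation $$G(A,L) = \langle x_1,\ldots,x_n,t \mid [x_i,x_j]=1 \text{ for } 1 \leq i<j \leq n,\ t\mathbf{x}^{\mathbf{v}}t^{-1} = \mathbf{x}^{A\mathbf{v}} \text{ for } \mathbf{v} \in L\rangle,$$ where $\mathbf{x}^{\mathbf{w}} := x_1^{w_1}\cdots x_n^{w_n}$ for $\mathbf{w}=(w_1,\ldots,w_n) \in \mathbb{Z}^n$. For a matrix $M$ and a subgroup $S$ of $\mathbb{Q}^n$, $MS = M(S)$ denotes the image $\{M\mathbf{v} \mid \mathbf{v}\in S\}$; $A^{-1}(\mathbb{Z}^n)$ is the image of $\mathbb{Z}^n$ under $A^{-1}$. $GL_0$ denotes the trivial group. *)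

theory Defs
  imports
    "HOL-Algebra.Multiplicative_Group"
    "Jordan_Normal_Form.Matrix"
begin

section \<open>Free groups and group presentations\<close>

text \<open>
  A letter is a generator together with a sign: \<open>(s, True)\<close> stands for \<open>s\<close> and \<open>(s, False)\<close> for
  its inverse. The free group on \<open>S\<close> consists of the reduced words over \<open>S\<close>, multiplied by
  concatenation followed by free reduction.
\<close>

type_synonym 'a word = "('a \<times> bool) list"

definition letter_inv :: "'a \<times> bool \<Rightarrow> 'a \<times> bool" where
  "letter_inv a = (fst a, \<not> snd a)"

definition reduced :: "'a word \<Rightarrow> bool" where
  "reduced w \<longleftrightarrow> successively (\<lambda>a b. b \<noteq> letter_inv a) w"

definition cancel_cons :: "'a \<times> bool \<Rightarrow> 'a word \<Rightarrow> 'a word" where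
  "cancel_cons a w = (if w \<noteq> [] \<and> hd w = letter_inv a then tl w else a # w)"

definition reduce :: "'a word \<Rightarrow> 'a word" where
  "reduce w = foldr cancel_cons w []"

definition free_group :: "'a set \<Rightarrow> 'a word monoid" where
  "free_group S = \<lparr>carrier = {w. reduced w \<and> set w \<subseteq> S \<times> UNIV},
                   monoid.mult = (\<lambda>u v. reduce (u @ v)), one = []\<rparr>"

definition normal_closure :: "('a, 'b) monoid_scheme \<Rightarrow> 'a set \<Rightarrow> 'a set" where
  "normal_closure G R = \<Inter>{N. N \<lhd> G \<and> R \<subseteq> N}"

text \<open>The group \<open>\<langle>S | r = 1 for r \<in> R\<rangle>\<close>.\<close>

definition presented_group :: "'a set \<Rightarrow> 'a word set \<Rightarrow> 'a word set monoid" where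
  "presented_group S R = free_group S Mod normal_closure (free_group S) R"

lemma letter_inv_inv [simp]: "letter_inv (letter_inv a) = a"
  by (simp add: letter_inv_def)

lemma reduced_Cons: "reduced (a # w) \<longleftrightarrow> reduced w \<and> (w \<noteq> [] \<longrightarrow> hd w \<noteq> letter_inv a)"
  by (cases w) (auto simp: reduced_def)

lemma reduced_cancel_cons: "reduced w \<Longrightarrow> reduced (cancel_cons a w)"
  by (cases w) (auto simp: cancel_cons_def reduced_Cons)

lemma cancel_cons_inv:
  "reduced w \<Longrightarrow> cancel_cons a (cancel_cons (letter_inv a) w) = w"
  by (cases w) (auto simp: cancel_cons_def reduced_Cons split: if_splits)

lemma reduced_foldr: "reduced w \<Longrightarrow> reduced (foldr cancel_cons u w)"
  by (induction u) (auto intro: reduced_cancel_cons)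

lemma reduced_reduce: "reduced (reduce w)"
  unfolding reduce_def by (rule reduced_foldr) (simp add: reduced_def)

lemma reduce_reduced: "reduced w \<Longrightarrow> reduce w = w"
  unfolding reduce_def by (induction w) (auto simp: reduced_Cons cancel_cons_def)

lemma set_cancel_cons: "set (cancel_cons a w) \<subseteq> insert a (set w)"
  by (cases w) (auto simp: cancel_cons_def)

lemma set_reduce: "set (reduce w) \<subseteq> set w"
  unfolding reduce_def
proof (induction w)
  case (Cons a w)
  then show ?case using set_cancel_cons[of a "foldr cancel_cons w []"] by auto
qed simp

lemma foldr_cancel_cons:
  assumes "reduced w"
  shows "foldr cancel_cons (cancel_cons a u) w = cancel_cons a (foldr cancel_cons u w)"
proof (cases "u \<noteq> [] \<and> hd u = letter_inv a")
  case True
  then obtain u' where u: "u = letter_inv a # u'" by (cases u) auto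
  show ?thesis
    using assms by (simp add: u cancel_cons_def[of a "letter_inv a # u'"] cancel_cons_inv reduced_foldr)
qed (auto simp: cancel_cons_def[of a u])

lemma foldr_reduce: "reduced w \<Longrightarrow> foldr cancel_cons (reduce u) w = foldr cancel_cons u w"
proof (induction u)
  case (Cons a u)
  then show ?case using foldr_cancel_cons[of w a "reduce u"] by (simp add: reduce_def)
qed (simp add: reduce_def)

lemma reduce_append: "reduce (u @ v) = foldr cancel_cons u (reduce v)"
  by (simp add: reduce_def)

lemma reduce_append_reduce_left: "reduce (reduce u @ v) = reduce (u @ v)"
  by (simp add: reduce_append foldr_reduce reduced_reduce)

lemma reduce_append_reduce_right: "reduce (u @ reduce v) = reduce (u @ v)"
  by (simp add: reduce_append reduce_reduced reduced_reduce)

lemma reduce_inverse_word: "reduce (rev (map letter_inv w) @ w) = []"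
proof (induction w)
  case Nil
  then show ?case by (simp add: reduce_def)
next
  case (Cons a w)
  have "reduce (rev (map letter_inv (a # w)) @ a # w)
        = foldr cancel_cons (rev (map letter_inv w))
            (cancel_cons (letter_inv a) (cancel_cons a (reduce w)))"
    by (simp add: reduce_def)
  also have "cancel_cons (letter_inv a) (cancel_cons a (reduce w)) = reduce w"
    using cancel_cons_inv[OF reduced_reduce, of "letter_inv a"] by simp
  finally show ?case using Cons by (simp add: reduce_append)
qed

lemma group_free_group: "group (free_group S)"
proof (rule groupI)
  fix x y assume "x \<in> carrier (free_group S)" "y \<in> carrier (free_group S)"
  then show "x \<otimes>\<^bsub>free_group S\<^esub> y \<in> carrier (free_group S)"
    using set_reduce[of "x @ y"] by (auto simp: free_group_def reduced_reduce)
next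
  fix x assume x: "x \<in> carrier (free_group S)"
  let ?y = "reduce (rev (map letter_inv x))"
  have "set x \<subseteq> S \<times> UNIV"
    using x by (simp add: free_group_def)
  then have "letter_inv ` set x \<subseteq> S \<times> UNIV"
    by (auto simp: letter_inv_def)
  then have "?y \<in> carrier (free_group S)"
    using set_reduce[of "rev (map letter_inv x)"] by (auto simp: free_group_def reduced_reduce)
  moreover have "?y \<otimes>\<^bsub>free_group S\<^esub> x = \<one>\<^bsub>free_group S\<^esub>"
    by (simp add: free_group_def reduce_append_reduce_left reduce_inverse_word)
  ultimately show "\<exists>y\<in>carrier (free_group S). y \<otimes>\<^bsub>free_group S\<^esub> x = \<one>\<^bsub>free_group S\<^esub>"
    by blast
qed (auto simp: free_group_def reduce_reduced reduce_append_reduce_left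
        reduce_append_reduce_right reduced_def[of "[]"])

lemma normal_normal_closure:
  assumes "group G" "R \<subseteq> carrier G"
  shows "normal_closure G R \<lhd> G"
proof -
  interpret group G by fact
  have "carrier G \<lhd> G"
    by (rule normal_invI) (auto intro: subgroup_self)
  then have ne: "carrier G \<in> {N. N \<lhd> G \<and> R \<subseteq> N}"
    using assms(2) by blast
  have "subgroup (normal_closure G R) G"
    unfolding normal_closure_def
    by (rule subgroups_Inter) (use ne in \<open>auto intro: normal_imp_subgroup\<close>)
  then show ?thesis
    by (rule normal_invI) (auto simp: normal_closure_def normal_inv_iff)
qed

lemma group_presented_group:
  "R \<subseteq> carrier (free_group S) \<Longrightarrow> group (presented_group S R)"
  unfolding presented_group_def
  by (intro normal.factorgroup_is_group normal_normal_closure group_free_group)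


section \<open>Rational lattices and linear groups\<close>

text \<open>
  All lattices are sets of rational column vectors, including \<open>\<int>\<^sup>n\<close>; likewise \<open>GL\<^sub>n(\<int>)\<close> is
  regarded as a set of rational matrices.
\<close>

definition Zvec :: "nat \<Rightarrow> rat vec set" where
  "Zvec n = map_vec of_int ` (carrier_vec n :: int vec set)"

definition GLQ :: "nat \<Rightarrow> rat mat monoid" where
  "GLQ n = units_of (ring_mat TYPE(rat) n ())"

definition GLZ :: "nat \<Rightarrow> rat mat set" where
  "GLZ n = map_mat of_int ` Units (ring_mat TYPE(int) n ())"

definition mat_image :: "rat mat \<Rightarrow> rat vec set \<Rightarrow> rat vec set" where
  "mat_image M S = (\<lambda>v. M *\<^sub>v v) ` S"

text \<open>The lattice \<open>\<int>\<^sup>n \<inter> A\<^sup>-\<^sup>1(\<int>\<^sup>n)\<close>, the largest subgroup of \<open>\<int>\<^sup>n\<close> that \<open>A\<close> maps into \<open>\<int>\<^sup>n\<close>.\<close>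

definition max_domain :: "nat \<Rightarrow> rat mat \<Rightarrow> rat vec set" where
  "max_domain n A = Zvec n \<inter> mat_image (inv\<^bsub>GLQ n\<^esub> A) (Zvec n)"

definition finite_index_subgroup :: "'a set \<Rightarrow> ('a, 'b) monoid_scheme \<Rightarrow> bool" where
  "finite_index_subgroup H G \<longleftrightarrow> subgroup H G \<and> finite (rcosets\<^bsub>G\<^esub> H)"

definition admissible :: "nat \<Rightarrow> rat mat \<Rightarrow> rat vec set \<Rightarrow> bool" where
  "admissible n A L \<longleftrightarrow>
     finite_index_subgroup L (monoid_vec TYPE(rat) n\<lparr>carrier := max_domain n A\<rparr>)"

lemma group_GLQ: "group (GLQ n)"
  unfolding GLQ_def by (intro monoid.units_group ring.is_monoid ring_mat)


section \<open>Leary--Minasyan groups\<close>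

text \<open>The stable letter \<open>t\<close> is \<open>T\<close>; the generators \<open>x\<^sub>1, \<dots>, x\<^sub>n\<close> are \<open>X 0, \<dots>, X (n - 1)\<close>.\<close>

datatype lm_gen = X nat | T

definition lm_gens :: "nat \<Rightarrow> lm_gen set" where
  "lm_gens n = insert T (X ` {..<n})"

abbreviation lm_free :: "nat \<Rightarrow> lm_gen word monoid" where
  "lm_free n \<equiv> free_group (lm_gens n)"

text \<open>
  The word whose factors are the powers \<open>x\<^sub>i ^ w\<^sub>i\<close>, in the order \<open>i = 1, \<dots>, n\<close>. It is only used
  for \<open>w\<close> in \<open>\<int>\<^sup>n\<close>, where the floor merely converts an integral rational to an integer.
\<close>

definition x_pow :: "nat \<Rightarrow> rat vec \<Rightarrow> lm_gen word" where
  "x_pow n w =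
     foldr (\<lambda>i u. ([(X i, True)] [^]\<^bsub>lm_free n\<^esub> \<lfloor>w $ i\<rfloor>) \<otimes>\<^bsub>lm_free n\<^esub> u) [0..<n] \<one>\<^bsub>lm_free n\<^esub>"

text \<open>A relation \<open>l = r\<close> is encoded by the relator \<open>l r\<^sup>-\<^sup>1\<close>.\<close>

definition lm_relators :: "nat \<Rightarrow> rat mat \<Rightarrow> rat vec set \<Rightarrow> lm_gen word set" where
  "lm_relators n A L =
     (let F = lm_free n; x = (\<lambda>i. [(X i, True)]); t = [(T, True)] in
       {x i \<otimes>\<^bsub>F\<^esub> x j \<otimes>\<^bsub>F\<^esub> inv\<^bsub>F\<^esub> (x i) \<otimes>\<^bsub>F\<^esub> inv\<^bsub>F\<^esub> (x j) | i j. i < j \<and> j < n} \<union>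
       {t \<otimes>\<^bsub>F\<^esub> x_pow n v \<otimes>\<^bsub>F\<^esub> inv\<^bsub>F\<^esub> t \<otimes>\<^bsub>F\<^esub> inv\<^bsub>F\<^esub> (x_pow n (A *\<^sub>v v)) | v. v \<in> L})"

definition lm_group :: "nat \<Rightarrow> rat mat \<Rightarrow> rat vec set \<Rightarrow> lm_gen word set monoid" where
  "lm_group n A L = presented_group (lm_gens n) (lm_relators n A L)"

lemma lm_gen_closed:
  "T \<in> lm_gens n" "i < n \<Longrightarrow> X i \<in> lm_gens n"
  "s \<in> lm_gens n \<Longrightarrow> [(s, b)] \<in> carrier (lm_free n)"
  by (auto simp: lm_gens_def free_group_def reduced_def)

lemma x_pow_closed: "x_pow n w \<in> carrier (lm_free n)"
proof -
  interpret F: group "lm_free n" by (rule group_free_group)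
  have "foldr (\<lambda>i u. ([(X i, True)] [^]\<^bsub>lm_free n\<^esub> \<lfloor>w $ i\<rfloor>) \<otimes>\<^bsub>lm_free n\<^esub> u) is \<one>\<^bsub>lm_free n\<^esub>
        \<in> carrier (lm_free n)" if "set is \<subseteq> {..<n}" for "is"
    using that by (induction "is") (auto intro!: F.m_closed F.int_pow_closed lm_gen_closed)
  from this[of "[0..<n]"] show ?thesis
    unfolding x_pow_def by (simp add: lessThan_atLeast0)
qed

lemma group_lm_group: "group (lm_group n A L)"
proof -
  interpret F: group "lm_free n" by (rule group_free_group)
  have "lm_relators n A L \<subseteq> carrier (lm_free n)"
    unfolding lm_relators_def Let_def
    by (auto intro!: F.m_closed F.inv_closed x_pow_closed lm_gen_closed)
  then show ?thesis unfolding lm_group_def by (rule group_presented_group)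
qed


section \<open>The block matrices of the finite-order case\<close>

definition lower_block :: "nat \<Rightarrow> rat vec \<Rightarrow> rat mat \<Rightarrow> rat mat" where
  "lower_block n u C =
     four_block_mat (1\<^sub>m 1) (0\<^sub>m 1 (n - 1)) (mat_of_cols (n - 1) [u]) C"

definition conjugate_GLZ :: "nat \<Rightarrow> rat mat \<Rightarrow> rat mat \<Rightarrow> bool" where
  "conjugate_GLZ n M N \<longleftrightarrow> (\<exists>P\<in>GLZ n. N = P * M * inv\<^bsub>GLQ n\<^esub> P)"

end

theory Submission
  imports Defs
begin

text \<open>
  If \<open>L\<close> or \<open>A L\<close> is \<open>\<int>\<^sup>n\<close>, then \<open>G(A, L)\<close> is the semidirect product of \<open>U = \<Union>\<^sub>j A\<^sup>j(\<int>\<^sup>n)\<close> with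
  \<open>\<int>\<close>, hence metabelian. An isomorphism of two such products either maps \<open>U\<close> onto \<open>U'\<close>, which is
  (ii), or the exponents of the images of \<open>u \<in> U\<close> form a nonzero \<open>A\<close>-invariant linear form. Since
  \<open>U\<close> is commutative, a power of \<open>A\<close> then acts trivially on the kernel of this form; this makes \<open>A\<close>
  and \<open>A'\<close> integral and yields the block form of (iii). Conversely, in the situation of (iii) an
  element \<open>(v\<^sub>1, q)\<close> of the product can serve as a new stable letter.

  Otherwise \<open>G(A, L)\<close> is an HNN extension with two proper edge groups. Van der Waerden's method, an
  action of the group on normal forms, shows that it is not metabelian, and ping-pong on normal forms
  shows that an element \<open>k\<close> that commutes with a power of each of its conjugates must be conjugate into
  \<open>\<int>\<^sup>n\<close>. Since commuting elements of this kind fix a common vertex of the Bass--Serre tree, every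
  isomorphism maps \<open>\<int>\<^sup>n\<close>, up to conjugation, onto \<open>\<int>\<^sup>n\<close>, that is, by some \<open>B \<in> GL\<^sub>n(\<int>)\<close>. The
  elements that translate by one edge then recover \<open>L\<close> and \<open>A\<close> up to inversion, which is (i).
\<close>

section \<open>Rational linear algebra\<close>

text \<open>The presentation alone yields homomorphisms out of \<open>G\<close>
  (\<open>hom_exists\<close>), but no proof that two elements differ; concrete targets supply that.
  Permutations of normal forms detect cosets of the base group. The semidirect product of Q^n with
  the integers shows that \<open>x\<close> is injective and that conjugation acts on integral
  vectors by powers of \<open>A\<close>. The tree itself is never constructed: the vertex
  \<open>gH\<close> is the list part of the normal form of \<open>g\<close>, and \<open>x u\<close>
  fixes it exactly when it reproduces this list (\<open>conj_H_iff\<close>). The commutation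
  property holds for \<open>H\<close> because \<open>H\<close> is commensurable with each of its
  conjugates; this is where the finite index of \<open>L\<close> enters, in the form that every
  integral vector has a multiple in \<open>L\<close>. Applying the property to an isomorphism and to
  its inverse leaves two inclusions between conjugates, which collapse because a whole base group
  fixes a single vertex. The ascending case has no such argument, since \<open>U\<close> need not be
  invariant under isomorphisms. There the failure is measured by one integral linear form, and
  twisting the stable letter removes it.\<close>

lemma mult_GLQ [simp]: "x \<otimes>\<^bsub>GLQ n\<^esub> y = x * y"
  by (simp add: GLQ_def units_of_mult ring_mat_simps)

lemma one_GLQ [simp]: "\<one>\<^bsub>GLQ n\<^esub> = 1\<^sub>m n"
  by (simp add: GLQ_def units_of_one ring_mat_simps)

lemma GLQ_I:
  fixes A B :: "rat mat"
  assumes "A \<in> carrier_mat n n" "B \<in> carrier_mat n n" "A * B = 1\<^sub>m n" "B * A = 1\<^sub>m n"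
  shows "A \<in> carrier (GLQ n)" "inv\<^bsub>GLQ n\<^esub> A = B"
proof -
  have *: "A \<in> carrier (GLQ n)" "B \<in> carrier (GLQ n)"
    using assms by (auto simp: GLQ_def units_of_carrier Units_def ring_mat_simps)
  then show "A \<in> carrier (GLQ n)" by simp
  show "inv\<^bsub>GLQ n\<^esub> A = B"
    using group.inv_equality[OF group_GLQ, of n B A] * assms(4) by simp
qed

lemma GLQ_carrier_mat: "A \<in> carrier (GLQ n) \<Longrightarrow> A \<in> carrier_mat n n"
  by (auto simp: GLQ_def units_of_carrier Units_def ring_mat_simps)

lemma GLQ_inv:
  assumes "A \<in> carrier (GLQ n)"
  shows "inv\<^bsub>GLQ n\<^esub> A \<in> carrier (GLQ n)" "inv\<^bsub>GLQ n\<^esub> A \<in> carrier_mat n n"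
    "A * inv\<^bsub>GLQ n\<^esub> A = 1\<^sub>m n" "inv\<^bsub>GLQ n\<^esub> A * A = 1\<^sub>m n"
  using group.inv_closed[OF group_GLQ assms] group.r_inv[OF group_GLQ assms]
    group.l_inv[OF group_GLQ assms] GLQ_carrier_mat by auto

lemma GLQ_mult: "A \<in> carrier (GLQ n) \<Longrightarrow> B \<in> carrier (GLQ n) \<Longrightarrow> A * B \<in> carrier (GLQ n)"
  using monoid.m_closed[OF group.is_monoid[OF group_GLQ], of A n B] by simp

lemma GLQ_inv_mult:
  "A \<in> carrier (GLQ n) \<Longrightarrow> B \<in> carrier (GLQ n) \<Longrightarrow>
    inv\<^bsub>GLQ n\<^esub> (A * B) = inv\<^bsub>GLQ n\<^esub> B * inv\<^bsub>GLQ n\<^esub> A"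
  using group.inv_mult_group[OF group_GLQ, of A n B] by simp

lemma GLQ_inv_inv: "A \<in> carrier (GLQ n) \<Longrightarrow> inv\<^bsub>GLQ n\<^esub> (inv\<^bsub>GLQ n\<^esub> A) = A"
  using group.inv_inv[OF group_GLQ, of A n] by simp

lemma GLQ_inv_cancel:
  assumes "A \<in> carrier (GLQ n)" "v \<in> carrier_vec n"
  shows "A *\<^sub>v (inv\<^bsub>GLQ n\<^esub> A *\<^sub>v v) = v" "inv\<^bsub>GLQ n\<^esub> A *\<^sub>v (A *\<^sub>v v) = v"
  using GLQ_inv[OF assms(1)] GLQ_carrier_mat[OF assms(1)] assms(2)
  by (metis assoc_mult_mat_vec one_mult_mat_vec)+

lemma mult_mat_vec_closed [simp]:
  "A \<in> carrier_mat m n \<Longrightarrow> A *\<^sub>v v \<in> carrier_vec m"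
  by (intro carrier_vecI) auto

text \<open>Powers are formed in the group \<open>GLQ n\<close>, so negative \<open>k\<close> is
  allowed. In the semidirect products below this is conjugation by the \<open>k\<close>-th power of
  the stable letter.\<close>

definition mact :: "nat \<Rightarrow> rat mat \<Rightarrow> int \<Rightarrow> rat vec \<Rightarrow> rat vec" where
  "mact n A k v = (A [^]\<^bsub>GLQ n\<^esub> k) *\<^sub>v v"

lemma GLQ_int_pow: 
  assumes "A \<in> carrier (GLQ n)"
  shows "A [^]\<^bsub>GLQ n\<^esub> (k::int) \<in> carrier (GLQ n)" "A [^]\<^bsub>GLQ n\<^esub> (k::int) \<in> carrier_mat n n"
  using group.int_pow_closed[OF group_GLQ assms] GLQ_carrier_mat by auto

lemma GLQ_int_pow_add:
  "A \<in> carrier (GLQ n) \<Longrightarrow> A [^]\<^bsub>GLQ n\<^esub> (j + k :: int) = A [^]\<^bsub>GLQ n\<^esub> j * A [^]\<^bsub>GLQ n\<^esub> k"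
  using group.int_pow_mult[OF group_GLQ, of A n j k] by simp

lemma GLQ_int_pow_neg1: "A \<in> carrier (GLQ n) \<Longrightarrow> A [^]\<^bsub>GLQ n\<^esub> (- 1 :: int) = inv\<^bsub>GLQ n\<^esub> A"
  using group.int_pow_neg[OF group_GLQ, of A n 1] group.int_pow_1[OF group_GLQ, of A n] by simp

lemma GLQ_int_pow_1: "A \<in> carrier (GLQ n) \<Longrightarrow> A [^]\<^bsub>GLQ n\<^esub> (1 :: int) = A"
  using group.int_pow_1[OF group_GLQ, of A n] by simp

context
  fixes n :: nat and A :: "rat mat"
  assumes A: "A \<in> carrier (GLQ n)"
begin

lemma mact_closed [simp]: "mact n A k v \<in> carrier_vec n"
  using GLQ_int_pow[OF A, of k] by (simp add: mact_def)

lemma mact_0: "v \<in> carrier_vec n \<Longrightarrow> mact n A 0 v = v"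
  by (simp add: mact_def)

lemma mact_1: "mact n A 1 v = A *\<^sub>v v"
  using A by (simp add: mact_def GLQ_int_pow_1)

lemma mact_neg1: "mact n A (- 1) v = inv\<^bsub>GLQ n\<^esub> A *\<^sub>v v"
  using A by (simp add: mact_def GLQ_int_pow_neg1)

lemma mact_plus: "v \<in> carrier_vec n \<Longrightarrow> mact n A (j + k) v = mact n A j (mact n A k v)"
  using GLQ_int_pow[OF A] assoc_mult_mat_vec unfolding mact_def GLQ_int_pow_add[OF A] by blast

lemma mact_cancel [simp]:
  "v \<in> carrier_vec n \<Longrightarrow> mact n A k (mact n A (- k) v) = v"
  "v \<in> carrier_vec n \<Longrightarrow> mact n A (- k) (mact n A k v) = v"
  using mact_plus[of v k "- k"] mact_plus[of v "- k" k] by (simp_all add: mact_0)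

lemma mact_add:
  "v \<in> carrier_vec n \<Longrightarrow> w \<in> carrier_vec n \<Longrightarrow> mact n A k (v + w) = mact n A k v + mact n A k w"
  using GLQ_int_pow(2)[OF A, of k] by (simp add: mact_def mult_add_distrib_mat_vec)

lemma mact_minus:
  "v \<in> carrier_vec n \<Longrightarrow> w \<in> carrier_vec n \<Longrightarrow> mact n A k (v - w) = mact n A k v - mact n A k w"
  using GLQ_int_pow(2)[OF A, of k] by (simp add: mact_def mult_minus_distrib_mat_vec)

lemma mact_smult:
  "v \<in> carrier_vec n \<Longrightarrow> mact n A k (c \<cdot>\<^sub>v v) = c \<cdot>\<^sub>v mact n A k v"
  using GLQ_int_pow(2)[OF A, of k] by (simp add: mact_def mult_mat_vec)

lemma mact_zero: "mact n A k (0\<^sub>v n) = 0\<^sub>v n"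
proof -
  have z: "0 \<cdot>\<^sub>v v = 0\<^sub>v n" if "v \<in> carrier_vec n" for v :: "rat vec" using that by auto
  show ?thesis using mact_smult[of "0\<^sub>v n" k 0] by (simp add: z)
qed

lemma mact_uminus: "v \<in> carrier_vec n \<Longrightarrow> mact n A k (- v) = - mact n A k v"
  using mact_minus[of "0\<^sub>v n" v k] by (simp add: mact_zero)

end

lemma mact_inv:
  assumes "A \<in> carrier (GLQ n)"
  shows "mact n (inv\<^bsub>GLQ n\<^esub> A) k = mact n A (- k)"
  unfolding mact_def
  using group.int_pow_inv[OF group_GLQ assms, of k] group.int_pow_neg[OF group_GLQ assms, of k]
  by simp

text \<open>The relation passes to the inverse of \<open>A\<close> by inserting
  \<open>mact n A (- 1) v\<close>; induction in both directions then covers all exponents.\<close>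

lemma mact_conj:
  assumes A: "A \<in> carrier (GLQ n)" and A': "A' \<in> carrier (GLQ n)" and B: "B \<in> carrier_mat n n"
    and eq: "A' * B = B * A" and v: "v \<in> carrier_vec n"
  shows "mact n A' k (B *\<^sub>v v) = B *\<^sub>v mact n A k v"
proof -
  have 1: "mact n A' 1 (B *\<^sub>v v) = B *\<^sub>v mact n A 1 v" if "v \<in> carrier_vec n" for v
    using A A' B eq that GLQ_carrier_mat[OF A] GLQ_carrier_mat[OF A']
    by (metis mact_1 assoc_mult_mat_vec)
  have m1: "mact n A' (-1) (B *\<^sub>v v) = B *\<^sub>v mact n A (-1) v" if "v \<in> carrier_vec n" for v
    using 1[of "mact n A (-1) v"] A A' B that
    by (metis mact_closed mact_cancel(1) mact_cancel(2) mult_mat_vec_closed)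
  show ?thesis
  proof (induction k rule: int_induct[where k = 0])
    case base
    then show ?case using A A' B v by (simp add: mact_0)
  next
    case (step1 i)
    then show ?case using A A' B v 1[of "mact n A i v"]
      by (metis mact_plus mact_closed mult_mat_vec_closed add.commute)
  next
    case (step2 i)
    then show ?case using A A' B v m1[of "mact n A i v"]
      by (metis mact_plus mact_closed mult_mat_vec_closed add.commute diff_conv_add_uminus)
  qed
qed

lemma mat_eq_by_unit_vecs:
  fixes A B :: "rat mat"
  assumes "A \<in> carrier_mat m n" "B \<in> carrier_mat m n"
    and "\<And>j. j < n \<Longrightarrow> A *\<^sub>v unit_vec n j = B *\<^sub>v unit_vec n j"
  shows "A = B"
proof (rule eq_matI)
  fix i j assume ij: "i < dim_row B" "j < dim_col B"
  then have "(A *\<^sub>v unit_vec n j) $ i = (B *\<^sub>v unit_vec n j) $ i" using assms by auto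
  then show "A $$ (i, j) = B $$ (i, j)" using ij assms(1,2) by simp
qed (use assms in auto)

text \<open>Equality of the traces of \<open>B * C\<close> and \<open>C * B\<close> forces
  \<open>m = n\<close>, because the rationals have characteristic zero.\<close>

lemma mutually_inverse_dims:
  fixes B C :: "rat mat"
  assumes B: "B \<in> carrier_mat m n" and C: "C \<in> carrier_mat n m"
    and "B * C = 1\<^sub>m m" "C * B = 1\<^sub>m n"
  shows "m = n"
proof -
  have *: "(\<Sum>i<m. (B * C) $$ (i, i)) = (\<Sum>i<m. \<Sum>j<n. B $$ (i, j) * C $$ (j, i))"
    using B C by (auto simp: scalar_prod_def lessThan_atLeast0 intro!: sum.cong)
  also have "\<dots> = (\<Sum>j<n. \<Sum>i<m. C $$ (j, i) * B $$ (i, j))"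
    by (subst sum.swap) (simp add: mult.commute)
  also have "\<dots> = (\<Sum>j<n. (C * B) $$ (j, j))"
    using B C by (auto simp: scalar_prod_def lessThan_atLeast0 intro!: sum.cong)
  finally have "rat_of_nat m = rat_of_nat n" using assms(3,4) by simp
  then show ?thesis by simp
qed

section \<open>Lattices\<close>

definition vsub :: "nat \<Rightarrow> rat vec set \<Rightarrow> bool" where
  "vsub n U \<longleftrightarrow> U \<subseteq> carrier_vec n \<and> 0\<^sub>v n \<in> U \<and> (\<forall>u\<in>U. \<forall>v\<in>U. u + v \<in> U) \<and> (\<forall>u\<in>U. - u \<in> U)"

text \<open>Additive subgroups of Q^n are written multiplicatively so that \<open>hom\<close>,
  \<open>iso\<close> and integer powers apply to them.\<close>

definition vgrp :: "nat \<Rightarrow> rat vec set \<Rightarrow> rat vec monoid" where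
  "vgrp n U = \<lparr>carrier = U, monoid.mult = (+), one = 0\<^sub>v n\<rparr>"

lemma vgrp_simps [simp]:
  "carrier (vgrp n U) = U" "u \<otimes>\<^bsub>vgrp n U\<^esub> v = u + v" "\<one>\<^bsub>vgrp n U\<^esub> = 0\<^sub>v n"
  by (simp_all add: vgrp_def)

lemma vsubD:
  assumes "vsub n U"
  shows "u \<in> U \<Longrightarrow> u \<in> carrier_vec n" "0\<^sub>v n \<in> U" "u \<in> U \<Longrightarrow> v \<in> U \<Longrightarrow> u + v \<in> U"
    "u \<in> U \<Longrightarrow> - u \<in> U" "u \<in> U \<Longrightarrow> v \<in> U \<Longrightarrow> u - v \<in> U"
proof -
  show "u \<in> U \<Longrightarrow> u \<in> carrier_vec n" "0\<^sub>v n \<in> U" "u \<in> U \<Longrightarrow> v \<in> U \<Longrightarrow> u + v \<in> U"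
    "u \<in> U \<Longrightarrow> - u \<in> U"
    using assms by (auto simp: vsub_def)
  assume "u \<in> U" "v \<in> U"
  then have "u + - v \<in> U" "u \<in> carrier_vec n" "v \<in> carrier_vec n"
    using assms by (auto simp: vsub_def)
  then show "u - v \<in> U" using minus_add_uminus_vec by metis
qed

lemma comm_group_vgrp: "vsub n U \<Longrightarrow> comm_group (vgrp n U)"
proof (rule comm_groupI)
  fix x assume U: "vsub n U" "x \<in> carrier (vgrp n U)"
  then show "\<exists>y\<in>carrier (vgrp n U). y \<otimes>\<^bsub>vgrp n U\<^esub> x = \<one>\<^bsub>vgrp n U\<^esub>"
    by (intro bexI[of _ "- x"]) (use vsubD(1,4)[OF U(1)] in auto)
qed (auto simp: vsub_def subset_iff intro: comm_add_vec assoc_add_vec)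

lemma group_vgrp: "vsub n U \<Longrightarrow> group (vgrp n U)"
  using comm_group_vgrp comm_group.axioms(2) by blast

lemma inv_vgrp: "vsub n U \<Longrightarrow> u \<in> U \<Longrightarrow> inv\<^bsub>vgrp n U\<^esub> u = - u"
  using group.inv_equality[OF group_vgrp, of n U "- u" u] vsubD[of n U] by simp

lemma vsub_carrier: "vsub n (carrier_vec n)"
  by (auto simp: vsub_def)

lemma vsub_nat_smult:
  assumes "vsub n U" "u \<in> U"
  shows "of_nat m \<cdot>\<^sub>v u \<in> U"
proof (induction m)
  case 0
  have "0 \<cdot>\<^sub>v u = 0\<^sub>v n" using vsubD(1)[OF assms] by auto
  then show ?case using vsubD[OF assms(1)] by simp
next
  case (Suc m)
  have "of_nat (Suc m) \<cdot>\<^sub>v u = of_nat m \<cdot>\<^sub>v u + u"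
    by (auto simp: algebra_simps)
  then show ?case using Suc vsubD[OF assms(1)] assms by simp
qed

lemma vsub_int_smult:
  assumes "vsub n U" "u \<in> U"
  shows "of_int m \<cdot>\<^sub>v u \<in> U"
proof (cases "m \<ge> 0")
  case True
  then show ?thesis using vsub_nat_smult[OF assms, of "nat m"] by simp
next
  case False
  then have "of_int m \<cdot>\<^sub>v u = - (of_nat (nat (- m)) \<cdot>\<^sub>v u)" by auto
  then show ?thesis using vsub_nat_smult[OF assms] vsubD(4)[OF assms(1)] by simp
qed

lemma nat_pow_vgrp:
  assumes "vsub n U" "u \<in> U"
  shows "u [^]\<^bsub>vgrp n U\<^esub> (m::nat) = of_nat m \<cdot>\<^sub>v u"
proof (induction m)
  case 0
  then show ?case using vsubD(1)[OF assms] by auto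
next
  case (Suc m)
  then show ?case by (auto simp: algebra_simps)
qed

lemma int_pow_vgrp:
  assumes "vsub n U" "u \<in> U"
  shows "u [^]\<^bsub>vgrp n U\<^esub> (m::int) = of_int m \<cdot>\<^sub>v u"
proof (cases "m \<ge> 0")
  case True
  then show ?thesis using nat_pow_vgrp[OF assms, of "nat m"] by (simp add: int_pow_def2 del: pow_nat)
next
  case False
  then have *: "of_int m \<cdot>\<^sub>v u = - (of_nat (nat (- m)) \<cdot>\<^sub>v u)" by auto
  show ?thesis
    using False unfolding * 
    by (simp add: int_pow_def2 nat_pow_vgrp[OF assms] inv_vgrp[OF assms(1) vsub_nat_smult[OF assms]] 
      del: pow_nat of_nat_nat)
qed

lemma Zvec_iff: "v \<in> Zvec n \<longleftrightarrow> v \<in> carrier_vec n \<and> (\<forall>i<n. v $ i \<in> \<int>)"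
proof
  assume "v \<in> Zvec n"
  then show "v \<in> carrier_vec n \<and> (\<forall>i<n. v $ i \<in> \<int>)"
    by (auto simp: Zvec_def)
next
  assume *: "v \<in> carrier_vec n \<and> (\<forall>i<n. v $ i \<in> \<int>)"
  then have "v = map_vec of_int (vec n (\<lambda>i. \<lfloor>v $ i\<rfloor>))"
    by (intro eq_vecI) auto
  then show "v \<in> Zvec n" unfolding Zvec_def by (rule image_eqI) simp
qed

lemma Zvec_carrier: "v \<in> Zvec n \<Longrightarrow> v \<in> carrier_vec n"
  by (simp add: Zvec_iff)

lemma vsub_Zvec: "vsub n (Zvec n)"
  by (auto simp: vsub_def Zvec_iff)

lemma unit_vec_Zvec [simp]: "unit_vec n i \<in> Zvec n"
  by (auto simp: Zvec_iff unit_vec_def)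

text \<open>Every integral vector is a sum of multiples of unit vectors. The rule speaks of sums and
  negatives rather than of coordinates, so that it fits homomorphisms and membership in
  subgroups.\<close>

lemma Zvec_induct:
  assumes v: "v \<in> Zvec n" and unit: "\<And>i. i < n \<Longrightarrow> P (unit_vec n i)" and zero: "P (0\<^sub>v n)"
    and add: "\<And>u w. u \<in> Zvec n \<Longrightarrow> w \<in> Zvec n \<Longrightarrow> P u \<Longrightarrow> P w \<Longrightarrow> P (u + w)"
    and neg: "\<And>u. u \<in> Zvec n \<Longrightarrow> P u \<Longrightarrow> P (- u)"
  shows "P v"
proof -
  have smult: "P (of_int k \<cdot>\<^sub>v unit_vec n i)" if i: "i < n" for k i
  proof -
    have Z: "of_int m \<cdot>\<^sub>v unit_vec n i \<in> Zvec n" for m :: int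
      by (rule vsub_int_smult[OF vsub_Zvec unit_vec_Zvec])
    have "P (of_nat m \<cdot>\<^sub>v unit_vec n i)" for m
    proof (induction m)
      case 0
      have "0 \<cdot>\<^sub>v unit_vec n i = (0\<^sub>v n :: rat vec)" by auto
      then show ?case using zero by simp
    next
      case (Suc m)
      have "of_nat (Suc m) \<cdot>\<^sub>v unit_vec n i = (of_nat m \<cdot>\<^sub>v unit_vec n i + unit_vec n i :: rat vec)"
        by (auto simp: algebra_simps)
      then show ?case using Suc add[OF Z[of "int m"] unit_vec_Zvec] unit[OF i] by simp
    qed note nat = this
    show ?thesis
    proof (cases "k \<ge> 0")
      case True
      then show ?thesis using nat[of "nat k"] by simp
    next
      case False
      then have "of_int k \<cdot>\<^sub>v unit_vec n i = (- (of_int (- k) \<cdot>\<^sub>v unit_vec n i) :: rat vec)" by auto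
      then show ?thesis using neg[OF Z[of "-k"]] nat[of "nat (- k)"] False by simp
    qed
  qed
  \<comment> \<open>The vector \<open>?t j\<close> keeps the first \<open>j\<close> coordinates of
    \<open>v\<close>; they are switched on one at a time.\<close>
  let ?t = "\<lambda>j. vec n (\<lambda>i. if i < j then v $ i else 0)"
  have tZ: "?t j \<in> Zvec n" for j using v by (auto simp: Zvec_iff)
  have "P (?t j)" if "j \<le> n" for j
    using that
  proof (induction j)
    case 0
    have "?t 0 = 0\<^sub>v n" by auto
    then show ?case using zero by simp
  next
    case (Suc j)
    have j: "j < n" and vj: "v $ j \<in> \<int>" using Suc v by (auto simp: Zvec_iff)
    then have eq: "?t (Suc j) = ?t j + of_int \<lfloor>v $ j\<rfloor> \<cdot>\<^sub>v unit_vec n j"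
      by (intro eq_vecI) (auto simp: less_Suc_eq)
    show ?case unfolding eq
      using Suc j by (intro add tZ smult vsub_int_smult[OF vsub_Zvec unit_vec_Zvec]) auto
  qed
  from this[of n] have "P (?t n)" by simp
  moreover have "?t n = v" using v by (intro eq_vecI) (auto simp: Zvec_iff)
  ultimately show ?thesis by simp
qed

lemma vgrp_hom_eqI:
  assumes G: "group G" and f: "f \<in> hom (vgrp n (Zvec n)) G" and g: "g \<in> hom (vgrp n (Zvec n)) G"
    and eq: "\<And>i. i < n \<Longrightarrow> f (unit_vec n i) = g (unit_vec n i)" and v: "v \<in> Zvec n"
  shows "f v = g v"
  using v
proof (rule Zvec_induct)
  interpret f: group_hom "vgrp n (Zvec n)" G f
    using G f group_vgrp[OF vsub_Zvec] by (simp add: group_hom_def group_hom_axioms_def)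
  interpret g: group_hom "vgrp n (Zvec n)" G g
    using G g group_vgrp[OF vsub_Zvec] by (simp add: group_hom_def group_hom_axioms_def)
  show "f (0\<^sub>v n) = g (0\<^sub>v n)" using f.hom_one g.hom_one by simp
  show "f (u + w) = g (u + w)" if "u \<in> Zvec n" "w \<in> Zvec n" "f u = g u" "f w = g w" for u w
    using f.hom_mult[of u w] g.hom_mult[of u w] that by simp
  show "f (- u) = g (- u)" if "u \<in> Zvec n" "f u = g u" for u
    using f.hom_inv[of u] g.hom_inv[of u] that inv_vgrp[OF vsub_Zvec] by simp
qed (use eq in auto)

lemma mat_hom_vgrp:
  assumes "B \<in> carrier_mat m n" "U \<subseteq> carrier_vec n" "\<And>v. v \<in> U \<Longrightarrow> B *\<^sub>v v \<in> V"
  shows "(\<lambda>v. B *\<^sub>v v) \<in> hom (vgrp n U) (vgrp m V)"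
  using assms by (auto simp: hom_def intro!: mult_add_distrib_mat_vec[OF assms(1)])

text \<open>The columns of the matrix are the images of the unit vectors.\<close>

lemma Zvec_hom_matrix:
  assumes U: "vsub m U" and f: "f \<in> hom (vgrp n (Zvec n)) (vgrp m U)"
  obtains B where "B \<in> carrier_mat m n" "\<And>v. v \<in> Zvec n \<Longrightarrow> f v = B *\<^sub>v v"
proof -
  define B where "B = mat m n (\<lambda>(i, j). f (unit_vec n j) $ i)"
  have B: "B \<in> carrier_mat m n" by (simp add: B_def)
  have fc: "f v \<in> carrier_vec m" if "v \<in> Zvec n" for v
    using f that vsubD(1)[OF U] by (auto simp: hom_def)
  \<comment> \<open>The comparison takes place in the full space, because the matrix is not yet
    known to map Z^n into \<open>U\<close>.\<close>
  have "f \<in> hom (vgrp n (Zvec n)) (vgrp m (carrier_vec m))"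
    using f fc by (auto simp: hom_def)
  moreover have "(\<lambda>v. B *\<^sub>v v) \<in> hom (vgrp n (Zvec n)) (vgrp m (carrier_vec m))"
    using B by (intro mat_hom_vgrp) (auto simp: Zvec_carrier)
  moreover have "f (unit_vec n j) = B *\<^sub>v unit_vec n j" if "j < n" for j
    using that fc[OF unit_vec_Zvec, of j] by (intro eq_vecI) (auto simp: B_def)
  ultimately have "f v = B *\<^sub>v v" if "v \<in> Zvec n" for v
    using vgrp_hom_eqI[OF group_vgrp[OF vsub_carrier]] that by blast
  then show ?thesis using that B by blast
qed

text \<open>The product of the denominators of all coordinates works: for each coordinate, the
  factor that belongs to it clears its denominator, and the other factors are integers.\<close>

lemma ex_int_multiple:
  assumes "v \<in> carrier_vec n"
  shows "\<exists>m::nat. m \<ge> 1 \<and> of_nat m \<cdot>\<^sub>v v \<in> Zvec n"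
proof -
  define d where "d i = nat (snd (quotient_of (v $ i)))" for i
  have d: "d i \<ge> 1" "of_nat (d i) * v $ i \<in> \<int>" for i
  proof -
    obtain p q where pq: "quotient_of (v $ i) = (p, q)" by force
    then have q: "q > 0" "v $ i = of_int p / of_int q"
      using quotient_of_denom_pos quotient_of_div by auto
    show "d i \<ge> 1" using pq q by (simp add: d_def)
    have "of_nat (d i) * v $ i = of_int p" using pq q by (simp add: d_def)
    then show "of_nat (d i) * v $ i \<in> \<int>" by simp
  qed
  let ?m = "\<Prod>i<n. d i"
  have "of_nat ?m * v $ i \<in> \<int>" if i: "i < n" for i
  proof -
    have "?m = d i * (\<Prod>j\<in>{..<n} - {i}. d j)" using i by (simp add: prod.remove)
    then have "of_nat ?m * v $ i = of_nat (\<Prod>j\<in>{..<n} - {i}. d j) * (of_nat (d i) * v $ i)"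
      by simp
    then show ?thesis using d(2)[of i] by (metis Ints_mult Ints_of_nat)
  qed
  moreover have "?m \<ge> 1" using d(1) by (meson One_nat_def leD linorder_not_less prod_ge_1)
  ultimately show ?thesis using assms by (intro exI[of _ ?m]) (auto simp: Zvec_iff)
qed

lemma smult_cancel:
  assumes "(c::rat) \<noteq> 0" "c \<cdot>\<^sub>v u = c \<cdot>\<^sub>v v" "u \<in> carrier_vec n" "v \<in> carrier_vec n"
  shows "u = v"
proof -
  have "inverse c \<cdot>\<^sub>v (c \<cdot>\<^sub>v u) = inverse c \<cdot>\<^sub>v (c \<cdot>\<^sub>v v)" using assms by simp
  then show ?thesis using assms(1) by (simp add: smult_smult_assoc)
qed

text \<open>Integrality is used below in this geometric form. An integer matrix with an integer
  inverse permutes the lattice; conversely the columns of \<open>B\<close> and of its inverse are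
  images of unit vectors, hence integral.\<close>

lemma GLZ_iff: "B \<in> GLZ n \<longleftrightarrow> B \<in> carrier (GLQ n) \<and> mat_image B (Zvec n) = Zvec n"
proof
  assume "B \<in> GLZ n"
  then obtain M N where M: "M \<in> carrier_mat n n" "N \<in> carrier_mat n n" "M * N = 1\<^sub>m n" "N * M = 1\<^sub>m n"
    and B: "B = map_mat rat_of_int M"
    by (auto simp: GLZ_def Units_def ring_mat_simps)
  let ?C = "map_mat rat_of_int N"
  have 1: "B * ?C = 1\<^sub>m n" "?C * B = 1\<^sub>m n"
    unfolding B using M by (metis of_int_hom.mat_hom_mult of_int_hom.mat_hom_one)+
  have c: "B \<in> carrier_mat n n" "?C \<in> carrier_mat n n" using M B by auto
  note BG = GLQ_I[OF c 1]
  have Z: "map_mat rat_of_int K *\<^sub>v v \<in> Zvec n" if "K \<in> carrier_mat n n" "v \<in> Zvec n" for K v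
  proof -
    obtain w where w: "v = map_vec rat_of_int w" "w \<in> carrier_vec n" using \<open>v \<in> Zvec n\<close>
      unfolding Zvec_def by auto
    then have "map_mat rat_of_int K *\<^sub>v v = map_vec rat_of_int (K *\<^sub>v w)"
      using of_int_hom.mult_mat_vec_hom[OF that(1) w(2), where 'a = rat] by (simp only:)
    then show ?thesis using that(1) by (simp add: Zvec_def)
  qed
  have "Zvec n \<subseteq> mat_image B (Zvec n)"
  proof
    fix v assume "v \<in> Zvec n"
    then have "v = B *\<^sub>v (?C *\<^sub>v v)" "?C *\<^sub>v v \<in> Zvec n"
      using Z[OF M(2)] 1 c Zvec_carrier by (metis assoc_mult_mat_vec one_mult_mat_vec, blast)
    then show "v \<in> mat_image B (Zvec n)" unfolding mat_image_def by blast
  qed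
  then show "B \<in> carrier (GLQ n) \<and> mat_image B (Zvec n) = Zvec n"
    using BG Z[OF M(1)] B by (auto simp: mat_image_def)
next
  assume B: "B \<in> carrier (GLQ n) \<and> mat_image B (Zvec n) = Zvec n"
  let ?C = "inv\<^bsub>GLQ n\<^esub> B"
  have c: "B \<in> carrier_mat n n" "?C \<in> carrier_mat n n" using B GLQ_carrier_mat GLQ_inv by auto
  have i: "B * ?C = 1\<^sub>m n" "?C * B = 1\<^sub>m n" using B GLQ_inv by auto
  have C: "?C *\<^sub>v v \<in> Zvec n" if "v \<in> Zvec n" for v
  proof -
    have "v \<in> mat_image B (Zvec n)" using B that by simp
    then obtain w where "w \<in> Zvec n" "v = B *\<^sub>v w" unfolding mat_image_def by blast
    then show ?thesis using GLQ_inv_cancel[of B n w] B Zvec_carrier by simp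
  qed
  have D: "B *\<^sub>v v \<in> Zvec n" if "v \<in> Zvec n" for v using B that unfolding mat_image_def by auto
  \<comment> \<open>A rational matrix that preserves Z^n has integral entries, so rounding down
    changes nothing.\<close>
  have fl: "K = map_mat rat_of_int (map_mat floor K)"
    if K: "K \<in> carrier_mat n n" "\<And>v. v \<in> Zvec n \<Longrightarrow> K *\<^sub>v v \<in> Zvec n" for K :: "rat mat"
  proof (rule eq_matI)
    fix i j assume ij: "i < dim_row (map_mat rat_of_int (map_mat floor K))"
      "j < dim_col (map_mat rat_of_int (map_mat floor K))"
    then have "(K *\<^sub>v unit_vec n j) $ i \<in> \<int>" using K(2)[of "unit_vec n j"] K(1) by (simp add: Zvec_iff)
    then have "K $$ (i, j) \<in> \<int>" using ij K(1) by simp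
    then show "K $$ (i, j) = map_mat rat_of_int (map_mat floor K) $$ (i, j)" using ij by auto
  qed (use K in auto)
  let ?M = "map_mat floor B" and ?N = "map_mat floor ?C"
  have MN: "?M \<in> carrier_mat n n" "?N \<in> carrier_mat n n" using c by auto
  have fB: "B = map_mat rat_of_int ?M" by (rule fl[OF c(1) D])
  have fC: "?C = map_mat rat_of_int ?N" by (rule fl[OF c(2) C])
  have "map_mat rat_of_int (?M * ?N) = map_mat rat_of_int (1\<^sub>m n)"
    unfolding of_int_hom.mat_hom_mult[OF MN] of_int_hom.mat_hom_one fB[symmetric] fC[symmetric]
    by (rule i(1))
  then have "?M * ?N = 1\<^sub>m n" by (rule of_int_hom.mat_hom_inj)
  moreover have "map_mat rat_of_int (?N * ?M) = map_mat rat_of_int (1\<^sub>m n)"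
    unfolding of_int_hom.mat_hom_mult[OF MN(2,1)] of_int_hom.mat_hom_one fB[symmetric] fC[symmetric]
    by (rule i(2))
  then have "?N * ?M = 1\<^sub>m n" by (rule of_int_hom.mat_hom_inj)
  ultimately have "?M \<in> Units (ring_mat TYPE(int) n ())"
    using MN by (auto simp: Units_def ring_mat_simps)
  then show "B \<in> GLZ n" unfolding GLZ_def by (subst fB) (rule imageI)
qed

lemma GLZ_D:
  assumes "B \<in> GLZ n"
  shows "B \<in> carrier (GLQ n)" "B \<in> carrier_mat n n" "v \<in> Zvec n \<Longrightarrow> B *\<^sub>v v \<in> Zvec n"
    "v \<in> Zvec n \<Longrightarrow> inv\<^bsub>GLQ n\<^esub> B *\<^sub>v v \<in> Zvec n"
proof -
  show B: "B \<in> carrier (GLQ n)" "B \<in> carrier_mat n n" "v \<in> Zvec n \<Longrightarrow> B *\<^sub>v v \<in> Zvec n"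
    using assms GLQ_carrier_mat unfolding GLZ_iff mat_image_def by blast+
  assume "v \<in> Zvec n"
  then have "v \<in> mat_image B (Zvec n)" using assms GLZ_iff by simp
  then obtain w where "w \<in> Zvec n" "v = B *\<^sub>v w" unfolding mat_image_def by blast
  then show "inv\<^bsub>GLQ n\<^esub> B *\<^sub>v v \<in> Zvec n" using GLQ_inv_cancel[of B n w] B Zvec_carrier by simp
qed

lemma GLZ_I:
  assumes B: "B \<in> carrier (GLQ n)" and 1: "\<And>v. v \<in> Zvec n \<Longrightarrow> B *\<^sub>v v \<in> Zvec n"
    and 2: "\<And>v. v \<in> Zvec n \<Longrightarrow> inv\<^bsub>GLQ n\<^esub> B *\<^sub>v v \<in> Zvec n"
  shows "B \<in> GLZ n"
proof -
  have "v \<in> mat_image B (Zvec n)" if "v \<in> Zvec n" for v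
    using 2[OF that] GLQ_inv_cancel(1)[OF B Zvec_carrier[OF that]] unfolding mat_image_def
    by (metis image_eqI)
  then show ?thesis using B 1 by (auto simp: GLZ_iff mat_image_def)
qed

lemma GLZ_inv: "B \<in> GLZ n \<Longrightarrow> inv\<^bsub>GLQ n\<^esub> B \<in> GLZ n"
  using GLZ_D by (intro GLZ_I) (auto simp: GLQ_inv GLQ_inv_inv)

lemma GLZ_mult:
  assumes "B \<in> GLZ n" "C \<in> GLZ n"
  shows "B * C \<in> GLZ n"
  using GLZ_D[OF assms(1)] GLZ_D[OF assms(2)] GLQ_inv(2)[of B n] GLQ_inv(2)[of C n]
  by (intro GLZ_I) (auto simp: GLQ_mult GLQ_inv_mult Zvec_carrier)

section \<open>Homomorphisms out of presented groups\<close>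

context group
begin

text \<open>Conjugation relations are kept in the form \<open>s \<otimes> x = y \<otimes> s\<close>,
  which turns inductions over powers into mere reassociation.\<close>

lemma conj_inv:
  assumes "s \<in> carrier G" "x \<in> carrier G" "y \<in> carrier G" "s \<otimes> x = y \<otimes> s"
  shows "s \<otimes> inv x = inv y \<otimes> s"
proof -
  have "s \<otimes> inv x = inv y \<otimes> (y \<otimes> s) \<otimes> inv x" using assms(1-3) by (simp add: m_assoc[symmetric])
  also have "\<dots> = inv y \<otimes> (s \<otimes> x) \<otimes> inv x" using assms(4) by simp
  also have "\<dots> = inv y \<otimes> s" using assms(1-3) by (simp add: m_assoc)
  finally show ?thesis .
qed

lemma conj_int_pow:
  assumes "s \<in> carrier G" "x \<in> carrier G" "y \<in> carrier G" "s \<otimes> x = y \<otimes> s"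
  shows "s \<otimes> x [^] (a::int) = y [^] a \<otimes> s"
proof (induction a rule: int_induct[where k = 0])
  case base
  then show ?case using assms by simp
next
  case (step1 i)
  have "s \<otimes> x [^] (i + 1) = (s \<otimes> x [^] i) \<otimes> x" using assms by (simp add: int_pow_mult m_assoc)
  also have "\<dots> = y [^] i \<otimes> (s \<otimes> x)" using assms(1-3) step1 by (simp add: m_assoc)
  also have "\<dots> = y [^] (i + 1) \<otimes> s" using assms by (simp add: int_pow_mult m_assoc)
  finally show ?case .
next
  case (step2 i)
  have "s \<otimes> x [^] (i - 1) = (s \<otimes> x [^] i) \<otimes> inv x" using assms by (simp add: int_pow_diff m_assoc)
  also have "\<dots> = y [^] i \<otimes> (s \<otimes> inv x)" using assms(1-3) step2 by (simp add: m_assoc)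
  also have "\<dots> = y [^] (i - 1) \<otimes> s"
    using assms(1-3) conj_inv[OF assms] by (simp add: int_pow_diff m_assoc)
  finally show ?case .
qed

lemma comm_int_pow:
  assumes "x \<in> carrier G" "y \<in> carrier G" "x \<otimes> y = y \<otimes> x"
  shows "x [^] (a::int) \<otimes> y = y \<otimes> x [^] a"
  using conj_int_pow[of y x x a] assms by simp

lemma conj_eq_of_relator:
  assumes "s \<in> carrier G" "a \<in> carrier G" "b \<in> carrier G" "s \<otimes> a \<otimes> inv s \<otimes> inv b = \<one>"
  shows "s \<otimes> a = b \<otimes> s"
proof -
  have "inv (inv b) = s \<otimes> a \<otimes> inv s" using assms by (intro inv_equality) auto
  then have "b \<otimes> s = s \<otimes> a \<otimes> inv s \<otimes> s" using assms by simp
  then show ?thesis using assms by (simp add: m_assoc)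
qed

definition letter_val :: "('c \<Rightarrow> 'a) \<Rightarrow> 'c \<times> bool \<Rightarrow> 'a" where
  "letter_val f a = (if snd a then f (fst a) else inv (f (fst a)))"

text \<open>Words that are not reduced have a value too, so compatibility with concatenation can be
  shown before reduction enters.\<close>

definition word_val :: "('c \<Rightarrow> 'a) \<Rightarrow> 'c word \<Rightarrow> 'a" where
  "word_val f w = foldr (\<lambda>a u. letter_val f a \<otimes> u) w \<one>"

context
  fixes f :: "'c \<Rightarrow> 'a" and S :: "'c set"
  assumes f: "\<And>s. s \<in> S \<Longrightarrow> f s \<in> carrier G"
begin

lemma letter_val_closed: "a \<in> S \<times> UNIV \<Longrightarrow> letter_val f a \<in> carrier G"
  by (auto simp: letter_val_def f)

lemma word_val_closed: "set w \<subseteq> S \<times> UNIV \<Longrightarrow> word_val f w \<in> carrier G"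
  by (induction w) (auto simp: word_val_def intro!: m_closed letter_val_closed)

lemma word_val_append:
  "set u \<subseteq> S \<times> UNIV \<Longrightarrow> set w \<subseteq> S \<times> UNIV \<Longrightarrow> word_val f (u @ w) = word_val f u \<otimes> word_val f w"
proof (induction u)
  case Nil
  then show ?case using word_val_closed[of w] by (simp add: word_val_def)
next
  case (Cons a u)
  then have "word_val f (a # u @ w) = letter_val f a \<otimes> (word_val f u \<otimes> word_val f w)"
    by (simp add: word_val_def)
  also have "\<dots> = word_val f (a # u) \<otimes> word_val f w"
    using Cons word_val_closed[of u] word_val_closed[of w] letter_val_closed[of a]
    by (simp add: word_val_def m_assoc)
  finally show ?case by simp
qed

lemma word_val_cancel_cons:
  assumes "a \<in> S \<times> UNIV" "set w \<subseteq> S \<times> UNIV"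
  shows "word_val f (cancel_cons a w) = letter_val f a \<otimes> word_val f w"
proof (cases "w \<noteq> [] \<and> hd w = letter_inv a")
  case True
  then obtain w' where w: "w = letter_inv a # w'" by (cases w) auto
  have "letter_val f a \<otimes> letter_val f (letter_inv a) = \<one>"
    using assms(1) f by (auto simp: letter_val_def letter_inv_def)
  then show ?thesis
    using assms w letter_val_closed[of a] letter_val_closed[of "letter_inv a"] word_val_closed[of w']
    by (simp add: cancel_cons_def word_val_def m_assoc[symmetric])
qed (auto simp: cancel_cons_def word_val_def)

lemma word_val_reduce: "set w \<subseteq> S \<times> UNIV \<Longrightarrow> word_val f (reduce w) = word_val f w"
proof (induction w)
  case (Cons a w)
  have "set (reduce w) \<subseteq> S \<times> UNIV" using set_reduce[of w] Cons by auto
  then show ?case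
    using Cons word_val_cancel_cons[of a "reduce w"] by (simp add: reduce_def word_val_def)
qed (simp add: reduce_def)

lemma word_val_hom: "word_val f \<in> hom (free_group S) G"
proof (rule homI)
  fix u w assume uw: "u \<in> carrier (free_group S)" "w \<in> carrier (free_group S)"
  then have s: "set u \<subseteq> S \<times> UNIV" "set w \<subseteq> S \<times> UNIV" by (auto simp: free_group_def)
  then show "word_val f u \<in> carrier G" by (intro word_val_closed)
  have "word_val f (reduce (u @ w)) = word_val f (u @ w)"
    using s by (intro word_val_reduce) auto
  then show "word_val f (u \<otimes>\<^bsub>free_group S\<^esub> w) = word_val f u \<otimes> word_val f w"
    using word_val_append[OF s] by (simp add: free_group_def)
qed

lemma word_val_single: "s \<in> S \<Longrightarrow> word_val f [(s, True)] = f s"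
  using f by (simp add: word_val_def letter_val_def)

text \<open>The kernel of the evaluation is a normal subgroup containing the relators, hence one of
  the groups whose intersection is the normal closure. The evaluation is therefore constant on
  cosets.\<close>

lemma presented_group_hom:
  assumes R: "R \<subseteq> carrier (free_group S)" "\<And>r. r \<in> R \<Longrightarrow> word_val f r = \<one>"
  obtains h where "h \<in> hom (presented_group S R) G"
    "\<And>w. w \<in> carrier (free_group S) \<Longrightarrow>
      h (normal_closure (free_group S) R #>\<^bsub>free_group S\<^esub> w) = word_val f w"
proof -
  let ?F = "free_group S" and ?N = "normal_closure (free_group S) R"
  interpret F: group ?F by (rule group_free_group)
  interpret e: group_hom ?F G "word_val f"
    by unfold_locales (rule word_val_hom)
  interpret N: normal ?N ?F by (rule normal_normal_closure[OF group_free_group R(1)])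
  have "?N \<subseteq> kernel ?F G (word_val f)"
    unfolding normal_closure_def
    using e.normal_kernel R by (intro Inter_lower) (auto simp: kernel_def)
  then have N1: "word_val f x = \<one>" if "x \<in> ?N" for x using that by (auto simp: kernel_def)
  have "word_val f x = word_val f y" if xy: "x \<in> carrier ?F" "y \<in> carrier ?F" "?N #>\<^bsub>?F\<^esub> x = ?N #>\<^bsub>?F\<^esub> y" for x y
  proof -
    have "x \<in> ?N #>\<^bsub>?F\<^esub> y" using F.rcos_self[OF xy(1) N.is_subgroup] xy(3) by simp
    then obtain a where a: "a \<in> ?N" "x = a \<otimes>\<^bsub>?F\<^esub> y" by (auto simp: r_coset_def)
    then have "word_val f x = word_val f a \<otimes> word_val f y"
      using e.hom_mult[of a y] xy(2) N.subset by auto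
    then show ?thesis using N1[OF a(1)] xy(2) by simp
  qed
  from FactGroup_universal[OF word_val_hom N.normal_axioms this] that show ?thesis
    unfolding presented_group_def by metis
qed

end
end

text \<open>The words \<open>x_pow\<close> are such products in the free group; this transports them
  along homomorphisms.\<close>

lemma pow_prod_image:
  assumes "group F" "group K" "h \<in> hom F K" and e: "\<And>i. i < n \<Longrightarrow> e i \<in> carrier F"
  shows "h (foldr (\<lambda>i u. e i [^]\<^bsub>F\<^esub> k i \<otimes>\<^bsub>F\<^esub> u) [0..<n] \<one>\<^bsub>F\<^esub>)
    = foldr (\<lambda>i u. h (e i) [^]\<^bsub>K\<^esub> (k i :: int) \<otimes>\<^bsub>K\<^esub> u) [0..<n] \<one>\<^bsub>K\<^esub>"
proof -
  interpret h: group_hom F K h using assms by (simp add: group_hom_def group_hom_axioms_def)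
  have "foldr (\<lambda>i u. e i [^]\<^bsub>F\<^esub> k i \<otimes>\<^bsub>F\<^esub> u) js \<one>\<^bsub>F\<^esub> \<in> carrier F \<and>
    h (foldr (\<lambda>i u. e i [^]\<^bsub>F\<^esub> k i \<otimes>\<^bsub>F\<^esub> u) js \<one>\<^bsub>F\<^esub>)
    = foldr (\<lambda>i u. h (e i) [^]\<^bsub>K\<^esub> (k i :: int) \<otimes>\<^bsub>K\<^esub> u) js \<one>\<^bsub>K\<^esub>"
    if "set js \<subseteq> {..<n}" for js
    using that by (induction js) (auto simp: e h.hom_int_pow)
  from this[of "[0..<n]"] show ?thesis by (simp add: lessThan_atLeast0)
qed

context group
begin

definition pow_prod :: "nat \<Rightarrow> (nat \<Rightarrow> 'a) \<Rightarrow> rat vec \<Rightarrow> 'a" where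
  "pow_prod n e v = foldr (\<lambda>i u. e i [^] \<lfloor>v $ i\<rfloor> \<otimes> u) [0..<n] \<one>"

context
  fixes n :: nat and e :: "nat \<Rightarrow> 'a"
  assumes e: "\<And>i. i < n \<Longrightarrow> e i \<in> carrier G"
    and comm: "\<And>i j. i < n \<Longrightarrow> j < n \<Longrightarrow> e i \<otimes> e j = e j \<otimes> e i"
begin

text \<open>A power of one element is moved past the product over the remaining indices
  (\<open>cm\<close>), which lets the products for \<open>v\<close> and \<open>w\<close> be merged
  factor by factor.\<close>

lemma pow_prod_hom: "pow_prod n e \<in> hom (vgrp n (Zvec n)) G"
proof -
  let ?P = "\<lambda>js v. foldr (\<lambda>i u. e i [^] \<lfloor>v $ i\<rfloor> \<otimes> u) js \<one>"
  have cl: "?P js v \<in> carrier G" if "set js \<subseteq> {..<n}" for js v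
    using that by (induction js) (auto simp: e)
  have cm: "e i [^] (a::int) \<otimes> ?P js v = ?P js v \<otimes> e i [^] a" if "set js \<subseteq> {..<n}" "i < n" for js v i a
    using that
  proof (induction js)
    case (Cons j js)
    have ij: "e i [^] a \<otimes> e j [^] b = e j [^] b \<otimes> e i [^] a" for b :: int
      using Cons e comm comm_int_pow[of "e j" "e i [^] a"] comm_int_pow[of "e i" "e j"] by simp
    have cc: "e i [^] a \<in> carrier G" "e j [^] \<lfloor>v $ j\<rfloor> \<in> carrier G" "?P js v \<in> carrier G"
      using Cons cl[of js v] e by auto
    have "e i [^] a \<otimes> ?P (j # js) v = e j [^] \<lfloor>v $ j\<rfloor> \<otimes> (e i [^] a \<otimes> ?P js v)"
      using cc ij by (simp add: m_assoc[symmetric])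
    also have "\<dots> = ?P (j # js) v \<otimes> e i [^] a"
      using cc Cons by (simp add: m_assoc)
    finally show ?case .
  qed (use e in simp)
  have "?P js (v + w) = ?P js v \<otimes> ?P js w" 
    if "set js \<subseteq> {..<n}" "v \<in> Zvec n" "w \<in> Zvec n" for js v w
    using that
  proof (induction js)
    case (Cons j js)
    then have j: "j < n" by auto
    \<comment> \<open>The floor is additive here because the coordinates are integral.\<close>
    have "\<lfloor>(v + w) $ j\<rfloor> = \<lfloor>v $ j\<rfloor> + \<lfloor>w $ j\<rfloor>"
      using Cons j by (auto simp: Zvec_iff elim!: Ints_cases)
    moreover have cc: "e j [^] \<lfloor>w $ j\<rfloor> \<in> carrier G" "e j [^] \<lfloor>v $ j\<rfloor> \<in> carrier G"
      "?P js v \<in> carrier G" "?P js w \<in> carrier G"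
      using Cons cl[of js] e by auto
    ultimately have "?P (j # js) (v + w) = e j [^] \<lfloor>v $ j\<rfloor> \<otimes> (e j [^] \<lfloor>w $ j\<rfloor> \<otimes> ?P js v) \<otimes> ?P js w"
      using Cons j e by (simp add: int_pow_mult m_assoc)
    also have "\<dots> = ?P (j # js) v \<otimes> ?P (j # js) w"
      using cc cm[of js j "\<lfloor>w $ j\<rfloor>" v] Cons by (simp add: m_assoc)
    finally show ?case .
  qed simp
  from this[of "[0..<n]"] cl[of "[0..<n]"] show ?thesis
    by (auto simp: hom_def pow_prod_def lessThan_atLeast0)
qed

lemma pow_prod_unit_vec:
  assumes i: "i < n"
  shows "pow_prod n e (unit_vec n i) = e i"
proof -
  have "foldr (\<lambda>j u. e j [^] \<lfloor>(unit_vec n i :: rat vec) $ j\<rfloor> \<otimes> u) js \<one> = (if i \<in> set js then e i else \<one>)"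
    if "distinct js" "set js \<subseteq> {..<n}" for js
    using that by (induction js) (auto simp: e unit_vec_def i)
  from this[of "[0..<n]"] show ?thesis using i by (simp add: pow_prod_def lessThan_atLeast0)
qed

end

lemma pow_prod_of_hom:
  assumes f: "f \<in> hom (vgrp n (Zvec n)) G" and v: "v \<in> Zvec n"
  shows "pow_prod n (\<lambda>i. f (unit_vec n i)) v = f v"
proof (rule vgrp_hom_eqI[OF group_axioms _ f _ v])
  have fc: "f u \<in> carrier G" if "u \<in> Zvec n" for u using f that by (auto simp: hom_def)
  have fm: "f (u + w) = f u \<otimes> f w" if "u \<in> Zvec n" "w \<in> Zvec n" for u w
    using f that by (auto simp: hom_def)
  have cm: "f u \<otimes> f w = f w \<otimes> f u" if "u \<in> Zvec n" "w \<in> Zvec n" for u w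
    using fm[OF that] fm[OF that(2,1)] comm_add_vec[of u n w] that Zvec_carrier by simp
  show "pow_prod n (\<lambda>i. f (unit_vec n i)) \<in> hom (vgrp n (Zvec n)) G"
    by (rule pow_prod_hom) (auto simp: fc cm)
  show "pow_prod n (\<lambda>i. f (unit_vec n i)) (unit_vec n i) = f (unit_vec n i)" if "i < n" for i
    using that by (intro pow_prod_unit_vec) (auto simp: fc cm)
qed

end

section \<open>The structure of Leary--Minasyan groups\<close>

text \<open>Finite index appears as \<open>tor\<close>: some positive multiple of each integral
  vector lies in \<open>L\<close>. In this form it passes easily to the inverse data
  (\<open>lm_data_inv\<close>).\<close>

locale lm_data =
  fixes n :: nat and A :: "rat mat" and L :: "rat vec set"
  assumes A: "A \<in> carrier (GLQ n)" and L: "vsub n L" and LZ: "L \<subseteq> Zvec n"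
    and ALZ: "\<And>v. v \<in> L \<Longrightarrow> A *\<^sub>v v \<in> Zvec n"
    and tor: "\<And>w. w \<in> Zvec n \<Longrightarrow> \<exists>m::nat. m \<ge> 1 \<and> of_nat m \<cdot>\<^sub>v w \<in> L"

text \<open>The parameters are explicit, and the definition stands outside the locale, because two
  such groups are compared later.\<close>

definition lm_x :: "nat \<Rightarrow> rat mat \<Rightarrow> rat vec set \<Rightarrow> rat vec \<Rightarrow> lm_gen word set" where
  "lm_x n A L v = normal_closure (lm_free n) (lm_relators n A L) #>\<^bsub>lm_free n\<^esub> x_pow n v"

definition lm_t :: "nat \<Rightarrow> rat mat \<Rightarrow> rat vec set \<Rightarrow> lm_gen word set" where
  "lm_t n A L = normal_closure (lm_free n) (lm_relators n A L) #>\<^bsub>lm_free n\<^esub> [(T, True)]"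

lemma lm_relators_closed: "lm_relators n A L \<subseteq> carrier (lm_free n)"
proof -
  interpret F: group "lm_free n" by (rule group_free_group)
  show ?thesis unfolding lm_relators_def Let_def
    by (auto intro!: F.m_closed F.inv_closed x_pow_closed lm_gen_closed)
qed

context lm_data
begin

abbreviation "F \<equiv> lm_free n"
abbreviation "N \<equiv> normal_closure (lm_free n) (lm_relators n A L)"
abbreviation "G \<equiv> lm_group n A L"
abbreviation "x \<equiv> lm_x n A L"
abbreviation "t \<equiv> lm_t n A L"

sublocale G: group G by (rule group_lm_group)
sublocale F: group F by (rule group_free_group)
sublocale N: normal N F by (rule normal_normal_closure[OF group_free_group lm_relators_closed])

lemma G_eq: "G = F Mod N"
  by (simp add: lm_group_def presented_group_def)

sublocale cls: group_hom F G "\<lambda>w. N #>\<^bsub>F\<^esub> w"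
  by unfold_locales (use N.r_coset_hom_Mod G_eq in simp)

lemma relator_one:
  assumes "r \<in> lm_relators n A L"
  shows "N #>\<^bsub>F\<^esub> r = \<one>\<^bsub>G\<^esub>"
proof -
  have "r \<in> N" using assms unfolding normal_closure_def by auto
  then have "N #>\<^bsub>F\<^esub> r = N" using F.coset_join2 N.is_subgroup N.subset by blast
  then show ?thesis by (simp add: G_eq)
qed

lemma t_closed [simp]: "t \<in> carrier G"
  unfolding lm_t_def by (intro cls.hom_closed lm_gen_closed)

lemma x_closed [simp]: "x v \<in> carrier G"
  unfolding lm_x_def by (intro cls.hom_closed x_pow_closed)

lemma x_pow_prod: "x v = G.pow_prod n (\<lambda>i. N #>\<^bsub>F\<^esub> [(X i, True)]) v"
  unfolding lm_x_def x_pow_def G.pow_prod_def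
  by (rule pow_prod_image[OF F.group_axioms G.group_axioms]) (auto simp: cls.homh lm_gen_closed)

lemma cls_X_comm:
  assumes "i < n" "j < n"
  shows "(N #>\<^bsub>F\<^esub> [(X i, True)]) \<otimes>\<^bsub>G\<^esub> (N #>\<^bsub>F\<^esub> [(X j, True)])
    = (N #>\<^bsub>F\<^esub> [(X j, True)]) \<otimes>\<^bsub>G\<^esub> (N #>\<^bsub>F\<^esub> [(X i, True)])"
proof -
  have *: "(N #>\<^bsub>F\<^esub> [(X i, True)]) \<otimes>\<^bsub>G\<^esub> (N #>\<^bsub>F\<^esub> [(X j, True)])
    = (N #>\<^bsub>F\<^esub> [(X j, True)]) \<otimes>\<^bsub>G\<^esub> (N #>\<^bsub>F\<^esub> [(X i, True)])" if ij: "i < j" "j < n" for i j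
  proof -
    let ?a = "[(X i, True)]" and ?b = "[(X j, True)]"
    have c: "?a \<in> carrier F" "?b \<in> carrier F" using ij by (auto intro!: lm_gen_closed)
    have "?a \<otimes>\<^bsub>F\<^esub> ?b \<otimes>\<^bsub>F\<^esub> inv\<^bsub>F\<^esub> ?a \<otimes>\<^bsub>F\<^esub> inv\<^bsub>F\<^esub> ?b \<in> lm_relators n A L"
      unfolding lm_relators_def Let_def using ij by blast
    from relator_one[OF this] c
    have "(N #>\<^bsub>F\<^esub> ?a) \<otimes>\<^bsub>G\<^esub> (N #>\<^bsub>F\<^esub> ?b) \<otimes>\<^bsub>G\<^esub> inv\<^bsub>G\<^esub> (N #>\<^bsub>F\<^esub> ?a) \<otimes>\<^bsub>G\<^esub> inv\<^bsub>G\<^esub> (N #>\<^bsub>F\<^esub> ?b) = \<one>\<^bsub>G\<^esub>"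
      by (simp add: cls.hom_mult cls.hom_inv)
    then show ?thesis using c by (intro G.conj_eq_of_relator) auto
  qed
  show ?thesis using *[of i j] *[of j i] assms by (cases i j rule: linorder_cases) auto
qed

lemma cls_X_closed: "i < n \<Longrightarrow> N #>\<^bsub>F\<^esub> [(X i, True)] \<in> carrier G"
  by (intro cls.hom_closed lm_gen_closed)

lemma x_hom: "x \<in> hom (vgrp n (Zvec n)) G"
proof -
  have "x = G.pow_prod n (\<lambda>i. N #>\<^bsub>F\<^esub> [(X i, True)])" 
    by (rule ext) (rule x_pow_prod)
  then show ?thesis using G.pow_prod_hom[OF cls_X_closed cls_X_comm] by (simp only:)
qed

lemma x_unit_vec: "i < n \<Longrightarrow> x (unit_vec n i) = N #>\<^bsub>F\<^esub> [(X i, True)]"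
  unfolding x_pow_prod by (rule G.pow_prod_unit_vec[OF cls_X_closed cls_X_comm])

lemma x_add: "v \<in> Zvec n \<Longrightarrow> w \<in> Zvec n \<Longrightarrow> x (v + w) = x v \<otimes>\<^bsub>G\<^esub> x w"
  using x_hom by (auto simp: hom_def)

lemma x_zero: "x (0\<^sub>v n) = \<one>\<^bsub>G\<^esub>"
  using hom_one[OF x_hom group_vgrp[OF vsub_Zvec] G.group_axioms] by simp

lemma x_uminus: "v \<in> Zvec n \<Longrightarrow> x (- v) = inv\<^bsub>G\<^esub> x v"
proof -
  assume v: "v \<in> Zvec n"
  have "x (- v) \<otimes>\<^bsub>G\<^esub> x v = x (- v + v)" using v vsubD(4)[OF vsub_Zvec] by (simp add: x_add)
  then show ?thesis using v Zvec_carrier[OF v] x_zero G.inv_equality by fastforce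
qed

lemma x_comm: "v \<in> Zvec n \<Longrightarrow> w \<in> Zvec n \<Longrightarrow> x v \<otimes>\<^bsub>G\<^esub> x w = x w \<otimes>\<^bsub>G\<^esub> x v"
  using x_add[of v w] x_add[of w v] comm_add_vec[of v n w] Zvec_carrier by simp

lemma t_x:
  assumes "v \<in> L"
  shows "t \<otimes>\<^bsub>G\<^esub> x v = x (A *\<^sub>v v) \<otimes>\<^bsub>G\<^esub> t"
proof -
  let ?t = "[(T, True)]"
  have c: "?t \<in> carrier F" by (auto intro!: lm_gen_closed)
  have "?t \<otimes>\<^bsub>F\<^esub> x_pow n v \<otimes>\<^bsub>F\<^esub> inv\<^bsub>F\<^esub> ?t \<otimes>\<^bsub>F\<^esub> inv\<^bsub>F\<^esub> (x_pow n (A *\<^sub>v v)) \<in> lm_relators n A L"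
    unfolding lm_relators_def Let_def using assms by blast
  from relator_one[OF this] c x_pow_closed
  have "t \<otimes>\<^bsub>G\<^esub> x v \<otimes>\<^bsub>G\<^esub> inv\<^bsub>G\<^esub> t \<otimes>\<^bsub>G\<^esub> inv\<^bsub>G\<^esub> (x (A *\<^sub>v v)) = \<one>\<^bsub>G\<^esub>"
    by (simp add: cls.hom_mult cls.hom_inv lm_t_def lm_x_def)
  then show ?thesis by (intro G.conj_eq_of_relator) auto
qed

lemma L_Zvec: "v \<in> L \<Longrightarrow> v \<in> Zvec n"
  using LZ by auto

text \<open>The universal property, with the commuting generators bundled into one homomorphism
  \<open>f\<close> on Z^n. The commutator relators are then respected automatically, and only the
  relation for the stable letter remains to be checked.\<close>

theorem hom_exists:
  assumes K: "group K" and f: "f \<in> hom (vgrp n (Zvec n)) K" and s: "s \<in> carrier K"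
    and rel: "\<And>v. v \<in> L \<Longrightarrow> s \<otimes>\<^bsub>K\<^esub> f v = f (A *\<^sub>v v) \<otimes>\<^bsub>K\<^esub> s"
  obtains h where "h \<in> hom G K" "\<And>v. v \<in> Zvec n \<Longrightarrow> h (x v) = f v" "h t = s"
proof -
  interpret K: group K by (rule K)
  have fc: "f u \<in> carrier K" if "u \<in> Zvec n" for u using f that by (auto simp: hom_def)
  have fm: "f (u + w) = f u \<otimes>\<^bsub>K\<^esub> f w" if "u \<in> Zvec n" "w \<in> Zvec n" for u w
    using f that by (auto simp: hom_def)
  have cm: "f u \<otimes>\<^bsub>K\<^esub> f w = f w \<otimes>\<^bsub>K\<^esub> f u" if "u \<in> Zvec n" "w \<in> Zvec n" for u w
    using fm[OF that] fm[OF that(2,1)] comm_add_vec[of u n w] that Zvec_carrier by simp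
  define g where "g a = (case a of X i \<Rightarrow> f (unit_vec n i) | T \<Rightarrow> s)" for a
  have g: "g a \<in> carrier K" if "a \<in> lm_gens n" for a
    using that s fc by (auto simp: g_def split: lm_gen.splits)
  have gv: "g (X i) = f (unit_vec n i)" "g T = s" for i by (simp_all add: g_def)
  interpret e: group_hom F K "K.word_val g"
    by unfold_locales (rule K.word_val_hom[OF g])
  have eX: "K.word_val g [(X i, True)] = f (unit_vec n i)" if "i < n" for i
    using K.word_val_single[of "lm_gens n" g "X i"] g lm_gen_closed(2)[OF that] gv by simp
  have eT: "K.word_val g [(T, True)] = s"
    using K.word_val_single[of "lm_gens n" g T] g lm_gen_closed(1) gv by simp
  \<comment> \<open>The word \<open>x_pow n v\<close> becomes a product of powers of the values
    \<open>f (unit_vec n i)\<close>, and this product is \<open>f v\<close> because \<open>f\<close>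
    is a homomorphism.\<close>
  have exp: "K.word_val g (x_pow n v) = f v" if v: "v \<in> Zvec n" for v
  proof -
    have "K.word_val g (x_pow n v) = K.pow_prod n (\<lambda>i. K.word_val g [(X i, True)]) v"
      unfolding x_pow_def K.pow_prod_def
      by (rule pow_prod_image[OF F.group_axioms K.group_axioms e.homh]) (auto intro!: lm_gen_closed)
    also have "\<dots> = K.pow_prod n (\<lambda>i. f (unit_vec n i)) v"
      unfolding K.pow_prod_def by (rule foldr_cong) (auto simp: eX)
    finally show ?thesis using K.pow_prod_of_hom[OF f v] by simp
  qed
  have c: "[(T, True)] \<in> carrier F" "i < n \<Longrightarrow> [(X i, True)] \<in> carrier F" for i
    by (auto intro!: lm_gen_closed)
  have comm1: "a \<otimes>\<^bsub>K\<^esub> b \<otimes>\<^bsub>K\<^esub> inv\<^bsub>K\<^esub> a \<otimes>\<^bsub>K\<^esub> inv\<^bsub>K\<^esub> b = \<one>\<^bsub>K\<^esub>"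
    if "a \<in> carrier K" "b \<in> carrier K" "a \<otimes>\<^bsub>K\<^esub> b = b \<otimes>\<^bsub>K\<^esub> a" for a b
    using that by (simp add: K.m_assoc)
  have rel1: "s \<otimes>\<^bsub>K\<^esub> a \<otimes>\<^bsub>K\<^esub> inv\<^bsub>K\<^esub> s \<otimes>\<^bsub>K\<^esub> inv\<^bsub>K\<^esub> b = \<one>\<^bsub>K\<^esub>"
    if "a \<in> carrier K" "b \<in> carrier K" "s \<otimes>\<^bsub>K\<^esub> a = b \<otimes>\<^bsub>K\<^esub> s" for a b
    using that s by (simp add: K.m_assoc)
  have "K.word_val g r = \<one>\<^bsub>K\<^esub>" if "r \<in> lm_relators n A L" for r
    using that unfolding lm_relators_def Let_def
    by (auto simp: e.hom_mult e.hom_inv c x_pow_closed eX eT exp fc s ALZ L_Zvec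
        intro!: comm1 rel1 cm rel)
  from K.presented_group_hom[OF g lm_relators_closed this]
  obtain h where h: "h \<in> hom G K"
    "\<And>w. w \<in> carrier F \<Longrightarrow> h (N #>\<^bsub>F\<^esub> w) = K.word_val g w"
    unfolding lm_group_def by blast
  show ?thesis
    by (rule that[OF h(1)]) (auto simp: lm_x_def lm_t_def h(2) exp eT c x_pow_closed)
qed

text \<open>A reduced word arises by prepending letters, so left multiplication suffices. Allowing
  all integral \<open>v\<close> in the step for \<open>x\<close> covers the generators and their
  inverses at once.\<close>

theorem lm_induct:
  assumes g: "g \<in> carrier G" and one: "P \<one>\<^bsub>G\<^esub>"
    and x: "\<And>h v. h \<in> carrier G \<Longrightarrow> v \<in> Zvec n \<Longrightarrow> P h \<Longrightarrow> P (x v \<otimes>\<^bsub>G\<^esub> h)"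
    and t: "\<And>h. h \<in> carrier G \<Longrightarrow> P h \<Longrightarrow> P (t \<otimes>\<^bsub>G\<^esub> h)"
    and ti: "\<And>h. h \<in> carrier G \<Longrightarrow> P h \<Longrightarrow> P (inv\<^bsub>G\<^esub> t \<otimes>\<^bsub>G\<^esub> h)"
  shows "P g"
proof -
  obtain w where w: "w \<in> carrier F" "g = N #>\<^bsub>F\<^esub> w"
    using g unfolding G_eq carrier_FactGroup by auto
  have "P (N #>\<^bsub>F\<^esub> w)" using w(1)
  proof (induction w)
    case Nil
    have "[] = \<one>\<^bsub>F\<^esub>" by (simp add: free_group_def)
    then show ?case using one cls.hom_one by simp
  next
    case (Cons a w)
    have w: "w \<in> carrier F" and a: "fst a \<in> lm_gens n" and red: "reduced (a # w)"
      using Cons.prems by (auto simp: free_group_def reduced_Cons)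
    have ac: "[a] \<in> carrier F" using lm_gen_closed(3)[OF a, of "snd a"] by simp
    have "a # w = [a] \<otimes>\<^bsub>F\<^esub> w" using red by (simp add: free_group_def reduce_reduced)
    then have eq: "N #>\<^bsub>F\<^esub> (a # w) = (N #>\<^bsub>F\<^esub> [a]) \<otimes>\<^bsub>G\<^esub> (N #>\<^bsub>F\<^esub> w)"
      using ac w cls.hom_mult by simp
    have neg: "[(s, False)] = inv\<^bsub>F\<^esub> [(s, True)]" if "s \<in> lm_gens n" for s
    proof (rule F.inv_equality[symmetric])
      show "[(s, False)] \<otimes>\<^bsub>F\<^esub> [(s, True)] = \<one>\<^bsub>F\<^esub>"
        by (simp add: free_group_def reduce_def cancel_cons_def letter_inv_def)
    qed (use that in \<open>auto intro!: lm_gen_closed\<close>)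
    have IH: "P (N #>\<^bsub>F\<^esub> w)" "N #>\<^bsub>F\<^esub> w \<in> carrier G" using Cons.IH w by auto
    show ?case
    proof (cases a)
      case (Pair s b)
      show ?thesis
      proof (cases s)
        case (X i)
        then have i: "i < n" using a Pair by (auto simp: lm_gens_def)
        have "N #>\<^bsub>F\<^esub> [a] = (if b then x (unit_vec n i) else x (- unit_vec n i))"
          using X Pair i neg[OF lm_gen_closed(2)] lm_gen_closed(3)[OF lm_gen_closed(2)[OF i], where b = True]
          by (simp add: x_unit_vec x_uminus cls.hom_inv)
        then show ?thesis unfolding eq using IH x vsubD(4)[OF vsub_Zvec] by auto
      next
        case T
        have "N #>\<^bsub>F\<^esub> [a] = (if b then t else inv\<^bsub>G\<^esub> t)"
          using T Pair neg[OF lm_gen_closed(1)] lm_gen_closed(3)[OF lm_gen_closed(1), where b = True] by (simp add: lm_t_def cls.hom_inv)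
        then show ?thesis unfolding eq using IH t ti by auto
      qed
    qed
  qed
  then show ?thesis using w by simp
qed

lemma homs_eqI:
  assumes K: "group K" and h: "h \<in> hom G K" "h' \<in> hom G K"
    and eq: "\<And>v. v \<in> Zvec n \<Longrightarrow> h (x v) = h' (x v)" "h t = h' t" and g: "g \<in> carrier G"
  shows "h g = h' g"
proof -
  interpret h: group_hom G K h using K h by (simp add: group_hom_def group_hom_axioms_def G.group_axioms)
  interpret h': group_hom G K h' using K h by (simp add: group_hom_def group_hom_axioms_def G.group_axioms)
  from g show ?thesis
    by (rule lm_induct) (auto simp: h.hom_mult h'.hom_mult h.hom_inv h'.hom_inv eq)
qed

end

text \<open>Pigeonhole principle: two multiples of \<open>w\<close> lie in the same coset of
  \<open>L\<close>, so their difference is a positive multiple of \<open>w\<close> in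
  \<open>L\<close>.\<close>

lemma admissible_lm_data:
  assumes A: "A \<in> carrier (GLQ n)" and adm: "admissible n A L"
  shows "lm_data n A L"
proof -
  let ?M = "monoid_vec TYPE(rat) n\<lparr>carrier := max_domain n A\<rparr>"
  have sub: "subgroup L ?M" and fin: "finite (rcosets\<^bsub>?M\<^esub> L)"
    using adm by (auto simp: admissible_def finite_index_subgroup_def)
  have M: "v \<in> max_domain n A \<longleftrightarrow> v \<in> Zvec n \<and> A *\<^sub>v v \<in> Zvec n" for v
    unfolding max_domain_def mat_image_def
    using GLQ_inv_cancel[OF A] by (auto simp: Zvec_carrier intro: rev_image_eqI)
  have LM: "L \<subseteq> max_domain n A" using subgroup.subset[OF sub] by simp
  have LZ: "v \<in> L \<Longrightarrow> v \<in> Zvec n" "v \<in> L \<Longrightarrow> A *\<^sub>v v \<in> Zvec n" for v using LM M by auto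
  note Ac = GLQ_carrier_mat[OF A]
  have vM: "vsub n (max_domain n A)"
    unfolding vsub_def
  proof (intro conjI ballI)
    show "max_domain n A \<subseteq> carrier_vec n" using M Zvec_carrier by auto
    have "A *\<^sub>v 0\<^sub>v n = 0\<^sub>v n" using mact_zero[OF A, of 1] by (simp add: mact_1[OF A])
    then show "0\<^sub>v n \<in> max_domain n A" using M vsubD(2)[OF vsub_Zvec] by simp
    show "u + v \<in> max_domain n A" if "u \<in> max_domain n A" "v \<in> max_domain n A" for u v
      using that M vsubD(3)[OF vsub_Zvec] Zvec_carrier mult_add_distrib_mat_vec[OF Ac, of u v] by auto
    show "- u \<in> max_domain n A" if "u \<in> max_domain n A" for u
      using that M vsubD(4)[OF vsub_Zvec] mact_uminus[OF A, of u 1] Zvec_carrier by (simp add: mact_1[OF A])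
  qed
  have Mv: "?M = vgrp n (max_domain n A)"
    by (simp add: monoid_vec_def vgrp_def)
  have vL: "vsub n L"
    unfolding vsub_def
  proof (intro conjI ballI)
    show "L \<subseteq> carrier_vec n" using LZ Zvec_carrier by auto
    show "0\<^sub>v n \<in> L" using subgroup.one_closed[OF sub] by (simp add: Mv)
    show "u + v \<in> L" if "u \<in> L" "v \<in> L" for u v
      using subgroup.m_closed[OF sub that] by (simp add: Mv)
    show "- u \<in> L" if "u \<in> L" for u
      using subgroup.m_inv_closed[OF sub that] inv_vgrp[OF vM, of u] LM that by (auto simp: Mv)
  qed
  have tor: "\<exists>m::nat. m \<ge> 1 \<and> of_nat m \<cdot>\<^sub>v w \<in> L" if w: "w \<in> max_domain n A" for w
  proof -
    let ?c = "\<lambda>k::nat. L #>\<^bsub>?M\<^esub> (of_nat k \<cdot>\<^sub>v w)"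
    have kw: "of_nat k \<cdot>\<^sub>v w \<in> max_domain n A" for k by (rule vsub_nat_smult[OF vM w])
    have "?c ` UNIV \<subseteq> rcosets\<^bsub>?M\<^esub> L" using kw by (auto simp: RCOSETS_def)
    then have "finite (range ?c)" using fin finite_subset by blast
    then have "\<not> inj ?c" using finite_imageD[of ?c UNIV] by auto
    then obtain a b where "a \<noteq> b" "?c a = ?c b" by (auto simp: inj_on_def)
    then obtain a b where ab: "a < b" "?c a = ?c b" by (metis linorder_neqE_nat)
    have "of_nat b \<cdot>\<^sub>v w \<in> ?c b"
      using group.rcos_self[of ?M _ L] sub kw group_vgrp[OF vM] by (simp add: Mv)
    then obtain l where l: "l \<in> L" "of_nat b \<cdot>\<^sub>v w = l + of_nat a \<cdot>\<^sub>v w"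
      using ab(2) by (auto simp: r_coset_def Mv)
    have wc: "w \<in> carrier_vec n" "l \<in> carrier_vec n" using w M l(1) LZ Zvec_carrier by auto
    have "of_nat (b - a) \<cdot>\<^sub>v w = l"
    proof (rule eq_vecI)
      fix i assume i: "i < dim_vec l"
      then have "(of_nat b \<cdot>\<^sub>v w) $ i = (l + of_nat a \<cdot>\<^sub>v w) $ i" using l by simp
      then show "(of_nat (b - a) \<cdot>\<^sub>v w) $ i = l $ i"
        using wc i ab(1) by (simp add: of_nat_diff algebra_simps)
    qed (use wc in auto)
    then show ?thesis using ab l(1) by (intro exI[of _ "b - a"]) auto
  qed
  show ?thesis
  proof
    fix w assume w: "w \<in> Zvec n"
    \<comment> \<open>The pigeonhole argument starts from a vector of \<open>max_domain n A\<close>;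
      clearing the denominators of \<open>A *\<^sub>v w\<close> provides one.\<close>
    obtain m where m: "m \<ge> 1" "of_nat m \<cdot>\<^sub>v (A *\<^sub>v w) \<in> Zvec n"
      using ex_int_multiple[of "A *\<^sub>v w" n] Ac by auto
    have "A *\<^sub>v (of_nat m \<cdot>\<^sub>v w) = of_nat m \<cdot>\<^sub>v (A *\<^sub>v w)"
      using Ac Zvec_carrier[OF w] by (simp add: mult_mat_vec)
    then have "of_nat m \<cdot>\<^sub>v w \<in> max_domain n A"
      using M m vsub_nat_smult[OF vsub_Zvec w] by simp
    from tor[OF this] obtain k where k: "k \<ge> 1" "of_nat k \<cdot>\<^sub>v (of_nat m \<cdot>\<^sub>v w) \<in> L" by auto
    then have "of_nat (k * m) \<cdot>\<^sub>v w \<in> L" by (simp add: smult_smult_assoc)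
    then show "\<exists>m::nat. m \<ge> 1 \<and> of_nat m \<cdot>\<^sub>v w \<in> L"
      using k m by (intro exI[of _ "k * m"]) auto
  qed (use A vL LZ in auto)
qed

section \<open>Isomorphisms from the presentation\<close>

lemma (in group) inv_conj_eq:
  assumes "s \<in> carrier G" "a \<in> carrier G" "b \<in> carrier G" "s \<otimes> a = b \<otimes> s"
  shows "inv s \<otimes> b = a \<otimes> inv s"
proof -
  have "inv s \<otimes> b = inv s \<otimes> (b \<otimes> s) \<otimes> inv s" using assms(1-3) by (simp add: m_assoc)
  also have "\<dots> = inv s \<otimes> (s \<otimes> a) \<otimes> inv s" using assms(4) by simp
  also have "\<dots> = a \<otimes> inv s" using assms(1-3) by (simp add: m_assoc[symmetric])
  finally show ?thesis .
qed

lemma iso_of_inverse_homs: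
  assumes "h \<in> hom G H" "k \<in> hom H G" "\<And>x. x \<in> carrier G \<Longrightarrow> k (h x) = x"
    "\<And>y. y \<in> carrier H \<Longrightarrow> h (k y) = y"
  shows "h \<in> iso G H"
  using assms by (intro group_isomorphisms_imp_iso[of _ _ _ k]) (auto simp: group_isomorphisms_def)

lemma vsub_mat_image:
  assumes M: "M \<in> carrier_mat m n" and U: "vsub n U"
  shows "vsub m (mat_image M U)"
  unfolding vsub_def
proof (intro conjI ballI)
  show "mat_image M U \<subseteq> carrier_vec m" using M by (auto simp: mat_image_def)
  have "M *\<^sub>v 0\<^sub>v n = 0\<^sub>v m" using M by (intro eq_vecI) auto
  then show "0\<^sub>v m \<in> mat_image M U" using vsubD(2)[OF U] unfolding mat_image_def by (metis image_eqI)
next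
  fix u v assume "u \<in> mat_image M U" "v \<in> mat_image M U"
  then obtain a b where ab: "a \<in> U" "b \<in> U" "u = M *\<^sub>v a" "v = M *\<^sub>v b" by (auto simp: mat_image_def)
  then have "u + v = M *\<^sub>v (a + b)" using mult_add_distrib_mat_vec[OF M] vsubD(1)[OF U] by simp
  then show "u + v \<in> mat_image M U" using vsubD(3)[OF U] ab unfolding mat_image_def by blast
next
  fix u assume "u \<in> mat_image M U"
  then obtain a where a: "a \<in> U" "u = M *\<^sub>v a" by (auto simp: mat_image_def)
  then have "- u = M *\<^sub>v (- a)" using M vsubD(1)[OF U a(1)] by (intro eq_vecI) auto
  then show "- u \<in> mat_image M U" using vsubD(4)[OF U] a unfolding mat_image_def by blast
qed

lemma mat_image_mult:
  assumes "M \<in> carrier_mat m n" "N \<in> carrier_mat n k" "S \<subseteq> carrier_vec k"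
  shows "mat_image (M * N) S = mat_image M (mat_image N S)"
proof -
  have "(M * N) *\<^sub>v v = M *\<^sub>v (N *\<^sub>v v)" if "v \<in> S" for v
    using assms that assoc_mult_mat_vec by blast
  then show ?thesis by (auto simp: mat_image_def image_image cong: image_cong)
qed

lemma mat_image_inv_cancel:
  assumes "A \<in> carrier (GLQ n)" "S \<subseteq> carrier_vec n"
  shows "mat_image (inv\<^bsub>GLQ n\<^esub> A) (mat_image A S) = S" "mat_image A (mat_image (inv\<^bsub>GLQ n\<^esub> A) S) = S"
proof -
  have "inv\<^bsub>GLQ n\<^esub> A *\<^sub>v (A *\<^sub>v v) = v" "A *\<^sub>v (inv\<^bsub>GLQ n\<^esub> A *\<^sub>v v) = v" if "v \<in> S" for v
    using assms that GLQ_inv_cancel[OF assms(1)] by blast+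
  then show "mat_image (inv\<^bsub>GLQ n\<^esub> A) (mat_image A S) = S" "mat_image A (mat_image (inv\<^bsub>GLQ n\<^esub> A) S) = S"
    by (auto simp: mat_image_def image_image cong: image_cong)
qed

context lm_data
begin

lemma L_carrier: "v \<in> L \<Longrightarrow> v \<in> carrier_vec n"
  using LZ Zvec_carrier by auto

text \<open>Replacing the stable letter by its inverse turns the relations for \<open>A\<close> on
  \<open>L\<close> into relations for the inverse matrix on \<open>A L\<close>. This symmetry
  transfers statements from one edge group to the other.\<close>

lemma lm_data_inv: "lm_data n (inv\<^bsub>GLQ n\<^esub> A) (mat_image A L)"
proof
  show "vsub n (mat_image A L)" by (rule vsub_mat_image[OF GLQ_carrier_mat[OF A] L])
  show "inv\<^bsub>GLQ n\<^esub> A *\<^sub>v v \<in> Zvec n" if "v \<in> mat_image A L" for v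
    using that GLQ_inv_cancel(2)[OF A L_carrier] L_Zvec by (auto simp: mat_image_def)
  show "\<exists>m\<ge>1. of_nat m \<cdot>\<^sub>v w \<in> mat_image A L" if w: "w \<in> Zvec n" for w
  proof -
    let ?u = "inv\<^bsub>GLQ n\<^esub> A *\<^sub>v w"
    have u: "?u \<in> carrier_vec n" using GLQ_inv(2)[OF A] by simp
    obtain m where m: "m \<ge> 1" "of_nat m \<cdot>\<^sub>v ?u \<in> Zvec n" using ex_int_multiple[OF u] by auto
    obtain k where k: "k \<ge> 1" "of_nat k \<cdot>\<^sub>v (of_nat m \<cdot>\<^sub>v ?u) \<in> L" using tor[OF m(2)] by auto
    have "A *\<^sub>v (of_nat (k * m) \<cdot>\<^sub>v ?u) = of_nat (k * m) \<cdot>\<^sub>v w"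
      using mult_mat_vec[OF GLQ_carrier_mat[OF A] u] GLQ_inv_cancel(1)[OF A Zvec_carrier[OF w]] by simp
    moreover have "of_nat (k * m) \<cdot>\<^sub>v ?u \<in> L" using k(2) by (simp add: smult_smult_assoc)
    ultimately have "of_nat (k * m) \<cdot>\<^sub>v w \<in> mat_image A L" unfolding mat_image_def by (metis image_eqI)
    then show ?thesis using k m by (intro exI[of _ "k * m"]) auto
  qed
qed (use GLQ_inv[OF A] ALZ in \<open>auto simp: mat_image_def\<close>)

lemma flip_hom:
  assumes "lm_data n A' L'" "A' = inv\<^bsub>GLQ n\<^esub> A" "L' = mat_image A L"
  obtains h where "h \<in> hom G (lm_group n A' L')" "\<And>v. v \<in> Zvec n \<Longrightarrow> h (x v) = lm_x n A' L' v"
    "h t = inv\<^bsub>lm_group n A' L'\<^esub> (lm_t n A' L')"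
proof -
  interpret B: lm_data n A' L' by fact
  have "inv\<^bsub>B.G\<^esub> B.t \<otimes>\<^bsub>B.G\<^esub> B.x v = B.x (A *\<^sub>v v) \<otimes>\<^bsub>B.G\<^esub> inv\<^bsub>B.G\<^esub> B.t" if v: "v \<in> L" for v
  proof -
    have "A *\<^sub>v v \<in> L'" using v assms(3) by (auto simp: mat_image_def)
    then have "B.t \<otimes>\<^bsub>B.G\<^esub> B.x (A *\<^sub>v v) = B.x v \<otimes>\<^bsub>B.G\<^esub> B.t"
      using B.t_x[of "A *\<^sub>v v"] GLQ_inv_cancel(2)[OF A L_carrier[OF v]] assms(2) by simp
    then show ?thesis by (intro B.G.inv_conj_eq) auto
  qed
  then show ?thesis
    using hom_exists[OF B.G.group_axioms B.x_hom B.G.inv_closed[OF B.t_closed]] that by metis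
qed

lemma flip_iso:
  assumes "lm_data n A' L'" "A' = inv\<^bsub>GLQ n\<^esub> A" "L' = mat_image A L"
  obtains h where "h \<in> iso G (lm_group n A' L')" "\<And>v. v \<in> Zvec n \<Longrightarrow> h (x v) = lm_x n A' L' v"
    "h t = inv\<^bsub>lm_group n A' L'\<^esub> (lm_t n A' L')"
proof -
  interpret B: lm_data n A' L' by fact
  obtain h where h: "h \<in> hom G B.G" "\<And>v. v \<in> Zvec n \<Longrightarrow> h (x v) = B.x v" "h t = inv\<^bsub>B.G\<^esub> B.t"
    using flip_hom assms by blast
  \<comment> \<open>Flipping twice restores the original data, so the same construction supplies the
    inverse homomorphism.\<close>
  have e: "A = inv\<^bsub>GLQ n\<^esub> A'" "L = mat_image A' L'"
    unfolding assms(2,3) using GLQ_inv_inv[OF A] mat_image_inv_cancel(1)[OF A, of L] L_carrier by auto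
  obtain k where k: "k \<in> hom B.G G" "\<And>v. v \<in> Zvec n \<Longrightarrow> k (B.x v) = x v" "k B.t = inv\<^bsub>G\<^esub> t"
    using B.flip_hom[OF lm_data_axioms e] by blast
  interpret h: group_hom G B.G h by unfold_locales (rule h(1))
  interpret k: group_hom B.G G k by unfold_locales (rule k(1))
  have "k (h g) = g" if "g \<in> carrier G" for g
    using homs_eqI[OF G.group_axioms, of "k \<circ> h" id g] that h k hom_compose[OF h(1) k(1)]
    by (auto simp: hom_def k.hom_inv)
  moreover have "h (k g) = g" if "g \<in> carrier B.G" for g
    using B.homs_eqI[OF B.G.group_axioms, of "h \<circ> k" id g] that h k hom_compose[OF k(1) h(1)]
    by (auto simp: hom_def h.hom_inv)
  ultimately have "h \<in> iso G B.G" using iso_of_inverse_homs[OF h(1) k(1)] by blast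
  then show ?thesis using that h by blast
qed

lemma flip_is_iso: "G \<cong> lm_group n (inv\<^bsub>GLQ n\<^esub> A) (mat_image A L)"
proof (rule flip_iso[OF lm_data_inv refl refl])
  fix h assume "h \<in> iso G (lm_group n (inv\<^bsub>GLQ n\<^esub> A) (mat_image A L))"
  then show ?thesis by (rule is_isoI)
qed

lemma conj_hom:
  assumes "lm_data n A' L'" "A' * B = B * A" "mat_image B L \<subseteq> L'" "B \<in> carrier_mat n n"
    and BZ: "\<And>v. v \<in> Zvec n \<Longrightarrow> B *\<^sub>v v \<in> Zvec n"
  obtains h where "h \<in> hom G (lm_group n A' L')" "\<And>v. v \<in> Zvec n \<Longrightarrow> h (x v) = lm_x n A' L' (B *\<^sub>v v)"
    "h t = lm_t n A' L'"
proof -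
  interpret B: lm_data n A' L' by fact
  have c: "A' \<in> carrier_mat n n" "A \<in> carrier_mat n n" using A B.A GLQ_carrier_mat by auto
  have "(\<lambda>v. B *\<^sub>v v) \<in> hom (vgrp n (Zvec n)) (vgrp n (Zvec n))"
    by (rule mat_hom_vgrp[OF assms(4)]) (use BZ in \<open>auto simp: Zvec_carrier\<close>)
  from hom_compose[OF this B.x_hom]
  have hom: "(\<lambda>v. B.x (B *\<^sub>v v)) \<in> hom (vgrp n (Zvec n)) B.G" by (simp add: comp_def)
  have "B.t \<otimes>\<^bsub>B.G\<^esub> B.x (B *\<^sub>v v) = B.x (B *\<^sub>v (A *\<^sub>v v)) \<otimes>\<^bsub>B.G\<^esub> B.t" if v: "v \<in> L" for v
  proof -
    have "B *\<^sub>v v \<in> L'" using v assms(3) by (auto simp: mat_image_def)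
    moreover have "A' *\<^sub>v (B *\<^sub>v v) = B *\<^sub>v (A *\<^sub>v v)"
      using assms(2,4) c L_carrier[OF v] by (metis assoc_mult_mat_vec)
    ultimately show ?thesis using B.t_x by fastforce
  qed
  then show ?thesis using hom_exists[OF B.G.group_axioms hom B.t_closed] that by metis
qed

text \<open>An integral base change sends \<open>x v\<close> to \<open>x (B *\<^sub>v v)\<close> and
  keeps the stable letter; the inverse matrix gives the inverse map, and both composites are
  identified on generators.\<close>

lemma conj_iso:
  assumes "lm_data n A' L'" and B: "B \<in> GLZ n" and "A' = B * A * inv\<^bsub>GLQ n\<^esub> B" "L' = mat_image B L"
  shows "G \<cong> lm_group n A' L'"
proof -
  interpret B: lm_data n A' L' by fact
  let ?C = "inv\<^bsub>GLQ n\<^esub> B"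
  note Bd = GLZ_D[OF B]
  note C = GLQ_inv[OF Bd(1)]
  note Ac = GLQ_carrier_mat[OF A]
  have c: "A * ?C \<in> carrier_mat n n" "B * A \<in> carrier_mat n n" using Ac C Bd by auto
  have "A' * B = B * A * (?C * B)"
    unfolding assms(3) using Ac C(2) Bd(2) c by (intro assoc_mult_mat) auto
  then have e1: "A' * B = B * A" using right_mult_one_mat[OF c(2)] C by simp
  have "?C * A' = ?C * (B * (A * ?C))"
    unfolding assms(3) using Ac C(2) Bd(2) by (subst assoc_mult_mat[OF Bd(2) Ac C(2)]) simp
  also have "\<dots> = (?C * B) * (A * ?C)" using assoc_mult_mat[OF C(2) Bd(2) c(1)] by simp
  finally have e2: "?C * A' = A * ?C" using left_mult_one_mat[OF c(1)] C by simp
  obtain h where h: "h \<in> hom G B.G" "\<And>v. v \<in> Zvec n \<Longrightarrow> h (x v) = B.x (B *\<^sub>v v)" "h t = B.t"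
    using conj_hom[OF assms(1) e1 _ Bd(2,3)] assms(4) by blast
  have "mat_image ?C L' \<subseteq> L"
    unfolding assms(4) using mat_image_inv_cancel(1)[OF Bd(1), of L] L_carrier by blast
  then obtain k where k: "k \<in> hom B.G G" "\<And>v. v \<in> Zvec n \<Longrightarrow> k (B.x v) = x (?C *\<^sub>v v)" "k B.t = t"
    using B.conj_hom[OF lm_data_axioms e2[symmetric] _ C(2) Bd(4)] by blast
  have "k (h g) = g" if "g \<in> carrier G" for g
    using homs_eqI[OF G.group_axioms, of "k \<circ> h" id g] that h k hom_compose[OF h(1) k(1)] Bd
      GLQ_inv_cancel[OF Bd(1) Zvec_carrier]
    by (auto simp: hom_def)
  moreover have "h (k g) = g" if "g \<in> carrier B.G" for g
    using B.homs_eqI[OF B.G.group_axioms, of "h \<circ> k" id g] that h k hom_compose[OF k(1) h(1)] Bd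
      GLQ_inv_cancel[OF Bd(1) Zvec_carrier]
    by (auto simp: hom_def)
  ultimately have "h \<in> iso G B.G" using iso_of_inverse_homs[OF h(1) k(1)] by blast
  then show ?thesis by (rule is_isoI)
qed

text \<open>After the flip this is \<open>conj_iso\<close> for the inverse data.\<close>

lemma conj_inv_iso:
  assumes "lm_data n A' L'" and B: "B \<in> GLZ n"
    and "A' = B * inv\<^bsub>GLQ n\<^esub> A * inv\<^bsub>GLQ n\<^esub> B" "L' = mat_image (B * A) L"
  shows "G \<cong> lm_group n A' L'"
proof -
  interpret I: lm_data n "inv\<^bsub>GLQ n\<^esub> A" "mat_image A L" by (rule lm_data_inv)
  have "L' = mat_image B (mat_image A L)"
    unfolding assms(4) using GLZ_D[OF B] GLQ_carrier_mat[OF A] L_carrier by (intro mat_image_mult) auto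
  from I.conj_iso[OF assms(1) B assms(3) this]
  have "I.G \<cong> lm_group n A' L'" .
  with flip_is_iso show ?thesis by (rule iso_trans)
qed

end

section \<open>Semidirect products of lattices with the integers\<close>

text \<open>The pair \<open>(v, k)\<close> stands for \<open>v\<close> times the \<open>k\<close>-th
  power of the stable letter \<open>(0\<^sub>v n, 1)\<close>, which acts on \<open>U\<close> by
  \<open>A\<close>.\<close>

definition sdp :: "nat \<Rightarrow> rat mat \<Rightarrow> rat vec set \<Rightarrow> (rat vec \<times> int) monoid" where
  "sdp n A U = \<lparr>carrier = U \<times> UNIV,
    monoid.mult = (\<lambda>p q. (fst p + mact n A (snd p) (fst q), snd p + snd q)), one = (0\<^sub>v n, 0)\<rparr>"

lemma sdp_simps [simp]:
  "carrier (sdp n A U) = U \<times> UNIV" "\<one>\<^bsub>sdp n A U\<^esub> = (0\<^sub>v n, 0)"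
  "p \<otimes>\<^bsub>sdp n A U\<^esub> q = (fst p + mact n A (snd p) (fst q), snd p + snd q)"
  by (simp_all add: sdp_def)

locale sdp_data =
  fixes n :: nat and A :: "rat mat" and U :: "rat vec set"
  assumes A: "A \<in> carrier (GLQ n)" and U: "vsub n U"
    and AU: "\<And>k v. v \<in> U \<Longrightarrow> mact n A k v \<in> U"
begin

abbreviation "S \<equiv> sdp n A U"

lemma Uc [simp]: "v \<in> U \<Longrightarrow> v \<in> carrier_vec n"
  using vsubD(1)[OF U] .

sublocale S: group S
proof (rule groupI)
  fix p q r assume "p \<in> carrier S" "q \<in> carrier S" "r \<in> carrier S"
  then have c: "fst p \<in> U" "fst q \<in> U" "fst r \<in> U" by auto
  have "fst p + mact n A (snd p) (fst q) + mact n A (snd p + snd q) (fst r)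
    = fst p + mact n A (snd p) (fst q + mact n A (snd q) (fst r))"
    using c A assoc_add_vec[of "fst p" n] by (simp add: mact_plus mact_add)
  then show "p \<otimes>\<^bsub>S\<^esub> q \<otimes>\<^bsub>S\<^esub> r = p \<otimes>\<^bsub>S\<^esub> (q \<otimes>\<^bsub>S\<^esub> r)" by simp
next
  fix p assume "p \<in> carrier S"
  then obtain v k where p: "p = (v, k)" "v \<in> U" by auto
  then show "\<exists>q\<in>carrier S. q \<otimes>\<^bsub>S\<^esub> p = \<one>\<^bsub>S\<^esub>"
    using AU vsubD(4)[OF U] by (intro bexI[of _ "(- mact n A (- k) v, - k)"]) (auto simp: A)
  show "\<one>\<^bsub>S\<^esub> \<otimes>\<^bsub>S\<^esub> p = p" using p A by (simp add: mact_0)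
qed (use AU vsubD[OF U] in auto)

lemma pow_t: "(0\<^sub>v n, 1) [^]\<^bsub>S\<^esub> (k::int) = (0\<^sub>v n, k)"
proof (induction k rule: int_induct[where k = 0])
  case (step1 i)
  have "(0\<^sub>v n, 1) [^]\<^bsub>S\<^esub> (i + 1) = (0\<^sub>v n, 1) [^]\<^bsub>S\<^esub> i \<otimes>\<^bsub>S\<^esub> (0\<^sub>v n, 1)"
    using vsubD(2)[OF U] S.int_pow_mult[of "(0\<^sub>v n, 1)" i 1] S.int_pow_1[of "(0\<^sub>v n, 1)"] by simp
  then show ?case using step1 A by (simp add: mact_zero)
next
  case (step2 i)
  have "(0\<^sub>v n, 1) [^]\<^bsub>S\<^esub> i = (0\<^sub>v n, 1) [^]\<^bsub>S\<^esub> (i - 1) \<otimes>\<^bsub>S\<^esub> (0\<^sub>v n, 1)"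
    using vsubD(2)[OF U] S.int_pow_mult[of "(0\<^sub>v n, 1)" "i - 1" 1] S.int_pow_1[of "(0\<^sub>v n, 1)"]
    by simp
  moreover obtain w j where w: "(0\<^sub>v n, 1) [^]\<^bsub>S\<^esub> (i - 1) = (w, j)" "w \<in> U"
    using S.int_pow_closed[of "(0\<^sub>v n, 1)" "i - 1"] vsubD(2)[OF U] by auto
  ultimately show ?case using step2 A by (simp add: mact_zero)
qed simp

lemma embed_hom: "(\<lambda>v. (v, 0)) \<in> hom (vgrp n U) S"
  using A by (auto simp: hom_def mact_0)

lemma t_embed: "v \<in> U \<Longrightarrow> (0\<^sub>v n, 1) \<otimes>\<^bsub>S\<^esub> (v, 0) = (A *\<^sub>v v, 0) \<otimes>\<^bsub>S\<^esub> (0\<^sub>v n, 1)"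
  using A AU[of v 1] mact_closed[OF A, of 1 v] by (simp add: mact_1 mact_0)

text \<open>Universal property of the semidirect product. The hypothesis moves \<open>s\<close> past
  \<open>f u\<close>, and \<open>pw\<close> extends this to all integer powers of
  \<open>s\<close>.\<close>

lemma hom_from:
  assumes K: "group K" and f: "f \<in> hom (vgrp n U) K" and s: "s \<in> carrier K"
    and rel: "\<And>u. u \<in> U \<Longrightarrow> s \<otimes>\<^bsub>K\<^esub> f u = f (A *\<^sub>v u) \<otimes>\<^bsub>K\<^esub> s"
  shows "(\<lambda>(v, k). f v \<otimes>\<^bsub>K\<^esub> s [^]\<^bsub>K\<^esub> k) \<in> hom S K"
proof -
  interpret K: group K by (rule K)
  have fc: "f u \<in> carrier K" if "u \<in> U" for u using f that by (auto simp: hom_def)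
  have fm: "f (u + w) = f u \<otimes>\<^bsub>K\<^esub> f w" if "u \<in> U" "w \<in> U" for u w
    using f that by (auto simp: hom_def)
  have pw: "s [^]\<^bsub>K\<^esub> k \<otimes>\<^bsub>K\<^esub> f u = f (mact n A k u) \<otimes>\<^bsub>K\<^esub> s [^]\<^bsub>K\<^esub> k" if u: "u \<in> U" for u and k :: int
  proof (induction k rule: int_induct[where k = 0])
    case base
    then show ?case using fc u A by (simp add: mact_0)
  next
    case (step1 i)
    let ?w = "mact n A i u"
    have w: "?w \<in> U" "mact n A (i + 1) u \<in> U" by (rule AU[OF u])+
    have w1: "mact n A (i + 1) u = A *\<^sub>v ?w"
      using mact_plus[OF A, of u 1 i] u A by (simp add: mact_1 add.commute)
    have "s [^]\<^bsub>K\<^esub> (i + 1) = s \<otimes>\<^bsub>K\<^esub> s [^]\<^bsub>K\<^esub> i"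
      using K.int_pow_mult[OF s, of 1 i] s by (simp add: add.commute)
    then have "s [^]\<^bsub>K\<^esub> (i + 1) \<otimes>\<^bsub>K\<^esub> f u = s \<otimes>\<^bsub>K\<^esub> f ?w \<otimes>\<^bsub>K\<^esub> s [^]\<^bsub>K\<^esub> i"
      using step1 s fc u w by (simp add: K.m_assoc)
    also have "\<dots> = f (mact n A (i + 1) u) \<otimes>\<^bsub>K\<^esub> (s \<otimes>\<^bsub>K\<^esub> s [^]\<^bsub>K\<^esub> i)"
      using rel[OF w(1)] s fc[OF w(1)] fc[OF w(2)] unfolding w1 by (simp add: K.m_assoc)
    also have "\<dots> = f (mact n A (i + 1) u) \<otimes>\<^bsub>K\<^esub> s [^]\<^bsub>K\<^esub> (i + 1)"
      using K.int_pow_mult[OF s, of 1 i] s by (simp add: add.commute)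
    finally show ?case .
  next
    case (step2 i)
    let ?w = "mact n A (i - 1) u"
    have w: "?w \<in> U" "mact n A i u \<in> U" by (rule AU[OF u])+
    have w1: "mact n A i u = A *\<^sub>v ?w"
      using mact_plus[OF A, of u 1 "i - 1"] u A by (simp add: mact_1)
    have si: "s [^]\<^bsub>K\<^esub> i = s \<otimes>\<^bsub>K\<^esub> s [^]\<^bsub>K\<^esub> (i - 1)"
      using K.int_pow_mult[OF s, of 1 "i - 1"] s by simp
    \<comment> \<open>Going down, both sides are multiplied by \<open>s\<close> on the left, which
      leads back to the known exponent \<open>i\<close>; then \<open>s\<close> is cancelled.\<close>
    have "s \<otimes>\<^bsub>K\<^esub> (s [^]\<^bsub>K\<^esub> (i - 1) \<otimes>\<^bsub>K\<^esub> f u) = s \<otimes>\<^bsub>K\<^esub> (f ?w \<otimes>\<^bsub>K\<^esub> s [^]\<^bsub>K\<^esub> (i - 1))"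
      using step2 rel[OF w(1)] s fc[OF u] fc[OF w(1)] fc[OF w(2)] unfolding si w1[symmetric]
      by (simp add: K.m_assoc[symmetric])
    then show ?case using s fc[OF u] fc[OF w(1)] by simp
  qed
  show ?thesis
  proof (rule homI)
    fix p q assume "p \<in> carrier S" "q \<in> carrier S"
    then obtain v k w l where pq: "p = (v, k)" "q = (w, l)" "v \<in> U" "w \<in> U" by auto
    have "f v \<otimes>\<^bsub>K\<^esub> s [^]\<^bsub>K\<^esub> k \<otimes>\<^bsub>K\<^esub> (f w \<otimes>\<^bsub>K\<^esub> s [^]\<^bsub>K\<^esub> l)
      = f v \<otimes>\<^bsub>K\<^esub> (s [^]\<^bsub>K\<^esub> k \<otimes>\<^bsub>K\<^esub> f w) \<otimes>\<^bsub>K\<^esub> s [^]\<^bsub>K\<^esub> l"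
      using pq fc s by (simp add: K.m_assoc)
    also have "\<dots> = f (v + mact n A k w) \<otimes>\<^bsub>K\<^esub> s [^]\<^bsub>K\<^esub> (k + l)"
      using pq fc s AU[of w k] by (simp add: pw fm K.int_pow_mult K.m_assoc)
    finally show "(\<lambda>(v, k). f v \<otimes>\<^bsub>K\<^esub> s [^]\<^bsub>K\<^esub> k) (p \<otimes>\<^bsub>S\<^esub> q)
      = (\<lambda>(v, k). f v \<otimes>\<^bsub>K\<^esub> s [^]\<^bsub>K\<^esub> k) p \<otimes>\<^bsub>K\<^esub> (\<lambda>(v, k). f v \<otimes>\<^bsub>K\<^esub> s [^]\<^bsub>K\<^esub> k) q"
      using pq by simp
  qed (use fc s in auto)
qed

text \<open>The sign \<open>e\<close> allows the stable letter to be sent to its inverse;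
  bijectivity in the second component comes from \<open>e * e = 1\<close>.\<close>

lemma linear_iso:
  assumes A': "A' \<in> carrier (GLQ n)" and B: "B \<in> carrier (GLQ n)" and e: "e \<in> {1, -1 :: int}"
    and conj: "\<And>v k. v \<in> carrier_vec n \<Longrightarrow> mact n A' k (B *\<^sub>v v) = B *\<^sub>v mact n A (e * k) v"
  shows "(\<lambda>(v, k). (B *\<^sub>v v, e * k)) \<in> iso S (sdp n A' (mat_image B U))"
proof -
  have ee: "e * (e * k) = k" for k using e by auto
  note Bc = GLQ_carrier_mat[OF B]
  have "(\<lambda>(v, k). (B *\<^sub>v v, e * k)) \<in> hom S (sdp n A' (mat_image B U))"
    using mult_add_distrib_mat_vec[OF Bc] AU
    by (auto simp: hom_def mat_image_def conj ee mact_closed[OF A] distrib_left)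
  moreover have "inj_on (\<lambda>(v, k). (B *\<^sub>v v, e * k)) (carrier S)"
    using GLQ_inv_cancel(2)[OF B] e by (auto simp: inj_on_def) (metis Uc)+
  moreover have "(\<lambda>(v, k). (B *\<^sub>v v, e * k)) ` carrier S = carrier (sdp n A' (mat_image B U))"
  proof -
    have "(B *\<^sub>v v, k) \<in> (\<lambda>(v, k). (B *\<^sub>v v, e * k)) ` (U \<times> UNIV)" if "v \<in> U" for v k
      using that ee by (intro rev_image_eqI[of "(v, e * k)"]) auto
    then show ?thesis by (auto simp: mat_image_def)
  qed
  ultimately show ?thesis by (auto simp: iso_def bij_betw_def)
qed

end

text \<open>This is the group \<open>U\<close> of the overview. When \<open>A\<close> or its inverse
  is integral, the union is a chain of lattices and hence a subgroup.\<close>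

definition lat :: "nat \<Rightarrow> rat mat \<Rightarrow> rat vec set" where
  "lat n A = (\<Union>j::int. mat_image (A [^]\<^bsub>GLQ n\<^esub> j) (Zvec n))"

lemma lat_iff: "u \<in> lat n A \<longleftrightarrow> (\<exists>j. \<exists>v\<in>Zvec n. u = mact n A j v)"
  by (auto simp: lat_def mat_image_def mact_def)

lemma mact_nonneg_Zvec:
  assumes A: "A \<in> carrier (GLQ n)" and AZ: "\<And>v. v \<in> Zvec n \<Longrightarrow> A *\<^sub>v v \<in> Zvec n"
    and v: "v \<in> Zvec n" and k: "k \<ge> 0"
  shows "mact n A k v \<in> Zvec n"
  using k
proof (induction k rule: int_ge_induct)
  case base
  then show ?case using v A Zvec_carrier by (simp add: mact_0)
next
  case (step i)
  then show ?case using AZ mact_plus[OF A Zvec_carrier[OF v], of 1 i] by (simp add: mact_1[OF A] add.commute)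
qed

lemma mact_lat: "A \<in> carrier (GLQ n) \<Longrightarrow> u \<in> lat n A \<Longrightarrow> mact n A k u \<in> lat n A"
  unfolding lat_iff by (metis mact_plus Zvec_carrier)

lemma Zvec_lat: "A \<in> carrier (GLQ n) \<Longrightarrow> Zvec n \<subseteq> lat n A"
  unfolding lat_iff subset_iff by (metis mact_0 Zvec_carrier)

lemma lat_inv:
  assumes "A \<in> carrier (GLQ n)"
  shows "lat n (inv\<^bsub>GLQ n\<^esub> A) = lat n A"
  unfolding set_eq_iff lat_iff mact_inv[OF assms] by (metis minus_minus)

lemma sdp_data_lat_aux:
  assumes A: "A \<in> carrier (GLQ n)" and AZ: "\<And>v. v \<in> Zvec n \<Longrightarrow> A *\<^sub>v v \<in> Zvec n"
  shows "vsub n (lat n A)"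
  unfolding vsub_def
proof (intro conjI ballI)
  show "lat n A \<subseteq> carrier_vec n" using A by (auto simp: lat_iff)
  show "0\<^sub>v n \<in> lat n A" using Zvec_lat[OF A] vsubD(2)[OF vsub_Zvec] by auto
next
  fix u v assume "u \<in> lat n A" "v \<in> lat n A"
  then obtain i a j b where ab: "a \<in> Zvec n" "b \<in> Zvec n" "u = mact n A i a" "v = mact n A j b"
    by (auto simp: lat_iff)
  \<comment> \<open>As \<open>A\<close> is integral, the lattices \<open>A\<^sup>j(Z^n)\<close> grow
    when \<open>j\<close> decreases; both vectors lie in the one with the smaller index.\<close>
  define m where "m = min i j"
  have "u = mact n A m (mact n A (i - m) a)" "v = mact n A m (mact n A (j - m) b)"
    using ab mact_plus[OF A Zvec_carrier, of _ m] by (metis add.commute diff_add_cancel)+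
  moreover have 1: "mact n A (i - m) a \<in> Zvec n" "mact n A (j - m) b \<in> Zvec n"
    using ab by (auto intro!: mact_nonneg_Zvec[OF A AZ] simp: m_def)
  ultimately have "u + v = mact n A m (mact n A (i - m) a + mact n A (j - m) b)"
    using mact_add[OF A] Zvec_carrier by simp
  then show "u + v \<in> lat n A" using 1 vsubD(3)[OF vsub_Zvec] unfolding lat_iff by blast
next
  fix u assume "u \<in> lat n A"
  then obtain i a where "a \<in> Zvec n" "u = mact n A i a" by (auto simp: lat_iff)
  then have "- u = mact n A i (- a)" "- a \<in> Zvec n"
    using mact_uminus[OF A Zvec_carrier] vsubD(4)[OF vsub_Zvec] by auto
  then show "- u \<in> lat n A" unfolding lat_iff by blast
qed

text \<open>The name refers to ascending HNN extensions. The condition mentions the matrix alone,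
  since this is what makes \<open>lat n A\<close> a chain; it follows when \<open>L\<close> or
  \<open>A L\<close> is all of Z^n (\<open>ascendingI\<close>).\<close>

definition ascending :: "nat \<Rightarrow> rat mat \<Rightarrow> bool" where
  "ascending n A \<longleftrightarrow> (\<forall>v\<in>Zvec n. A *\<^sub>v v \<in> Zvec n) \<or> (\<forall>v\<in>Zvec n. inv\<^bsub>GLQ n\<^esub> A *\<^sub>v v \<in> Zvec n)"

lemma sdp_data_lat:
  assumes A: "A \<in> carrier (GLQ n)" and "ascending n A"
  shows "sdp_data n A (lat n A)"
proof
  have "vsub n (lat n (inv\<^bsub>GLQ n\<^esub> A))" if "\<forall>v\<in>Zvec n. inv\<^bsub>GLQ n\<^esub> A *\<^sub>v v \<in> Zvec n"
    using that GLQ_inv[OF A] by (intro sdp_data_lat_aux) auto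
  then show "vsub n (lat n A)"
    using assms sdp_data_lat_aux[OF A] unfolding ascending_def lat_inv[OF A] by auto
qed (use A mact_lat in auto)

context lm_data
begin

text \<open>Every element is a nonpositive power of \<open>t\<close>, times some \<open>x v\<close>,
  times a power of \<open>t\<close> (\<open>nf\<close>). The image of such a product is trivial only
  if \<open>v = 0\<close> and the two exponents cancel, so the map to the semidirect product is
  injective.\<close>

lemma Zvec_sdp_iso:
  assumes LZ: "L = Zvec n"
  shows "G \<cong> sdp n A (lat n A)"
proof -
  have AZ: "\<And>v. v \<in> Zvec n \<Longrightarrow> A *\<^sub>v v \<in> Zvec n" using ALZ LZ by auto
  have tZ: "t \<otimes>\<^bsub>G\<^esub> x v = x (A *\<^sub>v v) \<otimes>\<^bsub>G\<^esub> t" if "v \<in> Zvec n" for v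
    using t_x[of v] that LZ by blast
  from AZ interpret U: sdp_data n A "lat n A"
    by (intro sdp_data_lat A) (auto simp: ascending_def)
  have t0: "(0\<^sub>v n, 1) \<in> carrier U.S" using vsubD(2)[OF U.U] by simp
  have "(\<lambda>v. (v, 0)) \<in> hom (vgrp n (Zvec n)) U.S"
    using U.embed_hom Zvec_lat[OF A] by (auto simp: hom_def)
  from hom_exists[OF U.S.group_axioms this t0] U.t_embed Zvec_lat[OF A] LZ
  obtain h where h: "h \<in> hom G U.S" "\<And>v. v \<in> Zvec n \<Longrightarrow> h (x v) = (v, 0)" "h t = (0\<^sub>v n, 1)"
    by blast
  interpret h: group_hom G U.S h by unfold_locales (rule h(1))
  have ht: "h (t [^]\<^bsub>G\<^esub> k) = (0\<^sub>v n, k)" for k :: int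
    using h.hom_int_pow[of t k] U.pow_t h(3) by simp
  \<comment> \<open>Restricted to nonnegative powers of \<open>t\<close>, because a negative power
    of \<open>A\<close> may lead out of Z^n.\<close>
  have tx: "t [^]\<^bsub>G\<^esub> int a \<otimes>\<^bsub>G\<^esub> x v = x (mact n A (int a) v) \<otimes>\<^bsub>G\<^esub> t [^]\<^bsub>G\<^esub> int a" if v: "v \<in> Zvec n" for a v
  proof (induction a)
    case 0
    then show ?case using v A Zvec_carrier by (simp add: mact_0)
  next
    case (Suc a)
    let ?w = "mact n A (int a) v"
    have w: "?w \<in> Zvec n" by (rule mact_nonneg_Zvec[OF A AZ v]) auto
    have w1: "mact n A (int (Suc a)) v = A *\<^sub>v ?w"
      using mact_plus[OF A Zvec_carrier[OF v], of 1 "int a"] by (simp add: mact_1[OF A])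
    have ts: "t [^]\<^bsub>G\<^esub> int (Suc a) = t \<otimes>\<^bsub>G\<^esub> t [^]\<^bsub>G\<^esub> int a"
      using G.int_pow_mult[OF t_closed, of 1 "int a"] G.int_pow_1[OF t_closed] by simp
    have "t [^]\<^bsub>G\<^esub> int (Suc a) \<otimes>\<^bsub>G\<^esub> x v = t \<otimes>\<^bsub>G\<^esub> x ?w \<otimes>\<^bsub>G\<^esub> t [^]\<^bsub>G\<^esub> int a"
      unfolding ts using Suc by (simp add: G.m_assoc del: pow_nat)
    also have "\<dots> = x (A *\<^sub>v ?w) \<otimes>\<^bsub>G\<^esub> (t \<otimes>\<^bsub>G\<^esub> t [^]\<^bsub>G\<^esub> int a)"
      using tZ[OF w] by (simp add: G.m_assoc[symmetric] del: pow_nat)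
    finally show ?case unfolding ts w1 .
  qed
  have nf: "\<exists>(a::nat) (b::int). \<exists>v\<in>Zvec n. g = t [^]\<^bsub>G\<^esub> (- int a) \<otimes>\<^bsub>G\<^esub> x v \<otimes>\<^bsub>G\<^esub> t [^]\<^bsub>G\<^esub> b"
    if "g \<in> carrier G" for g
    using that
  proof (rule lm_induct)
    have "\<one>\<^bsub>G\<^esub> = t [^]\<^bsub>G\<^esub> (- int 0) \<otimes>\<^bsub>G\<^esub> x (0\<^sub>v n) \<otimes>\<^bsub>G\<^esub> t [^]\<^bsub>G\<^esub> (0::int)" by (simp add: x_zero)
    then show "\<exists>(a::nat) (b::int). \<exists>v\<in>Zvec n. \<one>\<^bsub>G\<^esub> = t [^]\<^bsub>G\<^esub> (- int a) \<otimes>\<^bsub>G\<^esub> x v \<otimes>\<^bsub>G\<^esub> t [^]\<^bsub>G\<^esub> b"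
      using vsubD(2)[OF vsub_Zvec] by blast
  next
    fix g w assume "g \<in> carrier G" and w: "w \<in> Zvec n"
      and "\<exists>(a::nat) (b::int). \<exists>v\<in>Zvec n. g = t [^]\<^bsub>G\<^esub> (- int a) \<otimes>\<^bsub>G\<^esub> x v \<otimes>\<^bsub>G\<^esub> t [^]\<^bsub>G\<^esub> b"
    then obtain a :: nat and b :: int and v where
      v: "v \<in> Zvec n" "g = t [^]\<^bsub>G\<^esub> (- int a) \<otimes>\<^bsub>G\<^esub> x v \<otimes>\<^bsub>G\<^esub> t [^]\<^bsub>G\<^esub> b" by blast
    let ?w = "mact n A (int a) w"
    have w': "?w \<in> Zvec n" by (rule mact_nonneg_Zvec[OF A AZ w]) auto
    have 1: "x w \<otimes>\<^bsub>G\<^esub> t [^]\<^bsub>G\<^esub> (- int a) = t [^]\<^bsub>G\<^esub> (- int a) \<otimes>\<^bsub>G\<^esub> x ?w"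
      using G.inv_conj_eq[OF _ _ _ tx[OF w, of a]] by (simp add: G.int_pow_neg del: pow_nat)
    have "x w \<otimes>\<^bsub>G\<^esub> g = t [^]\<^bsub>G\<^esub> (- int a) \<otimes>\<^bsub>G\<^esub> x (?w + v) \<otimes>\<^bsub>G\<^esub> t [^]\<^bsub>G\<^esub> b"
      using 1 v w w' by (simp add: x_add G.m_assoc[symmetric])
    then show "\<exists>(a::nat) (b::int). \<exists>v\<in>Zvec n. x w \<otimes>\<^bsub>G\<^esub> g = t [^]\<^bsub>G\<^esub> (- int a) \<otimes>\<^bsub>G\<^esub> x v \<otimes>\<^bsub>G\<^esub> t [^]\<^bsub>G\<^esub> b"
      using vsubD(3)[OF vsub_Zvec w' v(1)] by blast
  next
    fix g assume "g \<in> carrier G"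
      and "\<exists>(a::nat) (b::int). \<exists>v\<in>Zvec n. g = t [^]\<^bsub>G\<^esub> (- int a) \<otimes>\<^bsub>G\<^esub> x v \<otimes>\<^bsub>G\<^esub> t [^]\<^bsub>G\<^esub> b"
    then obtain a :: nat and b :: int and v where
      v: "v \<in> Zvec n" "g = t [^]\<^bsub>G\<^esub> (- int a) \<otimes>\<^bsub>G\<^esub> x v \<otimes>\<^bsub>G\<^esub> t [^]\<^bsub>G\<^esub> b" by blast
    show "\<exists>(a::nat) (b::int). \<exists>v\<in>Zvec n. t \<otimes>\<^bsub>G\<^esub> g = t [^]\<^bsub>G\<^esub> (- int a) \<otimes>\<^bsub>G\<^esub> x v \<otimes>\<^bsub>G\<^esub> t [^]\<^bsub>G\<^esub> b"
    proof (cases a)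
      case 0
      have ts: "t [^]\<^bsub>G\<^esub> (1 + b) = t \<otimes>\<^bsub>G\<^esub> t [^]\<^bsub>G\<^esub> b"
        using G.int_pow_mult[OF t_closed, of 1 b] G.int_pow_1[OF t_closed] by simp
      have "t \<otimes>\<^bsub>G\<^esub> g = t \<otimes>\<^bsub>G\<^esub> x v \<otimes>\<^bsub>G\<^esub> t [^]\<^bsub>G\<^esub> b" using v 0 by (simp add: G.m_assoc)
      also have "\<dots> = t [^]\<^bsub>G\<^esub> (- int 0) \<otimes>\<^bsub>G\<^esub> x (A *\<^sub>v v) \<otimes>\<^bsub>G\<^esub> t [^]\<^bsub>G\<^esub> (1 + b)"
        using tZ[OF v(1)] unfolding ts by (simp add: G.m_assoc[symmetric])
      finally show ?thesis using AZ[OF v(1)] by blast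
    next
      case (Suc c)
      have ts: "t \<otimes>\<^bsub>G\<^esub> t [^]\<^bsub>G\<^esub> (- int a) = t [^]\<^bsub>G\<^esub> (- int c)"
        using G.int_pow_mult[OF t_closed, of 1 "- int a"] G.int_pow_1[OF t_closed] Suc by simp
      have "t \<otimes>\<^bsub>G\<^esub> g = t [^]\<^bsub>G\<^esub> (- int c) \<otimes>\<^bsub>G\<^esub> x v \<otimes>\<^bsub>G\<^esub> t [^]\<^bsub>G\<^esub> b"
        using v ts by (simp add: G.m_assoc[symmetric])
      then show ?thesis using v by blast
    qed
    have ts: "inv\<^bsub>G\<^esub> t \<otimes>\<^bsub>G\<^esub> t [^]\<^bsub>G\<^esub> (- int a) = t [^]\<^bsub>G\<^esub> (- int (Suc a))"
      using G.int_pow_mult[OF t_closed, of "-1" "- int a"] G.int_pow_neg[OF t_closed, of 1] by simp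
    have "inv\<^bsub>G\<^esub> t \<otimes>\<^bsub>G\<^esub> g = t [^]\<^bsub>G\<^esub> (- int (Suc a)) \<otimes>\<^bsub>G\<^esub> x v \<otimes>\<^bsub>G\<^esub> t [^]\<^bsub>G\<^esub> b"
      using v ts by (simp add: G.m_assoc[symmetric])
    then show "\<exists>(a::nat) (b::int). \<exists>v\<in>Zvec n. inv\<^bsub>G\<^esub> t \<otimes>\<^bsub>G\<^esub> g = t [^]\<^bsub>G\<^esub> (- int a) \<otimes>\<^bsub>G\<^esub> x v \<otimes>\<^bsub>G\<^esub> t [^]\<^bsub>G\<^esub> b"
      using v by blast
  qed
  have hv: "h (t [^]\<^bsub>G\<^esub> a \<otimes>\<^bsub>G\<^esub> x v \<otimes>\<^bsub>G\<^esub> t [^]\<^bsub>G\<^esub> b) = (mact n A a v, a + b)"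
    if "v \<in> Zvec n" for v and a b :: int
    using that h(2) ht A by (simp add: h.hom_mult mact_zero)
  have "h \<in> iso G U.S"
    unfolding h.iso_iff
  proof (intro conjI ballI impI)
    show "carrier U.S \<subseteq> h ` carrier G"
    proof
      fix p assume "p \<in> carrier U.S"
      then obtain k j v where p: "p = (mact n A j v, k)" "v \<in> Zvec n" by (auto simp: lat_iff)
      \<comment> \<open>Conjugation by the \<open>j\<close>-th power of \<open>t\<close> produces
        \<open>mact n A j v\<close>; the remaining power of \<open>t\<close> brings the exponent to
        \<open>k\<close>.\<close>
      then have "p = h (t [^]\<^bsub>G\<^esub> j \<otimes>\<^bsub>G\<^esub> x v \<otimes>\<^bsub>G\<^esub> t [^]\<^bsub>G\<^esub> (k - j))" by (simp only: p(1) hv[OF p(2)]) simp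
      then show "p \<in> h ` carrier G" by (rule image_eqI) simp
    qed
  next
    fix g assume "g \<in> carrier G" "h g = \<one>\<^bsub>U.S\<^esub>"
    then obtain a b v where v: "v \<in> Zvec n" "g = t [^]\<^bsub>G\<^esub> (- int a) \<otimes>\<^bsub>G\<^esub> x v \<otimes>\<^bsub>G\<^esub> t [^]\<^bsub>G\<^esub> (b::int)"
      "mact n A (- int a) v = 0\<^sub>v n" "b = int a" using nf[of g] hv by fastforce
    then have "v = 0\<^sub>v n"
      using mact_cancel(1)[OF A Zvec_carrier[OF v(1)], of "int a"] by (simp add: mact_zero[OF A])
    then show "g = \<one>\<^bsub>G\<^esub>" using v by (simp add: x_zero G.int_pow_neg del: pow_nat)
  qed
  then show ?thesis by (rule is_isoI)
qed

lemma ascendingI: "L = Zvec n \<or> mat_image A L = Zvec n \<Longrightarrow> ascending n A"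
proof -
  have "inv\<^bsub>GLQ n\<^esub> A *\<^sub>v v \<in> Zvec n" if "v \<in> mat_image A L" for v
    using that GLQ_inv_cancel(2)[OF A L_carrier] L_Zvec by (auto simp: mat_image_def)
  then show "L = Zvec n \<or> mat_image A L = Zvec n \<Longrightarrow> ascending n A"
    using ALZ unfolding ascending_def by auto
qed

theorem ascending_sdp_iso:
  assumes "L = Zvec n \<or> mat_image A L = Zvec n"
  shows "G \<cong> sdp n A (lat n A)"
  using assms
proof
  assume AL: "mat_image A L = Zvec n"
  \<comment> \<open>The flipped group falls under the previous case. Inverting the matrix leaves
    \<open>lat\<close> unchanged, and the identity matrix with sign \<open>- 1\<close> in
    \<open>linear_iso\<close> undoes the flip.\<close>
  interpret I: lm_data n "inv\<^bsub>GLQ n\<^esub> A" "mat_image A L" by (rule lm_data_inv)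
  interpret V: sdp_data n "inv\<^bsub>GLQ n\<^esub> A" "lat n A"
    using sdp_data_lat[OF I.A I.ascendingI] AL lat_inv[OF A] by simp
  have 2: "I.G \<cong> sdp n (inv\<^bsub>GLQ n\<^esub> A) (lat n A)"
    using I.Zvec_sdp_iso AL lat_inv[OF A] by simp
  have "mat_image (1\<^sub>m n) (lat n A) = lat n A"
  proof -
    have "1\<^sub>m n *\<^sub>v v = v" if "v \<in> lat n A" for v using that by simp
    then show ?thesis by (auto simp: mat_image_def)
  qed
  moreover have "1\<^sub>m n \<in> carrier (GLQ n)" using group.subgroup_self[OF group_GLQ] 
    by (metis group_GLQ group.is_monoid monoid.one_closed one_GLQ)
  ultimately have "(\<lambda>(v, k). (1\<^sub>m n *\<^sub>v v, - 1 * k)) \<in> iso (sdp n (inv\<^bsub>GLQ n\<^esub> A) (lat n A)) (sdp n A (lat n A))"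
    using V.linear_iso[OF A, of "1\<^sub>m n" "- 1"] A by (simp add: mact_inv)
  then have 3: "sdp n (inv\<^bsub>GLQ n\<^esub> A) (lat n A) \<cong> sdp n A (lat n A)" by (rule is_isoI)
  from iso_trans[OF iso_trans[OF flip_is_iso 2] 3] show ?thesis .
qed (rule Zvec_sdp_iso)

end

text \<open>\<open>B\<close> turns \<open>A\<^sup>jB\<^sup>-\<^sup>1v\<close> into a power of
  \<open>A'\<close> applied to \<open>v\<close>, so the equality of the two unions amounts to
  \<open>B\<close> mapping \<open>lat n A\<close> onto \<open>lat n A'\<close>.\<close>

lemma sdp_lat_iso:
  assumes A: "A \<in> carrier (GLQ n)" and A': "A' \<in> carrier (GLQ n)" and B: "B \<in> carrier (GLQ n)"
    and asc: "ascending n A" and e: "e \<in> {1, -1 :: int}"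
    and conj: "A' = B * (A [^]\<^bsub>GLQ n\<^esub> e) * inv\<^bsub>GLQ n\<^esub> B"
    and lat: "(\<Union>j::int. mat_image (A [^]\<^bsub>GLQ n\<^esub> j) (Zvec n)) =
      (\<Union>j::int. mat_image (A [^]\<^bsub>GLQ n\<^esub> j * inv\<^bsub>GLQ n\<^esub> B) (Zvec n))"
  shows "sdp n A (lat n A) \<cong> sdp n A' (lat n A')"
proof -
  interpret U: sdp_data n A "lat n A" by (rule sdp_data_lat[OF A asc])
  note Ae = GLQ_int_pow[OF A, of e]
  note Bc = GLQ_carrier_mat[OF B]
  note C = GLQ_inv[OF B]
  have "A' * B = B * (A [^]\<^bsub>GLQ n\<^esub> e) * (inv\<^bsub>GLQ n\<^esub> B * B)"
    unfolding conj using assoc_mult_mat[of "B * A [^]\<^bsub>GLQ n\<^esub> e" n n "inv\<^bsub>GLQ n\<^esub> B" n B n] Ae Bc C by simp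
  then have "A' * B = B * (A [^]\<^bsub>GLQ n\<^esub> e)" using Ae Bc C by simp
  then have "mact n A' k (B *\<^sub>v v) = B *\<^sub>v mact n (A [^]\<^bsub>GLQ n\<^esub> e) k v" if "v \<in> carrier_vec n" for k v
    using mact_conj[OF Ae(1) A' Bc] that by simp
  then have cj: "mact n A' k (B *\<^sub>v v) = B *\<^sub>v mact n A (e * k) v" if "v \<in> carrier_vec n" for k v
    using that group.int_pow_pow[OF group_GLQ A, of e k] by (simp add: mact_def)
  have ee: "e * (e * k) = k" for k using e by auto
  have "mat_image B (lat n A) = lat n A'"
  proof -
    have mv: "(A [^]\<^bsub>GLQ n\<^esub> j * inv\<^bsub>GLQ n\<^esub> B) *\<^sub>v v = mact n A j (inv\<^bsub>GLQ n\<^esub> B *\<^sub>v v)"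
      if "v \<in> Zvec n" for j :: int and v
      unfolding mact_def using assoc_mult_mat_vec[OF GLQ_int_pow(2)[OF A] C(2) Zvec_carrier[OF that]] .
    have "lat n A = (\<Union>j::int. mat_image (A [^]\<^bsub>GLQ n\<^esub> j * inv\<^bsub>GLQ n\<^esub> B) (Zvec n))"
      unfolding lat_def by (rule lat)
    also have "\<dots> = {mact n A j (inv\<^bsub>GLQ n\<^esub> B *\<^sub>v v) | j v. v \<in> Zvec n}"
      by (force simp: mat_image_def mv)
    finally have "lat n A = {mact n A j (inv\<^bsub>GLQ n\<^esub> B *\<^sub>v v) | j v. v \<in> Zvec n}" .
    then have "mat_image B (lat n A) = {B *\<^sub>v mact n A j (inv\<^bsub>GLQ n\<^esub> B *\<^sub>v v) | j v. v \<in> Zvec n}"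
      unfolding mat_image_def by auto
    also have "\<dots> = {mact n A' (e * j) v | j v. v \<in> Zvec n}"
    proof -
      have "B *\<^sub>v mact n A j (inv\<^bsub>GLQ n\<^esub> B *\<^sub>v v) = mact n A' (e * j) v" if "v \<in> Zvec n" for j v
        using cj[of "inv\<^bsub>GLQ n\<^esub> B *\<^sub>v v" "e * j"] C(2) GLQ_inv_cancel(1)[OF B Zvec_carrier[OF that]]
        by (simp add: ee)
      then show ?thesis by (intro Collect_cong) metis
    qed
    also have "\<dots> = lat n A'"
    proof -
      have "\<exists>i. mact n A' j v = mact n A' (e * i) v" for j v using ee by metis
      then show ?thesis unfolding set_eq_iff lat_iff by blast
    qed
    finally show ?thesis .
  qed
  then show ?thesis using U.linear_iso[OF A' B e cj] is_isoI by metis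
qed

section \<open>Block matrices\<close>

definition vcons :: "rat \<Rightarrow> rat vec \<Rightarrow> rat vec" where
  "vcons a w = vec (Suc (dim_vec w)) (case_nat a (\<lambda>i. w $ i))"

lemma vcons_simps [simp]:
  "dim_vec (vcons a w) = Suc (dim_vec w)" "vcons a w $ 0 = a"
  "i < dim_vec w \<Longrightarrow> vcons a w $ Suc i = w $ i"
  by (auto simp: vcons_def)

lemma vcons_carrier [simp]: "w \<in> carrier_vec k \<Longrightarrow> vcons a w \<in> carrier_vec (Suc k)"
  by (intro carrier_vecI) simp

lemma vec_Suc_eqI:
  assumes "v \<in> carrier_vec (Suc k)" "w \<in> carrier_vec (Suc k)" "v $ 0 = w $ 0"
    "\<And>i. i < k \<Longrightarrow> v $ Suc i = w $ Suc i"
  shows "v = w"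
proof (rule eq_vecI)
  fix i assume "i < dim_vec w"
  then show "v $ i = w $ i" using assms by (cases i) auto
qed (use assms in auto)

lemma vcons_cases:
  assumes "v \<in> carrier_vec (Suc k)"
  obtains w where "w \<in> carrier_vec k" "v = vcons (v $ 0) w"
proof
  show "vec k (\<lambda>i. v $ Suc i) \<in> carrier_vec k" by simp
  show "v = vcons (v $ 0) (vec k (\<lambda>i. v $ Suc i))"
    using assms by (intro vec_Suc_eqI[of _ k]) auto
qed

lemma vcons_eq_iff: "w \<in> carrier_vec k \<Longrightarrow> w' \<in> carrier_vec k \<Longrightarrow> vcons a w = vcons b w' \<longleftrightarrow> a = b \<and> w = w'"
proof
  assume w: "w \<in> carrier_vec k" "w' \<in> carrier_vec k" and eq: "vcons a w = vcons b w'"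
  have "a = b" using arg_cong[OF eq, of "\<lambda>v. v $ 0"] by simp
  moreover have "w = w'"
  proof (rule eq_vecI)
    fix i assume "i < dim_vec w'"
    then show "w $ i = w' $ i" using arg_cong[OF eq, of "\<lambda>v. v $ Suc i"] w by simp
  qed (use w in simp)
  ultimately show "a = b \<and> w = w'" by simp
qed simp

lemma vcons_Zvec: "w \<in> carrier_vec k \<Longrightarrow> vcons a w \<in> Zvec (Suc k) \<longleftrightarrow> a \<in> \<int> \<and> w \<in> Zvec k"
  by (auto simp: Zvec_iff All_less_Suc2)

lemma lower_block_carrier: "C \<in> carrier_mat k k \<Longrightarrow> lower_block (Suc k) u C \<in> carrier_mat (Suc k) (Suc k)"
  unfolding lower_block_def by (rule carrier_matI) auto

lemma lower_block_mult:
  assumes u: "u \<in> carrier_vec k" and C: "C \<in> carrier_mat k k" and w: "w \<in> carrier_vec k"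
  shows "lower_block (Suc k) u C *\<^sub>v vcons a w = vcons a (a \<cdot>\<^sub>v u + C *\<^sub>v w)"
proof (rule vec_Suc_eqI[of _ k])
  let ?M = "lower_block (Suc k) u C"
  have M: "?M \<in> carrier_mat (Suc k) (Suc k)" by (rule lower_block_carrier[OF C])
  then show "?M *\<^sub>v vcons a w \<in> carrier_vec (Suc k)" by simp
  show "vcons a (a \<cdot>\<^sub>v u + C *\<^sub>v w) \<in> carrier_vec (Suc k)" using u C w by simp
  have e: "?M $$ (0, 0) = 1" "j < k \<Longrightarrow> ?M $$ (0, Suc j) = 0" 
    "i < k \<Longrightarrow> ?M $$ (Suc i, 0) = u $ i" "i < k \<Longrightarrow> j < k \<Longrightarrow> ?M $$ (Suc i, Suc j) = C $$ (i, j)" for i j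
    using u C by (auto simp: lower_block_def mat_of_cols_def)
  have s: "(?M *\<^sub>v vcons a w) $ i = ?M $$ (i, 0) * a + (\<Sum>j<k. ?M $$ (i, Suc j) * w $ j)"
    if "i < Suc k" for i
  proof -
    have "(?M *\<^sub>v vcons a w) $ i = (\<Sum>j<Suc k. ?M $$ (i, j) * vcons a w $ j)"
      using that M w by (simp add: scalar_prod_def lessThan_atLeast0)
    also have "\<dots> = ?M $$ (i, 0) * a + (\<Sum>j<k. ?M $$ (i, Suc j) * vcons a w $ Suc j)"
      by (simp only: sum.lessThan_Suc_shift vcons_simps)
    also have "(\<Sum>j<k. ?M $$ (i, Suc j) * vcons a w $ Suc j) = (\<Sum>j<k. ?M $$ (i, Suc j) * w $ j)"
      using w by (intro sum.cong) auto
    finally show ?thesis .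
  qed
  show "(?M *\<^sub>v vcons a w) $ 0 = vcons a (a \<cdot>\<^sub>v u + C *\<^sub>v w) $ 0" using s[of 0] e by simp
  show "(?M *\<^sub>v vcons a w) $ Suc i = vcons a (a \<cdot>\<^sub>v u + C *\<^sub>v w) $ Suc i" if "i < k" for i
  proof -
    have "(\<Sum>j<k. ?M $$ (Suc i, Suc j) * w $ j) = (C *\<^sub>v w) $ i"
      using that C w by (auto simp: e scalar_prod_def lessThan_atLeast0 intro!: sum.cong)
    then show ?thesis using that s[of "Suc i"] e u C w by (simp add: mult.commute)
  qed
qed

text \<open>The inverse is again of block form, with lower right block
  \<open>C\<^sup>-\<^sup>1\<close> and first column \<open>- C\<^sup>-\<^sup>1u\<close>.\<close>

lemma lower_block_GLQ:
  assumes u: "u \<in> carrier_vec k" and C: "C \<in> carrier (GLQ k)"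
  shows "lower_block (Suc k) u C \<in> carrier (GLQ (Suc k))"
    "w \<in> carrier_vec k \<Longrightarrow> inv\<^bsub>GLQ (Suc k)\<^esub> (lower_block (Suc k) u C) *\<^sub>v vcons a w
      = vcons a (inv\<^bsub>GLQ k\<^esub> C *\<^sub>v (w - a \<cdot>\<^sub>v u))"
proof -
  let ?D = "inv\<^bsub>GLQ k\<^esub> C"
  let ?u = "- (?D *\<^sub>v u)"
  note Cc = GLQ_carrier_mat[OF C]
  note D = GLQ_inv[OF C]
  have u': "?u \<in> carrier_vec k" using D by simp
  let ?M = "lower_block (Suc k) u C" and ?N = "lower_block (Suc k) ?u ?D"
  note c = lower_block_carrier[OF Cc, of u] lower_block_carrier[OF D(2), of ?u]
  have N: "?N *\<^sub>v vcons a w = vcons a (?D *\<^sub>v (w - a \<cdot>\<^sub>v u))" if w: "w \<in> carrier_vec k" for a w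
  proof -
    have "a \<cdot>\<^sub>v ?u + ?D *\<^sub>v w = ?D *\<^sub>v w - a \<cdot>\<^sub>v (?D *\<^sub>v u)"
      using D by (intro eq_vecI) auto
    also have "\<dots> = ?D *\<^sub>v (w - a \<cdot>\<^sub>v u)"
      using w u D by (simp add: mult_minus_distrib_mat_vec mult_mat_vec)
    finally show ?thesis using lower_block_mult[OF u' D(2) w] by simp
  qed
  have MN: "?M *\<^sub>v (?N *\<^sub>v v) = v" "?N *\<^sub>v (?M *\<^sub>v v) = v" if v: "v \<in> carrier_vec (Suc k)" for v
  proof -
    obtain w where w: "w \<in> carrier_vec k" "v = vcons (v $ 0) w" using vcons_cases[OF v] by blast
    let ?a = "v $ 0"
    have z: "w - ?a \<cdot>\<^sub>v u \<in> carrier_vec k" "?a \<cdot>\<^sub>v u + (w - ?a \<cdot>\<^sub>v u) = w"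
      "(?a \<cdot>\<^sub>v u + C *\<^sub>v w) - ?a \<cdot>\<^sub>v u = C *\<^sub>v w"
      using w(1) u Cc by (auto intro!: eq_vecI)
    have "?M *\<^sub>v (?N *\<^sub>v vcons ?a w) = vcons ?a (?a \<cdot>\<^sub>v u + C *\<^sub>v (?D *\<^sub>v (w - ?a \<cdot>\<^sub>v u)))"
      using lower_block_mult[OF u Cc, of "?D *\<^sub>v (w - ?a \<cdot>\<^sub>v u)" ?a] D by (simp add: N[OF w(1)])
    then show "?M *\<^sub>v (?N *\<^sub>v v) = v" using w z GLQ_inv_cancel(1)[OF C z(1)] by simp
    have "?N *\<^sub>v (?M *\<^sub>v vcons ?a w) = vcons ?a (?D *\<^sub>v (?a \<cdot>\<^sub>v u + C *\<^sub>v w - ?a \<cdot>\<^sub>v u))"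
      using u Cc by (simp add: lower_block_mult[OF u Cc w(1)] N)
    then show "?N *\<^sub>v (?M *\<^sub>v v) = v" using w z GLQ_inv_cancel(2)[OF C w(1)] by simp
  qed
  have "?M * ?N = 1\<^sub>m (Suc k)"
    using c MN by (intro mat_eq_by_unit_vecs[of _ "Suc k" "Suc k"]) (auto simp: assoc_mult_mat_vec[OF c])
  moreover have "?N * ?M = 1\<^sub>m (Suc k)"
    using c MN by (intro mat_eq_by_unit_vecs[of _ "Suc k" "Suc k"]) (auto simp: assoc_mult_mat_vec[OF c(2,1)])
  ultimately have G: "?M \<in> carrier (GLQ (Suc k))" "inv\<^bsub>GLQ (Suc k)\<^esub> ?M = ?N" using GLQ_I c by auto
  show "?M \<in> carrier (GLQ (Suc k))" by (rule G)
  show "w \<in> carrier_vec k \<Longrightarrow> inv\<^bsub>GLQ (Suc k)\<^esub> ?M *\<^sub>v vcons a w = vcons a (?D *\<^sub>v (w - a \<cdot>\<^sub>v u))"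
    unfolding G using N by simp
qed

lemma lower_block_GLZ:
  assumes u: "u \<in> Zvec k" and C: "C \<in> GLZ k"
  shows "lower_block (Suc k) u C \<in> GLZ (Suc k)"
proof -
  note Cd = GLZ_D[OF C]
  note uc = Zvec_carrier[OF u]
  have sm: "a \<cdot>\<^sub>v u \<in> Zvec k" if "a \<in> \<int>" for a using that vsub_int_smult[OF vsub_Zvec u] by (auto elim: Ints_cases)
  show ?thesis
  proof (rule GLZ_I)
    show "lower_block (Suc k) u C \<in> carrier (GLQ (Suc k))" by (rule lower_block_GLQ[OF uc Cd(1)])
    fix v assume v: "v \<in> Zvec (Suc k)"
    obtain w where w: "w \<in> carrier_vec k" "v = vcons (v $ 0) w" using vcons_cases[OF Zvec_carrier[OF v]] .
    then have wz: "w \<in> Zvec k" "v $ 0 \<in> \<int>" using v vcons_Zvec by metis+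
    have c: "v $ 0 \<cdot>\<^sub>v u + C *\<^sub>v w \<in> Zvec k"
      by (rule vsubD(3)[OF vsub_Zvec sm[OF wz(2)] Cd(3)[OF wz(1)]])
    have "lower_block (Suc k) u C *\<^sub>v v = vcons (v $ 0) (v $ 0 \<cdot>\<^sub>v u + C *\<^sub>v w)"
      using lower_block_mult[OF uc Cd(2) w(1), of "v $ 0"] unfolding w(2)[symmetric] .
    then show "lower_block (Suc k) u C *\<^sub>v v \<in> Zvec (Suc k)"
      using vcons_Zvec[OF Zvec_carrier[OF c]] c wz by simp
    have c: "inv\<^bsub>GLQ k\<^esub> C *\<^sub>v (w - v $ 0 \<cdot>\<^sub>v u) \<in> Zvec k"
      by (rule Cd(4)[OF vsubD(5)[OF vsub_Zvec wz(1) sm[OF wz(2)]]])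
    have "inv\<^bsub>GLQ (Suc k)\<^esub> (lower_block (Suc k) u C) *\<^sub>v v
      = vcons (v $ 0) (inv\<^bsub>GLQ k\<^esub> C *\<^sub>v (w - v $ 0 \<cdot>\<^sub>v u))"
      using lower_block_GLQ(2)[OF uc Cd(1) w(1), of "v $ 0"] unfolding w(2)[symmetric] .
    then show "inv\<^bsub>GLQ (Suc k)\<^esub> (lower_block (Suc k) u C) *\<^sub>v v \<in> Zvec (Suc k)"
      using vcons_Zvec[OF Zvec_carrier[OF c]] c wz by simp
  qed
qed

text \<open>On vectors with first coordinate zero the column \<open>u\<close> never contributes,
  neither for the block matrix nor for its inverse.\<close>

lemma mact_lower_block:
  assumes u: "u \<in> carrier_vec k" and C: "C \<in> carrier (GLQ k)" and w: "w \<in> carrier_vec k"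
  shows "mact (Suc k) (lower_block (Suc k) u C) j (vcons 0 w) = vcons 0 (mact k C j w)"
proof (induction j rule: int_induct[where k = 0])
  case base
  then show ?case using w by (simp add: mact_0[OF C] mact_0[OF lower_block_GLQ(1)[OF u C]])
next
  case (step1 i)
  note M = lower_block_GLQ(1)[OF u C]
  have z: "0 \<cdot>\<^sub>v u + v = v" if "v \<in> carrier_vec k" for v using that u by (intro eq_vecI) auto
  have "mact (Suc k) (lower_block (Suc k) u C) (i + 1) (vcons 0 w)
    = lower_block (Suc k) u C *\<^sub>v vcons 0 (mact k C i w)"
    using mact_plus[OF M, of "vcons 0 w" 1 i] w step1 by (simp add: mact_1[OF M] add.commute)
  also have "\<dots> = vcons 0 (C *\<^sub>v mact k C i w)"
    using lower_block_mult[OF u GLQ_carrier_mat[OF C] mact_closed[OF C, of i w]] z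
      mult_mat_vec_closed[OF GLQ_carrier_mat[OF C]] by simp
  also have "\<dots> = vcons 0 (mact k C (i + 1) w)"
    using mact_plus[OF C w, of 1 i] by (simp add: mact_1[OF C] add.commute)
  finally show ?case .
next
  case (step2 i)
  note M = lower_block_GLQ(1)[OF u C]
  have z: "v - 0 \<cdot>\<^sub>v u = v" if "v \<in> carrier_vec k" for v using that u by (intro eq_vecI) auto
  have "mact (Suc k) (lower_block (Suc k) u C) (i - 1) (vcons 0 w)
    = inv\<^bsub>GLQ (Suc k)\<^esub> (lower_block (Suc k) u C) *\<^sub>v vcons 0 (mact k C i w)"
    using mact_plus[OF M, of "vcons 0 w" "- 1" i] w step2 by (simp add: mact_neg1[OF M])
  also have "\<dots> = vcons 0 (inv\<^bsub>GLQ k\<^esub> C *\<^sub>v mact k C i w)"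
    using lower_block_GLQ(2)[OF u C mact_closed[OF C, of i w]] z[OF mact_closed[OF C]] by simp
  also have "\<dots> = vcons 0 (mact k C (i - 1) w)"
    using mact_plus[OF C w, of "- 1" i] by (simp add: mact_neg1[OF C])
  finally show ?case .
qed

text \<open>The first row is a unit vector, and the inverse of \<open>A\<close> inherits this.
  Comparing both block forms on vectors with first coordinate zero shows that the lower right blocks
  are mutually inverse and integral; the first unit vector shows that \<open>u\<close> is
  integral.\<close>

lemma lower_block_ex:
  assumes A: "A \<in> GLZ (Suc k)" and fst: "\<And>v. v \<in> carrier_vec (Suc k) \<Longrightarrow> (A *\<^sub>v v) $ 0 = v $ 0"
  obtains u C where "u \<in> Zvec k" "C \<in> GLZ k" "A = lower_block (Suc k) u C"
proof -
  have ex: "\<exists>u C. u \<in> carrier_vec k \<and> C \<in> carrier_mat k k \<and> M = lower_block (Suc k) u C"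
    if M: "M \<in> carrier_mat (Suc k) (Suc k)" and f: "\<And>v. v \<in> carrier_vec (Suc k) \<Longrightarrow> (M *\<^sub>v v) $ 0 = v $ 0" for M
  proof -
    let ?u = "vec k (\<lambda>i. M $$ (Suc i, 0))" and ?C = "mat k k (\<lambda>(i, j). M $$ (Suc i, Suc j))"
    have e0: "M $$ (0, j) = (if j = 0 then 1 else 0)" if "j < Suc k" for j
      using f[of "unit_vec (Suc k) j"] M that by (auto split: if_splits)
    have "M = lower_block (Suc k) ?u ?C"
    proof (rule eq_matI)
      fix i j assume "i < dim_row (lower_block (Suc k) ?u ?C)" "j < dim_col (lower_block (Suc k) ?u ?C)"
      then have "i < Suc k" "j < Suc k" by (auto simp: lower_block_def)
      then show "M $$ (i, j) = lower_block (Suc k) ?u ?C $$ (i, j)"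
        using e0[of j] by (cases i; cases j) (auto simp: lower_block_def mat_of_cols_def)
    qed (use M in \<open>auto simp: lower_block_def\<close>)
    moreover have "?u \<in> carrier_vec k" "?C \<in> carrier_mat k k" by auto
    ultimately show ?thesis by blast
  qed
  note Ad = GLZ_D[OF A]
  note B = GLQ_inv[OF Ad(1)]
  let ?B = "inv\<^bsub>GLQ (Suc k)\<^esub> A"
  have "(?B *\<^sub>v v) $ 0 = v $ 0" if "v \<in> carrier_vec (Suc k)" for v
    using fst[of "?B *\<^sub>v v"] B GLQ_inv_cancel(1)[OF Ad(1) that] by simp
  then obtain u' D where D: "u' \<in> carrier_vec k" "D \<in> carrier_mat k k" "?B = lower_block (Suc k) u' D"
    using ex[OF B(2)] by blast
  obtain u C where C: "u \<in> carrier_vec k" "C \<in> carrier_mat k k" "A = lower_block (Suc k) u C"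
    using ex[OF Ad(2) fst] by blast
  have z: "0 \<cdot>\<^sub>v y + v = v" if "v \<in> carrier_vec k" "y \<in> carrier_vec k" for v y :: "rat vec"
    using that by (intro eq_vecI) auto
  have AC: "A *\<^sub>v vcons 0 w = vcons 0 (C *\<^sub>v w)" "?B *\<^sub>v vcons 0 w = vcons 0 (D *\<^sub>v w)"
    if w: "w \<in> carrier_vec k" for w
    unfolding D(3) using lower_block_mult[OF C(1,2) w, of 0] lower_block_mult[OF D(1,2) w, of 0] C D
    by (simp_all add: z)
  have "C *\<^sub>v (D *\<^sub>v w) = w" "D *\<^sub>v (C *\<^sub>v w) = w" if w: "w \<in> carrier_vec k" for w
  proof -
    have "vcons 0 (C *\<^sub>v (D *\<^sub>v w)) = vcons 0 w" "vcons 0 (D *\<^sub>v (C *\<^sub>v w)) = vcons 0 w"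
      using AC(1)[of "D *\<^sub>v w"] AC(2)[of "C *\<^sub>v w"] AC[OF w] GLQ_inv_cancel[OF Ad(1), of "vcons 0 w"] w C D
      by simp_all
    then show "C *\<^sub>v (D *\<^sub>v w) = w" "D *\<^sub>v (C *\<^sub>v w) = w"
      using vcons_eq_iff[of _ k w 0 0] w C D by (metis mult_mat_vec_closed)+
  qed note CD = this
  have "C * D = 1\<^sub>m k" "D * C = 1\<^sub>m k"
    using C D CD by (auto intro!: mat_eq_by_unit_vecs[of _ k k] simp: assoc_mult_mat_vec[of _ k k])
  then have CG: "C \<in> carrier (GLQ k)" "inv\<^bsub>GLQ k\<^esub> C = D" using GLQ_I C D by auto
  have CZ: "C \<in> GLZ k"
  proof (rule GLZ_I[OF CG(1)])
    fix w assume w: "w \<in> Zvec k"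
    have "vcons 0 w \<in> Zvec (Suc k)" using vcons_Zvec[OF Zvec_carrier[OF w]] w by simp
    then have "vcons 0 (C *\<^sub>v w) \<in> Zvec (Suc k)" "vcons 0 (D *\<^sub>v w) \<in> Zvec (Suc k)"
      using AC[OF Zvec_carrier[OF w]] Ad(3,4)[of "vcons 0 w"] by simp_all
    then show "C *\<^sub>v w \<in> Zvec k" "inv\<^bsub>GLQ k\<^esub> C *\<^sub>v w \<in> Zvec k"
      unfolding CG using vcons_Zvec[of _ k 0] C D by auto
  qed
  have "vcons 1 (0\<^sub>v k) \<in> Zvec (Suc k)" using vcons_Zvec[of "0\<^sub>v k" k 1] vsubD(2)[OF vsub_Zvec] by simp
  from Ad(3)[OF this] have "vcons 1 (1 \<cdot>\<^sub>v u + C *\<^sub>v 0\<^sub>v k) \<in> Zvec (Suc k)"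
    unfolding C(3) using lower_block_mult[OF C(1,2), of "0\<^sub>v k" 1] by simp
  moreover have "1 \<cdot>\<^sub>v u + C *\<^sub>v 0\<^sub>v k = u" using C by (intro eq_vecI) auto
  ultimately have "u \<in> Zvec k" using vcons_Zvec[OF C(1)] by simp
  then show ?thesis using that CZ C(3) by blast
qed

section \<open>Primitive linear forms\<close>

text \<open>Shears are the moves of the Euclidean algorithm below; the inverse of such a move is the
  shear with \<open>- c\<close>.\<close>

lemma shear_GLZ:
  assumes ij: "i < n" "j < n" "i \<noteq> j"
  obtains E where "E \<in> GLZ n"
    "\<And>v a. v \<in> carrier_vec n \<Longrightarrow> a < n \<Longrightarrow> (E *\<^sub>v v) $ a = v $ a + (if a = j then of_int c * v $ i else 0)"
proof -
  define E :: "int \<Rightarrow> rat mat" where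
    "E c = mat\<^sub>r n n (\<lambda>a. unit_vec n a + (if a = j then of_int c else 0) \<cdot>\<^sub>v unit_vec n i)" for c
  have Ec: "E c \<in> carrier_mat n n" for c by (simp add: E_def)
  have E: "(E c *\<^sub>v v) $ a = v $ a + (if a = j then of_int c * v $ i else 0)"
    if "v \<in> carrier_vec n" "a < n" for c v a
    using that ij by (simp add: E_def add_scalar_prod_distrib[of _ n])
  have EE: "E c *\<^sub>v (E (- c) *\<^sub>v v) = v" if v: "v \<in> carrier_vec n" for c v
    using v ij Ec[of c] by (intro eq_vecI) (auto simp: E mult_mat_vec_closed[OF Ec] simp del: index_mult_mat_vec)
  have 1: "E c * E (- c) = 1\<^sub>m n" for c
    using EE by (intro mat_eq_by_unit_vecs[of _ n n]) (auto simp: Ec mult_carrier_mat[OF Ec Ec] assoc_mult_mat_vec[OF Ec Ec])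
  have inv: "E c \<in> carrier (GLQ n)" "inv\<^bsub>GLQ n\<^esub> (E c) = E (- c)" for c
    using GLQ_I[OF Ec Ec 1] 1[of "- c"] by auto
  have "E c *\<^sub>v v \<in> Zvec n" if "v \<in> Zvec n" for c v
    using that ij mult_mat_vec_closed[OF Ec, of c v] by (auto simp: Zvec_iff E simp del: index_mult_mat_vec)
  then have "E c \<in> GLZ n" for c using inv by (intro GLZ_I) auto
  then show ?thesis using that E by blast
qed

lemma swap_GLZ:
  assumes ij: "i < n" "j < n"
  obtains E where "E \<in> GLZ n"
    "\<And>v a. v \<in> carrier_vec n \<Longrightarrow> a < n \<Longrightarrow> (E *\<^sub>v v) $ a = v $ (if a = i then j else if a = j then i else a)"
proof -
  define E :: "rat mat" where
    "E = mat\<^sub>r n n (\<lambda>a. unit_vec n (if a = i then j else if a = j then i else a))"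
  have Ec: "E \<in> carrier_mat n n" by (simp add: E_def)
  have E: "(E *\<^sub>v v) $ a = v $ (if a = i then j else if a = j then i else a)"
    if "v \<in> carrier_vec n" "a < n" for v a
    using that ij by (simp add: E_def)
  have EE: "E *\<^sub>v (E *\<^sub>v v) = v" if v: "v \<in> carrier_vec n" for v
    using v ij Ec by (intro eq_vecI) (auto simp: E mult_mat_vec_closed[OF Ec] simp del: index_mult_mat_vec)
  have 1: "E * E = 1\<^sub>m n"
    using EE by (intro mat_eq_by_unit_vecs[of _ n n]) (auto simp: Ec mult_carrier_mat[OF Ec Ec] assoc_mult_mat_vec[OF Ec Ec])
  have inv: "E \<in> carrier (GLQ n)" "inv\<^bsub>GLQ n\<^esub> E = E"
    using GLQ_I[OF Ec Ec 1] 1 by auto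
  have "E *\<^sub>v v \<in> Zvec n" if "v \<in> Zvec n" for v
    using that ij mult_mat_vec_closed[OF Ec, of v] by (auto simp: Zvec_iff E simp del: index_mult_mat_vec)
  then have "E \<in> GLZ n" using inv by (intro GLZ_I) auto
  then show ?thesis using that E by blast
qed

text \<open>Euclidean algorithm on the coefficients: while two of them are nonzero, the larger is
  reduced by the smaller through a shear, and the sum of the absolute values drops. Up to sign, the
  remaining \<open>d\<close> is the greatest common divisor.\<close>

lemma linear_form_normal_form:
  assumes "n > 0"
  shows "\<exists>P\<in>GLZ n. \<exists>d::int. \<forall>v\<in>carrier_vec n. (\<Sum>i<n. of_int (r i) * v $ i) = of_int d * (P *\<^sub>v v) $ 0"
proof (induction "\<Sum>i<n. nat \<bar>r i\<bar>" arbitrary: r rule: less_induct)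
  case less
  show ?case
  proof (cases "\<exists>i<n. \<exists>j<n. i \<noteq> j \<and> r i \<noteq> 0 \<and> r j \<noteq> 0 \<and> \<bar>r j\<bar> \<le> \<bar>r i\<bar>")
    case True
    then obtain i j where ij: "i < n" "j < n" "i \<noteq> j" "r i \<noteq> 0" "r j \<noteq> 0" "\<bar>r j\<bar> \<le> \<bar>r i\<bar>" by blast
    \<comment> \<open>With this sign \<open>c * r j\<close> has the sign of \<open>r i\<close>, so
      the difference has absolute value \<open>\<bar>r i\<bar> - \<bar>r j\<bar>\<close>.\<close>
    define c where "c = sgn (r i) * sgn (r j)"
    have c: "\<bar>r i - c * r j\<bar> < \<bar>r i\<bar>"
      using ij by (auto simp: c_def sgn_if)
    define r' where "r' = r(i := r i - c * r j)"
    have "(\<Sum>a<n. nat \<bar>r' a\<bar>) < (\<Sum>a<n. nat \<bar>r a\<bar>)"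
    proof (rule sum_strict_mono_ex1)
      show "\<forall>a\<in>{..<n}. nat \<bar>r' a\<bar> \<le> nat \<bar>r a\<bar>" using c by (auto simp: r'_def)
      show "\<exists>a\<in>{..<n}. nat \<bar>r' a\<bar> < nat \<bar>r a\<bar>" using c ij by (intro bexI[of _ i]) (auto simp: r'_def)
    qed simp
    from less[OF this] obtain P d where P: "P \<in> GLZ n"
      "\<And>v. v \<in> carrier_vec n \<Longrightarrow> (\<Sum>i<n. of_int (r' i) * v $ i) = of_int d * (P *\<^sub>v v) $ 0" by blast
    obtain E where E: "E \<in> GLZ n"
      "\<And>v a. v \<in> carrier_vec n \<Longrightarrow> a < n \<Longrightarrow> (E *\<^sub>v v) $ a = v $ a + (if a = j then of_int c * v $ i else 0)"
      using shear_GLZ[OF ij(1-3)] by blast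
    have "(\<Sum>a<n. of_int (r a) * v $ a) = of_int d * ((P * E) *\<^sub>v v) $ 0" if v: "v \<in> carrier_vec n" for v
    proof -
      have "(\<Sum>a<n. of_int (r' a) * (E *\<^sub>v v) $ a)
        = (\<Sum>a<n. of_int (r a) * v $ a - (if a = i then of_int (c * r j) * v $ i else 0)
            + (if a = j then of_int (c * r j) * v $ i else 0))"
        using ij v by (intro sum.cong) (auto simp: r'_def E(2) algebra_simps)
      also have "\<dots> = (\<Sum>a<n. of_int (r a) * v $ a)"
        using ij by (simp add: sum.distrib sum_subtractf)
      finally show ?thesis
        using P(2)[of "E *\<^sub>v v"] GLZ_D(2)[OF E(1)] GLZ_D(2)[OF P(1)] v by (simp add: assoc_mult_mat_vec del: index_mult_mat_vec)
    qed
    then show ?thesis using GLZ_mult[OF P(1) E(1)] by blast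
  next
    case False
    \<comment> \<open>At most one coefficient is nonzero now; if all of them vanish, the index
      \<open>0\<close> serves.\<close>
    obtain j where j: "j < n" "\<And>i. i < n \<Longrightarrow> i \<noteq> j \<Longrightarrow> r i = 0"
    proof (cases "\<exists>j<n. r j \<noteq> 0")
      case True
      then obtain j where "j < n" "r j \<noteq> 0" by blast
      then show ?thesis using that[of j] False by (metis linorder_le_cases)
    next
      case F: False
      then show ?thesis using that[of 0] assms by auto
    qed
    obtain E where E: "E \<in> GLZ n"
      "\<And>v a. v \<in> carrier_vec n \<Longrightarrow> a < n \<Longrightarrow> (E *\<^sub>v v) $ a = v $ (if a = 0 then j else if a = j then 0 else a)"
      using swap_GLZ[OF assms j(1)] by blast
    have "(\<Sum>i<n. of_int (r i) * v $ i) = of_int (r j) * (E *\<^sub>v v) $ 0" if v: "v \<in> carrier_vec n" for v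
    proof -
      have "(\<Sum>i<n. of_int (r i) * v $ i) = (\<Sum>i<n. if i = j then of_int (r j) * v $ j else 0)"
        using j by (intro sum.cong) auto
      then show ?thesis using E(2)[OF v assms] j assms by simp
    qed
    then show ?thesis using E(1) by blast
  qed
qed

text \<open>The values on unit vectors are the coefficients to be normalized. Nonvanishing of
  \<open>f\<close> gives \<open>d \<noteq> 0\<close> and excludes dimension zero.\<close>

lemma Zvec_linear_form:
  assumes f: "f \<in> Zvec n \<rightarrow> (UNIV :: int set)"
    "\<And>v w. v \<in> Zvec n \<Longrightarrow> w \<in> Zvec n \<Longrightarrow> f (v + w) = f v + f w"
    and nz: "\<exists>v\<in>Zvec n. f v \<noteq> 0"
  obtains P and d :: int where "n > 0" "P \<in> GLZ n" "d \<noteq> 0"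
    "\<And>v. v \<in> Zvec n \<Longrightarrow> of_int (f v) = of_int d * (P *\<^sub>v v) $ 0"
proof -
  define r where "r i = f (unit_vec n i)" for i
  have f0: "f (0\<^sub>v n) = 0" using f(2)[of "0\<^sub>v n" "0\<^sub>v n"] vsubD(2)[OF vsub_Zvec] by simp
  have fr: "of_int (f v) = (\<Sum>i<n. of_int (r i) * v $ i)" if "v \<in> Zvec n" for v
    using that
  proof (rule Zvec_induct)
    fix i assume i: "i < n"
    have "(\<Sum>a<n. of_int (r a) * unit_vec n i $ a) = (\<Sum>a<n. if a = i then rat_of_int (r i) else 0)"
      using i by (intro sum.cong) (auto simp: unit_vec_def)
    then show "rat_of_int (f (unit_vec n i)) = (\<Sum>a<n. of_int (r a) * unit_vec n i $ a)"
      using i by (simp add: r_def)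
  next
    fix u w assume uw: "u \<in> Zvec n" "w \<in> Zvec n" "rat_of_int (f u) = (\<Sum>i<n. of_int (r i) * u $ i)"
      "rat_of_int (f w) = (\<Sum>i<n. of_int (r i) * w $ i)"
    have "(\<Sum>i<n. of_int (r i) * (u + w) $ i) = (\<Sum>i<n. rat_of_int (r i) * u $ i + of_int (r i) * w $ i)"
      using Zvec_carrier[OF uw(2)] by (intro sum.cong) (auto simp: algebra_simps)
    then show "rat_of_int (f (u + w)) = (\<Sum>i<n. of_int (r i) * (u + w) $ i)"
      using uw f(2) by (simp add: sum.distrib)
  next
    fix u assume u: "u \<in> Zvec n" "rat_of_int (f u) = (\<Sum>i<n. of_int (r i) * u $ i)"
    have "f (u + - u) = f u + f (- u)" using u vsubD(4)[OF vsub_Zvec] by (intro f(2)) auto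
    then have "f (- u) = - f u" using f0 Zvec_carrier[OF u(1)] by simp
    moreover have "(\<Sum>i<n. of_int (r i) * (- u) $ i) = (\<Sum>i<n. - (rat_of_int (r i) * u $ i))"
      using Zvec_carrier[OF u(1)] by (intro sum.cong) auto
    ultimately show "rat_of_int (f (- u)) = (\<Sum>i<n. of_int (r i) * (- u) $ i)"
      using u by (simp add: sum_negf)
  qed (simp add: f0)
  have n: "n > 0"
  proof (rule ccontr)
    assume "\<not> n > 0"
    then have "\<forall>v\<in>Zvec n. v = 0\<^sub>v n" using Zvec_carrier by (metis carrier_vecD gr0I vec_of_dim_0)
    then show False using nz f0 by auto
  qed
  obtain P d where P: "P \<in> GLZ n"
    "\<And>v. v \<in> carrier_vec n \<Longrightarrow> (\<Sum>i<n. of_int (r i) * v $ i) = of_int d * (P *\<^sub>v v) $ 0"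
    using linear_form_normal_form[OF n, of r] by blast
  have "of_int (f v) = of_int d * (P *\<^sub>v v) $ 0" if "v \<in> Zvec n" for v
    using fr[OF that] P(2)[OF Zvec_carrier[OF that]] by simp
  moreover from this have "d \<noteq> 0" using nz by force
  ultimately show ?thesis using that n P(1) by blast
qed

section \<open>Twisting a semidirect product\<close>

text \<open>The situation of (iii) without block matrices. The vectors with first coordinate zero
  form an invariant subgroup \<open>P\<close>; on it \<open>A\<^sup>\<kappa>\<close> is trivial and
  \<open>A'\<close> is \<open>A\<^sup>q\<close>. The semidirect product modulo \<open>P\<close> is
  Z^2, by first coordinate and exponent. The new stable letter \<open>(v\<^sub>1, q)\<close> lies
  over \<open>(p, q)\<close>, a new first basis vector will lie over \<open>(l, \<kappa>)\<close>,
  and \<open>det\<close> makes these two a basis of Z^2.\<close>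

locale twist =
  fixes n :: nat and A A' :: "rat mat" and q \<kappa> l p :: int and v\<^sub>1 :: "rat vec"
  assumes n: "n > 0" and A: "A \<in> GLZ n" and A': "A' \<in> GLZ n"
    and fst: "\<And>v. v \<in> carrier_vec n \<Longrightarrow> (A *\<^sub>v v) $ 0 = v $ 0"
    and fst': "\<And>v. v \<in> carrier_vec n \<Longrightarrow> (A' *\<^sub>v v) $ 0 = v $ 0"
    and e0: "A' *\<^sub>v unit_vec n 0 = A *\<^sub>v unit_vec n 0"
    and W: "\<And>w. w \<in> Zvec n \<Longrightarrow> w $ 0 = 0 \<Longrightarrow> A' *\<^sub>v w = mact n A q w"
    and \<kappa>: "\<And>w. w \<in> Zvec n \<Longrightarrow> w $ 0 = 0 \<Longrightarrow> mact n A \<kappa> w = w"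
    and det: "q * l - \<kappa> * p = 1"
    and v1: "v\<^sub>1 \<in> Zvec n" "v\<^sub>1 $ 0 = of_int p"
begin

lemmas AQ = GLZ_D(1)[OF A]

abbreviation "a \<equiv> mact n A"
abbreviation "e\<^sub>0 \<equiv> unit_vec n 0 :: rat vec"

definition "P = {w \<in> Zvec n. w $ 0 = 0}"

lemma P_Z: "w \<in> P \<Longrightarrow> w \<in> Zvec n" and P_c: "w \<in> P \<Longrightarrow> w \<in> carrier_vec n" and P_0: "w \<in> P \<Longrightarrow> w $ 0 = 0"
  by (auto simp: P_def Zvec_carrier)

lemma vsub_P: "vsub n P"
  using vsubD[OF vsub_Zvec] n unfolding vsub_def P_def
  by (auto simp: Zvec_carrier Zvec_carrier[THEN carrier_vecD])

lemma a_dim [simp]: "dim_vec (a j v) = n"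
  using carrier_vecD[OF mact_closed[OF AQ]] .

lemma a_Z: "v \<in> Zvec n \<Longrightarrow> a j v \<in> Zvec n"
proof -
  have "mat_image A (Zvec n) = Zvec n" using A GLZ_iff by auto
  have p: "v \<in> Zvec n \<Longrightarrow> a (int i) v \<in> Zvec n" for i
    using GLZ_D(3)[OF A] by (intro mact_nonneg_Zvec[OF AQ]) auto
  have m: "v \<in> Zvec n \<Longrightarrow> a (- int i) v \<in> Zvec n" for i
    unfolding mact_inv[OF AQ, symmetric] using GLZ_D(3)[OF GLZ_inv[OF A]]
    by (intro mact_nonneg_Zvec[OF GLQ_inv(1)[OF AQ]]) auto
  show "v \<in> Zvec n \<Longrightarrow> a j v \<in> Zvec n" using p m by (cases j rule: int_cases2) auto
qed

lemma a_fst: 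
  assumes v: "v \<in> carrier_vec n"
  shows "a j v $ 0 = v $ 0"
proof (induction j rule: int_induct[where k = 0])
  case base
  then show ?case using v by (simp add: mact_0[OF AQ])
next
  case (step1 i)
  then show ?case using mact_plus[OF AQ v, of 1 i] fst[OF mact_closed[OF AQ]]
    by (simp add: mact_1[OF AQ] add.commute)
next
  case (step2 i)
  have "a i v = A *\<^sub>v a (i - 1) v" using mact_plus[OF AQ v, of 1 "i - 1"] by (simp add: mact_1[OF AQ])
  then show ?case using step2 fst[OF mact_closed[OF AQ, of "i - 1" v]] by simp
qed

lemma a_P: "w \<in> P \<Longrightarrow> a j w \<in> P"
  using a_Z a_fst by (auto simp: P_def Zvec_carrier)

lemma e0_Z [simp]: "e\<^sub>0 \<in> Zvec n" "e\<^sub>0 \<in> carrier_vec n" "e\<^sub>0 $ 0 = 1"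
  using n by auto

definition "pr v = v - v $ 0 \<cdot>\<^sub>v e\<^sub>0"

lemma smult_Z: "v \<in> Zvec n \<Longrightarrow> w \<in> Zvec n \<Longrightarrow> v $ 0 \<cdot>\<^sub>v w \<in> Zvec n"
  using n vsub_int_smult[OF vsub_Zvec] by (auto simp: Zvec_iff)

lemma pr_P: "v \<in> Zvec n \<Longrightarrow> pr v \<in> P"
  unfolding P_def pr_def using vsubD(5)[OF vsub_Zvec _ smult_Z] n by (auto simp: Zvec_carrier)

lemma pr_split: "v \<in> carrier_vec n \<Longrightarrow> v = v $ 0 \<cdot>\<^sub>v e\<^sub>0 + pr v"
  unfolding pr_def by (intro eq_vecI) auto

lemma a_split: "v \<in> carrier_vec n \<Longrightarrow> a j v = v $ 0 \<cdot>\<^sub>v a j e\<^sub>0 + a j (pr v)"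
  using mact_add[OF AQ, of "v $ 0 \<cdot>\<^sub>v e\<^sub>0" "pr v" j] mact_smult[OF AQ e0_Z(2), of j "v $ 0"]
    pr_split[of v] by (simp add: pr_def)

text \<open>Up to a leading zero this is the column \<open>u\<close> of the block matrix, the amount
  by which \<open>A\<close> fails to fix \<open>e\<^sub>0\<close>.\<close>

definition "u = a 1 e\<^sub>0 - e\<^sub>0"

lemma u_P: "u \<in> P"
  unfolding u_def P_def using vsubD(5)[OF vsub_Zvec a_Z[OF e0_Z(1)] e0_Z(1)] a_fst[OF e0_Z(2)] n by simp

text \<open>Modulo the image of \<open>A - 1\<close> on \<open>P\<close>, each application of
  \<open>A\<close> translates \<open>v\<close> by \<open>v $ 0\<close> times \<open>u\<close>; these
  steps telescope.\<close>

lemma drift: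
  assumes v: "v \<in> Zvec n"
  shows "\<exists>w\<in>P. a j v - v = (of_int j * v $ 0) \<cdot>\<^sub>v u + (a 1 w - w)"
proof -
  note vc = Zvec_carrier[OF v]
  have step: "\<exists>y\<in>P. a (i + 1) v - a i v = v $ 0 \<cdot>\<^sub>v u + (a 1 y - y)" for i
  proof (intro bexI)
    let ?y = "pr (a i v)"
    show "?y \<in> P" by (rule pr_P[OF a_Z[OF v]])
    have "a (i + 1) v = v $ 0 \<cdot>\<^sub>v a 1 e\<^sub>0 + a 1 ?y"
      using mact_plus[OF AQ vc, of 1 i] a_split[OF mact_closed[OF AQ], of 1 i v] a_fst[OF vc]
      by (simp add: add.commute)
    moreover have "a i v = v $ 0 \<cdot>\<^sub>v e\<^sub>0 + ?y"
      using pr_split[OF mact_closed[OF AQ], of i v] a_fst[OF vc] by simp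
    ultimately show "a (i + 1) v - a i v = v $ 0 \<cdot>\<^sub>v u + (a 1 ?y - ?y)"
      unfolding u_def by (intro eq_vecI) (auto simp: pr_def a_fst[OF vc] algebra_simps)
  qed
  show ?thesis
  proof (induction j rule: int_induct[where k = 0])
    case base
    have "a 0 v - v = (of_int 0 * v $ 0) \<cdot>\<^sub>v u + (a 1 (0\<^sub>v n) - 0\<^sub>v n)"
      using vc P_c[OF u_P] by (intro eq_vecI) (auto simp: mact_0[OF AQ] mact_zero[OF AQ])
    then show ?case using vsubD(2)[OF vsub_P] by blast
  next
    case (step1 i)
    then obtain w y where w: "w \<in> P" "a i v - v = (of_int i * v $ 0) \<cdot>\<^sub>v u + (a 1 w - w)"
      and y: "y \<in> P" "a (i + 1) v - a i v = v $ 0 \<cdot>\<^sub>v u + (a 1 y - y)" using step[of i] by blast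
    have "a (i + 1) v - v = (of_int (i + 1) * v $ 0) \<cdot>\<^sub>v u + (a 1 (w + y) - (w + y))"
    proof (rule eq_vecI)
      fix b assume "b < dim_vec ((of_int (i + 1) * v $ 0) \<cdot>\<^sub>v u + (a 1 (w + y) - (w + y)))"
      then have b: "b < n" using P_c[OF y(1)] by simp
      show "(a (i + 1) v - v) $ b = ((of_int (i + 1) * v $ 0) \<cdot>\<^sub>v u + (a 1 (w + y) - (w + y))) $ b"
        using arg_cong[OF w(2), of "\<lambda>x. x $ b"] arg_cong[OF y(2), of "\<lambda>x. x $ b"] b vc
          P_c[OF y(1)] P_c[OF w(1)] P_c[OF u_P]
        by (simp add: mact_add[OF AQ] algebra_simps)
    qed (use vc P_c[OF y(1)] in simp)
    then show ?case using vsubD(3)[OF vsub_P w(1) y(1)] by blast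
  next
    case (step2 i)
    then obtain w y where w: "w \<in> P" "a i v - v = (of_int i * v $ 0) \<cdot>\<^sub>v u + (a 1 w - w)"
      and y: "y \<in> P" "a i v - a (i - 1) v = v $ 0 \<cdot>\<^sub>v u + (a 1 y - y)" using step[of "i - 1"] by auto
    have "a (i - 1) v - v = (of_int (i - 1) * v $ 0) \<cdot>\<^sub>v u + (a 1 (w - y) - (w - y))"
    proof (rule eq_vecI)
      fix b assume "b < dim_vec ((of_int (i - 1) * v $ 0) \<cdot>\<^sub>v u + (a 1 (w - y) - (w - y)))"
      then have b: "b < n" using P_c[OF y(1)] by simp
      show "(a (i - 1) v - v) $ b = ((of_int (i - 1) * v $ 0) \<cdot>\<^sub>v u + (a 1 (w - y) - (w - y))) $ b"
        using arg_cong[OF w(2), of "\<lambda>x. x $ b"] arg_cong[OF y(2), of "\<lambda>x. x $ b"] b vc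
          P_c[OF y(1)] P_c[OF w(1)] P_c[OF u_P]
        by (simp add: mact_minus[OF AQ] algebra_simps)
    qed (use vc P_c[OF y(1)] in simp)
    then show ?case using vsubD(5)[OF vsub_P w(1) y(1)] by blast
  qed
qed

text \<open>On \<open>P\<close> the operators \<open>A - 1\<close> and \<open>A\<^sup>q - 1\<close> have the same image, since \<open>A\<close> acts there as
  \<open>A\<close> to the power \<open>q l\<close>.\<close>

lemma P_boundary:
  assumes w: "w \<in> P"
  shows "\<exists>y\<in>P. a 1 w - w = a q y - y"
proof -
  note wc = P_c[OF w]
  \<comment> \<open>Telescoping: passing from \<open>j\<close> to \<open>j + 1\<close> adds
    \<open>a (q * j) w\<close> to the witness.\<close>
  have "\<exists>y\<in>P. a (q * j) w - w = a q y - y" for j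
  proof (induction j rule: int_induct[where k = 0])
    case base
    have "a (q * 0) w - w = a q (0\<^sub>v n) - 0\<^sub>v n"
      using wc by (intro eq_vecI) (auto simp: mact_0[OF AQ] mact_zero[OF AQ])
    then show ?case using vsubD(2)[OF vsub_P] by blast
  next
    case (step1 i)
    then obtain y where y: "y \<in> P" "a (q * i) w - w = a q y - y" by blast
    let ?z = "a (q * i) w"
    have z: "?z \<in> P" "a (q * (i + 1)) w = a q ?z" 
      using a_P[OF w] mact_plus[OF AQ wc, of q "q * i"] by (auto simp: algebra_simps)
    have "a (q * (i + 1)) w - w = a q (y + ?z) - (y + ?z)"
    proof (rule eq_vecI)
      fix b assume "b < dim_vec (a q (y + ?z) - (y + ?z))"
      then have b: "b < n" using P_c[OF y(1)] by simp
      show "(a (q * (i + 1)) w - w) $ b = (a q (y + ?z) - (y + ?z)) $ b"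
        unfolding z(2) using arg_cong[OF y(2), of "\<lambda>x. x $ b"] b wc P_c[OF y(1)] P_c[OF z(1)]
        by (simp add: mact_add[OF AQ] algebra_simps)
    qed (use wc P_c[OF y(1)] in simp)
    then show ?case using vsubD(3)[OF vsub_P y(1) z(1)] by blast
  next
    case (step2 i)
    then obtain y where y: "y \<in> P" "a (q * i) w - w = a q y - y" by blast
    let ?z = "a (q * (i - 1)) w"
    have z: "?z \<in> P" "a (q * i) w = a q ?z" 
      using a_P[OF w] mact_plus[OF AQ wc, of q "q * (i - 1)"] by (auto simp: algebra_simps)
    have "?z - w = a q (y - ?z) - (y - ?z)"
    proof (rule eq_vecI)
      fix b assume "b < dim_vec (a q (y - ?z) - (y - ?z))"
      then have b: "b < n" using P_c[OF y(1)] by simp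
      show "(?z - w) $ b = (a q (y - ?z) - (y - ?z)) $ b"
        using arg_cong[OF y(2), of "\<lambda>x. x $ b"] b wc P_c[OF y(1)] P_c[OF z(1)]
        unfolding z(2) by (simp add: mact_minus[OF AQ] algebra_simps)
    qed (use wc P_c[OF y(1)] in simp)
    then show ?case using vsubD(5)[OF vsub_P y(1) z(1)] by blast
  qed
  moreover have "a (q * l) w = a 1 w"
  proof -
    have "a (\<kappa> * j) w = w" for j
    proof (induction j rule: int_induct[where k = 0])
      case base
      then show ?case using wc by (simp add: mact_0[OF AQ])
    next
      case (step1 i)
      then show ?case using mact_plus[OF AQ wc, of \<kappa> "\<kappa> * i"] \<kappa>[OF P_Z[OF w] P_0[OF w]]
        by (simp add: algebra_simps)
    next
      case (step2 i)
      let ?z = "a (\<kappa> * (i - 1)) w"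
      have "a (\<kappa> * i) w = a \<kappa> ?z" using mact_plus[OF AQ wc, of \<kappa> "\<kappa> * (i - 1)"] by (simp add: algebra_simps)
      also have "\<dots> = ?z" using a_P[OF w] by (intro \<kappa>) (auto simp: P_def)
      finally show ?case using step2 by simp
    qed
    moreover have "q * l = 1 + \<kappa> * p" using det by simp
    ultimately show ?thesis using mact_plus[OF AQ wc, of 1 "\<kappa> * p"] by simp
  qed
  ultimately show ?thesis by metis
qed

text \<open>For \<open>t = (v\<^sub>1, q)\<close> and \<open>x = (v2, \<kappa>)\<close> the equation
  is the relation \<open>t x = u x t\<close>. With \<open>v2\<close> equal to \<open>l\<close> times
  \<open>e\<^sub>0\<close> plus \<open>z\<close>, the two drifts contribute
  \<open>q l - \<kappa> p = 1\<close> copies of \<open>u\<close>, and the rest lies in the image of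
  \<open>A - 1\<close> on \<open>P\<close>. By \<open>P_boundary\<close> it also lies in the image
  of \<open>A\<^sup>q - 1\<close>, so a suitable \<open>z\<close> cancels it.\<close>

lemma ex_v2:
  obtains v2 where "v2 \<in> Zvec n" "v2 $ 0 = of_int l" "v\<^sub>1 + a q v2 = u + (v2 + a \<kappa> v\<^sub>1)"
proof -
  let ?s = "of_int l \<cdot>\<^sub>v e\<^sub>0"
  have s: "?s \<in> Zvec n" "?s $ 0 = of_int l" using vsub_int_smult[OF vsub_Zvec e0_Z(1)] n by auto
  obtain w where w: "w \<in> P" "a q ?s - ?s = (of_int q * of_int l) \<cdot>\<^sub>v u + (a 1 w - w)"
    using drift[OF s(1), of q] s(2) by auto
  obtain y where y: "y \<in> P" "a \<kappa> v\<^sub>1 - v\<^sub>1 = (of_int \<kappa> * of_int p) \<cdot>\<^sub>v u + (a 1 y - y)"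
    using drift[OF v1(1), of \<kappa>] v1(2) by auto
  obtain z where z: "z \<in> P" "a 1 (y - w) - (y - w) = a q z - z"
    using P_boundary[OF vsubD(5)[OF vsub_P y(1) w(1)]] by blast
  have ql: "rat_of_int q * of_int l = 1 + of_int \<kappa> * of_int p"
  proof -
    have "q * l = 1 + \<kappa> * p" using det by simp
    then show ?thesis by (metis of_int_1 of_int_add of_int_mult)
  qed
  show ?thesis
  proof
    show "?s + z \<in> Zvec n" by (rule vsubD(3)[OF vsub_Zvec s(1) P_Z[OF z(1)]])
    show "(?s + z) $ 0 = of_int l" using s(2) P_0[OF z(1)] P_c[OF z(1)] n by simp
    note c = Zvec_carrier[OF s(1)] Zvec_carrier[OF v1(1)] P_c[OF z(1)] P_c[OF y(1)] P_c[OF w(1)] P_c[OF u_P]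
    show "v\<^sub>1 + a q (?s + z) = u + (?s + z + a \<kappa> v\<^sub>1)"
    proof (rule eq_vecI)
      fix b assume "b < dim_vec (u + (?s + z + a \<kappa> v\<^sub>1))"
      then have b: "b < n" by simp
      have "(a q ?s - ?s) $ b = (1 + of_int \<kappa> * of_int p) * u $ b + (a 1 w - w) $ b"
        using arg_cong[OF w(2), of "\<lambda>x. x $ b"] b c unfolding ql by simp
      moreover have "(a \<kappa> v\<^sub>1 - v\<^sub>1) $ b = of_int \<kappa> * of_int p * u $ b + (a 1 y - y) $ b"
        using arg_cong[OF y(2), of "\<lambda>x. x $ b"] b c by simp
      ultimately show "(v\<^sub>1 + a q (?s + z)) $ b = (u + (?s + z + a \<kappa> v\<^sub>1)) $ b"
        using arg_cong[OF z(2), of "\<lambda>x. x $ b"] b c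
        by (simp add: mact_add[OF AQ] mact_minus[OF AQ] algebra_simps)
    qed (use c in simp)
  qed
qed

end

definition zgrp :: "int monoid" where
  "zgrp = \<lparr>carrier = UNIV, monoid.mult = (+), one = 0\<rparr>"

lemma zgrp_simps [simp]:
  "carrier zgrp = UNIV" "j \<otimes>\<^bsub>zgrp\<^esub> k = j + k" "\<one>\<^bsub>zgrp\<^esub> = 0"
  by (simp_all add: zgrp_def)

lemma group_zgrp: "group zgrp"
  by (rule groupI) (auto intro: exI[of _ "- _"])

lemma zgrp_int_pow: "j [^]\<^bsub>zgrp\<^esub> (k::int) = k * j"
proof -
  interpret group zgrp by (rule group_zgrp)
  have n: "j [^]\<^bsub>zgrp\<^esub> m = int m * j" for m :: nat
    by (induction m) (auto simp: algebra_simps)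
  show ?thesis
  proof (cases "k \<ge> 0")
    case True
    then show ?thesis using n[of "nat k"] by (simp add: int_pow_def2 del: pow_nat)
  next
    case False
    have "inv\<^bsub>zgrp\<^esub> m = - m" for m by (rule inv_equality) auto
    then show ?thesis using False n by (simp add: int_pow_def2 del: pow_nat)
  qed
qed

lemma sdp_data_Zvec:
  assumes A: "A \<in> GLZ n"
  shows "sdp_data n A (Zvec n)"
proof
  fix j v assume v: "v \<in> Zvec n"
  have p: "mact n A (int i) v \<in> Zvec n" for i
    using v GLZ_D[OF A] by (intro mact_nonneg_Zvec) auto
  have m: "mact n A (- int i) v \<in> Zvec n" for i
    unfolding mact_inv[OF GLZ_D(1)[OF A], symmetric] using v GLZ_D[OF GLZ_inv[OF A]]
    by (intro mact_nonneg_Zvec) auto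
  show "mact n A j v \<in> Zvec n" using p m by (cases j rule: int_cases2) auto
qed (use GLZ_D[OF A] vsub_Zvec in auto)

section \<open>The isomorphism given by the new stable letter\<close>

context twist
begin

sublocale S: sdp_data n A "Zvec n" by (rule sdp_data_Zvec[OF A])
sublocale S': sdp_data n A' "Zvec n" by (rule sdp_data_Zvec[OF A'])

definition "c v = \<lfloor>v $ 0\<rfloor>" for v :: "rat vec"

lemma c: "v \<in> Zvec n \<Longrightarrow> of_int (c v) = v $ 0"
  using n by (auto simp: c_def Zvec_iff)

lemma c_add: "v \<in> Zvec n \<Longrightarrow> w \<in> Zvec n \<Longrightarrow> c (v + w) = c v + c w"
proof -
  assume vw: "v \<in> Zvec n" "w \<in> Zvec n"
  have "rat_of_int (c (v + w)) = of_int (c v + c w)"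
    using c[OF vw(1)] c[OF vw(2)] c[OF vsubD(3)[OF vsub_Zvec vw]] Zvec_carrier[OF vw(2)] n by simp
  then show ?thesis by (simp only: of_int_eq_iff)
qed

lemma c_a: "v \<in> Zvec n \<Longrightarrow> c (a j v) = c v"
  by (simp add: c_def a_fst Zvec_carrier)

text \<open>Together with \<open>d\<close> these are the two coordinates of the semidirect product
  modulo \<open>P\<close>.\<close>

sublocale c: group_hom S.S zgrp "\<lambda>g. c (prod.fst g)"
  by (intro group_hom.intro group_hom_axioms.intro S.S.group_axioms group_zgrp) (auto simp: hom_def c_add c_a a_Z)

sublocale d: group_hom S.S zgrp "\<lambda>g. snd g"
  by (intro group_hom.intro group_hom_axioms.intro S.S.group_axioms group_zgrp) (auto simp: hom_def)

text \<open>The homomorphism \<open>f\<close> is the identity on \<open>P\<close> and sends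
  \<open>e\<^sub>0\<close> to \<open>x\<close>; with the image \<open>t\<close> of the stable letter
  it induces \<open>h\<close>. Modulo \<open>P\<close> this is an integer matrix of determinant one.
  The images of fibre and stable letter are recorded because they later show that a composite with
  \<open>h\<close> preserves fibres.\<close>

theorem twist_iso:
  "\<exists>h\<in>iso S'.S S.S. h (0\<^sub>v n, 1) = (v\<^sub>1, q) \<and>
    (\<forall>v\<in>Zvec n. \<exists>w\<in>Zvec n. h (v, 0) = (w, \<kappa> * c v) \<and> c w = l * c v)"
proof -
  obtain v2 where v2: "v2 \<in> Zvec n" "v2 $ 0 = of_int l" "v\<^sub>1 + a q v2 = u + (v2 + a \<kappa> v\<^sub>1)"
    using ex_v2 .
  define x where "x = (v2, \<kappa>)"
  define t where "t = (v\<^sub>1, q)"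
  have xc: "x \<in> carrier S.S" and tc: "t \<in> carrier S.S" using v2 v1 by (auto simp: x_def t_def)
  have wc: "(w, 0) \<in> carrier S.S" if "w \<in> P" for w using P_Z[OF that] by simp
  have x_comm: "x \<otimes>\<^bsub>S.S\<^esub> (w, 0) = (w, 0) \<otimes>\<^bsub>S.S\<^esub> x" if w: "w \<in> P" for w
    using \<kappa>[OF P_Z[OF w] P_0[OF w]] comm_add_vec[of v2 n w] P_c[OF w] Zvec_carrier[OF v2(1)]
    by (simp add: x_def mact_0[OF AQ])
  have x_pow_comm: "x [^]\<^bsub>S.S\<^esub> j \<otimes>\<^bsub>S.S\<^esub> (w, 0) = (w, 0) \<otimes>\<^bsub>S.S\<^esub> x [^]\<^bsub>S.S\<^esub> j" if w: "w \<in> P" for w and j :: int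
    by (rule S.S.comm_int_pow[OF xc wc[OF w] x_comm[OF w]])
  have w_mult: "(w, 0) \<otimes>\<^bsub>S.S\<^esub> (w', j) = (w + w', j)" if "w' \<in> Zvec n" for w w' j
    using Zvec_carrier[OF that] by (simp add: mact_0[OF AQ])
  have t_w: "t \<otimes>\<^bsub>S.S\<^esub> (w, 0) = (A' *\<^sub>v w, 0) \<otimes>\<^bsub>S.S\<^esub> t" if w: "w \<in> P" for w
    using W[OF P_Z[OF w] P_0[OF w]] comm_add_vec[of v\<^sub>1 n "a q w"] Zvec_carrier[OF v1(1)]
      Zvec_carrier[OF a_Z[OF P_Z[OF w]]]
    by (simp add: t_def mact_0[OF AQ])
  have t_x: "t \<otimes>\<^bsub>S.S\<^esub> x = ((u, 0) \<otimes>\<^bsub>S.S\<^esub> x) \<otimes>\<^bsub>S.S\<^esub> t"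
    using v2(3) P_c[OF u_P] Zvec_carrier[OF v2(1)] Zvec_carrier[OF v1(1)] 
      assoc_add_vec[OF P_c[OF u_P] Zvec_carrier[OF v2(1)] mact_closed[OF AQ], of \<kappa> v\<^sub>1]
    by (simp add: t_def x_def mact_0[OF AQ])
  have u_pow: "(u, 0) [^]\<^bsub>S.S\<^esub> j = (of_int j \<cdot>\<^sub>v u, 0)" for j :: int
  proof -
    interpret e: group_hom "vgrp n (Zvec n)" S.S "\<lambda>v. (v, 0)"
      using S.embed_hom S.S.group_axioms group_vgrp[OF vsub_Zvec]
      by (simp add: group_hom_def group_hom_axioms_def)
    show ?thesis using e.hom_int_pow[of u j] P_Z[OF u_P] int_pow_vgrp[OF vsub_Zvec P_Z[OF u_P]] by simp
  qed
  have t_x_pow: "t \<otimes>\<^bsub>S.S\<^esub> x [^]\<^bsub>S.S\<^esub> j = (of_int j \<cdot>\<^sub>v u, 0) \<otimes>\<^bsub>S.S\<^esub> x [^]\<^bsub>S.S\<^esub> j \<otimes>\<^bsub>S.S\<^esub> t" for j :: int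
  proof -
    have "t \<otimes>\<^bsub>S.S\<^esub> x [^]\<^bsub>S.S\<^esub> j = ((u, 0) \<otimes>\<^bsub>S.S\<^esub> x) [^]\<^bsub>S.S\<^esub> j \<otimes>\<^bsub>S.S\<^esub> t"
      by (rule S.S.conj_int_pow[OF tc xc S.S.m_closed[OF wc[OF u_P] xc] t_x])
    then show ?thesis
      using S.S.int_pow_mult_distrib[OF x_comm[OF u_P, symmetric] wc[OF u_P] xc, of j] u_pow by simp
  qed
  define f where "f v = (pr v, 0) \<otimes>\<^bsub>S.S\<^esub> x [^]\<^bsub>S.S\<^esub> c v" for v
  have xp: "x [^]\<^bsub>S.S\<^esub> (j::int) \<in> carrier S.S" for j using xc by (rule S.S.int_pow_closed)
  have fc: "f v \<in> carrier S.S" if "v \<in> Zvec n" for v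
    unfolding f_def using wc[OF pr_P[OF that]] xp by (rule S.S.m_closed)
  have f_hom: "f \<in> hom (vgrp n (Zvec n)) S.S"
  proof (rule homI)
    fix v w assume "v \<in> carrier (vgrp n (Zvec n))" "w \<in> carrier (vgrp n (Zvec n))"
    then have vw: "v \<in> Zvec n" "w \<in> Zvec n" by auto
    note P = pr_P[OF vw(1)] pr_P[OF vw(2)]
    have pr: "pr (v + w) = pr v + pr w"
      using Zvec_carrier[OF vw(1)] Zvec_carrier[OF vw(2)] n unfolding pr_def
      by (intro eq_vecI) (auto simp: algebra_simps)
    have "f (v + w) = (pr v, 0) \<otimes>\<^bsub>S.S\<^esub> (pr w, 0) \<otimes>\<^bsub>S.S\<^esub> (x [^]\<^bsub>S.S\<^esub> c v \<otimes>\<^bsub>S.S\<^esub> x [^]\<^bsub>S.S\<^esub> c w)"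
      unfolding f_def pr w_mult[OF P_Z[OF P(2)]] c_add[OF vw] by (simp only: S.S.int_pow_mult[OF xc])
    also have "\<dots> = (pr v, 0) \<otimes>\<^bsub>S.S\<^esub> ((pr w, 0) \<otimes>\<^bsub>S.S\<^esub> x [^]\<^bsub>S.S\<^esub> c v) \<otimes>\<^bsub>S.S\<^esub> x [^]\<^bsub>S.S\<^esub> c w"
      using wc[OF P(1)] wc[OF P(2)] xp by (simp only: S.S.m_assoc S.S.m_closed)
    also have "\<dots> = f v \<otimes>\<^bsub>S.S\<^esub> f w"
      unfolding f_def x_pow_comm[OF P(2), of "c v", symmetric]
      using wc[OF P(1)] wc[OF P(2)] xp by (simp only: S.S.m_assoc S.S.m_closed)
    finally show "f (v \<otimes>\<^bsub>vgrp n (Zvec n)\<^esub> w) = f v \<otimes>\<^bsub>S.S\<^esub> f w" by simp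
  qed (use fc in simp)
  have t_f: "t \<otimes>\<^bsub>S.S\<^esub> f v = f (A' *\<^sub>v v) \<otimes>\<^bsub>S.S\<^esub> t" if v: "v \<in> Zvec n" for v
  proof -
    note P = pr_P[OF v]
    have A'P: "A' *\<^sub>v pr v \<in> P" using W[OF P_Z[OF P] P_0[OF P]] a_P[OF P] by simp
    have uP: "of_int j \<cdot>\<^sub>v u \<in> P" for j by (rule vsub_int_smult[OF vsub_P u_P])
    have pr: "pr (A' *\<^sub>v v) = A' *\<^sub>v pr v + of_int (c v) \<cdot>\<^sub>v u"
    proof -
      have "A' *\<^sub>v v = v $ 0 \<cdot>\<^sub>v (A' *\<^sub>v e\<^sub>0) + A' *\<^sub>v pr v"
        using arg_cong[OF pr_split[OF Zvec_carrier[OF v]], of "\<lambda>z. A' *\<^sub>v z"] GLZ_D(2)[OF A'] P_c[OF P]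
        by (simp add: mult_add_distrib_mat_vec mult_mat_vec)
      also have "A' *\<^sub>v e\<^sub>0 = u + e\<^sub>0" unfolding e0 u_def mact_1[OF AQ]
        using GLZ_D(2)[OF A] by (intro eq_vecI) auto
      finally have "A' *\<^sub>v v = v $ 0 \<cdot>\<^sub>v (u + e\<^sub>0) + A' *\<^sub>v pr v" .
      then show ?thesis
        using fst'[OF Zvec_carrier[OF v]] c[OF v] P_c[OF u_P] P_c[OF A'P] P_0[OF u_P] P_0[OF A'P]
        unfolding pr_def[of "A' *\<^sub>v v"]
        by (intro eq_vecI) (auto simp: algebra_simps carrier_matD(1)[OF GLZ_D(2)[OF A']] 
            simp del: index_mult_mat_vec)
    qed
    have cA: "c (A' *\<^sub>v v) = c v" using fst'[OF Zvec_carrier[OF v]] by (simp add: c_def del: index_mult_mat_vec)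
    have "t \<otimes>\<^bsub>S.S\<^esub> f v = (t \<otimes>\<^bsub>S.S\<^esub> (pr v, 0)) \<otimes>\<^bsub>S.S\<^esub> x [^]\<^bsub>S.S\<^esub> c v"
      unfolding f_def using tc wc[OF P] xp by (simp only: S.S.m_assoc S.S.m_closed)
    also have "\<dots> = (A' *\<^sub>v pr v, 0) \<otimes>\<^bsub>S.S\<^esub> (t \<otimes>\<^bsub>S.S\<^esub> x [^]\<^bsub>S.S\<^esub> c v)"
      unfolding t_w[OF P] using tc wc[OF A'P] xp by (simp only: S.S.m_assoc S.S.m_closed)
    also have "\<dots> = ((A' *\<^sub>v pr v, 0) \<otimes>\<^bsub>S.S\<^esub> (of_int (c v) \<cdot>\<^sub>v u, 0)) \<otimes>\<^bsub>S.S\<^esub> x [^]\<^bsub>S.S\<^esub> c v \<otimes>\<^bsub>S.S\<^esub> t"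
      unfolding t_x_pow using tc wc[OF A'P] xp wc[OF uP] by (simp only: S.S.m_assoc S.S.m_closed)
    also have "\<dots> = f (A' *\<^sub>v v) \<otimes>\<^bsub>S.S\<^esub> t"
      unfolding w_mult[OF P_Z[OF uP]] f_def pr cA ..
    finally show ?thesis .
  qed
  define h where "h = (\<lambda>(v, k :: int). f v \<otimes>\<^bsub>S.S\<^esub> t [^]\<^bsub>S.S\<^esub> k)"
  have h_hom: "h \<in> hom S'.S S.S"
    unfolding h_def by (rule S'.hom_from[OF S.S.group_axioms f_hom tc t_f])
  interpret h: group_hom S'.S S.S h by unfold_locales (rule h_hom)
  have cx: "c (prod.fst (x [^]\<^bsub>S.S\<^esub> (j::int))) = j * l" "snd (x [^]\<^bsub>S.S\<^esub> (j::int)) = j * \<kappa>" for j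
    using c.hom_int_pow[OF xc, of j] d.hom_int_pow[OF xc, of j] v2(2) by (simp_all add: zgrp_int_pow x_def c_def)
  have ct: "c (prod.fst (t [^]\<^bsub>S.S\<^esub> (j::int))) = j * p" "snd (t [^]\<^bsub>S.S\<^esub> (j::int)) = j * q" for j
    using c.hom_int_pow[OF tc, of j] d.hom_int_pow[OF tc, of j] v1(2) by (simp_all add: zgrp_int_pow t_def c_def)
  have cf: "c (prod.fst (f v)) = c v * l" "snd (f v) = c v * \<kappa>" if v: "v \<in> Zvec n" for v
  proof -
    have "c (pr v) = 0" using P_0[OF pr_P[OF v]] by (simp add: c_def)
    then show "c (prod.fst (f v)) = c v * l" "snd (f v) = c v * \<kappa>"
      using c.hom_mult[OF wc[OF pr_P[OF v]] xp, of "c v"] d.hom_mult[OF wc[OF pr_P[OF v]] xp, of "c v"] cx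
      unfolding f_def by simp_all
  qed
  have ch: "c (prod.fst (h (v, k))) = c v * l + k * p" "snd (h (v, k)) = c v * \<kappa> + k * q"
    if v: "v \<in> Zvec n" for v k
    using c.hom_mult[OF fc[OF v] S.S.int_pow_closed[OF tc], of k]
      d.hom_mult[OF fc[OF v] S.S.int_pow_closed[OF tc], of k] cf[OF v] ct
    unfolding h_def by simp_all
  have f_P: "f w = (w, 0)" if w: "w \<in> P" for w
  proof -
    have "pr w = w" "c w = 0" using P_0[OF w] P_c[OF w] by (auto simp: pr_def c_def intro!: eq_vecI)
    then show ?thesis unfolding f_def using S.S.r_one[OF wc[OF w]] by simp
  qed
  have h_iso: "h \<in> iso S'.S S.S"
    unfolding h.iso_iff
  proof (intro conjI ballI impI)
    show "carrier S.S \<subseteq> h ` carrier S'.S"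
    proof
      fix g assume g: "g \<in> carrier S.S"
      \<comment> \<open>\<open>b\<close> and \<open>k\<close> solve the two linear equations for the
        coordinates of \<open>g\<close>, by the inverse of the matrix of determinant one.\<close>
      define b where "b = q * c (prod.fst g) - p * snd g"
      define k where "k = - \<kappa> * c (prod.fst g) + l * snd g"
      have 1: "b * l + k * p = (q * l - \<kappa> * p) * c (prod.fst g)" "b * \<kappa> + k * q = (q * l - \<kappa> * p) * snd g"
        unfolding b_def k_def by (simp_all add: algebra_simps)
      define y where "y = x [^]\<^bsub>S.S\<^esub> b \<otimes>\<^bsub>S.S\<^esub> t [^]\<^bsub>S.S\<^esub> k"
      have yc: "y \<in> carrier S.S" unfolding y_def using xc tc by (intro S.S.m_closed S.S.int_pow_closed)
      have cy: "c (prod.fst y) = c (prod.fst g)" "snd y = snd g"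
        using c.hom_mult[OF xp S.S.int_pow_closed[OF tc], of b k]
          d.hom_mult[OF xp S.S.int_pow_closed[OF tc], of b k] cx ct 1 det
        unfolding y_def by simp_all
      \<comment> \<open>Both coordinates of \<open>r\<close> vanish, so \<open>r\<close> lies in
        \<open>P\<close>, where \<open>h\<close> is the identity.\<close>
      define r where "r = g \<otimes>\<^bsub>S.S\<^esub> inv\<^bsub>S.S\<^esub> y"
      have rc: "r \<in> carrier S.S" unfolding r_def using g yc by (intro S.S.m_closed S.S.inv_closed)
      have gr: "g = r \<otimes>\<^bsub>S.S\<^esub> y" unfolding r_def using g yc S.S.m_assoc S.S.l_inv S.S.r_one S.S.inv_closed by metis
      have "c (prod.fst r) = 0" "snd r = 0"
        using c.hom_mult[OF rc yc] d.hom_mult[OF rc yc] cy unfolding gr[symmetric] by simp_all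
      then obtain w where w: "r = (w, 0)" "w \<in> Zvec n" "c w = 0" using rc by (cases r) auto
      then have wP: "w \<in> P" using c[OF w(2)] by (simp add: P_def)
      let ?s = "of_int b \<cdot>\<^sub>v e\<^sub>0"
      have s: "?s \<in> Zvec n" "c ?s = b" "pr ?s = 0\<^sub>v n"
        using vsub_int_smult[OF vsub_Zvec e0_Z(1)] n by (auto simp: c_def pr_def)
      have "f ?s = x [^]\<^bsub>S.S\<^esub> b" unfolding f_def s(2,3) using S.S.l_one[OF xp, of b] by simp
      then have "h (w + ?s, k) = (w, 0) \<otimes>\<^bsub>S.S\<^esub> x [^]\<^bsub>S.S\<^esub> b \<otimes>\<^bsub>S.S\<^esub> t [^]\<^bsub>S.S\<^esub> k"
        using hom_mult[OF f_hom, of w ?s] w(2) s(1) f_P[OF wP] unfolding h_def by simp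
      also have "\<dots> = g" unfolding gr y_def w(1)
        using S.S.m_assoc[OF wc[OF wP] xp S.S.int_pow_closed[OF tc]] .
      finally show "g \<in> h ` carrier S'.S"
        using vsubD(3)[OF vsub_Zvec w(2) s(1)] by (intro rev_image_eqI[of "(w + ?s, k)"]) auto
    qed
  next
    fix g assume "g \<in> carrier S'.S" and h1: "h g = \<one>\<^bsub>S.S\<^esub>"
    then obtain v k where g: "g = (v, k)" and v: "v \<in> Zvec n" by auto
    have 0: "c v * l + k * p = 0" "c v * \<kappa> + k * q = 0" using ch[OF v, of k] h1 n by (auto simp: g c_def)
    \<comment> \<open>The same inverse matrix recovers \<open>c v\<close> and \<open>k\<close> from
      the two coordinates, which vanish here.\<close>
    have 1: "c v = q * (c v * l + k * p) - p * (c v * \<kappa> + k * q)" "k = l * (c v * \<kappa> + k * q) - \<kappa> * (c v * l + k * p)"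
    proof -
      have "q * (c v * l + k * p) - p * (c v * \<kappa> + k * q) = (q * l - \<kappa> * p) * c v" 
        "l * (c v * \<kappa> + k * q) - \<kappa> * (c v * l + k * p) = (q * l - \<kappa> * p) * k"
        by (simp_all add: algebra_simps)
      then show "c v = q * (c v * l + k * p) - p * (c v * \<kappa> + k * q)" "k = l * (c v * \<kappa> + k * q) - \<kappa> * (c v * l + k * p)"
        using det by simp_all
    qed
    have z: "c v = 0" "k = 0" using 1 unfolding 0 by simp_all
    then have vP: "v \<in> P" using c[OF v] v by (simp add: P_def)
    have "h g = (v, 0)" unfolding g h_def z using f_P[OF vP] S.S.r_one[OF wc[OF vP]] by simp
    then show "g = \<one>\<^bsub>S'.S\<^esub>" using h1 g z by simp
  qed
  show ?thesis
  proof (intro bexI[OF _ h_iso] conjI ballI)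
    have "(0\<^sub>v n :: rat vec) \<in> P" using vsubD(2)[OF vsub_P] .
    then show "h (0\<^sub>v n, 1) = (v\<^sub>1, q)"
      unfolding h_def using f_P S.S.l_one[OF tc] S.S.int_pow_1[OF tc] by (simp add: t_def)
    fix v assume v: "v \<in> Zvec n"
    have "h (v, 0) = f v" unfolding h_def using S.S.r_one[OF fc[OF v]] by simp
    then show "\<exists>w\<in>Zvec n. h (v, 0) = (w, \<kappa> * c v) \<and> c w = l * c v"
      using cf[OF v] fc[OF v] by (intro bexI[of _ "prod.fst (f v)"]) (auto simp: mult.commute prod_eq_iff)
  qed
qed

end

lemma GLZ_int_pow:
  assumes C: "C \<in> GLZ k"
  shows "C [^]\<^bsub>GLQ k\<^esub> (j::int) \<in> GLZ k"
proof -
  interpret S: sdp_data k C "Zvec k" by (rule sdp_data_Zvec[OF C])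
  show ?thesis
  proof (rule GLZ_I)
    show "C [^]\<^bsub>GLQ k\<^esub> j \<in> carrier (GLQ k)" by (rule GLQ_int_pow[OF S.A])
    fix v assume v: "v \<in> Zvec k"
    show "C [^]\<^bsub>GLQ k\<^esub> j *\<^sub>v v \<in> Zvec k" using S.AU[OF v, of j] by (simp add: mact_def)
    have "inv\<^bsub>GLQ k\<^esub> (C [^]\<^bsub>GLQ k\<^esub> j) = C [^]\<^bsub>GLQ k\<^esub> (- j)"
      using group.int_pow_neg[OF group_GLQ S.A, of j] by simp
    then show "inv\<^bsub>GLQ k\<^esub> (C [^]\<^bsub>GLQ k\<^esub> j) *\<^sub>v v \<in> Zvec k" using S.AU[OF v, of "- j"] by (simp add: mact_def)
  qed
qed

lemma lower_block_twist:
  assumes u: "u \<in> Zvec k" and C: "C \<in> GLZ k"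
    and \<kappa>: "\<And>w. w \<in> Zvec k \<Longrightarrow> mact k C \<kappa> w = w"
    and det: "q * l - \<kappa> * p = 1" and v1: "v\<^sub>1 \<in> Zvec (Suc k)" "v\<^sub>1 $ 0 = of_int p"
  shows "twist (Suc k) (lower_block (Suc k) u C) (lower_block (Suc k) u (C [^]\<^bsub>GLQ k\<^esub> q)) q \<kappa> l p v\<^sub>1"
proof -
  let ?D = "C [^]\<^bsub>GLQ k\<^esub> q"
  have D: "?D \<in> GLZ k" by (rule GLZ_int_pow[OF C])
  note Cd = GLZ_D[OF C] and Dd = GLZ_D[OF D] and uc = Zvec_carrier[OF u]
  have fst: "(lower_block (Suc k) u E *\<^sub>v v) $ 0 = v $ 0"
    if v: "v \<in> carrier_vec (Suc k)" and E: "E \<in> carrier_mat k k" for v E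
  proof -
    obtain w where w: "w \<in> carrier_vec k" "v = vcons (v $ 0) w" using vcons_cases[OF v] .
    show ?thesis using lower_block_mult[OF uc E w(1), of "v $ 0"] unfolding w(2)[symmetric] by simp
  qed
  have e: "unit_vec (Suc k) 0 = vcons 1 (0\<^sub>v k)"
    by (intro vec_Suc_eqI[of _ k]) auto
  have z: "0 \<cdot>\<^sub>v u + v = v" if "v \<in> carrier_vec k" for v using that uc by (intro eq_vecI) auto
  show ?thesis
  proof
    show "lower_block (Suc k) u C \<in> GLZ (Suc k)" "lower_block (Suc k) u ?D \<in> GLZ (Suc k)"
      using lower_block_GLZ[OF u] C D by auto
    have "C *\<^sub>v 0\<^sub>v k = ?D *\<^sub>v 0\<^sub>v k" using Cd(2) Dd(2) by (intro eq_vecI) auto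
    then show "lower_block (Suc k) u ?D *\<^sub>v unit_vec (Suc k) 0 = lower_block (Suc k) u C *\<^sub>v unit_vec (Suc k) 0"
      unfolding e using lower_block_mult[OF uc Cd(2), of "0\<^sub>v k" 1] lower_block_mult[OF uc Dd(2), of "0\<^sub>v k" 1] by simp
    fix w assume w: "w \<in> Zvec (Suc k)" "w $ 0 = 0"
    obtain y where y: "y \<in> carrier_vec k" "w = vcons 0 y"
      using vcons_cases[OF Zvec_carrier[OF w(1)]] w(2) by metis
    have yZ: "y \<in> Zvec k" using w(1) y vcons_Zvec[OF y(1), of 0] by simp
    show "lower_block (Suc k) u ?D *\<^sub>v w = mact (Suc k) (lower_block (Suc k) u C) q w"
      unfolding y(2) mact_lower_block[OF uc Cd(1) y(1)]
      using lower_block_mult[OF uc Dd(2) y(1), of 0] z[of "?D *\<^sub>v y"] Dd(2) by (simp add: mact_def)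
    show "mact (Suc k) (lower_block (Suc k) u C) \<kappa> w = w"
      unfolding y(2) mact_lower_block[OF uc Cd(1) y(1)] \<kappa>[OF yZ] ..
  qed (use fst Cd Dd det v1 in auto)
qed

lemma GLZ_lm_data: "A \<in> GLZ n \<Longrightarrow> lm_data n A (Zvec n)"
proof
  fix w :: "rat vec" assume "w \<in> Zvec n"
  then show "\<exists>m::nat. m \<ge> 1 \<and> of_nat m \<cdot>\<^sub>v w \<in> Zvec n" by (intro exI[of _ 1]) simp
qed (use GLZ_D vsub_Zvec in auto)

lemma GLZ_lat: 
  assumes A: "A \<in> GLZ n"
  shows "lat n A = Zvec n"
proof -
  interpret S: sdp_data n A "Zvec n" by (rule sdp_data_Zvec[OF A])
  show ?thesis using S.AU Zvec_lat[OF S.A] by (auto simp: lat_iff)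
qed

lemma GLZ_sdp_iso: "A \<in> GLZ n \<Longrightarrow> lm_group n A (Zvec n) \<cong> sdp n A (Zvec n)"
  using lm_data.Zvec_sdp_iso[OF GLZ_lm_data refl] GLZ_lat by simp

lemma GLZ_conj: "P \<in> GLZ n \<Longrightarrow> A \<in> GLZ n \<Longrightarrow> P * A * inv\<^bsub>GLQ n\<^esub> P \<in> GLZ n"
  by (intro GLZ_mult GLZ_inv)

lemma GLZ_conj_iso:
  assumes "P \<in> GLZ n" "A \<in> GLZ n" "N = P * A * inv\<^bsub>GLQ n\<^esub> P"
  shows "lm_group n A (Zvec n) \<cong> lm_group n N (Zvec n)"
proof -
  interpret D: lm_data n A "Zvec n" by (rule GLZ_lm_data[OF assms(2)])
  have "mat_image P (Zvec n) = Zvec n" using assms(1) GLZ_iff by blast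
  then show ?thesis using D.conj_iso[OF GLZ_lm_data assms(1,3)] GLZ_conj[OF assms(1,2)] assms(3) by simp
qed

lemma finite_order_iso:
  assumes A: "A \<in> GLZ (Suc k)" "A' \<in> GLZ (Suc k)"
    and C: "C \<in> GLZ k" and m: "m = group.ord (GLQ k) C" "m > 0" and u: "u \<in> Zvec k"
    and q: "gcd q (int m) = 1"
    and cj: "conjugate_GLZ (Suc k) A (lower_block (Suc k) u C)"
      "conjugate_GLZ (Suc k) A' (lower_block (Suc k) u (C [^]\<^bsub>GLQ k\<^esub> q))"
  shows "lm_group (Suc k) A (Zvec (Suc k)) \<cong> lm_group (Suc k) A' (Zvec (Suc k))"
proof -
  let ?n = "Suc k" and ?M = "lower_block (Suc k) u C" and ?N = "lower_block (Suc k) u (C [^]\<^bsub>GLQ k\<^esub> q)"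
  note Cd = GLZ_D[OF C]
  have "C [^]\<^bsub>GLQ k\<^esub> m = \<one>\<^bsub>GLQ k\<^esub>" unfolding m(1) by (rule group.pow_ord_eq_1[OF group_GLQ Cd(1)])
  then have "C [^]\<^bsub>GLQ k\<^esub> int m = 1\<^sub>m k" by (simp add: int_pow_int)
  then have \<kappa>: "mact k C (int m) w = w" if "w \<in> Zvec k" for w
    using Zvec_carrier[OF that] by (simp add: mact_def)
  obtain x y where xy: "x * q + y * int m = 1" using bezout_int[of q "int m"] q by auto
  \<comment> \<open>Bezout supplies the parameters: \<open>\<kappa> = m\<close>,
    \<open>l = x\<close> and \<open>p = - y\<close> satisfy \<open>q l - \<kappa> p = 1\<close>, and
    \<open>?v\<close> is a vector with first coordinate \<open>p\<close>.\<close>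
  let ?v = "of_int (- y) \<cdot>\<^sub>v unit_vec (Suc k) 0 :: rat vec"
  interpret twist ?n ?M ?N q "int m" x "- y" ?v
    using xy vsub_int_smult[OF vsub_Zvec unit_vec_Zvec, of "- y" ?n 0]
    by (intro lower_block_twist[OF u C \<kappa>]) (auto simp: mult.commute)
  obtain h where "h \<in> iso S'.S S.S" using twist_iso by (rule bexE)
  then have 1: "S'.S \<cong> S.S" by (rule is_isoI)
  obtain P where P: "P \<in> GLZ ?n" "?M = P * A * inv\<^bsub>GLQ ?n\<^esub> P" using cj(1) by (auto simp: conjugate_GLZ_def)
  obtain P' where P': "P' \<in> GLZ ?n" "?N = P' * A' * inv\<^bsub>GLQ ?n\<^esub> P'" using cj(2) by (auto simp: conjugate_GLZ_def)
  have a: "lm_group ?n A (Zvec ?n) \<cong> S.S"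
    by (rule iso_trans[OF GLZ_conj_iso[OF P(1) assms(1) P(2)] GLZ_sdp_iso[OF lower_block_GLZ[OF u C]]])
  have b: "lm_group ?n A' (Zvec ?n) \<cong> S'.S"
    by (rule iso_trans[OF GLZ_conj_iso[OF P'(1) assms(2) P'(2)] GLZ_sdp_iso[OF lower_block_GLZ[OF u GLZ_int_pow[OF C]]]])
  have "S.S \<cong> S'.S" using group.iso_sym[OF S'.S.group_axioms 1] .
  moreover have "S'.S \<cong> lm_group ?n A' (Zvec ?n)" using group.iso_sym[OF group_lm_group b] .
  ultimately have "S.S \<cong> lm_group ?n A' (Zvec ?n)" by (rule iso_trans)
  with a show ?thesis by (rule iso_trans)
qed

section \<open>Isomorphisms between ascending groups\<close>

text \<open>An additive map commutes with multiplication by natural numbers, so clearing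
  denominators reduces its values on \<open>U\<close> to those on Z^n.\<close>

lemma vgrp_hom_matrix:
  assumes U: "vsub n U" "Zvec n \<subseteq> U" and V: "vsub m V" and f: "f \<in> hom (vgrp n U) (vgrp m V)"
  obtains B where "B \<in> carrier_mat m n" "\<And>u. u \<in> U \<Longrightarrow> f u = B *\<^sub>v u"
proof -
  have "f \<in> hom (vgrp n (Zvec n)) (vgrp m V)" using f U(2) by (auto simp: hom_def)
  then obtain B where B: "B \<in> carrier_mat m n" "\<And>v. v \<in> Zvec n \<Longrightarrow> f v = B *\<^sub>v v"
    using Zvec_hom_matrix[OF V] by blast
  interpret f: group_hom "vgrp n U" "vgrp m V" f
    using f U V group_vgrp by (simp add: group_hom_def group_hom_axioms_def)
  have "f u = B *\<^sub>v u" if u: "u \<in> U" for u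
  proof -
    have uc: "u \<in> carrier_vec n" by (rule vsubD(1)[OF U(1) u])
    obtain k where k: "k \<ge> 1" "of_nat k \<cdot>\<^sub>v u \<in> Zvec n" using ex_int_multiple[OF uc] by blast
    have fu: "f u \<in> V" using f.hom_closed u by simp
    have "of_nat k \<cdot>\<^sub>v f u = f (of_nat k \<cdot>\<^sub>v u)"
      using f.hom_nat_pow[of u k] u fu nat_pow_vgrp[OF U(1) u, of k] nat_pow_vgrp[OF V fu, of k] by simp
    also have "\<dots> = B *\<^sub>v (of_nat k \<cdot>\<^sub>v u)" by (rule B(2)[OF k(2)])
    also have "\<dots> = of_nat k \<cdot>\<^sub>v (B *\<^sub>v u)" using B(1) uc by (simp add: mult_mat_vec)
    finally show ?thesis
      using smult_cancel[of "of_nat k" "f u" "B *\<^sub>v u" m] k(1) vsubD(1)[OF V fu] B(1) by simp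
  qed
  then show ?thesis using that B(1) by blast
qed

text \<open>\<open>b\<close> and its inverse are both given by matrices, and these are mutually
  inverse since they are so on unit vectors; the trace argument then gives
  \<open>n = n'\<close>.\<close>

lemma vgrp_iso_matrix:
  assumes U: "vsub n U" "Zvec n \<subseteq> U" and U': "vsub n' U'" "Zvec n' \<subseteq> U'"
    and iso: "b \<in> iso (vgrp n U) (vgrp n' U')"
  shows "n = n' \<and> (\<exists>B\<in>carrier (GLQ n). mat_image B U = U' \<and> (\<forall>u\<in>U. b u = B *\<^sub>v u))"
proof -
  have b_hom: "b \<in> hom (vgrp n U) (vgrp n' U')" and b_bij: "bij_betw b U U'"
    using iso by (auto simp: iso_def)
  have b: "b u \<in> U'" if "u \<in> U" for u using b_bij that by (auto simp: bij_betw_def)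
  have b_add: "b (u + w) = b u + b w" if "u \<in> U" "w \<in> U" for u w
    using b_hom that by (auto simp: hom_def)
  obtain B where B: "B \<in> carrier_mat n' n" "\<And>u. u \<in> U \<Longrightarrow> b u = B *\<^sub>v u"
    using vgrp_hom_matrix[OF U U'(1) b_hom] by blast
  let ?g = "inv_into U b"
  have g: "?g u' \<in> U" "b (?g u') = u'" if "u' \<in> U'" for u'
    using b_bij that unfolding bij_betw_def by (auto intro: inv_into_into f_inv_into_f)
  have gb: "?g (b u) = u" if "u \<in> U" for u
    using b_bij that by (simp add: bij_betw_def)
  have g_hom: "?g \<in> hom (vgrp n' U') (vgrp n U)"
  proof (rule homI)
    fix u w assume "u \<in> carrier (vgrp n' U')" "w \<in> carrier (vgrp n' U')"
    then have uw: "u \<in> U'" "w \<in> U'" by auto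
    have "?g (u + w) = ?g (b (?g u + ?g w))" using b_add[OF g(1)[OF uw(1)] g(1)[OF uw(2)]] g uw by simp
    also have "\<dots> = ?g u + ?g w" using g uw vsubD(3)[OF U(1)] by (intro gb) auto
    finally show "?g (u \<otimes>\<^bsub>vgrp n' U'\<^esub> w) = ?g u \<otimes>\<^bsub>vgrp n U\<^esub> ?g w" by simp
  qed (use g in auto)
  obtain D where D: "D \<in> carrier_mat n n'" "\<And>u. u \<in> U' \<Longrightarrow> ?g u = D *\<^sub>v u"
    using vgrp_hom_matrix[OF U' U(1) g_hom] by blast
  have uU: "unit_vec n j \<in> U" "unit_vec n' j \<in> U'" for j using U(2) U'(2) by auto
  have BD: "B * D = 1\<^sub>m n'"
  proof (rule mat_eq_by_unit_vecs)
    fix j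
    have "B *\<^sub>v (D *\<^sub>v unit_vec n' j) = unit_vec n' j" using g[OF uU(2)] B(2)[OF g(1)[OF uU(2)]] D(2)[OF uU(2)] by simp
    then show "B * D *\<^sub>v unit_vec n' j = 1\<^sub>m n' *\<^sub>v unit_vec n' j" using B D by (simp add: assoc_mult_mat_vec[of _ n' n])
  qed (use B D in auto)
  have DB: "D * B = 1\<^sub>m n"
  proof (rule mat_eq_by_unit_vecs)
    fix j
    have "D *\<^sub>v (B *\<^sub>v unit_vec n j) = unit_vec n j" using gb[OF uU(1)] B(2)[OF uU(1)] D(2)[OF b[OF uU(1)]] by simp
    then show "D * B *\<^sub>v unit_vec n j = 1\<^sub>m n *\<^sub>v unit_vec n j" using B D by (simp add: assoc_mult_mat_vec[of _ n n'])
  qed (use B D in auto)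
  have nn: "n = n'" using mutually_inverse_dims[OF B(1) D(1) BD DB] by simp
  have BG: "B \<in> carrier (GLQ n)" using GLQ_I[of B n D] B D BD DB nn by simp
  have BU: "mat_image B U = U'"
    using b_bij B(2) unfolding mat_image_def bij_betw_def by (metis image_cong)
  show ?thesis using nn BG BU B(2) by blast
qed

lemma GLQ_conj_eqI:
  assumes B: "B \<in> carrier (GLQ n)" and A: "A \<in> carrier (GLQ n)" "A' \<in> carrier (GLQ n)"
    and eq: "A' * B = B * A"
  shows "A' = B * A * inv\<^bsub>GLQ n\<^esub> B"
proof -
  note c = GLQ_carrier_mat[OF B] GLQ_carrier_mat[OF A(2)] GLQ_inv[OF B]
  have "B * A * inv\<^bsub>GLQ n\<^esub> B = A' * (B * inv\<^bsub>GLQ n\<^esub> B)"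
    unfolding eq[symmetric] using c by (intro assoc_mult_mat) auto
  then show ?thesis using c right_mult_one_mat[OF c(2)] by simp
qed

lemma sdp_snd_pow:
  assumes "sdp_data n A U" "sdp_data n' A' U'" and \<phi>: "\<phi> \<in> hom (sdp n A U) (sdp n' A' U')" and v: "v \<in> U"
  shows "snd (\<phi> (v, k)) = snd (\<phi> (v, 0)) + k * snd (\<phi> (0\<^sub>v n, 1))"
proof -
  interpret S: sdp_data n A U by fact
  interpret S': sdp_data n' A' U' by fact
  interpret \<phi>: group_hom S.S S'.S \<phi> by unfold_locales (rule \<phi>)
  interpret d: group_hom S'.S zgrp snd
    by (intro group_hom.intro group_hom_axioms.intro S'.S.group_axioms group_zgrp) (auto simp: hom_def)
  have t: "(0\<^sub>v n, 1) \<in> carrier S.S" "(v, 0) \<in> carrier S.S" "(0\<^sub>v n, k) \<in> carrier S.S"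
    using vsubD(2)[OF S.U] v by auto
  have "(v, k) = (v, 0) \<otimes>\<^bsub>S.S\<^esub> (0\<^sub>v n, 1) [^]\<^bsub>S.S\<^esub> k"
    unfolding S.pow_t using S.Uc[OF v] by (simp add: mact_0[OF S.A])
  then have "\<phi> (v, k) = \<phi> (v, 0) \<otimes>\<^bsub>S'.S\<^esub> \<phi> (0\<^sub>v n, 1) [^]\<^bsub>S'.S\<^esub> k"
    using \<phi>.hom_mult[OF t(2) S.S.int_pow_closed[OF t(1)], of k] \<phi>.hom_int_pow[OF t(1), of k] by simp
  then show ?thesis
    using d.hom_mult[OF \<phi>.hom_closed[OF t(2)] S'.S.int_pow_closed[OF \<phi>.hom_closed[OF t(1)]], of k]
      d.hom_int_pow[OF \<phi>.hom_closed[OF t(1)], of k] by (simp add: zgrp_int_pow)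
qed

text \<open>At first \<open>U\<close> is only mapped into \<open>U'\<close>. All exponents in the
  image are multiples of that of the image of the stable letter, so surjectivity makes the latter
  \<open>1\<close> or \<open>- 1\<close>, which in turn forces \<open>U\<close> onto
  \<open>U'\<close>. The linear map \<open>B\<close> so obtained intertwines conjugation by the
  stable letter with conjugation by its image.\<close>

lemma sdp_iso_fibre_preserving:
  assumes "sdp_data n A U" "sdp_data n' A' U'" and ZU: "Zvec n \<subseteq> U" "Zvec n' \<subseteq> U'"
    and \<phi>: "\<phi> \<in> iso (sdp n A U) (sdp n' A' U')"
    and fib: "\<And>u. u \<in> U \<Longrightarrow> snd (\<phi> (u, 0)) = 0"
  obtains B where "n = n'" "B \<in> carrier (GLQ n)" "mat_image B U = U'"
    "snd (\<phi> (0\<^sub>v n, 1)) \<in> {1, -1}"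
    "A' = B * (A [^]\<^bsub>GLQ n\<^esub> snd (\<phi> (0\<^sub>v n, 1))) * inv\<^bsub>GLQ n\<^esub> B"
proof -
  interpret S: sdp_data n A U by fact
  interpret S': sdp_data n' A' U' by fact
  have hom: "\<phi> \<in> hom S.S S'.S" and bij: "bij_betw \<phi> (carrier S.S) (carrier S'.S)"
    using \<phi> by (auto simp: iso_def)
  interpret \<phi>: group_hom S.S S'.S \<phi> by unfold_locales (rule hom)
  let ?e = "snd (\<phi> (0\<^sub>v n, 1))"
  have s: "snd (\<phi> (v, k)) = k * ?e" if "v \<in> U" for v k
    using sdp_snd_pow[OF S.sdp_data_axioms S'.sdp_data_axioms hom that, of k] fib[OF that] by simp
  have sur: "\<exists>v\<in>U. \<exists>k. \<phi> (v, k) = g" if "g \<in> carrier S'.S" for g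
  proof -
    have "g \<in> \<phi> ` carrier S.S" using bij that by (simp add: bij_betw_def)
    then show ?thesis by (auto simp: image_iff)
  qed
  have e: "?e \<in> {1, -1}"
  proof -
    have "(0\<^sub>v n', 1) \<in> carrier S'.S" using vsubD(2)[OF S'.U] by simp
    from sur[OF this] obtain v k where "v \<in> U" "\<phi> (v, k) = (0\<^sub>v n', 1)" by blast
    then have "k * ?e = 1" using s[of v k] by simp
    then show ?thesis using zmult_eq_1_iff by auto
  qed
  define b where "b u = fst (\<phi> (u, 0))" for u
  have b: "\<phi> (u, 0) = (b u, 0)" "b u \<in> U'" if "u \<in> U" for u
    using fib[OF that] \<phi>.hom_closed[of "(u, 0)"] that by (auto simp: b_def prod_eq_iff)
  have b_add: "b (u + w) = b u + b w" if "u \<in> U" "w \<in> U" for u w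
    using \<phi>.hom_mult[of "(u, 0)" "(w, 0)"] that vsubD(3)[OF S.U that] b[of u] b[of w] b[of "u + w"]
    by (simp add: mact_0[OF S.A] mact_0[OF S'.A])
  have b_bij: "bij_betw b U U'"
    unfolding bij_betw_def
  proof
    show "inj_on b U"
    proof (rule inj_onI)
      fix u w assume uw: "u \<in> U" "w \<in> U" "b u = b w"
      then have "\<phi> (u, 0) = \<phi> (w, 0)" using b by simp
      then show "u = w" using bij uw unfolding bij_betw_def by (auto dest: inj_onD)
    qed
    show "b ` U = U'"
    proof
      show "b ` U \<subseteq> U'" using b by auto
      show "U' \<subseteq> b ` U"
      proof
        fix u' assume "u' \<in> U'"
        then obtain v k where v: "v \<in> U" "\<phi> (v, k) = (u', 0)" using sur[of "(u', 0)"] by auto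
        then have "k = 0" using s[of v k] e by auto
        then show "u' \<in> b ` U" using v b[of v] by (intro rev_image_eqI[of v]) auto
      qed
    qed
  qed
  have b_hom: "b \<in> hom (vgrp n U) (vgrp n' U')" using b b_add by (auto simp: hom_def)
  have "b \<in> iso (vgrp n U) (vgrp n' U')" using b_hom b_bij by (simp add: iso_def)
  then obtain B where nn: "n = n'" and BG: "B \<in> carrier (GLQ n)" and BU: "mat_image B U = U'"
    and Bb: "\<And>u. u \<in> U \<Longrightarrow> b u = B *\<^sub>v u"
    using vgrp_iso_matrix[OF S.U ZU(1) S'.U ZU(2)] by blast
  have uU: "unit_vec n j \<in> U" for j using ZU by auto
  have "mact n' A' ?e (B *\<^sub>v u) = B *\<^sub>v (A *\<^sub>v u)" if u: "u \<in> U" for u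
  proof -
    have t: "(0\<^sub>v n, 1) \<in> carrier S.S" "(u, 0) \<in> carrier S.S" using vsubD(2)[OF S.U] u by auto
    have Au: "A *\<^sub>v u \<in> U" using S.AU[OF u, of 1] by (simp add: mact_1[OF S.A])
    define c where "c = fst (\<phi> (0\<^sub>v n, 1))"
    have c: "c \<in> U'" using \<phi>.hom_closed[OF t(1)] by (auto simp: c_def mem_Times_iff)
    have "\<phi> ((0\<^sub>v n, 1) \<otimes>\<^bsub>S.S\<^esub> (u, 0)) = \<phi> ((A *\<^sub>v u, 0) \<otimes>\<^bsub>S.S\<^esub> (0\<^sub>v n, 1))" using S.t_embed[OF u] by simp
    then have "\<phi> (0\<^sub>v n, 1) \<otimes>\<^bsub>S'.S\<^esub> \<phi> (u, 0) = \<phi> (A *\<^sub>v u, 0) \<otimes>\<^bsub>S'.S\<^esub> \<phi> (0\<^sub>v n, 1)"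
      using \<phi>.hom_mult[OF t] \<phi>.hom_mult[of "(A *\<^sub>v u, 0)" "(0\<^sub>v n, 1)"] t Au by simp
    \<comment> \<open>The translation part \<open>c\<close> of the image of the stable letter drops
      out because \<open>U'\<close> is commutative.\<close>
    then have eq: "c + mact n' A' ?e (b u) = b (A *\<^sub>v u) + c"
      using c by (simp add: b(1)[OF u] b(1)[OF Au] c_def mact_0[OF S'.A])
    note k = S'.Uc[OF c] S'.Uc[OF b(2)[OF Au]] mact_closed[OF S'.A, of ?e "b u"]
    have "mact n' A' ?e (b u) = b (A *\<^sub>v u)"
    proof (rule eq_vecI)
      fix i assume "i < dim_vec (b (A *\<^sub>v u))"
      then show "mact n' A' ?e (b u) $ i = b (A *\<^sub>v u) $ i" using arg_cong[OF eq, of "\<lambda>z. z $ i"] k by simp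
    qed (use k in simp)
    then show ?thesis using Bb[OF u] Bb[OF Au] by simp
  qed note eqv = this
  have "A' [^]\<^bsub>GLQ n\<^esub> ?e * B = B * A"
  proof (rule mat_eq_by_unit_vecs)
    note Ae = GLQ_int_pow(2)[OF S'.A[folded nn], of ?e] and Bc = GLQ_carrier_mat[OF BG] and Ac = GLQ_carrier_mat[OF S.A]
    show "A' [^]\<^bsub>GLQ n\<^esub> ?e * B \<in> carrier_mat n n" "B * A \<in> carrier_mat n n" using Ae Bc Ac by auto
    fix j
    show "A' [^]\<^bsub>GLQ n\<^esub> ?e * B *\<^sub>v unit_vec n j = B * A *\<^sub>v unit_vec n j"
      using eqv[OF uU] assoc_mult_mat_vec[OF Ae Bc] assoc_mult_mat_vec[OF Bc Ac] by (simp add: mact_def nn)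
  qed
  from GLQ_conj_eqI[OF BG S.A GLQ_int_pow(1)[OF S'.A[folded nn]] this]
  have cj: "A' [^]\<^bsub>GLQ n\<^esub> ?e = B * A * inv\<^bsub>GLQ n\<^esub> B" .
  have "A' = B * (A [^]\<^bsub>GLQ n\<^esub> ?e) * inv\<^bsub>GLQ n\<^esub> B"
  proof (cases "?e = 1")
    case True
    then show ?thesis using cj GLQ_int_pow_1 S.A S'.A[folded nn] by simp
  next
    case False
    then have e1: "?e = - 1" using e by auto
    note A'n = S'.A[folded nn] and Bi = GLQ_inv(1)[OF BG]
    have "A' = inv\<^bsub>GLQ n\<^esub> (B * A * inv\<^bsub>GLQ n\<^esub> B)"
      using cj GLQ_int_pow_neg1[OF A'n] GLQ_inv_inv[OF A'n] unfolding e1 by simp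
    also have "\<dots> = B * (inv\<^bsub>GLQ n\<^esub> A * inv\<^bsub>GLQ n\<^esub> B)"
      using GLQ_inv_mult[OF GLQ_mult[OF BG S.A] Bi] GLQ_inv_mult[OF BG S.A] GLQ_inv_inv[OF BG] by simp
    also have "\<dots> = B * inv\<^bsub>GLQ n\<^esub> A * inv\<^bsub>GLQ n\<^esub> B"
      using assoc_mult_mat[OF GLQ_carrier_mat[OF BG] GLQ_inv(2)[OF S.A] GLQ_inv(2)[OF BG]] by simp
    finally show ?thesis unfolding e1 GLQ_int_pow_neg1[OF S.A] .
  qed
  then show ?thesis using that nn BG BU e by blast
qed

lemma mact_nonpos_Zvec:
  assumes A: "A \<in> carrier (GLQ n)" and AZ: "\<And>v. v \<in> Zvec n \<Longrightarrow> inv\<^bsub>GLQ n\<^esub> A *\<^sub>v v \<in> Zvec n"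
    and v: "v \<in> Zvec n" and k: "k \<le> 0"
  shows "mact n A k v \<in> Zvec n"
  using mact_nonneg_Zvec[OF GLQ_inv(1)[OF A] AZ v, of "- k"] k by (simp add: mact_inv[OF A])

text \<open>If the inverse preserves the fibre, it sends the stable letter to an element of exponent
  \<open>1\<close> or \<open>- 1\<close>; so \<open>(v, k)\<close> can have a preimage of exponent
  zero only for \<open>k = 0\<close>. Contrapositively, if one direction moves the fibre, so does
  the other.\<close>

lemma sdp_iso_fibre_sym:
  assumes S: "sdp_data n A U" and S': "sdp_data n' A' U'" and Z: "Zvec n \<subseteq> U" "Zvec n' \<subseteq> U'"
    and \<phi>: "\<phi> \<in> iso (sdp n A U) (sdp n' A' U')"
    and fib: "\<And>u. u \<in> U' \<Longrightarrow> snd (inv_into (carrier (sdp n A U)) \<phi> (u, 0)) = 0" and u: "u \<in> U"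
  shows "snd (\<phi> (u, 0)) = 0"
proof -
  interpret S: sdp_data n A U by fact
  interpret S': sdp_data n' A' U' by fact
  let ?\<psi> = "inv_into (carrier S.S) \<phi>"
  have \<psi>: "?\<psi> \<in> iso S'.S S.S" by (rule S.S.iso_set_sym[OF \<phi>])
  have e: "snd (?\<psi> (0\<^sub>v n', 1)) \<in> {1, -1}"
    by (rule sdp_iso_fibre_preserving[OF S' S Z(2,1) \<psi> fib])
  have bij: "bij_betw \<phi> (carrier S.S) (carrier S'.S)" using \<phi> by (simp add: iso_def)
  have uc: "(u, 0) \<in> carrier S.S" using u by simp
  obtain v k where vk: "\<phi> (u, 0) = (v, k)" by fastforce
  have v: "v \<in> U'" using bij_betwE[OF bij] uc vk by fastforce
  have "?\<psi> (v, k) = (u, 0)" using bij_betw_inv_into_left[OF bij uc] vk by simp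
  moreover have "?\<psi> \<in> hom S'.S S.S" using \<psi> by (simp add: iso_def)
  ultimately have "0 = k * snd (?\<psi> (0\<^sub>v n', 1))" using sdp_snd_pow[OF S' S _ v, of ?\<psi> k] fib[OF v] by simp
  then show ?thesis using e vk by auto
qed

text \<open>Some \<open>(c, 0)\<close> has a preimage \<open>(y, j)\<close> with
  \<open>j \<noteq> 0\<close>. Since \<open>U'\<close> is commutative, \<open>(y, j)\<close>
  commutes with the kernel of the exponent form \<open>f\<close>, so \<open>A\<^sup>j\<close> fixes
  this kernel. As \<open>f\<close> is invariant under \<open>A\<close>, the kernel contains all
  \<open>A u - u\<close>. The resulting equation \<open>A\<^sup>j(A u - u) = A u - u\<close>
  expresses the inverse of \<open>A\<close> by nonnegative powers of \<open>A\<close>, or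
  \<open>A\<close> by nonpositive ones.\<close>

lemma fibre_moving_GLZ:
  assumes A: "A \<in> carrier (GLQ n)" and asc: "ascending n A"
    and S': "sdp_data n' A' U'" "Zvec n' \<subseteq> U'"
    and \<phi>: "\<phi> \<in> iso (sdp n A (lat n A)) (sdp n' A' U')"
    and mv: "\<exists>u\<in>lat n A. snd (\<phi> (u, 0)) \<noteq> 0"
  shows "A \<in> GLZ n"
proof -
  interpret S: sdp_data n A "lat n A" by (rule sdp_data_lat[OF A asc])
  interpret S': sdp_data n' A' U' by fact
  note Z = Zvec_lat[OF A]
  have hom: "\<phi> \<in> hom S.S S'.S" and bij: "bij_betw \<phi> (carrier S.S) (carrier S'.S)"
    using \<phi> by (auto simp: iso_def)
  interpret \<phi>: group_hom S.S S'.S \<phi> by unfold_locales (rule hom)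
  let ?\<psi> = "inv_into (carrier S.S) \<phi>" and ?U = "lat n A" and ?a = "mact n A"
  define f where "f u = snd (\<phi> (u, 0))" for u
  have f_A: "f (?a 1 u - u) = 0" if u: "u \<in> ?U" for u
  proof -
    have t: "(0\<^sub>v n, 1) \<in> carrier S.S" "(u, 0) \<in> carrier S.S" using vsubD(2)[OF S.U] u by auto
    have Au: "?a 1 u \<in> ?U" by (rule S.AU[OF u])
    have d: "?a 1 u - u \<in> ?U" by (rule vsubD(5)[OF S.U Au u])
    have "\<phi> ((0\<^sub>v n, 1) \<otimes>\<^bsub>S.S\<^esub> (u, 0)) = \<phi> ((?a 1 u, 0) \<otimes>\<^bsub>S.S\<^esub> (0\<^sub>v n, 1))"
      using S.t_embed[OF u] by (simp add: mact_1[OF A])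
    then have "\<phi> (0\<^sub>v n, 1) \<otimes>\<^bsub>S'.S\<^esub> \<phi> (u, 0) = \<phi> (?a 1 u, 0) \<otimes>\<^bsub>S'.S\<^esub> \<phi> (0\<^sub>v n, 1)"
      using \<phi>.hom_mult[OF t] \<phi>.hom_mult[of "(?a 1 u, 0)" "(0\<^sub>v n, 1)"] t Au by simp
    then have 1: "f u = f (?a 1 u)" by (simp add: f_def)
    have "(?a 1 u - u, 0) \<otimes>\<^bsub>S.S\<^esub> (u, 0) = (?a 1 u, 0)"
      using S.Uc[OF u] S.Uc[OF Au] by (auto simp: mact_0[OF A] intro!: eq_vecI)
    then have "\<phi> (?a 1 u, 0) = \<phi> (?a 1 u - u, 0) \<otimes>\<^bsub>S'.S\<^esub> \<phi> (u, 0)"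
      using \<phi>.hom_mult[of "(?a 1 u - u, 0)" "(u, 0)"] u d by simp
    then show ?thesis using 1 by (simp add: f_def)
  qed
  have "\<exists>u\<in>U'. snd (?\<psi> (u, 0)) \<noteq> 0"
    using sdp_iso_fibre_sym[OF S.sdp_data_axioms S'(1) Z S'(2) \<phi>] mv by blast
  then obtain c k where c: "c \<in> U'" "?\<psi> (c, 0) = k" "snd k \<noteq> 0" by blast
  have cc: "(c, 0) \<in> \<phi> ` carrier S.S" using bij c(1) by (simp add: bij_betw_def)
  obtain y j where g: "?\<psi> (c, 0) = (y, j)" "y \<in> ?U" "j \<noteq> 0" "\<phi> (y, j) = (c, 0)"
    using inv_into_into[OF cc] f_inv_into_f[OF cc] c by (cases k) auto
  have fix1: "?a j w = w" if w: "w \<in> ?U" "f w = 0" for w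
  proof -
    obtain z where z: "\<phi> (w, 0) = (z, 0)" using w(2) by (metis f_def prod.collapse)
    have wc: "(w, 0) \<in> carrier S.S" "(y, j) \<in> carrier S.S" using w g by auto
    have zU: "z \<in> U'" using \<phi>.hom_closed[OF wc(1)] z by simp
    have "\<phi> ((y, j) \<otimes>\<^bsub>S.S\<^esub> (w, 0)) = \<phi> ((w, 0) \<otimes>\<^bsub>S.S\<^esub> (y, j))"
      unfolding \<phi>.hom_mult[OF wc] \<phi>.hom_mult[OF wc(2,1)] z g(4)
      using comm_add_vec[OF S'.Uc[OF c(1)] S'.Uc[OF zU]] S'.Uc[OF c(1)] S'.Uc[OF zU]
      by (simp add: mact_0[OF S'.A])
    then have "(y, j) \<otimes>\<^bsub>S.S\<^esub> (w, 0) = (w, 0) \<otimes>\<^bsub>S.S\<^esub> (y, j)"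
      using bij wc S.S.m_closed unfolding bij_betw_def by (meson inj_onD)
    then have eq: "y + ?a j w = w + y" using S.Uc[OF g(2)] by (simp add: mact_0[OF A])
    show ?thesis
    proof (rule eq_vecI)
      fix i assume "i < dim_vec w"
      then show "?a j w $ i = w $ i"
        using arg_cong[OF eq, of "\<lambda>z. z $ i"] S.Uc[OF g(2)] S.Uc[OF w(1)] mact_closed[OF A, of j w] by simp
    qed (use S.Uc[OF w(1)] carrier_vecD[OF mact_closed[OF A]] in simp)
  qed
  have fixm: "?a (- j) w = w" if w: "w \<in> ?U" "f w = 0" for w
    using fix1[OF w] mact_cancel(2)[OF A S.Uc[OF w(1)], of j] by simp
  have rel: "?a (i + 1) u - ?a i u = ?a 1 u - u" if u: "u \<in> ?U" and i: "i = \<bar>j\<bar> \<or> i = - \<bar>j\<bar>" for u i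
  proof -
    have "?a i (?a 1 u - u) = ?a 1 u - u"
      using fix1[OF vsubD(5)[OF S.U S.AU[OF u] u] f_A[OF u]] fixm[OF vsubD(5)[OF S.U S.AU[OF u] u] f_A[OF u]] i
      by (cases "j \<ge> 0") auto
    then show ?thesis using mact_minus[OF A mact_closed[OF A] S.Uc[OF u], of i 1 u] mact_plus[OF A S.Uc[OF u], of i 1] by simp
  qed
  have dim: "dim_vec (?a i v) = n" for i v using carrier_vecD[OF mact_closed[OF A]] .
  have both: "(\<forall>v\<in>Zvec n. A *\<^sub>v v \<in> Zvec n) \<and> (\<forall>v\<in>Zvec n. inv\<^bsub>GLQ n\<^esub> A *\<^sub>v v \<in> Zvec n)"
    using asc unfolding ascending_def
  proof
    assume AZ: "\<forall>v\<in>Zvec n. A *\<^sub>v v \<in> Zvec n"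
    have "inv\<^bsub>GLQ n\<^esub> A *\<^sub>v v \<in> Zvec n" if v: "v \<in> Zvec n" for v
    proof -
      \<comment> \<open>The relation for \<open>?u\<close>, solved for \<open>?u\<close>, contains
        only the powers \<open>?k\<close> and \<open>?k - 1\<close> of \<open>A\<close>, both
        nonnegative because \<open>j \<noteq> 0\<close>.\<close>
      let ?u = "?a (- 1) v" and ?k = "\<bar>j\<bar>"
      note vc = Zvec_carrier[OF v]
      have u: "?u \<in> ?U" using S.AU Z v by auto
      have e: "?a (?k + 1) ?u = ?a ?k v" "?a ?k ?u = ?a (?k - 1) v" "?a 1 ?u = v"
        using mact_plus[OF A vc, of "?k + 1" "- 1"] mact_plus[OF A vc, of ?k "- 1"] mact_cancel(1)[OF A vc, of 1] by simp_all
      have "?a ?k v - ?a (?k - 1) v = v - ?u" using rel[OF u, of ?k] e by simp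
      then have eq: "(?a ?k v - ?a (?k - 1) v) $ i = (v - ?u) $ i" for i by simp
      have "?u = v - ?a ?k v + ?a (?k - 1) v"
      proof (rule eq_vecI)
        fix i assume "i < dim_vec (v - ?a ?k v + ?a (?k - 1) v)"
        then show "?u $ i = (v - ?a ?k v + ?a (?k - 1) v) $ i" using eq[of i] vc by (simp add: dim)
      qed (use vc in \<open>simp add: dim\<close>)
      moreover have "?a ?k v \<in> Zvec n" "?a (?k - 1) v \<in> Zvec n"
        using g(3) by (auto intro!: mact_nonneg_Zvec[OF A] simp: AZ v)
      ultimately have "?u \<in> Zvec n" using v vsubD(3,5)[OF vsub_Zvec] by metis
      then show ?thesis by (simp add: mact_neg1[OF A])
    qed
    then show ?thesis using AZ by blast
  next
    assume AZ: "\<forall>v\<in>Zvec n. inv\<^bsub>GLQ n\<^esub> A *\<^sub>v v \<in> Zvec n"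
    have "A *\<^sub>v v \<in> Zvec n" if v: "v \<in> Zvec n" for v
    proof -
      \<comment> \<open>Mirror image: the powers \<open>?k\<close> and \<open>?k + 1\<close> are
        nonpositive, so the integral inverse of \<open>A\<close> produces them.\<close>
      let ?k = "- \<bar>j\<bar>"
      note vc = Zvec_carrier[OF v]
      have "?a (?k + 1) v - ?a ?k v = ?a 1 v - v" using rel[of v ?k] Z v by auto
      then have eq: "(?a (?k + 1) v - ?a ?k v) $ i = (?a 1 v - v) $ i" for i by simp
      have "?a 1 v = v + ?a (?k + 1) v - ?a ?k v"
      proof (rule eq_vecI)
        fix i assume "i < dim_vec (v + ?a (?k + 1) v - ?a ?k v)"
        then show "?a 1 v $ i = (v + ?a (?k + 1) v - ?a ?k v) $ i" using eq[of i] vc by (simp add: dim)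
      qed (use vc in \<open>simp add: dim\<close>)
      moreover have "?a ?k v \<in> Zvec n" "?a (?k + 1) v \<in> Zvec n"
        using g(3) by (auto intro!: mact_nonpos_Zvec[OF A] simp: AZ v)
      ultimately have "?a 1 v \<in> Zvec n" using v vsubD(3,5)[OF vsub_Zvec] by metis
      then show ?thesis by (simp add: mact_1[OF A])
    qed
    then show ?thesis using AZ by blast
  qed
  then show ?thesis by (intro GLZ_I[OF A]) auto
qed

text \<open>The image of \<open>(v, j)\<close> has exponent \<open>d\<close> times
  \<open>v $ 0\<close> plus \<open>j s\<close>, so the preimage \<open>(v1, q)\<close> of the stable
  letter gives \<open>d p + q s = 1\<close>. The element \<open>?x\<close> lies over
  \<open>(s, - d)\<close> and its image has exponent zero, so it commutes with the vectors of first
  coordinate zero; hence the order of \<open>C\<close> divides \<open>d\<close> and is prime to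
  \<open>q\<close>. Twisting by \<open>(v1, q)\<close> before \<open>\<phi>\<close> makes the
  composite fibre-preserving, which identifies \<open>A'\<close> up to conjugation.\<close>

lemma finite_order_of_iso:
  assumes A: "A \<in> GLZ n" and A': "A' \<in> GLZ n'" and n: "n > 0"
    and \<phi>: "\<phi> \<in> iso (sdp n A (Zvec n)) (sdp n' A' (Zvec n'))" and d: "d \<noteq> 0"
    and f: "\<And>v. v \<in> Zvec n \<Longrightarrow> rat_of_int (snd (\<phi> (v, 0))) = of_int d * v $ 0"
  obtains u C q where "n = n'" "u \<in> Zvec (n - 1)" "C \<in> GLZ (n - 1)" "group.ord (GLQ (n - 1)) C > 0"
    "gcd q (int (group.ord (GLQ (n - 1)) C)) = 1" "A = lower_block n u C"
    "conjugate_GLZ n A' (lower_block n u (C [^]\<^bsub>GLQ (n - 1)\<^esub> q))"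
proof -
  obtain k where k: "n = Suc k" using n by (cases n) auto
  interpret S: sdp_data n A "Zvec n" by (rule sdp_data_Zvec[OF A])
  interpret S': sdp_data n' A' "Zvec n'" by (rule sdp_data_Zvec[OF A'])
  have hom: "\<phi> \<in> hom S.S S'.S" and bij: "bij_betw \<phi> (carrier S.S) (carrier S'.S)"
    using \<phi> by (auto simp: iso_def)
  interpret \<phi>: group_hom S.S S'.S \<phi> by unfold_locales (rule hom)
  note AQ = GLZ_D(1)[OF A]
  define s where "s = snd (\<phi> (0\<^sub>v n, 1))"
  have sn: "rat_of_int (snd (\<phi> (v, j))) = of_int d * v $ 0 + of_int j * of_int s" if "v \<in> Zvec n" for v j
    using sdp_snd_pow[OF S.sdp_data_axioms S'.sdp_data_axioms hom that, of j] f[OF that] by (simp add: s_def)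
  have fstZ: "(A *\<^sub>v v) $ 0 = v $ 0" if v: "v \<in> Zvec n" for v
  proof -
    have t: "(0\<^sub>v n, 1) \<in> carrier S.S" "(v, 0) \<in> carrier S.S" using vsubD(2)[OF S.U] v by auto
    have Av: "A *\<^sub>v v \<in> Zvec n" by (rule GLZ_D(3)[OF A v])
    have "\<phi> ((0\<^sub>v n, 1) \<otimes>\<^bsub>S.S\<^esub> (v, 0)) = \<phi> ((A *\<^sub>v v, 0) \<otimes>\<^bsub>S.S\<^esub> (0\<^sub>v n, 1))" using S.t_embed[OF v] by simp
    then have "\<phi> (0\<^sub>v n, 1) \<otimes>\<^bsub>S'.S\<^esub> \<phi> (v, 0) = \<phi> (A *\<^sub>v v, 0) \<otimes>\<^bsub>S'.S\<^esub> \<phi> (0\<^sub>v n, 1)"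
      using \<phi>.hom_mult[OF t] \<phi>.hom_mult[of "(A *\<^sub>v v, 0)" "(0\<^sub>v n, 1)"] t Av by simp
    then have "snd (\<phi> (v, 0)) = snd (\<phi> (A *\<^sub>v v, 0))" by simp
    then have "of_int d * v $ 0 = of_int d * (A *\<^sub>v v) $ 0" using f[OF v] f[OF Av] by metis
    then show ?thesis using d by (simp del: index_mult_mat_vec)
  qed
  have fst: "(A *\<^sub>v v) $ 0 = v $ 0" if v: "v \<in> carrier_vec n" for v
  proof -
    obtain m where m: "m \<ge> 1" "of_nat m \<cdot>\<^sub>v v \<in> Zvec n" using ex_int_multiple[OF v] by blast
    have "(A *\<^sub>v (of_nat m \<cdot>\<^sub>v v)) $ 0 = of_nat m * (A *\<^sub>v v) $ 0"
      unfolding mult_mat_vec[OF GLZ_D(2)[OF A] v] using n GLZ_D(2)[OF A] by (simp del: index_mult_mat_vec)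
    then show ?thesis using fstZ[OF m(2)] m(1) n v by (simp del: index_mult_mat_vec)
  qed
  obtain u C where uC: "u \<in> Zvec k" "C \<in> GLZ k" "A = lower_block (Suc k) u C"
    using lower_block_ex[OF A[unfolded k] fst[unfolded k]] .
  have "(0\<^sub>v n', 1) \<in> \<phi> ` carrier S.S" using bij vsubD(2)[OF S'.U] by (simp add: bij_betw_def)
  then obtain v1 q where v1: "v1 \<in> Zvec n" "\<phi> (v1, q) = (0\<^sub>v n', 1)" by auto
  define p where "p = \<lfloor>v1 $ 0\<rfloor>"
  have p: "v1 $ 0 = of_int p" using v1(1) n by (auto simp: p_def Zvec_iff)
  have "rat_of_int (d * p + q * s) = of_int 1" using sn[OF v1(1), of q] v1(2) p by simp
  then have dp: "d * p + q * s = 1" by (simp only: of_int_eq_iff)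
  let ?x = "(of_int s \<cdot>\<^sub>v unit_vec n 0, - d)"
  have xc: "?x \<in> carrier S.S" using vsub_int_smult[OF vsub_Zvec unit_vec_Zvec] by auto
  have "rat_of_int (snd (\<phi> ?x)) = of_int 0" using sn[of "of_int s \<cdot>\<^sub>v unit_vec n 0" "- d"] xc n by simp
  then have x0: "snd (\<phi> ?x) = 0" by (simp only: of_int_eq_iff)
  have fixw: "mact n A (- d) w = w" if w: "w \<in> Zvec n" "w $ 0 = 0" for w
  proof -
    have wc: "(w, 0) \<in> carrier S.S" using w by auto
    have "rat_of_int (snd (\<phi> (w, 0))) = of_int 0" using f[OF w(1)] w(2) by simp
    then have w0: "snd (\<phi> (w, 0)) = 0" by (simp only: of_int_eq_iff)
    have "\<phi> (?x \<otimes>\<^bsub>S.S\<^esub> (w, 0)) = \<phi> ((w, 0) \<otimes>\<^bsub>S.S\<^esub> ?x)"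
    proof -
      obtain y z where yz: "\<phi> ?x = (y, 0)" "\<phi> (w, 0) = (z, 0)" using x0 w0 by (metis prod.collapse)
      have c: "y \<in> Zvec n'" "z \<in> Zvec n'" using \<phi>.hom_closed[OF xc] \<phi>.hom_closed[OF wc] yz by simp_all
      show ?thesis unfolding \<phi>.hom_mult[OF wc xc] \<phi>.hom_mult[OF xc wc] yz
        using comm_add_vec[OF S'.Uc[OF c(1)] S'.Uc[OF c(2)]] S'.Uc[OF c(1)] S'.Uc[OF c(2)]
        by (simp add: mact_0[OF S'.A])
    qed
    then have "?x \<otimes>\<^bsub>S.S\<^esub> (w, 0) = (w, 0) \<otimes>\<^bsub>S.S\<^esub> ?x"
      using bij wc xc S.S.m_closed unfolding bij_betw_def by (meson inj_onD)
    then have eq: "of_int s \<cdot>\<^sub>v unit_vec n 0 + mact n A (- d) w = w + of_int s \<cdot>\<^sub>v unit_vec n 0"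
      by (simp add: mact_0[OF AQ])
    show ?thesis
    proof (rule eq_vecI)
      fix i assume "i < dim_vec w"
      then show "mact n A (- d) w $ i = w $ i"
        using arg_cong[OF eq, of "\<lambda>z. z $ i"] S.Uc[OF w(1)] mact_closed[OF AQ, of "- d" w] by simp
    qed (use S.Uc[OF w(1)] carrier_vecD[OF mact_closed[OF AQ]] in simp)
  qed
  note CQ = GLZ_D(1)[OF uC(2)]
  have \<kappa>: "mact k C (- d) w = w" if w: "w \<in> Zvec k" for w
  proof -
    have "vcons 0 w \<in> Zvec n" using vcons_Zvec[OF Zvec_carrier[OF w]] w unfolding k by simp
    from fixw[OF this] have "vcons 0 (mact k C (- d) w) = vcons 0 w"
      using mact_lower_block[OF Zvec_carrier[OF uC(1)] CQ Zvec_carrier[OF w], of "- d"] uC(3) k by simp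
    then show ?thesis using vcons_eq_iff[OF mact_closed[OF CQ] Zvec_carrier[OF w]] by simp
  qed
  interpret ck: group "GLQ k" by (rule group_GLQ)
  have "C [^]\<^bsub>GLQ k\<^esub> (- d) = 1\<^sub>m k"
    using \<kappa> GLQ_int_pow(2)[OF CQ, of "- d"] by (intro mat_eq_by_unit_vecs[of _ k k]) (auto simp: mact_def)
  then have dvd: "int (ck.ord C) dvd - d" using ck.int_pow_eq_id[OF CQ, of "- d"] by simp
  then have ord: "ck.ord C > 0" using d by (cases "ck.ord C = 0") auto
  have "gcd q (int (ck.ord C)) dvd 1"
  proof -
    have "gcd q (int (ck.ord C)) dvd q" "gcd q (int (ck.ord C)) dvd d" using dvd by (auto intro: dvd_trans)
    then have "gcd q (int (ck.ord C)) dvd d * p + q * s" by (intro dvd_add dvd_mult2)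
    then show ?thesis unfolding dp .
  qed
  then have q: "gcd q (int (ck.ord C)) = 1" by simp
  \<comment> \<open>This is the determinant condition of the twist with
    \<open>\<kappa> = - d\<close> and \<open>l = s\<close>.\<close>
  have det: "q * s - - d * p = 1" using dp by simp
  interpret tw: twist n A "lower_block (Suc k) u (C [^]\<^bsub>GLQ k\<^esub> q)" q "- d" s p v1
    unfolding uC(3) k by (rule lower_block_twist[OF uC(1,2) \<kappa> det v1(1)[unfolded k] p])
  let ?A2 = "lower_block (Suc k) u (C [^]\<^bsub>GLQ k\<^esub> q)"
  obtain h where h: "h \<in> iso tw.S'.S S.S" "h (0\<^sub>v n, 1) = (v1, q)"
    "\<forall>v\<in>Zvec n. \<exists>w\<in>Zvec n. h (v, 0) = (w, - d * tw.c v) \<and> tw.c w = s * tw.c v"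
    using tw.twist_iso by blast
  have comp: "\<phi> \<circ> h \<in> iso tw.S'.S S'.S" using iso_set_trans[OF h(1) \<phi>] .
  \<comment> \<open>\<open>h (v, 0)\<close> lies over a multiple of \<open>(s, - d)\<close>, where
    the exponent \<open>d s - d s\<close> of the image vanishes.\<close>
  have fib: "snd ((\<phi> \<circ> h) (v, 0)) = 0" if v: "v \<in> Zvec n" for v
  proof -
    obtain w where w: "w \<in> Zvec n" "h (v, 0) = (w, - d * tw.c v)" "tw.c w = s * tw.c v" using bspec[OF h(3) v] by blast
    have w0: "w $ 0 = of_int s * of_int (tw.c v)" using tw.c[OF w(1)] w(3) by simp
    have "rat_of_int (snd (\<phi> (h (v, 0)))) = of_int 0"
      unfolding w(2) sn[OF w(1)] w0 by simp
    then show ?thesis by (simp only: of_int_eq_iff comp_def)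
  qed
  have one: "snd ((\<phi> \<circ> h) (0\<^sub>v n, 1)) = 1" using h(2) v1(2) by simp
  obtain B where B: "n = n'" "B \<in> carrier (GLQ n)" "mat_image B (Zvec n) = Zvec n'"
    "A' = B * (?A2 [^]\<^bsub>GLQ n\<^esub> snd ((\<phi> \<circ> h) (0\<^sub>v n, 1))) * inv\<^bsub>GLQ n\<^esub> B"
    by (rule sdp_iso_fibre_preserving[OF tw.S'.sdp_data_axioms S'.sdp_data_axioms subset_refl subset_refl comp fib])
  have A2: "?A2 \<in> GLZ n" using lower_block_GLZ[OF uC(1) GLZ_int_pow[OF uC(2)]] k by simp
  have BZ: "B \<in> GLZ n" using B by (simp add: GLZ_iff)
  have A'B: "A' = B * ?A2 * inv\<^bsub>GLQ n\<^esub> B" using B(4) GLQ_int_pow_1[OF GLZ_D(1)[OF A2]] unfolding one by simp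
  have "conjugate_GLZ n A' ?A2"
    unfolding conjugate_GLZ_def
  proof (rule bexI[OF _ GLZ_inv[OF BZ]])
    note Bi = GLQ_inv[OF B(2)] and Bc = GLQ_carrier_mat[OF B(2)] and A2c = GLZ_D(2)[OF A2]
    have "inv\<^bsub>GLQ n\<^esub> B * A' = (inv\<^bsub>GLQ n\<^esub> B * B) * (?A2 * inv\<^bsub>GLQ n\<^esub> B)"
      unfolding A'B assoc_mult_mat[OF Bc A2c Bi(2)] 
      using assoc_mult_mat[OF Bi(2) Bc mult_carrier_mat[OF A2c Bi(2)]] by simp
    also have "\<dots> = ?A2 * inv\<^bsub>GLQ n\<^esub> B" unfolding Bi(4) by (rule left_mult_one_mat[OF mult_carrier_mat[OF A2c Bi(2)]])
    finally have "inv\<^bsub>GLQ n\<^esub> B * A' * B = ?A2 * (inv\<^bsub>GLQ n\<^esub> B * B)"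
      using assoc_mult_mat[OF A2c Bi(2) Bc] by simp
    then show "?A2 = inv\<^bsub>GLQ n\<^esub> B * A' * inv\<^bsub>GLQ n\<^esub> (inv\<^bsub>GLQ n\<^esub> B)"
      unfolding GLQ_inv_inv[OF B(2)] Bi(4) using right_mult_one_mat[OF A2c] by simp
  qed
  then show ?thesis using that[OF B(1), of u C q] uC ord q k by simp
qed

theorem sdp_lat_iso_cases:
  assumes A: "A \<in> carrier (GLQ n)" and A': "A' \<in> carrier (GLQ n')"
    and asc: "ascending n A" "ascending n' A'"
    and iso: "sdp n A (lat n A) \<cong> sdp n' A' (lat n' A')"
  shows "n = n' \<and>
    ((\<exists>B\<in>carrier (GLQ n).
        (\<exists>\<epsilon>\<in>{1, -1 :: int}. A' = B * (A [^]\<^bsub>GLQ n\<^esub> \<epsilon>) * inv\<^bsub>GLQ n\<^esub> B) \<and>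
        (\<Union>j::int. mat_image (A [^]\<^bsub>GLQ n\<^esub> j) (Zvec n)) =
        (\<Union>j::int. mat_image (A [^]\<^bsub>GLQ n\<^esub> j * inv\<^bsub>GLQ n\<^esub> B) (Zvec n))) \<or>
     (n \<ge> 1 \<and> A \<in> GLZ n \<and> A' \<in> GLZ n \<and>
      (\<exists>C\<in>GLZ (n - 1). \<exists>m::nat. m = group.ord (GLQ (n - 1)) C \<and> m > 0 \<and>
        (\<exists>u\<in>Zvec (n - 1). \<exists>q::int. gcd q (int m) = 1 \<and>
          conjugate_GLZ n A (lower_block n u C) \<and>
          conjugate_GLZ n A' (lower_block n u (C [^]\<^bsub>GLQ (n - 1)\<^esub> q))))))"
proof -
  interpret S: sdp_data n A "lat n A" by (rule sdp_data_lat[OF A asc(1)])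
  interpret S': sdp_data n' A' "lat n' A'" by (rule sdp_data_lat[OF A' asc(2)])
  note Z = Zvec_lat[OF A] Zvec_lat[OF A']
  obtain \<phi> where \<phi>: "\<phi> \<in> iso S.S S'.S" using iso by (auto simp: is_iso_def)
  show ?thesis
  proof (cases "\<forall>u\<in>lat n A. snd (\<phi> (u, 0)) = 0")
    case True
    let ?e = "snd (\<phi> (0\<^sub>v n, 1))"
    from True have fib: "\<And>u. u \<in> lat n A \<Longrightarrow> snd (\<phi> (u, 0)) = 0" by blast
    obtain B where B: "n = n'" "B \<in> carrier (GLQ n)" "mat_image B (lat n A) = lat n' A'"
      "?e \<in> {1, -1}" "A' = B * (A [^]\<^bsub>GLQ n\<^esub> ?e) * inv\<^bsub>GLQ n\<^esub> B"
      by (rule sdp_iso_fibre_preserving[OF S.sdp_data_axioms S'.sdp_data_axioms Z \<phi> fib])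
    note Ae = GLQ_int_pow[OF A, of ?e] and Bc = GLQ_carrier_mat[OF B(2)] and D = GLQ_inv[OF B(2)]
    note A'n = A'[folded B(1)]
    have "A' * B = B * (A [^]\<^bsub>GLQ n\<^esub> ?e) * (inv\<^bsub>GLQ n\<^esub> B * B)"
      unfolding B(5) by (rule assoc_mult_mat[OF mult_carrier_mat[OF Bc Ae(2)] D(2) Bc])
    also have "\<dots> = B * (A [^]\<^bsub>GLQ n\<^esub> ?e)" unfolding D(4) by (rule right_mult_one_mat[OF mult_carrier_mat[OF Bc Ae(2)]])
    finally have "A' * B = B * (A [^]\<^bsub>GLQ n\<^esub> ?e)" .
    from mact_conj[OF Ae(1) A'n Bc this]
    have cj: "mact n A' k (B *\<^sub>v v) = B *\<^sub>v mact n A (?e * k) v" if "v \<in> carrier_vec n" for k v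
      using that group.int_pow_pow[OF group_GLQ A, of ?e k] by (simp add: mact_def)
    have ee: "?e * (?e * k) = k" for k using B(4) by auto
    have mv: "(A [^]\<^bsub>GLQ n\<^esub> j * inv\<^bsub>GLQ n\<^esub> B) *\<^sub>v v = mact n A j (inv\<^bsub>GLQ n\<^esub> B *\<^sub>v v)"
      if "v \<in> Zvec n" for j :: int and v
      unfolding mact_def using assoc_mult_mat_vec[OF GLQ_int_pow(2)[OF A] D(2) Zvec_carrier[OF that]] .
    have key: "B *\<^sub>v mact n A j (inv\<^bsub>GLQ n\<^esub> B *\<^sub>v v) = mact n A' (?e * j) v" if "v \<in> Zvec n" for j v
      using cj[of "inv\<^bsub>GLQ n\<^esub> B *\<^sub>v v" "?e * j"] D(2) GLQ_inv_cancel(1)[OF B(2) Zvec_carrier[OF that]]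
      by (simp add: ee)
    have "lat n A = (\<Union>j::int. mat_image (A [^]\<^bsub>GLQ n\<^esub> j * inv\<^bsub>GLQ n\<^esub> B) (Zvec n))"
    proof (rule subset_antisym; rule subsetI)
      fix w assume w: "w \<in> lat n A"
      then have "B *\<^sub>v w \<in> lat n A'" using B(1,3) unfolding mat_image_def by blast
      then obtain j v where v: "v \<in> Zvec n" "B *\<^sub>v w = mact n A' j v" by (auto simp: lat_iff)
      have "w = inv\<^bsub>GLQ n\<^esub> B *\<^sub>v (B *\<^sub>v w)" using GLQ_inv_cancel(2)[OF B(2) S.Uc[OF w]] by simp
      also have "\<dots> = inv\<^bsub>GLQ n\<^esub> B *\<^sub>v (B *\<^sub>v mact n A (?e * j) (inv\<^bsub>GLQ n\<^esub> B *\<^sub>v v))"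
        using key[OF v(1), of "?e * j"] v(2) by (simp add: ee)
      also have "\<dots> = mact n A (?e * j) (inv\<^bsub>GLQ n\<^esub> B *\<^sub>v v)" by (rule GLQ_inv_cancel(2)[OF B(2) mact_closed[OF A]])
      finally have "w \<in> mat_image (A [^]\<^bsub>GLQ n\<^esub> (?e * j) * inv\<^bsub>GLQ n\<^esub> B) (Zvec n)"
        unfolding mat_image_def using mv[OF v(1)] v(1) by (intro image_eqI[of _ _ v]) auto
      then show "w \<in> (\<Union>j::int. mat_image (A [^]\<^bsub>GLQ n\<^esub> j * inv\<^bsub>GLQ n\<^esub> B) (Zvec n))" by blast
    next
      fix w assume "w \<in> (\<Union>j::int. mat_image (A [^]\<^bsub>GLQ n\<^esub> j * inv\<^bsub>GLQ n\<^esub> B) (Zvec n))"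
      then obtain j :: int and v where v: "v \<in> Zvec n" "w = mact n A j (inv\<^bsub>GLQ n\<^esub> B *\<^sub>v v)"
        by (auto simp: mat_image_def mv)
      have "B *\<^sub>v w \<in> lat n A'" unfolding v(2) key[OF v(1)] using v(1) lat_iff by blast
      then have "B *\<^sub>v w \<in> mat_image B (lat n A)" using B(1,3) by simp
      then obtain y where y: "y \<in> lat n A" "B *\<^sub>v w = B *\<^sub>v y" unfolding mat_image_def by blast
      have "w = y" using GLQ_inv_cancel(2)[OF B(2) S.Uc[OF y(1)]] y(2) v(2)
        GLQ_inv_cancel(2)[OF B(2) mact_closed[OF A]] by metis
      then show "w \<in> lat n A" using y by simp
    qed
    then have "(\<Union>j::int. mat_image (A [^]\<^bsub>GLQ n\<^esub> j) (Zvec n)) =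
        (\<Union>j::int. mat_image (A [^]\<^bsub>GLQ n\<^esub> j * inv\<^bsub>GLQ n\<^esub> B) (Zvec n))" unfolding lat_def .
    then show ?thesis using B by blast
  next
    case False
    let ?\<psi> = "inv_into (carrier S.S) \<phi>"
    have \<psi>: "?\<psi> \<in> iso S'.S S.S" by (rule S.S.iso_set_sym[OF \<phi>])
    have AZ: "A \<in> GLZ n" using fibre_moving_GLZ[OF A asc(1) S'.sdp_data_axioms Z(2) \<phi>] False by blast
    have mv': "\<exists>u\<in>lat n' A'. snd (?\<psi> (u, 0)) \<noteq> 0"
      using sdp_iso_fibre_sym[OF S.sdp_data_axioms S'.sdp_data_axioms Z \<phi>] False by blast
    have AZ': "A' \<in> GLZ n'" by (rule fibre_moving_GLZ[OF A' asc(2) S.sdp_data_axioms Z(1) \<psi> mv'])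
    note lats = GLZ_lat[OF AZ] GLZ_lat[OF AZ']
    have hom: "\<phi> \<in> hom S.S S'.S" using \<phi> by (simp add: iso_def)
    interpret \<phi>: group_hom S.S S'.S \<phi> by unfold_locales (rule hom)
    have "snd (\<phi> (v + w, 0)) = snd (\<phi> (v, 0)) + snd (\<phi> (w, 0))" if vw: "v \<in> Zvec n" "w \<in> Zvec n" for v w
      using \<phi>.hom_mult[of "(v, 0)" "(w, 0)"] subsetD[OF Z(1) vw(1)] subsetD[OF Z(1) vw(2)] Zvec_carrier[OF vw(2)]
      by (simp add: mact_0[OF A])
    moreover have "\<exists>v\<in>Zvec n. snd (\<phi> (v, 0)) \<noteq> 0" using False lats by simp
    ultimately obtain P d where P: "n > 0" "P \<in> GLZ n" "d \<noteq> 0"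
      "\<And>v. v \<in> Zvec n \<Longrightarrow> rat_of_int (snd (\<phi> (v, 0))) = of_int d * (P *\<^sub>v v) $ 0"
      using Zvec_linear_form[of "\<lambda>v. snd (\<phi> (v, 0))" n] by blast
    let ?Q = "inv\<^bsub>GLQ n\<^esub> P"
    have Q: "?Q \<in> GLZ n" by (rule GLZ_inv[OF P(2)])
    \<comment> \<open>The base change by \<open>P\<close> turns the exponent form into
      \<open>d\<close> times the first coordinate, as \<open>finite_order_of_iso\<close>
      requires.\<close>
    define M where "M = P * A * ?Q"
    have M: "M \<in> GLZ n" unfolding M_def by (rule GLZ_conj[OF P(2) AZ])
    interpret M: sdp_data n M "Zvec n" by (rule sdp_data_Zvec[OF M])
    note Pc = GLZ_D(2)[OF P(2)] and Qc = GLZ_D(2)[OF Q] and Ac = GLQ_carrier_mat[OF A]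
    have "?Q * M = (?Q * P) * (A * ?Q)"
      unfolding M_def assoc_mult_mat[OF Pc Ac Qc] using assoc_mult_mat[OF Qc Pc mult_carrier_mat[OF Ac Qc]] by simp
    also have "\<dots> = A * ?Q" unfolding GLQ_inv(4)[OF GLZ_D(1)[OF P(2)]]
      by (rule left_mult_one_mat[OF mult_carrier_mat[OF Ac Qc]])
    finally have "A * ?Q = ?Q * M" by simp
    from mact_conj[OF M.A A Qc this]
    have "\<And>v k. v \<in> carrier_vec n \<Longrightarrow> mact n A k (?Q *\<^sub>v v) = ?Q *\<^sub>v mact n M (1 * k) v" by simp
    from M.linear_iso[OF A GLZ_D(1)[OF Q] _ this]
    have "(\<lambda>(v, k). (?Q *\<^sub>v v, 1 * k)) \<in> iso M.S (sdp n A (mat_image ?Q (Zvec n)))" by simp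
    moreover have "mat_image ?Q (Zvec n) = Zvec n" using Q by (simp add: GLZ_iff)
    ultimately have l: "(\<lambda>(v, k). (?Q *\<^sub>v v, k)) \<in> iso M.S S.S" using lats by simp
    have comp: "\<phi> \<circ> (\<lambda>(v, k). (?Q *\<^sub>v v, k)) \<in> iso (sdp n M (Zvec n)) (sdp n' A' (Zvec n'))"
      using iso_set_trans[OF l \<phi>] lats by simp
    have "rat_of_int (snd ((\<phi> \<circ> (\<lambda>(v, k). (?Q *\<^sub>v v, k))) (v, 0))) = of_int d * v $ 0" if v: "v \<in> Zvec n" for v
      using P(4)[OF GLZ_D(3)[OF Q v]] GLQ_inv_cancel(1)[OF GLZ_D(1)[OF P(2)] Zvec_carrier[OF v]] by simp
    from finite_order_of_iso[OF M AZ' P(1) comp P(3) this]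
    obtain u C q where R: "n = n'" "u \<in> Zvec (n - 1)" "C \<in> GLZ (n - 1)" "group.ord (GLQ (n - 1)) C > 0"
      "gcd q (int (group.ord (GLQ (n - 1)) C)) = 1" "M = lower_block n u C"
      "conjugate_GLZ n A' (lower_block n u (C [^]\<^bsub>GLQ (n - 1)\<^esub> q))" by metis
    have cA: "conjugate_GLZ n A (lower_block n u C)"
      unfolding conjugate_GLZ_def R(6)[symmetric] M_def using P(2) by blast
    have ex: "\<exists>C\<in>GLZ (n - 1). \<exists>m::nat. m = group.ord (GLQ (n - 1)) C \<and> m > 0 \<and>
        (\<exists>u\<in>Zvec (n - 1). \<exists>q::int. gcd q (int m) = 1 \<and>
          conjugate_GLZ n A (lower_block n u C) \<and>
          conjugate_GLZ n A' (lower_block n u (C [^]\<^bsub>GLQ (n - 1)\<^esub> q)))"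
      by (intro bexI[OF _ R(3)] exI[of _ "group.ord (GLQ (n - 1)) C"] conjI refl R(4) bexI[OF _ R(2)]
          exI[of _ q] R(5) cA R(7))
    have n: "1 \<le> n" "A' \<in> GLZ n" using P(1) AZ' R(1) by simp_all
    show ?thesis by (rule conjI[OF R(1) disjI2[OF conjI[OF n(1) conjI[OF AZ conjI[OF n(2) ex]]]]])
  qed
qed

section \<open>Normal forms in Leary--Minasyan groups\<close>

definition perm_group :: "('a \<Rightarrow> 'a) monoid" where
  "perm_group = \<lparr>carrier = {f. bij f}, monoid.mult = (\<circ>), one = id\<rparr>"

lemma perm_group_simps [simp]:
  "f \<in> carrier perm_group \<longleftrightarrow> bij f" "f \<otimes>\<^bsub>perm_group\<^esub> g = f \<circ> g" "\<one>\<^bsub>perm_group\<^esub> = id"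
  by (simp_all add: perm_group_def)

lemma group_perm_group: "group perm_group"
proof (rule groupI)
  fix f :: "'a \<Rightarrow> 'a" assume "f \<in> carrier perm_group"
  then show "\<exists>g\<in>carrier perm_group. g \<otimes>\<^bsub>perm_group\<^esub> f = \<one>\<^bsub>perm_group\<^esub>"
    by (intro bexI[of _ "inv_into UNIV f"]) (auto simp: bij_is_inj bij_imp_bij_inv)
qed (auto simp: bij_comp comp_assoc)

text \<open>A state \<open>(ls, v)\<close> stands for the product of the pairs in \<open>ls\<close>,
  each a power product times a signed stable letter, followed by \<open>x v\<close>; see
  \<open>val\<close>.\<close>

type_synonym nform = "(rat vec \<times> bool) list \<times> rat vec"

section \<open>Edge groups, transversals and van der Waerden's action\<close>

context lm_data
begin

text \<open>The sign \<open>True\<close> denotes the stable letter and \<open>False\<close> its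
  inverse. \<open>Ls e\<close> is the edge group whose elements can be moved from the right of
  \<open>te e\<close> to its left, where \<open>Am e\<close> is applied to them.\<close>

definition Ls :: "bool \<Rightarrow> rat vec set" where
  "Ls e = (if e then L else mat_image A L)"

definition Am :: "bool \<Rightarrow> rat vec \<Rightarrow> rat vec" where
  "Am e = mact n A (if e then 1 else - 1)"

definition te :: "bool \<Rightarrow> lm_gen word set" where
  "te e = (if e then t else inv\<^bsub>G\<^esub> t)"

lemma te_closed [simp]: "te e \<in> carrier G"
  by (simp add: te_def)

lemma Ls_vsub: "vsub n (Ls e)"
  using L vsub_mat_image[OF GLQ_carrier_mat[OF A] L] by (simp add: Ls_def)

lemma Ls_Z: "v \<in> Ls e \<Longrightarrow> v \<in> Zvec n"
  using ALZ L_Zvec by (auto simp: Ls_def mat_image_def split: if_splits)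

lemma Am_carrier [simp]: "Am e v \<in> carrier_vec n"
  using A by (simp add: Am_def)

lemma Am_Am: "v \<in> carrier_vec n \<Longrightarrow> Am (\<not> e) (Am e v) = v" "v \<in> carrier_vec n \<Longrightarrow> Am e (Am (\<not> e) v) = v"
  using mact_cancel[OF A, of v 1] by (auto simp: Am_def)

lemma Am_Ls: "v \<in> Ls e \<Longrightarrow> Am e v \<in> Ls (\<not> e)"
proof (cases e)
  case True
  then show "v \<in> Ls e \<Longrightarrow> Am e v \<in> Ls (\<not> e)" by (auto simp: Ls_def Am_def mact_1[OF A] mat_image_def)
next
  case False
  then show "v \<in> Ls e \<Longrightarrow> Am e v \<in> Ls (\<not> e)"
    using GLQ_inv_cancel(2)[OF A L_carrier] by (auto simp: Ls_def Am_def mact_neg1[OF A] mat_image_def)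
qed

lemma Am_add: "v \<in> carrier_vec n \<Longrightarrow> w \<in> carrier_vec n \<Longrightarrow> Am e (v + w) = Am e v + Am e w"
  by (simp add: Am_def mact_add[OF A])

lemma Am_zero: "Am e (0\<^sub>v n) = 0\<^sub>v n"
  by (simp add: Am_def mact_zero[OF A])

lemma te_x:
  assumes v: "v \<in> Ls e"
  shows "te e \<otimes>\<^bsub>G\<^esub> x v = x (Am e v) \<otimes>\<^bsub>G\<^esub> te e"
proof (cases e)
  case True
  then show ?thesis using v t_x by (simp add: te_def Ls_def Am_def mact_1[OF A])
next
  case False
  then obtain w where w: "w \<in> L" "v = A *\<^sub>v w" using v by (auto simp: Ls_def mat_image_def)
  have "Am e v = w" using False w GLQ_inv_cancel(2)[OF A L_carrier[OF w(1)]] by (simp add: Am_def mact_neg1[OF A])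
  then show ?thesis using G.inv_conj_eq[OF t_closed x_closed x_closed t_x[OF w(1)]] False w by (simp add: te_def)
qed

text \<open>The predicate under the choice operator depends only on the coset of \<open>v\<close>,
  so equal cosets receive equal representatives. The trivial coset is represented by zero, which
  makes a possible cancellation visible in the list.\<close>

definition rep :: "bool \<Rightarrow> rat vec \<Rightarrow> rat vec" where
  "rep e v = (if v \<in> Ls e then 0\<^sub>v n else SOME r. r \<in> Zvec n \<and> r - v \<in> Ls e)"

lemma rep_props:
  assumes v: "v \<in> Zvec n"
  shows "rep e v \<in> Zvec n" "v - rep e v \<in> Ls e" "rep e v - v \<in> Ls e"
proof -
  note vc = Zvec_carrier[OF v]
  have "rep e v \<in> Zvec n \<and> rep e v - v \<in> Ls e"
  proof (cases "v \<in> Ls e")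
    case True
    have "0\<^sub>v n - v = - v" using vc by auto
    then show ?thesis using True vsubD(4)[OF Ls_vsub True] vsubD(2)[OF vsub_Zvec] by (simp add: rep_def)
  next
    case False
    have "v - v = 0\<^sub>v n" using vc by auto
    then have "v \<in> Zvec n \<and> v - v \<in> Ls e" using v vsubD(2)[OF Ls_vsub] by simp
    then have "(SOME r. r \<in> Zvec n \<and> r - v \<in> Ls e) \<in> Zvec n \<and> (SOME r. r \<in> Zvec n \<and> r - v \<in> Ls e) - v \<in> Ls e"
      by (rule someI)
    then show ?thesis using False by (simp add: rep_def)
  qed
  then show 1: "rep e v \<in> Zvec n" "rep e v - v \<in> Ls e" by auto
  have "v - rep e v = - (rep e v - v)" using vc Zvec_carrier[OF 1(1)] by (intro eq_vecI) auto
  then show "v - rep e v \<in> Ls e" using vsubD(4)[OF Ls_vsub 1(2)] by simp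
qed

lemma rep_cong:
  assumes vw: "v \<in> Zvec n" "w \<in> Zvec n" and d: "v - w \<in> Ls e"
  shows "rep e v = rep e w"
proof -
  note c = Zvec_carrier[OF vw(1)] Zvec_carrier[OF vw(2)]
  have eq: "v = (v - w) + w" "w = v - (v - w)" using c by (auto intro!: eq_vecI)
  have "v \<in> Ls e \<longleftrightarrow> w \<in> Ls e" using vsubD(3)[OF Ls_vsub d] vsubD(5)[OF Ls_vsub _ d] eq by metis
  moreover have "r - v \<in> Ls e \<longleftrightarrow> r - w \<in> Ls e" if "r \<in> Zvec n" for r
  proof -
    have "r - w = (r - v) + (v - w)" "r - v = (r - w) - (v - w)" using c Zvec_carrier[OF that] by (auto intro!: eq_vecI)
    then show ?thesis using vsubD(3)[OF Ls_vsub _ d] vsubD(5)[OF Ls_vsub _ d] by metis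
  qed
  ultimately show ?thesis unfolding rep_def by (simp cong: conj_cong)
qed

lemma rep_0_iff: 
  assumes v: "v \<in> Zvec n"
  shows "rep e v = 0\<^sub>v n \<longleftrightarrow> v \<in> Ls e"
proof
  assume "rep e v = 0\<^sub>v n"
  then show "v \<in> Ls e" using rep_props(2)[OF v, of e] Zvec_carrier[OF v] by simp
qed (simp add: rep_def)

lemma rep_zero [simp]: "rep e (0\<^sub>v n) = 0\<^sub>v n"
  using vsubD(2)[OF Ls_vsub] by (simp add: rep_def)

lemma rep_rep: "v \<in> Zvec n \<Longrightarrow> rep e (rep e v) = rep e v"
  using rep_props by (intro rep_cong) auto

lemma rep_add:
  assumes "l \<in> Ls e" "v \<in> Zvec n"
  shows "rep e (l + v) = rep e v"
proof (rule rep_cong)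
  have "l + v - v = l" using Zvec_carrier[OF Ls_Z[OF assms(1)]] Zvec_carrier[OF assms(2)] by (intro eq_vecI) auto
  then show "l + v - v \<in> Ls e" using assms by simp
qed (use assms Ls_Z vsubD(3)[OF vsub_Zvec] in auto)

text \<open>Left multiplication by \<open>x w\<close>: in front of \<open>te e\<close> the sum
  \<open>w + r\<close> is replaced by its representative, and the difference, which lies in
  \<open>Ls (\<not> e)\<close>, is carried through \<open>te e\<close> to the next letter.
  \<open>xl\<close> collects the letters; \<open>xr\<close> is the carry that leaves on the
  right.\<close>

fun xl :: "rat vec \<Rightarrow> (rat vec \<times> bool) list \<Rightarrow> (rat vec \<times> bool) list" where
  "xl w [] = []"
| "xl w ((r, e) # ls) = (rep (\<not> e) (w + r), e) # xl (Am (\<not> e) (w + r - rep (\<not> e) (w + r))) ls"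

fun xr :: "rat vec \<Rightarrow> (rat vec \<times> bool) list \<Rightarrow> rat vec" where
  "xr w [] = w"
| "xr w ((r, e) # ls) = xr (Am (\<not> e) (w + r - rep (\<not> e) (w + r))) ls"

text \<open>Representatives are taken modulo \<open>Ls (\<not> e)\<close>, the group that passes
  \<open>te e\<close> from left to right. The last clause excludes opposite stable letters separated
  by a trivial representative; with zero as the representative of the trivial coset, these are all
  the pinches.\<close>

fun ok :: "(rat vec \<times> bool) list \<Rightarrow> bool" where
  "ok [] \<longleftrightarrow> True"
| "ok ((r, e) # ls) \<longleftrightarrow> r \<in> Zvec n \<and> rep (\<not> e) r = r \<and> ok ls \<and> (ls \<noteq> [] \<longrightarrow> hd ls \<noteq> (0\<^sub>v n, \<not> e))"

definition \<Omega> :: "nform set" where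
  "\<Omega> = {(ls, v). ok ls \<and> v \<in> Zvec n}"

definition Xs :: "rat vec \<Rightarrow> nform \<Rightarrow> nform" where
  "Xs w s = (xl w (fst s), xr w (fst s) + snd s)"

definition Ts :: "bool \<Rightarrow> nform \<Rightarrow> nform" where
  "Ts e s = (if fst s \<noteq> [] \<and> hd (fst s) = (0\<^sub>v n, \<not> e) then (tl (fst s), snd s) else ((0\<^sub>v n, e) # fst s, snd s))"

lemma carry:
  assumes "w \<in> Zvec n" "r \<in> Zvec n"
  shows "w + r - rep e (w + r) \<in> Ls e" "Am e (w + r - rep e (w + r)) \<in> Ls (\<not> e)"
    "Am e (w + r - rep e (w + r)) \<in> Zvec n"
proof -
  show 1: "w + r - rep e (w + r) \<in> Ls e" using rep_props(2) vsubD(3)[OF vsub_Zvec] assms by blast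
  show "Am e (w + r - rep e (w + r)) \<in> Ls (\<not> e)" by (rule Am_Ls[OF 1])
  then show "Am e (w + r - rep e (w + r)) \<in> Zvec n" by (rule Ls_Z)
qed

lemma xl_Nil_iff [simp]: "xl w ls = [] \<longleftrightarrow> ls = []"
  by (cases ls) auto

lemma xl_hd: "ls \<noteq> [] \<Longrightarrow> hd (xl w ls) = (rep (\<not> snd (hd ls)) (w + fst (hd ls)), snd (hd ls))"
  by (cases ls) auto

text \<open>No pinch is created: the carry behind \<open>te e\<close> lies in \<open>Ls e\<close>,
  which is exactly the group modulo which a following opposite letter takes its representative, so
  the coset of that letter does not change.\<close>

lemma xl_ok: "w \<in> Zvec n \<Longrightarrow> ok ls \<Longrightarrow> ok (xl w ls)"
proof (induction ls arbitrary: w)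
  case (Cons a ls)
  obtain r e where a: "a = (r, e)" by force
  let ?w = "Am (\<not> e) (w + r - rep (\<not> e) (w + r))"
  have r: "r \<in> Zvec n" "ok ls" using Cons.prems a by auto
  note c = carry[OF Cons.prems(1) r(1), of "\<not> e"]
  have "hd (xl ?w ls) \<noteq> (0\<^sub>v n, \<not> e)" if ne: "ls \<noteq> []"
  proof
    assume h: "hd (xl ?w ls) = (0\<^sub>v n, \<not> e)"
    obtain r' e' ls' where ls: "ls = (r', e') # ls'" using ne by (cases ls) auto
    have r': "r' \<in> Zvec n" "rep (\<not> e') r' = r'" using r(2) ls by auto
    have "e' = (\<not> e)" "rep (\<not> e') (?w + r') = 0\<^sub>v n" using h ls by auto
    then have "r' = 0\<^sub>v n" using rep_add[of ?w e r'] c r' by simp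
    then show False using Cons.prems(2) a ls \<open>e' = (\<not> e)\<close> by simp
  qed
  then show ?case using Cons.IH[OF c(3) r(2)] a rep_props(1)[of "w + r"] rep_rep[of "w + r"]
      vsubD(3)[OF vsub_Zvec Cons.prems(1) r(1)] by simp
qed simp

lemma xr_Z: "w \<in> Zvec n \<Longrightarrow> ok ls \<Longrightarrow> xr w ls \<in> Zvec n"
proof (induction ls arbitrary: w)
  case (Cons a ls)
  then show ?case using carry(3) by (cases a) auto
qed simp

lemma x_zero_state: "ok ls \<Longrightarrow> xl (0\<^sub>v n) ls = ls \<and> xr (0\<^sub>v n) ls = 0\<^sub>v n"
proof (induction ls)
  case (Cons a ls)
  obtain r e where a: "a = (r, e)" by force
  have r: "r \<in> carrier_vec n" "rep (\<not> e) r = r" "ok ls" using Cons.prems a Zvec_carrier by auto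
  then have "r - r = 0\<^sub>v n" "0\<^sub>v n + r = r" by auto
  then show ?case using Cons.IH[OF r(3)] r a by (simp add: Am_zero)
qed simp

text \<open>Carries are additive: the carry of \<open>w + w'\<close> at a letter is the carry of
  \<open>w'\<close> there plus the carry of \<open>w\<close> at the letter already changed by
  \<open>w'\<close>.\<close>

lemma x_add_state:
  "w \<in> Zvec n \<Longrightarrow> w' \<in> Zvec n \<Longrightarrow> ok ls \<Longrightarrow>
    xl (w + w') ls = xl w (xl w' ls) \<and> xr (w + w') ls = xr w (xl w' ls) + xr w' ls"
proof (induction ls arbitrary: w w')
  case (Cons a ls)
  obtain r e where a: "a = (r, e)" by force
  let ?f = "\<not> e"
  have r: "r \<in> Zvec n" "ok ls" using Cons.prems a by auto
  let ?r1 = "rep ?f (w' + r)"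
  let ?l1 = "w' + r - ?r1"
  have r1: "?r1 \<in> Zvec n" using rep_props(1) vsubD(3)[OF vsub_Zvec Cons.prems(2) r(1)] by blast
  let ?l2 = "w + ?r1 - rep ?f (w + ?r1)"
  note c1 = carry[OF Cons.prems(2) r(1), of ?f] and c2 = carry[OF Cons.prems(1) r1, of ?f]
  note cc = Zvec_carrier[OF Cons.prems(1)] Zvec_carrier[OF Cons.prems(2)] Zvec_carrier[OF r(1)] Zvec_carrier[OF r1]
  have wr1: "w + ?r1 \<in> Zvec n" by (rule vsubD(3)[OF vsub_Zvec Cons.prems(1) r1])
  have "w + w' + r = ?l1 + (w + ?r1)" using cc by (intro eq_vecI) auto
  then have rr: "rep ?f (w + w' + r) = rep ?f (w + ?r1)" using rep_add[OF c1(1) wr1] by simp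
  note rc = Zvec_carrier[OF rep_props(1)[OF wr1, of ?f]]
  have "w + w' + r - rep ?f (w + ?r1) = ?l2 + ?l1" using cc rc by (intro eq_vecI) auto
  then have "Am ?f (w + w' + r - rep ?f (w + w' + r)) = Am ?f ?l2 + Am ?f ?l1"
    unfolding rr using Am_add[OF Zvec_carrier[OF Ls_Z[OF c2(1)]] Zvec_carrier[OF Ls_Z[OF c1(1)]]] by simp
  then show ?case using Cons.IH[OF c2(3) c1(3) r(2)] rr a by simp
qed simp

lemma Xs_\<Omega>: "w \<in> Zvec n \<Longrightarrow> s \<in> \<Omega> \<Longrightarrow> Xs w s \<in> \<Omega>"
  using xl_ok xr_Z vsubD(3)[OF vsub_Zvec] by (auto simp: \<Omega>_def Xs_def)

lemma Xs_zero: "s \<in> \<Omega> \<Longrightarrow> Xs (0\<^sub>v n) s = s"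
  using x_zero_state Zvec_carrier by (auto simp: \<Omega>_def Xs_def)

lemma Xs_add: "w \<in> Zvec n \<Longrightarrow> w' \<in> Zvec n \<Longrightarrow> s \<in> \<Omega> \<Longrightarrow> Xs (w + w') s = Xs w (Xs w' s)"
proof -
  assume w: "w \<in> Zvec n" "w' \<in> Zvec n" and "s \<in> \<Omega>"
  then obtain ls v where s: "s = (ls, v)" "ok ls" "v \<in> Zvec n" by (auto simp: \<Omega>_def)
  show "Xs (w + w') s = Xs w (Xs w' s)"
    using x_add_state[OF w s(2)] s(1) assoc_add_vec[OF Zvec_carrier[OF xr_Z[OF w(1) xl_ok[OF w(2) s(2)]]]
        Zvec_carrier[OF xr_Z[OF w(2) s(2)]] Zvec_carrier[OF s(3)]]
    by (simp add: Xs_def)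
qed

lemma Ts_\<Omega>: "s \<in> \<Omega> \<Longrightarrow> Ts e s \<in> \<Omega>"
proof -
  assume s: "s \<in> \<Omega>"
  show "Ts e s \<in> \<Omega>"
  proof (cases "fst s \<noteq> [] \<and> hd (fst s) = (0\<^sub>v n, \<not> e)")
    case True
    then show ?thesis using s by (cases s; cases "fst s") (auto simp: \<Omega>_def Ts_def)
  next
    case False
    then show ?thesis using s vsubD(2)[OF vsub_Zvec] by (auto simp: \<Omega>_def Ts_def)
  qed
qed

lemma Ts_push: "\<not> (fst s \<noteq> [] \<and> hd (fst s) = (0\<^sub>v n, \<not> e)) \<Longrightarrow> Ts e s = ((0\<^sub>v n, e) # fst s, snd s)"
  by (auto simp: Ts_def)

lemma Ts_pop: "Ts e ((0\<^sub>v n, \<not> e) # ls, v) = (ls, v)"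
  by (simp add: Ts_def)

lemma Ts_inv: "s \<in> \<Omega> \<Longrightarrow> Ts (\<not> e) (Ts e s) = s"
proof -
  assume s: "s \<in> \<Omega>"
  show "Ts (\<not> e) (Ts e s) = s"
  proof (cases "fst s \<noteq> [] \<and> hd (fst s) = (0\<^sub>v n, \<not> e)")
    case True
    then obtain ls v where ls: "s = ((0\<^sub>v n, \<not> e) # ls, v)" by (cases s; cases "fst s") auto
    then have "ls \<noteq> [] \<longrightarrow> hd ls \<noteq> (0\<^sub>v n, e)" using s by (auto simp: \<Omega>_def)
    then show ?thesis using ls Ts_pop[of e ls v] by (auto simp: Ts_def)
  next
    case False
    then show ?thesis using Ts_push[OF False] by (auto simp: Ts_def)
  qed
qed

text \<open>If \<open>Ts e\<close> cancels the first letter, its representative is trivial and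
  \<open>w\<close> is carried through it completely. Otherwise \<open>w \<in> Ls e\<close> cannot
  make the representative of an opposite first letter trivial, so both sides push a letter.\<close>

lemma Ts_Xs:
  assumes w: "w \<in> Ls e" and s: "s \<in> \<Omega>"
  shows "Ts e (Xs w s) = Xs (Am e w) (Ts e s)"
proof -
  note wZ = Ls_Z[OF w] and wc = Zvec_carrier[OF Ls_Z[OF w]]
  obtain ls v where sv: "s = (ls, v)" by force
  show ?thesis
  proof (cases "ls \<noteq> [] \<and> hd ls = (0\<^sub>v n, \<not> e)")
    case True
    then obtain ms where ls: "ls = (0\<^sub>v n, \<not> e) # ms" by (cases ls) auto
    have "w + 0\<^sub>v n = w" "w - 0\<^sub>v n = w" using wc by auto
    moreover have "rep e w = 0\<^sub>v n" using rep_0_iff[OF wZ] w by simp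
    ultimately show ?thesis unfolding sv ls by (simp add: Xs_def Ts_def)
  next
    case False
    have "\<not> (xl w ls \<noteq> [] \<and> hd (xl w ls) = (0\<^sub>v n, \<not> e))"
    proof
      assume h: "xl w ls \<noteq> [] \<and> hd (xl w ls) = (0\<^sub>v n, \<not> e)"
      then obtain r e' ms where ls: "ls = (r, e') # ms" by (cases ls) auto
      then have e': "e' = (\<not> e)" "rep e (w + r) = 0\<^sub>v n" using h by auto
      have "r \<in> Zvec n" "rep e r = r" using s sv ls e' by (auto simp: \<Omega>_def)
      then show False using False ls e' rep_add[OF w] by simp
    qed
    then have 1: "Ts e (Xs w s) = ((0\<^sub>v n, e) # xl w ls, xr w ls + v)"
      using Ts_push[of "Xs w s" e] by (simp add: sv Xs_def)
    have 2: "Ts e s = ((0\<^sub>v n, e) # ls, v)" using Ts_push[of s e] False sv by simp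
    have "rep (\<not> e) (Am e w) = 0\<^sub>v n" using rep_0_iff Ls_Z Am_Ls[OF w] by blast
    moreover have "Am e w + 0\<^sub>v n = Am e w" "Am e w - 0\<^sub>v n = Am e w" using right_zero_vec minus_zero_vec Am_carrier by blast+
    ultimately show ?thesis unfolding 1 2 using Am_Am(1)[OF wc] by (simp add: Xs_def)
  qed
qed

text \<open>\<open>perm_group\<close> consists of permutations of a whole type, so maps of
  \<open>\<Omega>\<close> are extended by the identity.\<close>

definition on\<Omega> :: "(nform \<Rightarrow> nform) \<Rightarrow> nform \<Rightarrow> nform" where
  "on\<Omega> f s = (if s \<in> \<Omega> then f s else s)"

lemma on\<Omega>_bij:
  assumes "\<And>s. s \<in> \<Omega> \<Longrightarrow> f s \<in> \<Omega>" "\<And>s. s \<in> \<Omega> \<Longrightarrow> g s \<in> \<Omega>"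
    "\<And>s. s \<in> \<Omega> \<Longrightarrow> f (g s) = s" "\<And>s. s \<in> \<Omega> \<Longrightarrow> g (f s) = s"
  shows "bij (on\<Omega> f)" "on\<Omega> f \<circ> on\<Omega> g = id" "on\<Omega> g \<circ> on\<Omega> f = id"
proof -
  show *: "on\<Omega> f \<circ> on\<Omega> g = id" "on\<Omega> g \<circ> on\<Omega> f = id" using assms by (auto simp: on\<Omega>_def)
  show "bij (on\<Omega> f)" by (rule o_bij[OF *(2,1)])
qed

lemma Xs_inv:
  assumes w: "w \<in> Zvec n" and s: "s \<in> \<Omega>"
  shows "Xs w (Xs (- w) s) = s" "Xs (- w) (Xs w s) = s"
  using Xs_add[OF w vsubD(4)[OF vsub_Zvec w] s] Xs_add[OF vsubD(4)[OF vsub_Zvec w] w s] Xs_zero[OF s]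
    Zvec_carrier[OF w] by simp_all

lemma action_exists:
  "\<exists>h\<in>hom G perm_group. (\<forall>v\<in>Zvec n. h (x v) = on\<Omega> (Xs v)) \<and> h t = on\<Omega> (Ts True)"
proof -
  have bX: "bij (on\<Omega> (Xs w))" if "w \<in> Zvec n" for w
    using Xs_\<Omega> Xs_inv vsubD(4)[OF vsub_Zvec] that by (intro on\<Omega>_bij(1)[of _ "Xs (- w)"]) auto
  have bT: "bij (on\<Omega> (Ts True))"
    using Ts_\<Omega> Ts_inv[of _ True] Ts_inv[of _ False] by (intro on\<Omega>_bij(1)[of _ "Ts False"]) auto
  have 1: "(\<lambda>v. on\<Omega> (Xs v)) \<in> hom (vgrp n (Zvec n)) perm_group"
    by (auto simp: hom_def bX on\<Omega>_def Xs_add Xs_\<Omega> fun_eq_iff)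
  have 2: "on\<Omega> (Ts True) \<in> carrier perm_group" using bT by simp
  have 3: "on\<Omega> (Ts True) \<otimes>\<^bsub>perm_group\<^esub> on\<Omega> (Xs v) = on\<Omega> (Xs (A *\<^sub>v v)) \<otimes>\<^bsub>perm_group\<^esub> on\<Omega> (Ts True)"
    if v: "v \<in> L" for v
    using Ts_Xs[of v True] v Xs_\<Omega>[OF L_Zvec[OF v]] Ts_\<Omega>
    by (auto simp: on\<Omega>_def fun_eq_iff Ls_def Am_def mact_1[OF A])
  obtain h where "h \<in> hom G perm_group" "\<And>v. v \<in> Zvec n \<Longrightarrow> h (x v) = on\<Omega> (Xs v)" "h t = on\<Omega> (Ts True)"
    using hom_exists[OF group_perm_group 1 2 3] by metis
  then show ?thesis by blast
qed

definition act :: "lm_gen word set \<Rightarrow> nform \<Rightarrow> nform" where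
  "act = (SOME h. h \<in> hom G perm_group \<and> (\<forall>v\<in>Zvec n. h (x v) = on\<Omega> (Xs v)) \<and> h t = on\<Omega> (Ts True))"

lemma act_props:
  "act \<in> hom G perm_group" "v \<in> Zvec n \<Longrightarrow> act (x v) = on\<Omega> (Xs v)" "act t = on\<Omega> (Ts True)"
proof -
  have "\<exists>h. h \<in> hom G perm_group \<and> (\<forall>v\<in>Zvec n. h (x v) = on\<Omega> (Xs v)) \<and> h t = on\<Omega> (Ts True)"
    using action_exists by blast
  from someI_ex[OF this, folded act_def]
  show "act \<in> hom G perm_group" "v \<in> Zvec n \<Longrightarrow> act (x v) = on\<Omega> (Xs v)" "act t = on\<Omega> (Ts True)" by auto
qed

sublocale act: group_hom G perm_group act
  by (intro group_hom.intro group_hom_axioms.intro G.group_axioms group_perm_group act_props)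

lemma act_mult: "g \<in> carrier G \<Longrightarrow> h \<in> carrier G \<Longrightarrow> act (g \<otimes>\<^bsub>G\<^esub> h) s = act g (act h s)"
  by simp

lemma act_one: "act \<one>\<^bsub>G\<^esub> s = s"
  by simp

lemma act_x: "v \<in> Zvec n \<Longrightarrow> s \<in> \<Omega> \<Longrightarrow> act (x v) s = Xs v s"
  by (simp add: act_props on\<Omega>_def)

lemma act_te: "s \<in> \<Omega> \<Longrightarrow> act (te e) s = Ts e s"
proof (cases e)
  case False
  have "on\<Omega> (Ts False) \<circ> on\<Omega> (Ts True) = id" "bij (on\<Omega> (Ts False))"
    using Ts_\<Omega> Ts_inv[of _ True] Ts_inv[of _ False] on\<Omega>_bij[of "Ts False" "Ts True"] by auto
  moreover have "bij (on\<Omega> (Ts True))" using act.hom_closed[OF t_closed] act_props(3) by simp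
  ultimately have "inv\<^bsub>perm_group\<^esub> (on\<Omega> (Ts True)) = on\<Omega> (Ts False)"
    by (intro group.inv_equality[OF group_perm_group]) auto
  then have "act (inv\<^bsub>G\<^esub> t) = on\<Omega> (Ts False)" using act.hom_inv[OF t_closed] act_props(3) by simp
  then show "s \<in> \<Omega> \<Longrightarrow> act (te e) s = Ts e s" using False by (simp add: te_def on\<Omega>_def)
qed (simp add: te_def act_props on\<Omega>_def)

section \<open>Existence and uniqueness of normal forms\<close>

definition Nw :: "(rat vec \<times> bool) list \<Rightarrow> lm_gen word set" where
  "Nw ls = foldr (\<lambda>a g. x (fst a) \<otimes>\<^bsub>G\<^esub> te (snd a) \<otimes>\<^bsub>G\<^esub> g) ls \<one>\<^bsub>G\<^esub>"

lemma Nw_simps [simp]: "Nw [] = \<one>\<^bsub>G\<^esub>" "Nw ((r, e) # ls) = x r \<otimes>\<^bsub>G\<^esub> te e \<otimes>\<^bsub>G\<^esub> Nw ls"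
  by (simp_all add: Nw_def)

lemma Nw_closed [simp]: "Nw ls \<in> carrier G"
  by (induction ls) auto

lemma Nw_append: "Nw (ls @ ms) = Nw ls \<otimes>\<^bsub>G\<^esub> Nw ms"
proof (induction ls)
  case (Cons a ls)
  then show ?case by (cases a) (simp add: G.m_assoc)
qed simp

definition val :: "nform \<Rightarrow> lm_gen word set" where
  "val s = Nw (fst s) \<otimes>\<^bsub>G\<^esub> x (snd s)"

lemma val_closed [simp]: "val s \<in> carrier G"
  by (simp add: val_def)

lemma val_Xs_aux: "ok ls \<Longrightarrow> w \<in> Zvec n \<Longrightarrow> x w \<otimes>\<^bsub>G\<^esub> Nw ls = Nw (xl w ls) \<otimes>\<^bsub>G\<^esub> x (xr w ls)"
proof (induction ls arbitrary: w)
  case (Cons a ls)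
  obtain r e where a: "a = (r, e)" by force
  have r: "r \<in> Zvec n" "ok ls" using Cons.prems a by auto
  let ?r = "rep (\<not> e) (w + r)"
  let ?l = "w + r - ?r"
  let ?w = "Am (\<not> e) ?l"
  note c = carry[OF Cons.prems(2) r(1), of "\<not> e"]
  have wr: "w + r \<in> Zvec n" by (rule vsubD(3)[OF vsub_Zvec Cons.prems(2) r(1)])
  note r' = rep_props(1)[OF wr, of "\<not> e"]
  have "w + r = ?r + ?l" using Zvec_carrier[OF wr] Zvec_carrier[OF r'] Zvec_carrier[OF r(1)] by (intro eq_vecI) auto
  then have 1: "x w \<otimes>\<^bsub>G\<^esub> x r = x ?r \<otimes>\<^bsub>G\<^esub> x ?l"
    using x_add[OF Cons.prems(2) r(1)] x_add[OF r' Ls_Z[OF c(1)]] by simp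
  have 2: "te e \<otimes>\<^bsub>G\<^esub> x ?w = x ?l \<otimes>\<^bsub>G\<^esub> te e"
    using te_x[of ?w e] c(2) Am_Am(2)[OF Zvec_carrier[OF Ls_Z[OF c(1)]]] by simp
  have "x w \<otimes>\<^bsub>G\<^esub> Nw (a # ls) = x w \<otimes>\<^bsub>G\<^esub> x r \<otimes>\<^bsub>G\<^esub> te e \<otimes>\<^bsub>G\<^esub> Nw ls" using a by (simp add: G.m_assoc)
  also have "\<dots> = x ?r \<otimes>\<^bsub>G\<^esub> (x ?l \<otimes>\<^bsub>G\<^esub> te e) \<otimes>\<^bsub>G\<^esub> Nw ls" unfolding 1 by (simp add: G.m_assoc)
  also have "\<dots> = x ?r \<otimes>\<^bsub>G\<^esub> te e \<otimes>\<^bsub>G\<^esub> (x ?w \<otimes>\<^bsub>G\<^esub> Nw ls)" unfolding 2[symmetric] by (simp add: G.m_assoc)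
  also have "\<dots> = Nw (xl w (a # ls)) \<otimes>\<^bsub>G\<^esub> x (xr w (a # ls))"
    unfolding Cons.IH[OF r(2) c(3)] using a by (simp add: G.m_assoc)
  finally show ?case .
qed simp

lemma val_Xs: "w \<in> Zvec n \<Longrightarrow> s \<in> \<Omega> \<Longrightarrow> val (Xs w s) = x w \<otimes>\<^bsub>G\<^esub> val s"
  using val_Xs_aux[of "fst s" w] xr_Z[of w "fst s"]
  by (auto simp: val_def Xs_def \<Omega>_def x_add G.m_assoc[symmetric])

lemma te_te: "te e \<otimes>\<^bsub>G\<^esub> te (\<not> e) = \<one>\<^bsub>G\<^esub>"
  by (simp add: te_def)

lemma val_Ts: "s \<in> \<Omega> \<Longrightarrow> val (Ts e s) = te e \<otimes>\<^bsub>G\<^esub> val s"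
proof -
  assume s: "s \<in> \<Omega>"
  show "val (Ts e s) = te e \<otimes>\<^bsub>G\<^esub> val s"
  proof (cases "fst s \<noteq> [] \<and> hd (fst s) = (0\<^sub>v n, \<not> e)")
    case True
    then obtain ls v where ls: "s = ((0\<^sub>v n, \<not> e) # ls, v)" by (cases s; cases "fst s") auto
    have "te e \<otimes>\<^bsub>G\<^esub> val s = (te e \<otimes>\<^bsub>G\<^esub> te (\<not> e)) \<otimes>\<^bsub>G\<^esub> Nw ls \<otimes>\<^bsub>G\<^esub> x v"
      unfolding ls val_def by (simp add: x_zero G.m_assoc)
    then show ?thesis unfolding te_te ls Ts_pop by (simp add: val_def)
  next
    case False
    then show ?thesis unfolding Ts_push[OF False] val_def by (simp add: x_zero G.m_assoc)
  qed
qed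

text \<open>Under \<open>val\<close> the action is left multiplication. Applied to
  \<open>base\<close>, whose value is the neutral element, this gives the existence of normal forms;
  uniqueness is the reverse computation \<open>nf_val\<close>.\<close>

lemma act_\<Omega>_val: "g \<in> carrier G \<Longrightarrow> s \<in> \<Omega> \<Longrightarrow> act g s \<in> \<Omega> \<and> val (act g s) = g \<otimes>\<^bsub>G\<^esub> val s"
proof (induction rule: lm_induct[consumes 1])
  case 1
  then show ?case using act_one by simp
next
  case (2 h v)
  then show ?case using act_x Xs_\<Omega> val_Xs by (simp add: act_mult G.m_assoc)
next
  case (3 h)
  then show ?case using act_te[of _ True] Ts_\<Omega> val_Ts[of _ True] by (simp add: act_mult G.m_assoc te_def)
next
  case (4 h)
  then show ?case using act_te[of _ False] Ts_\<Omega> val_Ts[of _ False] act_mult[of "inv\<^bsub>G\<^esub> t" h]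
    by (simp add: G.m_assoc te_def del: act.hom_mult act.hom_inv)
qed

lemma act_\<Omega>: "g \<in> carrier G \<Longrightarrow> s \<in> \<Omega> \<Longrightarrow> act g s \<in> \<Omega>"
  using act_\<Omega>_val by blast

definition base :: nform where "base = ([], 0\<^sub>v n)"

lemma base_\<Omega> [simp]: "base \<in> \<Omega>"
  using vsubD(2)[OF vsub_Zvec] by (simp add: base_def \<Omega>_def)

definition nf :: "lm_gen word set \<Rightarrow> nform" where "nf g = act g base"

lemma nf_\<Omega>: "g \<in> carrier G \<Longrightarrow> nf g \<in> \<Omega>"
  unfolding nf_def by (rule act_\<Omega>[OF _ base_\<Omega>])

lemma val_nf: "g \<in> carrier G \<Longrightarrow> val (nf g) = g"
  using act_\<Omega>_val[OF _ base_\<Omega>, of g] unfolding nf_def by (simp add: val_def base_def x_zero)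

lemma act_x_ne: "ok ls \<Longrightarrow> ok ((r, e) # ls) \<Longrightarrow> v \<in> Zvec n \<Longrightarrow> act (x r \<otimes>\<^bsub>G\<^esub> te e) (ls, v) = ((r, e) # ls, v)"
proof -
  assume ls: "ok ls" "ok ((r, e) # ls)" and v: "v \<in> Zvec n"
  have r: "r \<in> Zvec n" "rep (\<not> e) r = r" "r \<in> carrier_vec n" using ls(2) Zvec_carrier by auto
  have z: "r + 0\<^sub>v n = r" "r - r = 0\<^sub>v n" "0\<^sub>v n + v = v" using r(3) Zvec_carrier[OF v] by auto
  have s: "(ls, v) \<in> \<Omega>" using ls v by (simp add: \<Omega>_def)
  have "Ts e (ls, v) = ((0\<^sub>v n, e) # ls, v)" using Ts_push[of "(ls, v)" e] ls(2) by auto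
  moreover have "Xs r ((0\<^sub>v n, e) # ls, v) = ((r, e) # ls, v)"
    using r z x_zero_state[OF ls(1)] by (simp add: Xs_def Am_zero)
  ultimately show ?thesis using act_mult[of "x r" "te e"] act_te[OF s] act_x[OF r(1) Ts_\<Omega>[OF s], of e] by simp
qed

text \<open>Since the concatenated list has no pinch, \<open>ls\<close> is rebuilt in front of
  \<open>ms\<close> letter by letter, without cancellation.\<close>

lemma act_Nw: "ok (ls @ ms) \<Longrightarrow> v \<in> Zvec n \<Longrightarrow> act (Nw ls) (ms, v) = (ls @ ms, v)"
proof (induction ls)
  case Nil
  then show ?case using act_one by simp
next
  case (Cons a ls)
  obtain r e where a: "a = (r, e)" by force
  have ok: "ok (ls @ ms)" using Cons.prems a by simp
  have "act (Nw (a # ls)) (ms, v) = act (x r \<otimes>\<^bsub>G\<^esub> te e) (act (Nw ls) (ms, v))"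
    using act_mult[of "x r \<otimes>\<^bsub>G\<^esub> te e" "Nw ls"] a by simp
  then show ?case using Cons.IH[OF ok Cons.prems(2)] act_x_ne[OF ok _ Cons.prems(2), of r e] Cons.prems(1) a by simp
qed

lemma nf_val: "s \<in> \<Omega> \<Longrightarrow> nf (val s) = s"
proof -
  assume s: "s \<in> \<Omega>"
  obtain ls v where ls: "s = (ls, v)" "ok ls" "v \<in> Zvec n" using s by (auto simp: \<Omega>_def)
  have "v + 0\<^sub>v n = v" using Zvec_carrier[OF ls(3)] by auto
  then have "act (x v) base = ([], v)" using act_x[OF ls(3) base_\<Omega>] by (simp add: base_def Xs_def)
  then show "nf (val s) = s"
    using act_Nw[of ls "[]" v] ls act_mult[of "Nw ls" "x v"] by (simp add: nf_def val_def)
qed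

section \<open>Cosets of the base group as vertices of the tree\<close>

definition H :: "lm_gen word set set" where "H = x ` Zvec n"

text \<open>Right multiplication by elements of \<open>H\<close> does not change the list
  (\<open>path_mult_H\<close>), so it describes the coset \<open>gH\<close>: it is the reduced edge
  path from \<open>H\<close> to \<open>gH\<close> in the Bass--Serre tree.\<close>

definition path :: "lm_gen word set \<Rightarrow> (rat vec \<times> bool) list" where "path g = fst (nf g)"

lemma path_ok: "g \<in> carrier G \<Longrightarrow> ok (path g)"
  using nf_\<Omega>[of g] by (cases "nf g") (auto simp: path_def \<Omega>_def)

lemma path_decomp: "g \<in> carrier G \<Longrightarrow> \<exists>v\<in>Zvec n. g = Nw (path g) \<otimes>\<^bsub>G\<^esub> x v"
  using nf_\<Omega>[of g] val_nf[of g] by (auto simp: path_def val_def \<Omega>_def split: prod.splits intro!: bexI[of _ "snd (nf g)"])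

lemma path_val: "ok ls \<Longrightarrow> v \<in> Zvec n \<Longrightarrow> path (Nw ls \<otimes>\<^bsub>G\<^esub> x v) = ls"
  using nf_val[of "(ls, v)"] by (simp add: path_def val_def \<Omega>_def)

lemma path_Nil_iff: "g \<in> carrier G \<Longrightarrow> path g = [] \<longleftrightarrow> g \<in> H"
proof
  show "g \<in> carrier G \<Longrightarrow> path g = [] \<Longrightarrow> g \<in> H" using path_decomp[of g] by (auto simp: H_def)
  show "g \<in> H \<Longrightarrow> path g = []" using path_val[of "[]"] by (auto simp: H_def)
qed

lemma path_mult_H: 
  assumes g: "g \<in> carrier G" and v: "v \<in> Zvec n"
  shows "path (g \<otimes>\<^bsub>G\<^esub> x v) = path g"
proof -
  obtain w where w: "w \<in> Zvec n" "g = Nw (path g) \<otimes>\<^bsub>G\<^esub> x w" using path_decomp[OF g] by blast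
  have "g \<otimes>\<^bsub>G\<^esub> x v = Nw (path g) \<otimes>\<^bsub>G\<^esub> x (w + v)"
    by (subst w(2)) (simp add: x_add[OF w(1) v] G.m_assoc)
  then show ?thesis using path_val[OF path_ok[OF g] vsubD(3)[OF vsub_Zvec w(1) v]] by simp
qed

lemma path_H_mult: "g \<in> carrier G \<Longrightarrow> v \<in> Zvec n \<Longrightarrow> path (x v \<otimes>\<^bsub>G\<^esub> g) = xl v (path g)"
  using act_mult[of "x v" g] act_x[of v "nf g"] nf_\<Omega>[of g] by (simp add: path_def nf_def Xs_def)

text \<open>Both sides say that \<open>x u\<close> fixes the vertex \<open>gH\<close>, as left
  multiplication by \<open>x u\<close> acts on paths through \<open>xl u\<close>.\<close>

lemma conj_H_iff:
  assumes g: "g \<in> carrier G" and u: "u \<in> Zvec n"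
  shows "inv\<^bsub>G\<^esub> g \<otimes>\<^bsub>G\<^esub> x u \<otimes>\<^bsub>G\<^esub> g \<in> H \<longleftrightarrow> xl u (path g) = path g"
proof
  assume "inv\<^bsub>G\<^esub> g \<otimes>\<^bsub>G\<^esub> x u \<otimes>\<^bsub>G\<^esub> g \<in> H"
  then obtain w where w: "w \<in> Zvec n" "inv\<^bsub>G\<^esub> g \<otimes>\<^bsub>G\<^esub> x u \<otimes>\<^bsub>G\<^esub> g = x w" by (auto simp: H_def)
  have "x u \<otimes>\<^bsub>G\<^esub> g = g \<otimes>\<^bsub>G\<^esub> (inv\<^bsub>G\<^esub> g \<otimes>\<^bsub>G\<^esub> x u \<otimes>\<^bsub>G\<^esub> g)" using g by (simp add: G.m_assoc[symmetric])
  then show "xl u (path g) = path g" using path_H_mult[OF g u] path_mult_H[OF g w(1)] w(2) by simp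
next
  assume eq: "xl u (path g) = path g"
  obtain v where v: "v \<in> Zvec n" "g = Nw (path g) \<otimes>\<^bsub>G\<^esub> x v" using path_decomp[OF g] by blast
  obtain w where w: "w \<in> Zvec n" "x u \<otimes>\<^bsub>G\<^esub> g = Nw (path g) \<otimes>\<^bsub>G\<^esub> x w"
    using path_decomp[of "x u \<otimes>\<^bsub>G\<^esub> g"] path_H_mult[OF g u] eq g by auto
  have "inv\<^bsub>G\<^esub> g = inv\<^bsub>G\<^esub> (x v) \<otimes>\<^bsub>G\<^esub> inv\<^bsub>G\<^esub> (Nw (path g))" by (subst v(2)) (simp add: G.inv_mult_group)
  then have "inv\<^bsub>G\<^esub> g \<otimes>\<^bsub>G\<^esub> (x u \<otimes>\<^bsub>G\<^esub> g) = inv\<^bsub>G\<^esub> (x v) \<otimes>\<^bsub>G\<^esub> (inv\<^bsub>G\<^esub> (Nw (path g)) \<otimes>\<^bsub>G\<^esub> (Nw (path g) \<otimes>\<^bsub>G\<^esub> x w))"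
    unfolding w(2) by (simp add: G.m_assoc)
  also have "\<dots> = x (- v + w)" using x_add[OF vsubD(4)[OF vsub_Zvec v(1)] w(1)] x_uminus[OF v(1)]
    by (simp add: G.m_assoc[symmetric])
  finally have "inv\<^bsub>G\<^esub> g \<otimes>\<^bsub>G\<^esub> x u \<otimes>\<^bsub>G\<^esub> g = x (- v + w)" using g by (simp add: G.m_assoc)
  then show "inv\<^bsub>G\<^esub> g \<otimes>\<^bsub>G\<^esub> x u \<otimes>\<^bsub>G\<^esub> g \<in> H"
    using vsubD(3)[OF vsub_Zvec vsubD(4)[OF vsub_Zvec v(1)] w(1)] by (auto simp: H_def)
qed

end

section \<open>Virtual commutation and elliptic elements\<close>

definition commutator :: "('a, 'b) monoid_scheme \<Rightarrow> 'a \<Rightarrow> 'a \<Rightarrow> 'a" where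
  "commutator G g h = g \<otimes>\<^bsub>G\<^esub> h \<otimes>\<^bsub>G\<^esub> inv\<^bsub>G\<^esub> g \<otimes>\<^bsub>G\<^esub> inv\<^bsub>G\<^esub> h"

lemma (in group) commutator_closed [simp]:
  "g \<in> carrier G \<Longrightarrow> h \<in> carrier G \<Longrightarrow> commutator G g h \<in> carrier G"
  by (simp add: commutator_def)

lemma (in group_hom) hom_commutator:
  "g \<in> carrier G \<Longrightarrow> k \<in> carrier G \<Longrightarrow> h (commutator G g k) = commutator H (h g) (h k)"
  by (simp add: commutator_def)

text \<open>This isomorphism-invariant property singles out the conjugates of the base group.\<close>

definition virt_comm :: "('a, 'b) monoid_scheme \<Rightarrow> 'a \<Rightarrow> bool" where
  "virt_comm G k \<longleftrightarrow> (\<forall>y\<in>carrier G. \<exists>m::nat. m \<ge> 1 \<and>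
    k \<otimes>\<^bsub>G\<^esub> (y \<otimes>\<^bsub>G\<^esub> k [^]\<^bsub>G\<^esub> m \<otimes>\<^bsub>G\<^esub> inv\<^bsub>G\<^esub> y) = y \<otimes>\<^bsub>G\<^esub> k [^]\<^bsub>G\<^esub> m \<otimes>\<^bsub>G\<^esub> inv\<^bsub>G\<^esub> y \<otimes>\<^bsub>G\<^esub> k)"

lemma virt_comm_iso:
  assumes "group G" "group K" and h: "h \<in> iso G K" and k: "k \<in> carrier G" "virt_comm G k"
  shows "virt_comm K (h k)"
  unfolding virt_comm_def
proof
  interpret h: group_hom G K h using assms by (simp add: group_hom_def group_hom_axioms_def iso_def)
  fix y assume "y \<in> carrier K"
  then obtain z where z: "z \<in> carrier G" "y = h z" using h by (auto simp: iso_def bij_betw_def)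
  obtain m :: nat where m: "m \<ge> 1" "k \<otimes>\<^bsub>G\<^esub> (z \<otimes>\<^bsub>G\<^esub> k [^]\<^bsub>G\<^esub> m \<otimes>\<^bsub>G\<^esub> inv\<^bsub>G\<^esub> z) = z \<otimes>\<^bsub>G\<^esub> k [^]\<^bsub>G\<^esub> m \<otimes>\<^bsub>G\<^esub> inv\<^bsub>G\<^esub> z \<otimes>\<^bsub>G\<^esub> k"
    using k z(1) unfolding virt_comm_def by blast
  have "h (k \<otimes>\<^bsub>G\<^esub> (z \<otimes>\<^bsub>G\<^esub> k [^]\<^bsub>G\<^esub> m \<otimes>\<^bsub>G\<^esub> inv\<^bsub>G\<^esub> z)) = h (z \<otimes>\<^bsub>G\<^esub> k [^]\<^bsub>G\<^esub> m \<otimes>\<^bsub>G\<^esub> inv\<^bsub>G\<^esub> z \<otimes>\<^bsub>G\<^esub> k)"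
    using m(2) by simp
  then have "h k \<otimes>\<^bsub>K\<^esub> (y \<otimes>\<^bsub>K\<^esub> h k [^]\<^bsub>K\<^esub> m \<otimes>\<^bsub>K\<^esub> inv\<^bsub>K\<^esub> y) = y \<otimes>\<^bsub>K\<^esub> h k [^]\<^bsub>K\<^esub> m \<otimes>\<^bsub>K\<^esub> inv\<^bsub>K\<^esub> y \<otimes>\<^bsub>K\<^esub> h k"
    using k z by (simp add: h.hom_nat_pow)
  then show "\<exists>m::nat. m \<ge> 1 \<and> h k \<otimes>\<^bsub>K\<^esub> (y \<otimes>\<^bsub>K\<^esub> h k [^]\<^bsub>K\<^esub> m \<otimes>\<^bsub>K\<^esub> inv\<^bsub>K\<^esub> y) = y \<otimes>\<^bsub>K\<^esub> h k [^]\<^bsub>K\<^esub> m \<otimes>\<^bsub>K\<^esub> inv\<^bsub>K\<^esub> y \<otimes>\<^bsub>K\<^esub> h k"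
    using m(1) by blast
qed

lemma (in group) inv_mult_cancel:
  "x \<in> carrier G \<Longrightarrow> y \<in> carrier G \<Longrightarrow> inv x \<otimes> (x \<otimes> y) = y"
  "x \<in> carrier G \<Longrightarrow> y \<in> carrier G \<Longrightarrow> x \<otimes> (inv x \<otimes> y) = y"
  by (simp_all add: m_assoc[symmetric])

lemma (in group) conj_aut:
  assumes c: "c \<in> carrier G"
  shows "(\<lambda>g. inv c \<otimes> g \<otimes> c) \<in> iso G G"
proof (rule iso_of_inverse_homs[of _ _ _ "\<lambda>g. c \<otimes> g \<otimes> inv c"])
  note r = inv_mult_cancel[OF c]
  show "(\<lambda>g. inv c \<otimes> g \<otimes> c) \<in> hom G G" "(\<lambda>g. c \<otimes> g \<otimes> inv c) \<in> hom G G"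
    using c by (auto simp: hom_def m_assoc r)
  show "c \<otimes> (inv c \<otimes> y \<otimes> c) \<otimes> inv c = y" "inv c \<otimes> (c \<otimes> y \<otimes> inv c) \<otimes> c = y" if "y \<in> carrier G" for y
    using that c by (simp_all add: m_assoc r)
qed

lemma (in group) conj_conj:
  "c \<in> carrier G \<Longrightarrow> d \<in> carrier G \<Longrightarrow> g \<in> carrier G \<Longrightarrow>
    inv (c \<otimes> d) \<otimes> g \<otimes> (c \<otimes> d) = inv d \<otimes> (inv c \<otimes> g \<otimes> c) \<otimes> d"
  by (simp add: inv_mult_group m_assoc)

text \<open>Commutators have exponent zero, hence lie in the commutative subgroup
  \<open>U\<close>.\<close>

lemma sdp_metabelian:
  assumes "sdp_data n A U" and g: "a \<in> carrier (sdp n A U)" "b \<in> carrier (sdp n A U)"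
    "c \<in> carrier (sdp n A U)" "d \<in> carrier (sdp n A U)"
  shows "commutator (sdp n A U) (commutator (sdp n A U) a b) (commutator (sdp n A U) c d) = \<one>\<^bsub>sdp n A U\<^esub>"
proof -
  interpret S: sdp_data n A U by fact
  interpret s: group_hom S.S zgrp snd
    by (intro group_hom.intro group_hom_axioms.intro S.S.group_axioms group_zgrp) (auto simp: hom_def)
  have "inv\<^bsub>zgrp\<^esub> j = - j" for j by (rule group.inv_equality[OF group_zgrp]) auto
  then have 0: "snd (commutator S.S x y) = 0" if "x \<in> carrier S.S" "y \<in> carrier S.S" for x y
    using s.hom_commutator[OF that] by (simp add: commutator_def)
  have cm: "x \<otimes>\<^bsub>S.S\<^esub> y = y \<otimes>\<^bsub>S.S\<^esub> x" if "x \<in> carrier S.S" "y \<in> carrier S.S" "snd x = 0" "snd y = 0" for x y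
    using that comm_add_vec[of "fst x" n "fst y"] by (auto simp: mact_0[OF S.A])
  let ?x = "commutator S.S a b" and ?y = "commutator S.S c d"
  have k: "?x \<in> carrier S.S" "?y \<in> carrier S.S" using S.S.commutator_closed g by blast+
  have "commutator S.S ?x ?y = (?y \<otimes>\<^bsub>S.S\<^esub> ?x) \<otimes>\<^bsub>S.S\<^esub> inv\<^bsub>S.S\<^esub> ?x \<otimes>\<^bsub>S.S\<^esub> inv\<^bsub>S.S\<^esub> ?y"
    unfolding commutator_def[of _ ?x] using cm[OF k 0[OF g(1,2)] 0[OF g(3,4)]] by (simp only:)
  then show ?thesis using k S.S.m_assoc S.S.r_inv S.S.inv_closed S.S.m_closed S.S.r_one by metis
qed

context lm_data
begin

lemma H_subgroup: "subgroup H G"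
proof (rule G.subgroupI)
  show "H \<subseteq> carrier G" by (auto simp: H_def)
  show "H \<noteq> {}" using vsubD(2)[OF vsub_Zvec, of n] by (auto simp: H_def)
  show "inv\<^bsub>G\<^esub> g \<in> H" if "g \<in> H" for g
    using that vsubD(4)[OF vsub_Zvec] by (auto simp: H_def x_uminus[symmetric])
  show "g \<otimes>\<^bsub>G\<^esub> h \<in> H" if "g \<in> H" "h \<in> H" for g h
    using that vsubD(3)[OF vsub_Zvec] by (auto simp: H_def x_add[symmetric])
qed

lemma x_nat_pow: "v \<in> Zvec n \<Longrightarrow> x v [^]\<^bsub>G\<^esub> (m::nat) = x (of_nat m \<cdot>\<^sub>v v)"
proof -
  assume v: "v \<in> Zvec n"
  interpret e: group_hom "vgrp n (Zvec n)" G x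
    using x_hom G.group_axioms group_vgrp[OF vsub_Zvec] by (simp add: group_hom_def group_hom_axioms_def)
  show ?thesis using e.hom_nat_pow[of v m] v nat_pow_vgrp[OF vsub_Zvec v] by simp
qed

lemma tor_Ls:
  assumes w: "w \<in> Zvec n"
  shows "\<exists>m::nat. m \<ge> 1 \<and> of_nat m \<cdot>\<^sub>v w \<in> Ls e"
proof (cases e)
  case True
  then show ?thesis using tor[OF w] by (simp add: Ls_def)
next
  case False
  interpret I: lm_data n "inv\<^bsub>GLQ n\<^esub> A" "mat_image A L" by (rule lm_data_inv)
  show ?thesis using I.tor[OF w] False by (simp add: Ls_def)
qed

lemma te_conj_power_in_H:
  assumes h: "h \<in> carrier G"
    and IH: "\<exists>m::nat. m \<ge> 1 \<and> h \<otimes>\<^bsub>G\<^esub> x v [^]\<^bsub>G\<^esub> m \<otimes>\<^bsub>G\<^esub> inv\<^bsub>G\<^esub> h \<in> H"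
  shows "\<exists>m::nat. m \<ge> 1 \<and> te e \<otimes>\<^bsub>G\<^esub> h \<otimes>\<^bsub>G\<^esub> x v [^]\<^bsub>G\<^esub> m \<otimes>\<^bsub>G\<^esub> inv\<^bsub>G\<^esub> (te e \<otimes>\<^bsub>G\<^esub> h) \<in> H"
proof -
  obtain m :: nat and w where m: "m \<ge> 1" "w \<in> Zvec n" "h \<otimes>\<^bsub>G\<^esub> x v [^]\<^bsub>G\<^esub> m \<otimes>\<^bsub>G\<^esub> inv\<^bsub>G\<^esub> h = x w"
    using IH by (auto simp: H_def)
  obtain k where k: "k \<ge> 1" "of_nat k \<cdot>\<^sub>v w \<in> Ls e" using tor_Ls[OF m(2)] by blast
  have pw: "h \<otimes>\<^bsub>G\<^esub> g [^]\<^bsub>G\<^esub> k \<otimes>\<^bsub>G\<^esub> inv\<^bsub>G\<^esub> h = (h \<otimes>\<^bsub>G\<^esub> g \<otimes>\<^bsub>G\<^esub> inv\<^bsub>G\<^esub> h) [^]\<^bsub>G\<^esub> k" if g: "g \<in> carrier G" for g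
  proof -
    have "h \<otimes>\<^bsub>G\<^esub> g = (h \<otimes>\<^bsub>G\<^esub> g \<otimes>\<^bsub>G\<^esub> inv\<^bsub>G\<^esub> h) \<otimes>\<^bsub>G\<^esub> h" using h g by (simp add: G.m_assoc)
    from G.conj_int_pow[OF h g _ this, of "int k"]
    show ?thesis using h g by (simp add: int_pow_int G.m_assoc)
  qed
  have "h \<otimes>\<^bsub>G\<^esub> x v [^]\<^bsub>G\<^esub> (m * k) \<otimes>\<^bsub>G\<^esub> inv\<^bsub>G\<^esub> h = h \<otimes>\<^bsub>G\<^esub> (x v [^]\<^bsub>G\<^esub> m) [^]\<^bsub>G\<^esub> k \<otimes>\<^bsub>G\<^esub> inv\<^bsub>G\<^esub> h"
    by (simp add: G.nat_pow_pow)
  also have "\<dots> = x (of_nat k \<cdot>\<^sub>v w)" using pw[of "x v [^]\<^bsub>G\<^esub> m"] m x_nat_pow by simp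
  finally have 1: "h \<otimes>\<^bsub>G\<^esub> x v [^]\<^bsub>G\<^esub> (m * k) \<otimes>\<^bsub>G\<^esub> inv\<^bsub>G\<^esub> h = x (of_nat k \<cdot>\<^sub>v w)" .
  have "te e \<otimes>\<^bsub>G\<^esub> h \<otimes>\<^bsub>G\<^esub> x v [^]\<^bsub>G\<^esub> (m * k) \<otimes>\<^bsub>G\<^esub> inv\<^bsub>G\<^esub> (te e \<otimes>\<^bsub>G\<^esub> h)
    = te e \<otimes>\<^bsub>G\<^esub> (h \<otimes>\<^bsub>G\<^esub> x v [^]\<^bsub>G\<^esub> (m * k) \<otimes>\<^bsub>G\<^esub> inv\<^bsub>G\<^esub> h) \<otimes>\<^bsub>G\<^esub> inv\<^bsub>G\<^esub> (te e)"
    using h by (simp add: G.inv_mult_group G.m_assoc)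
  also have "\<dots> = x (Am e (of_nat k \<cdot>\<^sub>v w))" unfolding 1 te_x[OF k(2)] by (simp add: G.m_assoc)
  finally have "te e \<otimes>\<^bsub>G\<^esub> h \<otimes>\<^bsub>G\<^esub> x v [^]\<^bsub>G\<^esub> (m * k) \<otimes>\<^bsub>G\<^esub> inv\<^bsub>G\<^esub> (te e \<otimes>\<^bsub>G\<^esub> h) \<in> H"
    using Ls_Z[OF Am_Ls[OF k(2)]] by (auto simp: H_def)
  then show ?thesis using m(1) k(1) by (intro exI[of _ "m * k"]) auto
qed

text \<open>Commensurability of \<open>H\<close> with its conjugates. Each further stable letter
  requires a multiple lying in its edge group, which exists by \<open>tor_Ls\<close>; the exponents
  multiply.\<close>

lemma conj_power_in_H:
  "y \<in> carrier G \<Longrightarrow> v \<in> Zvec n \<Longrightarrow> \<exists>m::nat. m \<ge> 1 \<and> y \<otimes>\<^bsub>G\<^esub> x v [^]\<^bsub>G\<^esub> m \<otimes>\<^bsub>G\<^esub> inv\<^bsub>G\<^esub> y \<in> H"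
proof (induction y rule: lm_induct[consumes 1])
  case 1
  then show ?case by (intro exI[of _ 1]) (auto simp: H_def)
next
  case (2 h w)
  then obtain m :: nat where m: "m \<ge> 1" "h \<otimes>\<^bsub>G\<^esub> x v [^]\<^bsub>G\<^esub> m \<otimes>\<^bsub>G\<^esub> inv\<^bsub>G\<^esub> h \<in> H" by blast
  have wH: "x w \<in> H" using 2 by (auto simp: H_def)
  have "x w \<otimes>\<^bsub>G\<^esub> h \<otimes>\<^bsub>G\<^esub> x v [^]\<^bsub>G\<^esub> m \<otimes>\<^bsub>G\<^esub> inv\<^bsub>G\<^esub> (x w \<otimes>\<^bsub>G\<^esub> h)
    = x w \<otimes>\<^bsub>G\<^esub> (h \<otimes>\<^bsub>G\<^esub> x v [^]\<^bsub>G\<^esub> m \<otimes>\<^bsub>G\<^esub> inv\<^bsub>G\<^esub> h) \<otimes>\<^bsub>G\<^esub> inv\<^bsub>G\<^esub> (x w)"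
    using 2 by (simp add: G.inv_mult_group G.m_assoc)
  then show ?case using m wH H_subgroup by (metis subgroup.m_closed subgroup.m_inv_closed)
next
  case (3 h)
  then show ?case using te_conj_power_in_H[of h v True] by (simp add: te_def)
next
  case (4 h)
  then show ?case using te_conj_power_in_H[of h v False] by (simp add: te_def)
qed

lemma x_virt_comm:
  assumes v: "v \<in> Zvec n"
  shows "virt_comm G (x v)"
  unfolding virt_comm_def
proof
  fix y assume y: "y \<in> carrier G"
  obtain m :: nat and w where "m \<ge> 1" "y \<otimes>\<^bsub>G\<^esub> x v [^]\<^bsub>G\<^esub> m \<otimes>\<^bsub>G\<^esub> inv\<^bsub>G\<^esub> y = x w" "w \<in> Zvec n"
    using conj_power_in_H[OF y v] by (auto simp: H_def)
  then show "\<exists>m::nat. m \<ge> 1 \<and> x v \<otimes>\<^bsub>G\<^esub> (y \<otimes>\<^bsub>G\<^esub> x v [^]\<^bsub>G\<^esub> m \<otimes>\<^bsub>G\<^esub> inv\<^bsub>G\<^esub> y)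
    = y \<otimes>\<^bsub>G\<^esub> x v [^]\<^bsub>G\<^esub> m \<otimes>\<^bsub>G\<^esub> inv\<^bsub>G\<^esub> y \<otimes>\<^bsub>G\<^esub> x v"
    using x_comm[OF v] by metis
qed

text \<open>The states with a prescribed first edge are the sets between which ping-pong is
  played.\<close>

definition hd_is :: "nform \<Rightarrow> rat vec \<Rightarrow> bool \<Rightarrow> bool" where
  "hd_is s r e \<longleftrightarrow> s \<in> \<Omega> \<and> fst s \<noteq> [] \<and> hd (fst s) = (r, e)"

lemma hd_is_\<Omega>: "hd_is s r e \<Longrightarrow> s \<in> \<Omega>"
  by (simp add: hd_is_def)

lemma hd_is_unique: "hd_is s r e \<Longrightarrow> hd_is s r' e' \<Longrightarrow> r = r' \<and> e = e'"
  by (simp add: hd_is_def)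

lemma not_hd_is_base: "\<not> hd_is base r e"
  by (simp add: hd_is_def base_def)

lemma not_hd_is_x_base: "v \<in> Zvec n \<Longrightarrow> act (x v) base \<in> \<Omega> \<and> \<not> hd_is (act (x v) base) r e"
proof -
  assume v: "v \<in> Zvec n"
  have "fst (Xs v base) = []" by (simp add: Xs_def base_def)
  then show ?thesis using act_x[OF v base_\<Omega>] Xs_\<Omega>[OF v base_\<Omega>] by (simp add: hd_is_def)
qed

lemma hd_is_x: "hd_is s r e \<Longrightarrow> w \<in> Zvec n \<Longrightarrow> hd_is (act (x w) s) (rep (\<not> e) (w + r)) e"
  using act_x[of w s] Xs_\<Omega>[of w s] xl_hd[of "fst s" w] by (auto simp: hd_is_def Xs_def)

lemma hd_is_te: "s \<in> \<Omega> \<Longrightarrow> \<not> hd_is s (0\<^sub>v n) (\<not> e) \<Longrightarrow> hd_is (act (te e) s) (0\<^sub>v n) e"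
  using act_te[of s e] Ts_\<Omega>[of s e] Ts_push[of s e] by (auto simp: hd_is_def)

text \<open>\<open>te f\<close> cancels only an opposite first letter whose representative is
  trivial after \<open>x w\<close>, and this means \<open>w \<in> Ls f\<close>.\<close>

lemma hd_is_step:
  assumes s: "hd_is s (0\<^sub>v n) e" and w: "w \<in> Zvec n" and e: "f = e \<or> w \<notin> Ls f"
  shows "hd_is (act (te f) (act (x w) s)) (0\<^sub>v n) f"
proof (rule hd_is_te)
  have wz: "w + 0\<^sub>v n = w" using Zvec_carrier[OF w] by simp
  have h: "hd_is (act (x w) s) (rep (\<not> e) w) e" using hd_is_x[OF s w] unfolding wz .
  then show "act (x w) s \<in> \<Omega>" by (rule hd_is_\<Omega>)
  show "\<not> hd_is (act (x w) s) (0\<^sub>v n) (\<not> f)"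
  proof
    assume "hd_is (act (x w) s) (0\<^sub>v n) (\<not> f)"
    from hd_is_unique[OF h this] have "rep (\<not> e) w = 0\<^sub>v n" "e = (\<not> f)" by auto
    then show False using e rep_0_iff[OF w, of f] by auto
  qed
qed

lemma ok_append:
  "ok ls \<Longrightarrow> ok ms \<Longrightarrow> (ls \<noteq> [] \<Longrightarrow> ms \<noteq> [] \<Longrightarrow> hd ms \<noteq> (0\<^sub>v n, \<not> snd (last ls))) \<Longrightarrow> ok (ls @ ms)"
proof (induction ls)
  case (Cons a ls)
  then show ?case by (cases a; cases ls) auto
qed simp

lemma ok_append_left: "ok (ls @ ms) \<Longrightarrow> ok ls"
proof (induction ls)
  case (Cons a ls)
  then show ?case by (cases a; cases ls) auto
qed simp

lemma act_Nw_hd: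
  assumes ls: "ok ls" "ls \<noteq> []" and s: "s \<in> \<Omega>" "\<not> hd_is s (0\<^sub>v n) (\<not> snd (last ls))"
  shows "act (Nw ls) s \<in> \<Omega> \<and> (\<exists>ms. fst (act (Nw ls) s) = ls @ ms)"
proof -
  obtain ms v where ms: "s = (ms, v)" "ok ms" "v \<in> Zvec n" using s(1) by (auto simp: \<Omega>_def)
  have "ok (ls @ ms)" using ls ms s by (intro ok_append) (auto simp: hd_is_def)
  from act_Nw[OF this ms(3)] show ?thesis using act_\<Omega>[OF Nw_closed s(1), of ls] ms(1) by simp
qed

text \<open>A group is not the union of two proper subgroups: if \<open>a\<close> and
  \<open>b\<close> each avoid just one of them, then \<open>a + b\<close> avoids both.\<close>

lemma proper_union:
  assumes "Ls True \<noteq> Zvec n" "Ls False \<noteq> Zvec n"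
  obtains v where "v \<in> Zvec n" "v \<notin> Ls True" "v \<notin> Ls False"
proof -
  obtain a b where ab: "a \<in> Zvec n" "a \<notin> Ls True" "b \<in> Zvec n" "b \<notin> Ls False" using assms Ls_Z by blast
  show ?thesis
  proof (cases "a \<in> Ls False \<and> b \<in> Ls True")
    case True
    have "a = (a + b) - b" "b = (a + b) - a"
      using Zvec_carrier[OF ab(1)] Zvec_carrier[OF ab(3)] by (auto intro!: eq_vecI)
    then have "a + b \<notin> Ls True" "a + b \<notin> Ls False"
      using True ab vsubD(5)[OF Ls_vsub] by metis+
    then show ?thesis using that vsubD(3)[OF vsub_Zvec ab(1,3)] by blast
  next
    case False
    then show ?thesis using that ab by blast
  qed
qed

lemma Ls_uminus: "v \<in> Zvec n \<Longrightarrow> - v \<in> Ls e \<longleftrightarrow> v \<in> Ls e"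
  using vsubD(4)[OF Ls_vsub, of v e] vsubD(4)[OF Ls_vsub, of "- v" e] by auto

text \<open>For \<open>v\<close> outside both edge groups the double commutator built from
  \<open>x v\<close>, \<open>t\<close> and the inverse of \<open>t\<close> is a word without
  pinches, so it moves \<open>base\<close>.\<close>

theorem not_metabelian:
  assumes na: "Ls True \<noteq> Zvec n" "Ls False \<noteq> Zvec n"
  obtains a b c d where "a \<in> carrier G" "b \<in> carrier G" "c \<in> carrier G" "d \<in> carrier G"
    "commutator G (commutator G a b) (commutator G c d) \<noteq> \<one>\<^bsub>G\<^esub>"
proof -
  obtain v where v: "v \<in> Zvec n" "\<And>e. v \<notin> Ls e" using proper_union[OF na] by (metis (full_types))
  have v': "- v \<in> Zvec n" "\<And>e. - v \<notin> Ls e" using vsubD(4)[OF vsub_Zvec v(1)] Ls_uminus[OF v(1)] v(2) by auto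
  let ?a = "x v" and ?ai = "x (- v)" and ?t = "te True" and ?i = "te False"
  have it: "inv\<^bsub>G\<^esub> ?t = ?i" "inv\<^bsub>G\<^esub> ?i = ?t" "inv\<^bsub>G\<^esub> ?a = ?ai" "inv\<^bsub>G\<^esub> ?ai = ?a"
    using x_uminus[OF v(1)] by (simp_all add: te_def)
  let ?w = "commutator G (commutator G ?a ?t) (commutator G ?a ?i)"
  have w: "?w = ?a \<otimes>\<^bsub>G\<^esub> (?t \<otimes>\<^bsub>G\<^esub> (?ai \<otimes>\<^bsub>G\<^esub> (?i \<otimes>\<^bsub>G\<^esub> (?a \<otimes>\<^bsub>G\<^esub> (?i \<otimes>\<^bsub>G\<^esub> (?ai \<otimes>\<^bsub>G\<^esub> (?t \<otimes>\<^bsub>G\<^esub> (?t \<otimes>\<^bsub>G\<^esub> (?a \<otimes>\<^bsub>G\<^esub>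
    (?i \<otimes>\<^bsub>G\<^esub> (?ai \<otimes>\<^bsub>G\<^esub> (?i \<otimes>\<^bsub>G\<^esub> (?a \<otimes>\<^bsub>G\<^esub> (?t \<otimes>\<^bsub>G\<^esub> ?ai))))))))))))))"
    by (simp add: commutator_def G.inv_mult_group G.m_assoc it)
  \<comment> \<open>The word is applied to \<open>base\<close> from right to left; the facts below
    follow the first edge after each stable letter.\<close>
  let ?s1 = "act ?t (act ?ai base)"
  have 1: "hd_is ?s1 (0\<^sub>v n) True" using not_hd_is_x_base[OF v'(1)] by (intro hd_is_te) auto
  note 2 = hd_is_step[OF 1 v(1), of False, OF disjI2[OF v(2)]]
  note 3 = hd_is_step[OF 2 v'(1), of False, OF disjI1[OF refl]]
  note 4 = hd_is_step[OF 3 v(1), of True, OF disjI2[OF v(2)]]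
  have 5: "hd_is (act ?t s) (0\<^sub>v n) True" if "hd_is s (0\<^sub>v n) True" for s
    using hd_is_te[OF hd_is_\<Omega>[OF that], of True] that by (auto simp: hd_is_def)
  note 6 = hd_is_step[OF 5[OF 4] v'(1), of False, OF disjI2[OF v'(2)]]
  note 7 = hd_is_step[OF 6 v(1), of False, OF disjI1[OF refl]]
  note 8 = hd_is_step[OF 7 v'(1), of True, OF disjI2[OF v'(2)]]
  note 9 = hd_is_x[OF 8 v(1)]
  have "act ?w base \<noteq> base" using 9 not_hd_is_base unfolding w by (auto simp: act_mult simp del: act.hom_mult)
  then have "?w \<noteq> \<one>\<^bsub>G\<^esub>" using act_one by metis
  then show ?thesis using that[of ?a ?t ?a ?i] by simp
qed

definition elliptic :: "lm_gen word set \<Rightarrow> bool" where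
  "elliptic k \<longleftrightarrow> (\<exists>c\<in>carrier G. inv\<^bsub>G\<^esub> c \<otimes>\<^bsub>G\<^esub> k \<otimes>\<^bsub>G\<^esub> c \<in> H)"

text \<open>Conjugation by the first representative moves it to the end of the word. If the last and
  the first stable letter then form a pinch across the end, conjugation by the first one removes
  both, and induction on the length of the path applies.\<close>

lemma cyclically_reduced:
  "k \<in> carrier G \<Longrightarrow> elliptic k \<or> (\<exists>c\<in>carrier G. \<exists>e ls. \<exists>v\<in>Zvec n.
    inv\<^bsub>G\<^esub> c \<otimes>\<^bsub>G\<^esub> k \<otimes>\<^bsub>G\<^esub> c = Nw ((0\<^sub>v n, e) # ls) \<otimes>\<^bsub>G\<^esub> x v \<and> ok ((0\<^sub>v n, e) # ls) \<and>
    (snd (last ((0\<^sub>v n, e) # ls)) = e \<or> v \<notin> Ls (snd (last ((0\<^sub>v n, e) # ls)))))"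
proof (induction "length (path k)" arbitrary: k rule: less_induct)
  case less
  note k = less.prems
  obtain v where v: "v \<in> Zvec n" "k = Nw (path k) \<otimes>\<^bsub>G\<^esub> x v" using path_decomp[OF k] by blast
  show ?case
  proof (cases "path k")
    case Nil
    then have "inv\<^bsub>G\<^esub> \<one>\<^bsub>G\<^esub> \<otimes>\<^bsub>G\<^esub> k \<otimes>\<^bsub>G\<^esub> \<one>\<^bsub>G\<^esub> \<in> H" using path_Nil_iff[OF k] k by simp
    then show ?thesis unfolding elliptic_def by blast
  next
    case (Cons a ls)
    obtain r e where a: "a = (r, e)" by force
    have okk: "ok ((r, e) # ls)" using path_ok[OF k] Cons a by simp
    then have r: "r \<in> Zvec n" and ok0: "ok ((0\<^sub>v n, e) # ls)" using vsubD(2)[OF vsub_Zvec] by auto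
    let ?u = "v + r"
    have u: "?u \<in> Zvec n" by (rule vsubD(3)[OF vsub_Zvec v(1) r])
    have k1: "inv\<^bsub>G\<^esub> (x r) \<otimes>\<^bsub>G\<^esub> k \<otimes>\<^bsub>G\<^esub> x r = Nw ((0\<^sub>v n, e) # ls) \<otimes>\<^bsub>G\<^esub> x ?u"
    proof -
      have "k = x r \<otimes>\<^bsub>G\<^esub> (te e \<otimes>\<^bsub>G\<^esub> Nw ls \<otimes>\<^bsub>G\<^esub> x v)" by (subst v(2)) (simp add: Cons a G.m_assoc)
      then have "inv\<^bsub>G\<^esub> (x r) \<otimes>\<^bsub>G\<^esub> k = te e \<otimes>\<^bsub>G\<^esub> Nw ls \<otimes>\<^bsub>G\<^esub> x v" by (simp add: G.m_assoc[symmetric])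
      then show ?thesis using x_add[OF v(1) r] by (simp add: x_zero G.m_assoc)
    qed
    let ?en = "snd (last ((0\<^sub>v n, e) # ls))"
    show ?thesis
    proof (cases "?en = e \<or> ?u \<notin> Ls ?en")
      case True
      show ?thesis
        by (intro disjI2 bexI[of _ "x r"] exI[of _ e] exI[of _ ls] bexI[of _ ?u] conjI k1 ok0 True u x_closed)
    next
      case False
      then have ne: "ls \<noteq> []" and en: "?en = (\<not> e)" and uL: "?u \<in> Ls (\<not> e)" by auto
      obtain ms b where "ls = ms @ [b]" using ne by (cases ls rule: rev_cases) auto
      moreover from this obtain r' where "b = (r', \<not> e)" using en by (cases b) auto
      ultimately have ms: "ls = ms @ [(r', \<not> e)]" by simp
      have okls: "ok ls" using okk by simp
      have okms: "ok ms" using okls ms ok_append_left by simp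
      have r': "r' \<in> Zvec n"
      proof -
        have "ok (ms @ ys) \<Longrightarrow> ok ys" for ys by (induction ms) (auto elim: ok.elims)
        then show ?thesis using okls ms by fastforce
      qed
      \<comment> \<open>What remains at the end after the pinch: the last representative and
        \<open>?u\<close> carried through the last stable letter.\<close>
      let ?w = "r' + Am (\<not> e) ?u"
      have aZ: "Am (\<not> e) ?u \<in> Zvec n" using Ls_Z[OF Am_Ls[OF uL]] .
      have wZ: "?w \<in> Zvec n" by (rule vsubD(3)[OF vsub_Zvec r' aZ])
      let ?c = "x r \<otimes>\<^bsub>G\<^esub> te e"
      have "inv\<^bsub>G\<^esub> ?c \<otimes>\<^bsub>G\<^esub> k \<otimes>\<^bsub>G\<^esub> ?c = inv\<^bsub>G\<^esub> (te e) \<otimes>\<^bsub>G\<^esub> (Nw ((0\<^sub>v n, e) # ls) \<otimes>\<^bsub>G\<^esub> x ?u) \<otimes>\<^bsub>G\<^esub> te e"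
        using G.conj_conj[OF x_closed te_closed k] k1 by simp
      also have "\<dots> = Nw ms \<otimes>\<^bsub>G\<^esub> x r' \<otimes>\<^bsub>G\<^esub> (te (\<not> e) \<otimes>\<^bsub>G\<^esub> x ?u) \<otimes>\<^bsub>G\<^esub> te e"
        unfolding ms by (simp add: Nw_append x_zero G.m_assoc G.inv_mult_cancel)
      also have "\<dots> = Nw ms \<otimes>\<^bsub>G\<^esub> x r' \<otimes>\<^bsub>G\<^esub> x (Am (\<not> e) ?u) \<otimes>\<^bsub>G\<^esub> (te (\<not> e) \<otimes>\<^bsub>G\<^esub> te e)"
        unfolding te_x[OF uL] by (simp add: G.m_assoc)
      also have "\<dots> = Nw ms \<otimes>\<^bsub>G\<^esub> x ?w"
        using te_te[of "\<not> e"] x_add[OF r' aZ] by (simp add: G.m_assoc)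
      finally have k2: "inv\<^bsub>G\<^esub> ?c \<otimes>\<^bsub>G\<^esub> k \<otimes>\<^bsub>G\<^esub> ?c = Nw ms \<otimes>\<^bsub>G\<^esub> x ?w" .
      let ?k = "Nw ms \<otimes>\<^bsub>G\<^esub> x ?w"
      have cc: "?c \<in> carrier G" "?k \<in> carrier G" by simp_all
      have "path ?k = ms" by (rule path_val[OF okms wZ])
      then have len: "length (path ?k) < length (path k)" using Cons ms by simp
      have comp: "inv\<^bsub>G\<^esub> (?c \<otimes>\<^bsub>G\<^esub> d) \<otimes>\<^bsub>G\<^esub> k \<otimes>\<^bsub>G\<^esub> (?c \<otimes>\<^bsub>G\<^esub> d) = inv\<^bsub>G\<^esub> d \<otimes>\<^bsub>G\<^esub> ?k \<otimes>\<^bsub>G\<^esub> d" if "d \<in> carrier G" for d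
        using G.conj_conj[OF cc(1) that k] unfolding k2 .
      from less.hyps[OF len cc(2)] show ?thesis
      proof
        assume "elliptic ?k"
        then obtain d where d: "d \<in> carrier G" "inv\<^bsub>G\<^esub> d \<otimes>\<^bsub>G\<^esub> ?k \<otimes>\<^bsub>G\<^esub> d \<in> H" unfolding elliptic_def by blast
        have "elliptic k" unfolding elliptic_def
          by (rule bexI[of _ "?c \<otimes>\<^bsub>G\<^esub> d"]) (unfold comp[OF d(1)], rule d(2), rule G.m_closed[OF cc(1) d(1)])
        then show ?thesis ..
      next
        assume "\<exists>c\<in>carrier G. \<exists>e ls. \<exists>v\<in>Zvec n.
          inv\<^bsub>G\<^esub> c \<otimes>\<^bsub>G\<^esub> ?k \<otimes>\<^bsub>G\<^esub> c = Nw ((0\<^sub>v n, e) # ls) \<otimes>\<^bsub>G\<^esub> x v \<and> ok ((0\<^sub>v n, e) # ls) \<and>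
          (snd (last ((0\<^sub>v n, e) # ls)) = e \<or> v \<notin> Ls (snd (last ((0\<^sub>v n, e) # ls))))"
        then obtain d f ls' v' where d: "d \<in> carrier G" and v': "v' \<in> Zvec n"
          and P: "inv\<^bsub>G\<^esub> d \<otimes>\<^bsub>G\<^esub> ?k \<otimes>\<^bsub>G\<^esub> d = Nw ((0\<^sub>v n, f) # ls') \<otimes>\<^bsub>G\<^esub> x v' \<and> ok ((0\<^sub>v n, f) # ls') \<and>
          (snd (last ((0\<^sub>v n, f) # ls')) = f \<or> v' \<notin> Ls (snd (last ((0\<^sub>v n, f) # ls'))))" by blast
        show ?thesis
          by (intro disjI2 bexI[of _ "?c \<otimes>\<^bsub>G\<^esub> d"] exI[of _ f] exI[of _ ls'] bexI[of _ v'])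
            (unfold comp[OF d], rule P, rule v', rule G.m_closed[OF cc(1) d])
      qed
    qed
  qed
qed

end

context lm_data
begin

text \<open>Ping-pong between the normal forms that start like \<open>k\<close> and those that start like a suitable
  elliptic element \<open>y\<close> whose first edge is neither the first edge of \<open>k\<close> nor that of its inverse.\<close>

lemma cyclically_reduced_not_virt_comm:
  assumes na: "\<And>e. Ls e \<noteq> Zvec n"
    and ls: "ok ((0\<^sub>v n, e) # ls)" and v: "v \<in> Zvec n"
    and cyc: "snd (last ((0\<^sub>v n, e) # ls)) = e \<or> v \<notin> Ls (snd (last ((0\<^sub>v n, e) # ls)))"
  shows "\<not> virt_comm G (Nw ((0\<^sub>v n, e) # ls) \<otimes>\<^bsub>G\<^esub> x v)"
proof
  let ?ls = "(0\<^sub>v n, e) # ls"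
  define en where "en = snd (last ?ls)"
  define k where "k = Nw ?ls \<otimes>\<^bsub>G\<^esub> x v"
  assume "virt_comm G (Nw ?ls \<otimes>\<^bsub>G\<^esub> x v)"
  then have vc: "virt_comm G k" by (simp add: k_def)
  have kc: "k \<in> carrier G" by (simp add: k_def)
  have zZ: "0\<^sub>v n \<in> Zvec n" by (rule vsubD(2)[OF vsub_Zvec])
  \<comment> \<open>The edge \<open>(b, f)\<close>, with \<open>b\<close> the representative of
    \<open>a\<close>, has to differ from the first edges of \<open>k\<close> and of its inverse. The
    latter has sign \<open>\<not> en\<close>. For \<open>en = e\<close> the sign \<open>e\<close>
    avoids it and a nontrivial representative avoids the former; for \<open>en = (\<not> e)\<close>
    the sign \<open>\<not> e\<close> avoids both.\<close>
  obtain f a where fa: "a \<in> Zvec n" "(en = e \<and> f = e \<and> a \<notin> Ls (\<not> e)) \<or> (en = (\<not> e) \<and> f = (\<not> e) \<and> a = 0\<^sub>v n)"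
  proof (cases "en = e")
    case True
    obtain a where "a \<in> Zvec n" "a \<notin> Ls (\<not> e)" using na[of "\<not> e"] Ls_Z by blast
    then show ?thesis using that[of a e] True by simp
  next
    case False
    then show ?thesis using that[of "0\<^sub>v n" "\<not> e"] zZ by simp
  qed
  \<comment> \<open>Because \<open>c\<close> lies outside \<open>Ls f\<close>, the stable letters on
    both sides of \<open>x c\<close> in \<open>?y\<close> do not cancel.\<close>
  obtain c where c: "c \<in> Zvec n" "c \<notin> Ls f" using na[of f] Ls_Z by blast
  define b where "b = rep (\<not> f) a"
  have b0: "b \<noteq> 0\<^sub>v n \<or> f \<noteq> e" using fa rep_0_iff[OF fa(1)] by (auto simp: b_def)
  define S1 where "S1 s \<longleftrightarrow> hd_is s (0\<^sub>v n) e" for s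
  define S2 where "S2 s \<longleftrightarrow> hd_is s b f" for s
  have disj: "\<not> (S1 s \<and> S2 s)" for s
    using hd_is_unique[of s "0\<^sub>v n" e b f] b0 by (auto simp: S1_def S2_def)
  have k_act: "S1 (act k s)" if s: "s \<in> \<Omega>" "\<not> hd_is (act (x v) s) (0\<^sub>v n) (\<not> en)" for s
  proof -
    have "act (Nw ?ls) (act (x v) s) \<in> \<Omega> \<and> (\<exists>ms. fst (act (Nw ?ls) (act (x v) s)) = ?ls @ ms)"
      using s act_\<Omega>[OF x_closed s(1)] unfolding en_def by (intro act_Nw_hd[OF ls]) auto
    then have "hd_is (act (Nw ?ls) (act (x v) s)) (0\<^sub>v n) e" by (auto simp: hd_is_def)
    then show ?thesis using act_mult[OF Nw_closed x_closed] by (simp only: S1_def k_def)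
  qed
  have k1: "S1 (act k s)" if s: "S1 s" for s
  proof (rule k_act)
    show "s \<in> \<Omega>" by (rule hd_is_\<Omega>[OF s[unfolded S1_def]])
    have v0: "v + 0\<^sub>v n = v" using Zvec_carrier[OF v] by simp
    have "hd_is (act (x v) s) (rep (\<not> e) v) e" using hd_is_x[of s "0\<^sub>v n" e v] s v unfolding v0 S1_def by simp
    then have "r = rep (\<not> e) v \<and> g = e" if "hd_is (act (x v) s) r g" for r g using hd_is_unique that by blast
    moreover have "rep (\<not> e) v \<noteq> 0\<^sub>v n \<or> en = e"
    proof (cases "en = e")
      case False
      then have "en = (\<not> e)" by simp
      then show ?thesis using cyc rep_0_iff[OF v, of "\<not> e"] unfolding en_def[symmetric] by (simp only:) simp
    qed simp
    ultimately show "\<not> hd_is (act (x v) s) (0\<^sub>v n) (\<not> en)" by metis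
  qed
  \<comment> \<open>Cancellation against the last letter of \<open>k\<close> would need the sign
    \<open>\<not> en\<close>, but \<open>f = en\<close> in both cases.\<close>
  have k2: "S1 (act k s)" if s: "S2 s" for s
  proof (rule k_act)
    show "s \<in> \<Omega>" by (rule hd_is_\<Omega>[OF s[unfolded S2_def]])
    have "hd_is (act (x v) s) (rep (\<not> f) (v + b)) f" using hd_is_x[of s b f v] s v unfolding S2_def by simp
    then have "g = f" if "hd_is (act (x v) s) r g" for r g using hd_is_unique that by blast
    then show "\<not> hd_is (act (x v) s) (0\<^sub>v n) (\<not> en)" using fa by blast
  qed
  have k0: "S1 (act k base)" using not_hd_is_x_base[OF v] by (intro k_act) auto
  have y_act: "S2 (act (x a \<otimes>\<^bsub>G\<^esub> te f \<otimes>\<^bsub>G\<^esub> x d \<otimes>\<^bsub>G\<^esub> te (\<not> f) \<otimes>\<^bsub>G\<^esub> x (- a)) s)"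
    if d: "d \<in> Zvec n" "d \<notin> Ls f" and s: "s = base \<or> S1 s" for d s
  proof -
    have a': "- a \<in> Zvec n" by (rule vsubD(4)[OF vsub_Zvec fa(1)])
    have s\<Omega>: "s \<in> \<Omega>" using s base_\<Omega> hd_is_\<Omega>[of s "0\<^sub>v n" e] unfolding S1_def by blast
    let ?s = "act (x (- a)) s"
    have "\<not> hd_is ?s (0\<^sub>v n) f"
    proof
      assume h: "hd_is ?s (0\<^sub>v n) f"
      then have "S1 s" using s not_hd_is_x_base[OF a'] by blast
      have a0: "- a + 0\<^sub>v n = - a" using Zvec_carrier[OF a'] by simp
      have "hd_is ?s (rep (\<not> e) (- a)) e" using hd_is_x[of s "0\<^sub>v n" e "- a"] \<open>S1 s\<close> a' unfolding a0 S1_def by simp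
      from hd_is_unique[OF h this] have "f = e" "rep (\<not> e) (- a) = 0\<^sub>v n" by auto
      then show False using fa(2) rep_0_iff[OF a'] Ls_uminus[OF fa(1)] by auto
    qed
    then have 1: "hd_is (act (te (\<not> f)) ?s) (0\<^sub>v n) (\<not> f)"
      using act_\<Omega>[OF x_closed s\<Omega>] by (intro hd_is_te) auto
    note 2 = hd_is_step[OF 1 d(1), of f, OF disjI2[OF d(2)]]
    have a0: "a + 0\<^sub>v n = a" using Zvec_carrier[OF fa(1)] by simp
    have "hd_is (act (x a) (act (te f) (act (x d) (act (te (\<not> f)) ?s)))) b f"
      using hd_is_x[OF 2 fa(1)] unfolding a0 b_def .
    then show ?thesis unfolding S2_def by (simp add: act_mult del: act.hom_mult)
  qed
  let ?y = "x a \<otimes>\<^bsub>G\<^esub> te f \<otimes>\<^bsub>G\<^esub> x c \<otimes>\<^bsub>G\<^esub> te (\<not> f) \<otimes>\<^bsub>G\<^esub> x (- a)"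
  have c': "- c \<in> Zvec n" "- c \<notin> Ls f" using vsubD(4)[OF vsub_Zvec c(1)] Ls_uminus[OF c(1)] c(2) by auto
  have yi: "inv\<^bsub>G\<^esub> ?y = x a \<otimes>\<^bsub>G\<^esub> te f \<otimes>\<^bsub>G\<^esub> x (- c) \<otimes>\<^bsub>G\<^esub> te (\<not> f) \<otimes>\<^bsub>G\<^esub> x (- a)"
    using x_uminus[OF fa(1)] x_uminus[OF c(1)] by (simp add: G.inv_mult_group G.m_assoc te_def)
  have y1: "S2 (act ?y s)" if "s = base \<or> S1 s" for s by (rule y_act[OF c that])
  have y2: "S2 (act (inv\<^bsub>G\<^esub> ?y) s)" if "s = base \<or> S1 s" for s unfolding yi by (rule y_act[OF c' that])
  have yc: "?y \<in> carrier G" by simp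
  obtain m :: nat where m: "m \<ge> 1"
    "k \<otimes>\<^bsub>G\<^esub> (?y \<otimes>\<^bsub>G\<^esub> k [^]\<^bsub>G\<^esub> m \<otimes>\<^bsub>G\<^esub> inv\<^bsub>G\<^esub> ?y) = ?y \<otimes>\<^bsub>G\<^esub> k [^]\<^bsub>G\<^esub> m \<otimes>\<^bsub>G\<^esub> inv\<^bsub>G\<^esub> ?y \<otimes>\<^bsub>G\<^esub> k"
    using vc yc unfolding virt_comm_def by blast
  have km: "S1 (act (k [^]\<^bsub>G\<^esub> Suc j) s)" if s: "S2 s" for s j
  proof (induction j)
    case 0
    then show ?case using k2[OF s] kc by simp
  next
    case (Suc j)
    have "k [^]\<^bsub>G\<^esub> Suc (Suc j) = k \<otimes>\<^bsub>G\<^esub> k [^]\<^bsub>G\<^esub> Suc j" by (rule G.nat_pow_Suc2[OF kc])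
    then show ?case using k1[OF Suc] act_mult[OF kc G.nat_pow_closed[OF kc]] by (simp only:)
  qed
  obtain j where j: "m = Suc j" using m(1) by (cases m) auto
  have kmc: "k [^]\<^bsub>G\<^esub> m \<in> carrier G" by (rule G.nat_pow_closed[OF kc])
  have conj: "S2 (act (?y \<otimes>\<^bsub>G\<^esub> k [^]\<^bsub>G\<^esub> m \<otimes>\<^bsub>G\<^esub> inv\<^bsub>G\<^esub> ?y) s)" if "s = base \<or> S1 s" for s
  proof -
    have "S2 (act ?y (act (k [^]\<^bsub>G\<^esub> m) (act (inv\<^bsub>G\<^esub> ?y) s)))"
      using y1[OF disjI2[OF km[OF y2[OF that], of j]]] unfolding j .
    then show ?thesis using yc kmc
      by (simp only: act_mult[OF G.m_closed[OF yc kmc] G.inv_closed[OF yc]] act_mult[OF yc kmc])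
  qed
  let ?z = "?y \<otimes>\<^bsub>G\<^esub> k [^]\<^bsub>G\<^esub> m \<otimes>\<^bsub>G\<^esub> inv\<^bsub>G\<^esub> ?y"
  have zc: "?z \<in> carrier G" by (intro G.m_closed yc kmc G.inv_closed[OF yc])
  \<comment> \<open>The two sides of the commutation relation move \<open>base\<close> to states
    with different first edges.\<close>
  have "S1 (act (k \<otimes>\<^bsub>G\<^esub> ?z) base)"
    using k2[OF conj[OF disjI1[OF refl]]] by (simp only: act_mult[OF kc zc])
  moreover have "S2 (act (?z \<otimes>\<^bsub>G\<^esub> k) base)"
    using conj[OF disjI2[OF k0]] by (simp only: act_mult[OF zc kc])
  ultimately show False using disj unfolding m(2) by blast
qed

theorem virt_comm_elliptic:
  assumes na: "\<And>e. Ls e \<noteq> Zvec n" and k: "k \<in> carrier G" "virt_comm G k"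
  shows "elliptic k"
proof (rule ccontr)
  assume "\<not> elliptic k"
  then obtain c e ls v where c: "c \<in> carrier G" "v \<in> Zvec n"
    "inv\<^bsub>G\<^esub> c \<otimes>\<^bsub>G\<^esub> k \<otimes>\<^bsub>G\<^esub> c = Nw ((0\<^sub>v n, e) # ls) \<otimes>\<^bsub>G\<^esub> x v" "ok ((0\<^sub>v n, e) # ls)"
    "snd (last ((0\<^sub>v n, e) # ls)) = e \<or> v \<notin> Ls (snd (last ((0\<^sub>v n, e) # ls)))"
    using cyclically_reduced[OF k(1)] by blast
  have "virt_comm G (inv\<^bsub>G\<^esub> c \<otimes>\<^bsub>G\<^esub> k \<otimes>\<^bsub>G\<^esub> c)"
    by (rule virt_comm_iso[OF G.group_axioms G.group_axioms G.conj_aut[OF c(1)] k])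
  then show False using cyclically_reduced_not_virt_comm[OF na c(4,2,5)] c(3) by simp
qed

text \<open>Inverting a normal form reverses it without creating pinches, so the inverse of the last
  stable letter comes first.\<close>

lemma hd_is_inv_Nw:
  "ok (ls @ [(r, e)]) \<Longrightarrow> hd_is (act (inv\<^bsub>G\<^esub> (Nw (ls @ [(r, e)]))) base) (0\<^sub>v n) (\<not> e)"
proof (induction ls arbitrary: r e rule: rev_induct)
  case Nil
  have r: "r \<in> Zvec n" "- r \<in> Zvec n" using Nil vsubD(4)[OF vsub_Zvec] by auto
  have "inv\<^bsub>G\<^esub> (Nw ([] @ [(r, e)])) = te (\<not> e) \<otimes>\<^bsub>G\<^esub> x (- r)"
    using x_uminus[OF r(1)] by (simp add: G.inv_mult_group te_def)
  then have "act (inv\<^bsub>G\<^esub> (Nw ([] @ [(r, e)]))) base = act (te (\<not> e)) (act (x (- r)) base)"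
    by (simp only: act_mult[OF te_closed x_closed])
  moreover have "hd_is (act (te (\<not> e)) (act (x (- r)) base)) (0\<^sub>v n) (\<not> e)"
    using not_hd_is_x_base[OF r(2)] by (intro hd_is_te) auto
  ultimately show ?case by simp
next
  case (snoc a ls)
  obtain r' e' where a: "a = (r', e')" by force
  have ok1: "ok (ls @ [(r', e')])" using ok_append_left[of "ls @ [a]" "[(r, e)]"] snoc.prems a by simp
  have sub: "ok (ms @ ys) \<Longrightarrow> ok ys" for ms ys by (induction ms) (auto elim: ok.elims)
  have "ok [a, (r, e)]" using sub[of ls "[a, (r, e)]"] snoc.prems by simp
  then have r: "r \<in> Zvec n" "rep (\<not> e) r = r" "(r, e) \<noteq> (0\<^sub>v n, \<not> e')" using a by auto
  have r': "- r \<in> Zvec n" by (rule vsubD(4)[OF vsub_Zvec r(1)])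
  let ?s = "act (inv\<^bsub>G\<^esub> (Nw (ls @ [a]))) base"
  have IH: "hd_is ?s (0\<^sub>v n) (\<not> e')" using snoc.IH[OF ok1] a by simp
  have "inv\<^bsub>G\<^esub> (Nw ((ls @ [a]) @ [(r, e)])) = te (\<not> e) \<otimes>\<^bsub>G\<^esub> x (- r) \<otimes>\<^bsub>G\<^esub> inv\<^bsub>G\<^esub> (Nw (ls @ [a]))"
    unfolding Nw_append[of "ls @ [a]"] using x_uminus[OF r(1)] by (simp add: G.inv_mult_group te_def G.m_assoc)
  then have eq: "act (inv\<^bsub>G\<^esub> (Nw ((ls @ [a]) @ [(r, e)]))) base = act (te (\<not> e)) (act (x (- r)) ?s)"
    by (simp only: act_mult[OF G.m_closed[OF te_closed x_closed] G.inv_closed[OF Nw_closed]] act_mult[OF te_closed x_closed])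
  have "(\<not> e) = (\<not> e') \<or> - r \<notin> Ls (\<not> e)"
  proof (rule ccontr)
    assume "\<not> ((\<not> e) = (\<not> e') \<or> - r \<notin> Ls (\<not> e))"
    then have ee: "e' = (\<not> e)" and "- r \<in> Ls (\<not> e)" by blast+
    then have "r \<in> Ls (\<not> e)" using Ls_uminus[OF r(1)] by blast
    then have "r = 0\<^sub>v n" using r(2) rep_0_iff[OF r(1), of "\<not> e"] by simp
    then show False using r(3) ee by blast
  qed
  from hd_is_step[OF IH r' this] show ?case unfolding eq .
qed

text \<open>An element of \<open>H\<close> that fixes the end of a path starting at \<open>H\<close>
  fixes every vertex on it: letters and carries are computed from the left.\<close>

lemma xl_append_left: "xl w (ls @ ms) = ls @ ms \<Longrightarrow> xl w ls = ls"
proof (induction ls arbitrary: w)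
  case (Cons a ls)
  obtain r e where a: "a = (r, e)" by force
  let ?w = "Am (\<not> e) (w + r - rep (\<not> e) (w + r))"
  have *: "rep (\<not> e) (w + r) = r \<and> xl ?w (ls @ ms) = ls @ ms"
    using Cons.prems unfolding a append_Cons xl.simps list.inject prod.inject by (rule conjE) blast
  note conjunct1[OF *] conjunct2[OF *]
  then show ?case using Cons.IH[of ?w] unfolding a xl.simps by (simp only:)
qed simp

text \<open>Among the vertices fixed by \<open>k\<close>, one with shortest path \<open>ls\<close>
  from the vertex \<open>H\<close> is chosen. By minimality the path from \<open>H\<close> to its
  image under \<open>k\<close> runs through it. An \<open>x u\<close> that commutes with
  \<open>k\<close> fixes \<open>H\<close>, hence also this image, and therefore the whole path
  between them.\<close>

lemma elliptic_fixed_point: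
  assumes k: "k \<in> carrier G" "elliptic k"
  shows "\<exists>g\<in>carrier G. inv\<^bsub>G\<^esub> g \<otimes>\<^bsub>G\<^esub> k \<otimes>\<^bsub>G\<^esub> g \<in> H \<and>
    (\<forall>u\<in>Zvec n. x u \<otimes>\<^bsub>G\<^esub> k = k \<otimes>\<^bsub>G\<^esub> x u \<longrightarrow> inv\<^bsub>G\<^esub> g \<otimes>\<^bsub>G\<^esub> x u \<otimes>\<^bsub>G\<^esub> g \<in> H)"
proof -
  define Q where "Q ls \<longleftrightarrow> ok ls \<and> inv\<^bsub>G\<^esub> (Nw ls) \<otimes>\<^bsub>G\<^esub> k \<otimes>\<^bsub>G\<^esub> Nw ls \<in> H" for ls
  have "\<exists>ls. Q ls"
  proof -
    obtain c where c: "c \<in> carrier G" "inv\<^bsub>G\<^esub> c \<otimes>\<^bsub>G\<^esub> k \<otimes>\<^bsub>G\<^esub> c \<in> H" using k(2) unfolding elliptic_def by blast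
    obtain w where w: "w \<in> Zvec n" "c = Nw (path c) \<otimes>\<^bsub>G\<^esub> x w" using path_decomp[OF c(1)] by blast
    let ?N = "Nw (path c)"
    have xw: "x w \<in> H" using w by (auto simp: H_def)
    have "inv\<^bsub>G\<^esub> c \<otimes>\<^bsub>G\<^esub> k \<otimes>\<^bsub>G\<^esub> c = inv\<^bsub>G\<^esub> (x w) \<otimes>\<^bsub>G\<^esub> (inv\<^bsub>G\<^esub> ?N \<otimes>\<^bsub>G\<^esub> k \<otimes>\<^bsub>G\<^esub> ?N) \<otimes>\<^bsub>G\<^esub> x w"
      using G.conj_conj[OF Nw_closed x_closed k(1), of "path c" w] w(2) by simp
    then have "inv\<^bsub>G\<^esub> ?N \<otimes>\<^bsub>G\<^esub> k \<otimes>\<^bsub>G\<^esub> ?N = x w \<otimes>\<^bsub>G\<^esub> (inv\<^bsub>G\<^esub> c \<otimes>\<^bsub>G\<^esub> k \<otimes>\<^bsub>G\<^esub> c) \<otimes>\<^bsub>G\<^esub> inv\<^bsub>G\<^esub> (x w)"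
      using k(1) by (simp add: G.m_assoc G.inv_mult_cancel)
    then have "inv\<^bsub>G\<^esub> ?N \<otimes>\<^bsub>G\<^esub> k \<otimes>\<^bsub>G\<^esub> ?N \<in> H"
      using xw c(2) H_subgroup by (metis subgroup.m_closed subgroup.m_inv_closed)
    then show ?thesis using path_ok[OF c(1)] unfolding Q_def by blast
  qed
  then obtain ls where ls: "Q ls" and min: "\<And>ms. Q ms \<Longrightarrow> length ls \<le> length ms"
    using ex_has_least_nat[of Q _ length] by metis
  have okl: "ok ls" using ls by (simp add: Q_def)
  obtain v where v: "v \<in> Zvec n" "inv\<^bsub>G\<^esub> (Nw ls) \<otimes>\<^bsub>G\<^esub> k \<otimes>\<^bsub>G\<^esub> Nw ls = x v" using ls by (auto simp: Q_def H_def)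
  have k_eq: "k = Nw ls \<otimes>\<^bsub>G\<^esub> (x v \<otimes>\<^bsub>G\<^esub> inv\<^bsub>G\<^esub> (Nw ls))"
    unfolding v(2)[symmetric] using k(1) by (simp add: G.m_assoc G.inv_mult_cancel)
  show ?thesis
  proof (intro bexI[of _ "Nw ls"] conjI ballI impI)
    show "inv\<^bsub>G\<^esub> (Nw ls) \<otimes>\<^bsub>G\<^esub> k \<otimes>\<^bsub>G\<^esub> Nw ls \<in> H" using ls by (simp add: Q_def)
    fix u assume u: "u \<in> Zvec n" and cm: "x u \<otimes>\<^bsub>G\<^esub> k = k \<otimes>\<^bsub>G\<^esub> x u"
    have "xl u ls = ls"
    proof (cases ls rule: rev_cases)
      case (snoc ms a)
      obtain r e where a: "a = (r, e)" by force
      \<comment> \<open>Otherwise \<open>k\<close> would also fix the vertex before the last edge of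
        \<open>ls\<close>, against minimality.\<close>
      have vL: "v \<notin> Ls e"
      proof
        assume vL: "v \<in> Ls e"
        have Lr: "r \<in> Zvec n"
        proof -
          have "ok (ms @ ys) \<Longrightarrow> ok ys" for ys by (induction ms) (auto elim: ok.elims)
          then show ?thesis using okl snoc a by fastforce
        qed
        have okm: "ok ms" using okl snoc ok_append_left by simp
        let ?h = "x r \<otimes>\<^bsub>G\<^esub> te e"
        have Nl: "Nw ls = Nw ms \<otimes>\<^bsub>G\<^esub> ?h" using snoc a by (simp add: Nw_append G.m_assoc)
        have "inv\<^bsub>G\<^esub> ?h \<otimes>\<^bsub>G\<^esub> (inv\<^bsub>G\<^esub> (Nw ms) \<otimes>\<^bsub>G\<^esub> k \<otimes>\<^bsub>G\<^esub> Nw ms) \<otimes>\<^bsub>G\<^esub> ?h = x v"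
          using G.conj_conj[of "Nw ms" ?h k] k(1) v(2) Nl by simp
        moreover have "z = ?h \<otimes>\<^bsub>G\<^esub> (inv\<^bsub>G\<^esub> ?h \<otimes>\<^bsub>G\<^esub> z \<otimes>\<^bsub>G\<^esub> ?h) \<otimes>\<^bsub>G\<^esub> inv\<^bsub>G\<^esub> ?h" if "z \<in> carrier G" for z
          using that G.inv_mult_cancel[of ?h] by (simp add: G.m_assoc)
        ultimately have "inv\<^bsub>G\<^esub> (Nw ms) \<otimes>\<^bsub>G\<^esub> k \<otimes>\<^bsub>G\<^esub> Nw ms = ?h \<otimes>\<^bsub>G\<^esub> x v \<otimes>\<^bsub>G\<^esub> inv\<^bsub>G\<^esub> ?h"
          using k(1) G.m_closed[OF G.m_closed[OF G.inv_closed[OF Nw_closed] k(1)] Nw_closed] by metis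
        also have "\<dots> = x r \<otimes>\<^bsub>G\<^esub> (te e \<otimes>\<^bsub>G\<^esub> x v) \<otimes>\<^bsub>G\<^esub> inv\<^bsub>G\<^esub> ?h" by (simp add: G.m_assoc)
        also have "\<dots> = x r \<otimes>\<^bsub>G\<^esub> x (Am e v) \<otimes>\<^bsub>G\<^esub> inv\<^bsub>G\<^esub> (x r)"
          unfolding te_x[OF vL] by (simp add: G.m_assoc G.inv_mult_group G.inv_mult_cancel)
        also have "\<dots> \<in> H"
          by (intro subgroup.m_closed[OF H_subgroup] subgroup.m_inv_closed[OF H_subgroup])
            (auto simp: H_def Lr intro: Ls_Z[OF Am_Ls[OF vL]])
        finally have "Q ms" using okm by (simp add: Q_def)
        then show False using min[of ms] snoc by simp
      qed
      let ?s = "act (inv\<^bsub>G\<^esub> (Nw ls)) base"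
      have hs: "hd_is ?s (0\<^sub>v n) (\<not> e)" using hd_is_inv_Nw[of ms r e] okl snoc a by simp
      have v0: "v + 0\<^sub>v n = v" using Zvec_carrier[OF v(1)] by simp
      have h2: "hd_is (act (x v) ?s) (rep e v) (\<not> e)" using hd_is_x[OF hs v(1)] unfolding v0 by simp
      have "\<not> hd_is (act (x v) ?s) (0\<^sub>v n) (\<not> e)" using hd_is_unique[OF h2] rep_0_iff[OF v(1)] vL by metis
      then have "\<exists>ms. fst (act (Nw ls) (act (x v) ?s)) = ls @ ms"
        using act_Nw_hd[OF okl _ hd_is_\<Omega>[OF h2]] snoc a by simp
      moreover have "act k base = act (Nw ls) (act (x v) ?s)"
        by (subst k_eq) (simp only: act_mult[OF Nw_closed G.m_closed[OF x_closed G.inv_closed[OF Nw_closed]]]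
            act_mult[OF x_closed G.inv_closed[OF Nw_closed]])
      ultimately obtain ks where ks: "path k = ls @ ks" unfolding path_def nf_def by auto
      \<comment> \<open>Multiplying \<open>k\<close> by \<open>x u\<close> on the right does not
        change the vertex \<open>kH\<close>, and on the left it acts by \<open>xl u\<close>; by
        commutation the results agree.\<close>
      have "xl u (path k) = path k" using path_H_mult[OF k(1) u] path_mult_H[OF k(1) u] cm by simp
      then show ?thesis using xl_append_left unfolding ks by blast
    qed simp
    moreover have "path (Nw ls) = ls"
      using path_val[OF okl vsubD(2)[OF vsub_Zvec]] by (simp add: x_zero)
    ultimately show "inv\<^bsub>G\<^esub> (Nw ls) \<otimes>\<^bsub>G\<^esub> x u \<otimes>\<^bsub>G\<^esub> Nw ls \<in> H" using conj_H_iff[OF Nw_closed u] by simp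
  qed simp
qed

text \<open>After a conjugation the earlier elements lie in \<open>H\<close> and commute with the
  new one, so \<open>elliptic_fixed_point\<close> provides a vertex that all of them fix.\<close>

theorem commuting_elliptics:
  assumes "finite K" "K \<subseteq> carrier G" "\<And>k. k \<in> K \<Longrightarrow> elliptic k"
    and "\<And>k l. k \<in> K \<Longrightarrow> l \<in> K \<Longrightarrow> k \<otimes>\<^bsub>G\<^esub> l = l \<otimes>\<^bsub>G\<^esub> k"
  shows "\<exists>c\<in>carrier G. \<forall>k\<in>K. inv\<^bsub>G\<^esub> c \<otimes>\<^bsub>G\<^esub> k \<otimes>\<^bsub>G\<^esub> c \<in> H"
  using assms
proof (induction K)
  case empty
  then show ?case by auto
next
  case (insert k K)
  then obtain c where c: "c \<in> carrier G" "\<And>l. l \<in> K \<Longrightarrow> inv\<^bsub>G\<^esub> c \<otimes>\<^bsub>G\<^esub> l \<otimes>\<^bsub>G\<^esub> c \<in> H" by auto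
  have k: "k \<in> carrier G" "elliptic k" using insert.prems by auto
  let ?f = "\<lambda>g. inv\<^bsub>G\<^esub> c \<otimes>\<^bsub>G\<^esub> g \<otimes>\<^bsub>G\<^esub> c"
  let ?k = "?f k"
  have f: "?f \<in> hom G G" using G.conj_aut[OF c(1)] by (simp add: iso_def)
  have kc: "?k \<in> carrier G" using k c by simp
  have "elliptic ?k"
  proof -
    obtain d where d: "d \<in> carrier G" "inv\<^bsub>G\<^esub> d \<otimes>\<^bsub>G\<^esub> k \<otimes>\<^bsub>G\<^esub> d \<in> H" using k(2) unfolding elliptic_def by blast
    let ?d = "inv\<^bsub>G\<^esub> c \<otimes>\<^bsub>G\<^esub> d"
    have dc: "?d \<in> carrier G" using c d by simp
    have "c \<otimes>\<^bsub>G\<^esub> ?d = d" using c d by (simp add: G.inv_mult_cancel)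
    then have "inv\<^bsub>G\<^esub> ?d \<otimes>\<^bsub>G\<^esub> ?k \<otimes>\<^bsub>G\<^esub> ?d = inv\<^bsub>G\<^esub> d \<otimes>\<^bsub>G\<^esub> k \<otimes>\<^bsub>G\<^esub> d"
      using G.conj_conj[OF c(1) dc k(1)] by simp
    then show ?thesis unfolding elliptic_def using d(2) dc by metis
  qed
  from elliptic_fixed_point[OF kc this] obtain g where g: "g \<in> carrier G" "inv\<^bsub>G\<^esub> g \<otimes>\<^bsub>G\<^esub> ?k \<otimes>\<^bsub>G\<^esub> g \<in> H"
    "\<forall>u\<in>Zvec n. x u \<otimes>\<^bsub>G\<^esub> ?k = ?k \<otimes>\<^bsub>G\<^esub> x u \<longrightarrow> inv\<^bsub>G\<^esub> g \<otimes>\<^bsub>G\<^esub> x u \<otimes>\<^bsub>G\<^esub> g \<in> H"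
    by (elim bexE conjE) (rule that)
  have "inv\<^bsub>G\<^esub> (c \<otimes>\<^bsub>G\<^esub> g) \<otimes>\<^bsub>G\<^esub> l \<otimes>\<^bsub>G\<^esub> (c \<otimes>\<^bsub>G\<^esub> g) \<in> H" if l: "l \<in> insert k K" for l
  proof -
    have lc: "l \<in> carrier G" using l insert.prems(1) by blast
    have "inv\<^bsub>G\<^esub> g \<otimes>\<^bsub>G\<^esub> ?f l \<otimes>\<^bsub>G\<^esub> g \<in> H"
    proof (cases "l = k")
      case False
      then have "?f l \<in> H" using c(2) l by blast
      then obtain u where u: "u \<in> Zvec n" "?f l = x u" by (auto simp: H_def)
      have "?f (l \<otimes>\<^bsub>G\<^esub> k) = ?f (k \<otimes>\<^bsub>G\<^esub> l)" using insert.prems(3)[OF l, of k] by simp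
      then have "?f l \<otimes>\<^bsub>G\<^esub> ?k = ?k \<otimes>\<^bsub>G\<^esub> ?f l" using hom_mult[OF f lc k(1)] hom_mult[OF f k(1) lc] by simp
      then show ?thesis using g(3)[rule_format, OF u(1)] u(2) by simp
    qed (use g(2) in simp)
    then show ?thesis using G.conj_conj[OF c(1) g(1) lc] by simp
  qed
  then show ?case using G.m_closed[OF c(1) g(1)] by blast
qed

text \<open>If \<open>H\<close> fixed a vertex \<open>hH\<close> other than its own, it would fix
  the first edge on the way there, and then the edge group \<open>Ls (\<not> e)\<close> would be all
  of Z^n.\<close>

lemma H_malnormal:
  assumes na: "\<And>e. Ls e \<noteq> Zvec n" and h: "h \<in> carrier G"
    and sub: "\<And>u. u \<in> Zvec n \<Longrightarrow> inv\<^bsub>G\<^esub> h \<otimes>\<^bsub>G\<^esub> x u \<otimes>\<^bsub>G\<^esub> h \<in> H"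
  shows "h \<in> H"
proof (rule ccontr)
  assume "h \<notin> H"
  then obtain r e ls where p: "path h = (r, e) # ls" using path_Nil_iff[OF h] by (cases "path h") auto
  have r: "r \<in> Zvec n" using path_ok[OF h] p by simp
  have "u \<in> Ls (\<not> e)" if u: "u \<in> Zvec n" for u
  proof -
    have "xl u (path h) = path h" using conj_H_iff[OF h u] sub[OF u] by simp
    then have rr: "rep (\<not> e) (u + r) = r" unfolding p by simp
    have "u + r - r = u" using Zvec_carrier[OF u] Zvec_carrier[OF r] by (intro eq_vecI) auto
    then show ?thesis using rep_props(2)[OF vsubD(3)[OF vsub_Zvec u r], of "\<not> e"] unfolding rr by simp
  qed
  then show False using na[of "\<not> e"] Ls_Z by blast
qed

section \<open>Exponents, heights and edge stabilizers\<close>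

interpretation V: sdp_data n A "carrier_vec n"
  by unfold_locales (auto simp: A vsub_carrier)

text \<open>Over the full rational space every power of \<open>A\<close> acts, so this target exists
  for ascending and non-ascending groups alike. It separates the elements of \<open>H\<close> and
  records the exponent of the stable letter.\<close>

lemma affine_rep:
  "\<exists>h\<in>hom G (sdp n A (carrier_vec n)). (\<forall>v\<in>Zvec n. h (x v) = (v, 0)) \<and> h t = (0\<^sub>v n, 1)"
proof -
  have 1: "(\<lambda>v. (v, 0)) \<in> hom (vgrp n (Zvec n)) V.S"
    using V.embed_hom Zvec_carrier by (auto simp: hom_def)
  have 2: "(0\<^sub>v n, 1) \<in> carrier V.S" by simp
  obtain h where "h \<in> hom G V.S" "\<And>v. v \<in> Zvec n \<Longrightarrow> h (x v) = (v, 0)" "h t = (0\<^sub>v n, 1)"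
    using hom_exists[OF V.S.group_axioms 1 2 V.t_embed[OF L_carrier]] by metis
  then show ?thesis by blast
qed

definition aff :: "lm_gen word set \<Rightarrow> rat vec \<times> int" where
  "aff = (SOME h. h \<in> hom G (sdp n A (carrier_vec n)) \<and> (\<forall>v\<in>Zvec n. h (x v) = (v, 0)) \<and> h t = (0\<^sub>v n, 1))"

lemma aff_props:
  "aff \<in> hom G (sdp n A (carrier_vec n))" "v \<in> Zvec n \<Longrightarrow> aff (x v) = (v, 0)" "aff t = (0\<^sub>v n, 1)"
proof -
  have "\<exists>h. h \<in> hom G (sdp n A (carrier_vec n)) \<and> (\<forall>v\<in>Zvec n. h (x v) = (v, 0)) \<and> h t = (0\<^sub>v n, 1)"
    using affine_rep by blast
  from someI_ex[OF this, folded aff_def]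
  show "aff \<in> hom G (sdp n A (carrier_vec n))" "v \<in> Zvec n \<Longrightarrow> aff (x v) = (v, 0)" "aff t = (0\<^sub>v n, 1)" by auto
qed

definition expo :: "lm_gen word set \<Rightarrow> int" where "expo g = snd (aff g)"

lemma expo_hom: "expo \<in> hom G zgrp"
  using aff_props(1) by (auto simp: hom_def expo_def)

lemma expo_x: "v \<in> Zvec n \<Longrightarrow> expo (x v) = 0" and expo_t: "expo t = 1"
  using aff_props by (simp_all add: expo_def)

sublocale expo: group_hom G zgrp expo
  by (intro group_hom.intro group_hom_axioms.intro G.group_axioms group_zgrp expo_hom)

lemma x_inj: "v \<in> Zvec n \<Longrightarrow> w \<in> Zvec n \<Longrightarrow> x v = x w \<Longrightarrow> v = w"
  using aff_props(2) by (metis prod.inject)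

text \<open>In the affine image the translation part of \<open>g\<close> cancels, and only its
  exponent acts on \<open>u\<close>.\<close>

lemma conj_x_mact:
  assumes g: "g \<in> carrier G" and u: "u \<in> Zvec n" "w \<in> Zvec n" and eq: "g \<otimes>\<^bsub>G\<^esub> x u = x w \<otimes>\<^bsub>G\<^esub> g"
  shows "w = mact n A (expo g) u"
proof -
  interpret a: group_hom G V.S aff
    by (intro group_hom.intro group_hom_axioms.intro G.group_axioms V.S.group_axioms aff_props)
  obtain c j where c: "aff g = (c, j)" by force
  have cc: "c \<in> carrier_vec n" using a.hom_closed[OF g] c by simp
  have "aff g \<otimes>\<^bsub>V.S\<^esub> aff (x u) = aff (x w) \<otimes>\<^bsub>V.S\<^esub> aff g"
    using a.hom_mult[OF g x_closed] a.hom_mult[OF x_closed g] eq by metis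
  then have eq: "c + mact n A j u = w + c" using aff_props(2) u cc c by (simp add: mact_0[OF A])
  show ?thesis
  proof (rule eq_vecI)
    show "dim_vec w = dim_vec (mact n A (expo g) u)" using Zvec_carrier[OF u(2)] carrier_vecD[OF mact_closed[OF A]] by simp
    fix i assume "i < dim_vec (mact n A (expo g) u)"
    then show "w $ i = mact n A (expo g) u $ i"
      using arg_cong[OF eq, of "\<lambda>z. z $ i"] cc Zvec_carrier[OF u(2)] carrier_vecD[OF mact_closed[OF A, of j u]] c
      by (simp add: expo_def)
  qed
qed

fun height :: "(rat vec \<times> bool) list \<Rightarrow> int" where
  "height [] = 0"
| "height ((r, e) # ls) = (if e then 1 else - 1) + height ls"

lemma expo_Nw: "ok ls \<Longrightarrow> expo (Nw ls) = height ls"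
proof (induction ls)
  case Nil
  then show ?case using expo.hom_one by simp
next
  case (Cons a ls)
  obtain r e where a: "a = (r, e)" by force
  have r: "r \<in> Zvec n" "ok ls" using Cons.prems a by auto
  have "inv\<^bsub>zgrp\<^esub> 1 = - 1" by (rule group.inv_equality[OF group_zgrp]) auto
  then have "expo (te e) = (if e then 1 else - 1)" using expo.hom_inv[OF t_closed] expo_t by (simp add: te_def)
  then show ?case using a expo_x[OF r(1)] Cons.IH[OF r(2)] by simp
qed

text \<open>Along a fixed path the vector carried at height \<open>i\<close> is
  \<open>A\<^sup>-\<^sup>iu\<close>, and it lies in the group of each edge that is crossed. A path
  from height \<open>0\<close> to height \<open>h\<close> crosses all levels in between; upward
  edges contribute \<open>Ls False\<close> and downward edges \<open>Ls True\<close>.\<close>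

lemma fixed_path_levels:
  "ok ls \<Longrightarrow> u \<in> Zvec n \<Longrightarrow> xl u ls = ls \<Longrightarrow>
    (\<forall>i. 0 \<le> i \<and> i < - height ls \<longrightarrow> mact n A i u \<in> Ls True) \<and>
    (\<forall>i. 0 \<le> i \<and> i < height ls \<longrightarrow> mact n A (- i) u \<in> Ls False)"
proof (induction ls arbitrary: u)
  case (Cons a ls)
  obtain r e where a: "a = (r, e)" by force
  have r: "r \<in> Zvec n" "ok ls" using Cons.prems a by auto
  have rr: "rep (\<not> e) (u + r) = r" using Cons.prems(3) a by simp
  have ur: "u + r - r = u" using Zvec_carrier[OF Cons.prems(2)] Zvec_carrier[OF r(1)] by (intro eq_vecI) auto
  have uL: "u \<in> Ls (\<not> e)"
    using rep_props(2)[OF vsubD(3)[OF vsub_Zvec Cons.prems(2) r(1)], of "\<not> e"] unfolding rr ur .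
  let ?u = "Am (\<not> e) u"
  have fx: "xl ?u ls = ls" using Cons.prems(3) a rr ur by simp
  note IH = Cons.IH[OF r(2) Ls_Z[OF Am_Ls[OF uL]] fx]
  note uc = Zvec_carrier[OF Cons.prems(2)]
  show ?case
  proof (cases e)
    case True
    have m: "mact n A i (Am False u) = mact n A (i - 1) u" for i
      using mact_plus[OF A uc, of i "- 1"] True by (simp add: Am_def)
    have "mact n A i u \<in> Ls True" if "0 \<le> i" "i < - height (a # ls)" for i
      using IH[THEN conjunct1, rule_format, of "i + 1"] that a True by (simp add: m)
    moreover have "mact n A (- i) u \<in> Ls False" if i: "0 \<le> i" "i < height (a # ls)" for i
    proof (cases "i = 0")
      case True
      then show ?thesis using uL \<open>e\<close> by (simp add: mact_0[OF A uc])
    next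
      case False
      then show ?thesis using IH[THEN conjunct2, rule_format, of "i - 1"] i a True by (simp add: m)
    qed
    ultimately show ?thesis by blast
  next
    case False
    have m: "mact n A i (Am True u) = mact n A (i + 1) u" for i
      using mact_plus[OF A uc, of i 1] False by (simp add: Am_def)
    have "mact n A (- i) u \<in> Ls False" if "0 \<le> i" "i < height (a # ls)" for i
      using IH[THEN conjunct2, rule_format, of "i + 1"] that a False by (simp add: m)
    moreover have "mact n A i u \<in> Ls True" if i: "0 \<le> i" "i < - height (a # ls)" for i
    proof (cases "i = 0")
      case True
      then show ?thesis using uL False by (simp add: mact_0[OF A uc])
    next
      case F: False
      then show ?thesis using IH[THEN conjunct1, rule_format, of "i - 1"] i a False by (simp add: m)
    qed
    ultimately show ?thesis by blast
  qed
qed auto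

text \<open>A path from height \<open>0\<close> to height \<open>\<plusminus>1\<close> in the Bass--Serre tree crosses an edge between these
  heights, and the stabilizer of that edge is a translate of \<open>L\<close> or \<open>A L\<close>.\<close>

theorem conj_x_domain:
  assumes g: "g \<in> carrier G" and u: "u \<in> Zvec n" "w \<in> Zvec n" and eq: "g \<otimes>\<^bsub>G\<^esub> x u = x w \<otimes>\<^bsub>G\<^esub> g"
    and e: "expo g = (if e then 1 else - 1)"
  shows "u \<in> Ls e"
proof -
  \<comment> \<open>In terms of \<open>?h\<close> the relation says that \<open>x u\<close> fixes
    the vertex with path \<open>path ?h\<close>. Its height is minus the exponent of
    \<open>g\<close>, so level \<open>0\<close> of that path gives the claim.\<close>
  let ?h = "inv\<^bsub>G\<^esub> g"
  have h: "?h \<in> carrier G" using g by simp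
  have "inv\<^bsub>G\<^esub> ?h \<otimes>\<^bsub>G\<^esub> x u \<otimes>\<^bsub>G\<^esub> ?h = x w" using g eq by (simp add: G.m_assoc)
  then have fx: "xl u (path ?h) = path ?h" using conj_H_iff[OF h u(1)] u(2) by (auto simp: H_def)
  obtain v where v: "v \<in> Zvec n" "?h = Nw (path ?h) \<otimes>\<^bsub>G\<^esub> x v" using path_decomp[OF h] by blast
  have "expo (Nw (path ?h) \<otimes>\<^bsub>G\<^esub> x v) = height (path ?h)"
    using expo.hom_mult[OF Nw_closed x_closed, of "path ?h" v] by (simp add: expo_x[OF v(1)] expo_Nw[OF path_ok[OF h]])
  then have "expo ?h = height (path ?h)" using v(2) by (rule subst[OF sym, rotated])
  moreover have "inv\<^bsub>zgrp\<^esub> j = - j" for j by (rule group.inv_equality[OF group_zgrp]) auto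
  then have "expo ?h = - expo g" using expo.hom_inv[OF g] by simp
  ultimately have ht: "height (path ?h) = - (if e then 1 else - 1)" using e by simp
  note lv = fixed_path_levels[OF path_ok[OF h] u(1) fx]
  show ?thesis
  proof (cases e)
    case True
    then show ?thesis using lv[THEN conjunct1, rule_format, of 0] ht mact_0[OF A Zvec_carrier[OF u(1)]] by simp
  next
    case False
    then show ?thesis using lv[THEN conjunct2, rule_format, of 0] ht mact_0[OF A Zvec_carrier[OF u(1)]] by simp
  qed
qed

end

section \<open>Isomorphisms between non-ascending groups\<close>

definition metabelian :: "('a, 'b) monoid_scheme \<Rightarrow> bool" where
  "metabelian G \<longleftrightarrow> (\<forall>a\<in>carrier G. \<forall>b\<in>carrier G. \<forall>c\<in>carrier G. \<forall>d\<in>carrier G.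
    commutator G (commutator G a b) (commutator G c d) = \<one>\<^bsub>G\<^esub>)"

lemma metabelian_iso:
  assumes "group G" "group K" and iso: "G \<cong> K" and K: "metabelian K"
  shows "metabelian G"
  unfolding metabelian_def
proof (intro ballI)
  interpret G: group G by fact
  obtain h where h: "h \<in> iso G K" using iso by (auto simp: is_iso_def)
  interpret h: group_hom G K h using assms h by (simp add: group_hom_def group_hom_axioms_def iso_def)
  fix a b c d assume g: "a \<in> carrier G" "b \<in> carrier G" "c \<in> carrier G" "d \<in> carrier G"
  let ?g = "commutator G (commutator G a b) (commutator G c d)"
  have gc: "?g \<in> carrier G" using g by simp
  have "h ?g = \<one>\<^bsub>K\<^esub>" using g K by (simp add: h.hom_commutator metabelian_def)
  then have "h ?g = h \<one>\<^bsub>G\<^esub>" by simp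
  moreover have "inj_on h (carrier G)" using h by (simp add: iso_def bij_betw_def)
  ultimately show "?g = \<one>\<^bsub>G\<^esub>" using inj_onD gc G.one_closed by metis
qed

context lm_data
begin

text \<open>An isomorphism-invariant property separates the ascending groups from the others, so no
  isomorphism connects the two kinds.\<close>

lemma metabelian_iff: "metabelian G \<longleftrightarrow> L = Zvec n \<or> mat_image A L = Zvec n"
proof
  assume m: "metabelian G"
  show "L = Zvec n \<or> mat_image A L = Zvec n"
  proof (rule ccontr)
    assume "\<not> (L = Zvec n \<or> mat_image A L = Zvec n)"
    then have na: "Ls True \<noteq> Zvec n" "Ls False \<noteq> Zvec n" by (simp_all add: Ls_def)
    show False
      by (rule not_metabelian[OF na]) (use m in \<open>simp add: metabelian_def\<close>)
  qed
next
  assume asc: "L = Zvec n \<or> mat_image A L = Zvec n"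
  interpret S: sdp_data n A "lat n A" by (rule sdp_data_lat[OF A ascendingI[OF asc]])
  have "metabelian S.S" using sdp_metabelian[OF S.sdp_data_axioms] unfolding metabelian_def by blast
  then show "metabelian G"
    by (rule metabelian_iso[OF G.group_axioms S.S.group_axioms ascending_sdp_iso[OF asc]])
qed

text \<open>The images of the finitely many generators commute, and they are elliptic because
  isomorphisms preserve \<open>virt_comm\<close>. A common fixed vertex then takes care of all
  integral vectors.\<close>

lemma iso_conj_into_H:
  assumes na: "\<And>e. Ls e \<noteq> Zvec n" and "lm_data n' A' L'" and h: "h \<in> iso (lm_group n' A' L') G"
  shows "\<exists>c\<in>carrier G. \<forall>v\<in>Zvec n'. inv\<^bsub>G\<^esub> c \<otimes>\<^bsub>G\<^esub> h (lm_x n' A' L' v) \<otimes>\<^bsub>G\<^esub> c \<in> H"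
proof -
  interpret D: lm_data n' A' L' by fact
  interpret h: group_hom D.G G h
    using h by (simp add: group_hom_def group_hom_axioms_def iso_def G.group_axioms D.G.group_axioms)
  let ?K = "(\<lambda>i. h (D.x (unit_vec n' i))) ` {..<n'}"
  have "\<exists>c\<in>carrier G. \<forall>k\<in>?K. inv\<^bsub>G\<^esub> c \<otimes>\<^bsub>G\<^esub> k \<otimes>\<^bsub>G\<^esub> c \<in> H"
  proof (rule commuting_elliptics)
    show "elliptic k" if "k \<in> ?K" for k
      using that virt_comm_iso[OF D.G.group_axioms G.group_axioms h D.x_closed D.x_virt_comm]
      by (auto intro!: virt_comm_elliptic[OF na])
    show "k \<otimes>\<^bsub>G\<^esub> l = l \<otimes>\<^bsub>G\<^esub> k" if "k \<in> ?K" "l \<in> ?K" for k l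
    proof -
      obtain i j where "k = h (D.x (unit_vec n' i))" "l = h (D.x (unit_vec n' j))" using \<open>k \<in> ?K\<close> \<open>l \<in> ?K\<close> by blast
      then show ?thesis using D.x_comm[of "unit_vec n' i" "unit_vec n' j"] by (simp flip: h.hom_mult)
    qed
  qed auto
  then obtain c where c: "c \<in> carrier G" "\<forall>k\<in>?K. inv\<^bsub>G\<^esub> c \<otimes>\<^bsub>G\<^esub> k \<otimes>\<^bsub>G\<^esub> c \<in> H" by blast
  let ?f = "\<lambda>g. inv\<^bsub>G\<^esub> c \<otimes>\<^bsub>G\<^esub> h g \<otimes>\<^bsub>G\<^esub> c"
  have "(\<lambda>g. inv\<^bsub>G\<^esub> c \<otimes>\<^bsub>G\<^esub> g \<otimes>\<^bsub>G\<^esub> c) \<circ> h \<in> iso D.G G" by (rule iso_set_trans[OF h G.conj_aut[OF c(1)]])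
  then interpret f: group_hom D.G G ?f
    by (simp add: group_hom_def group_hom_axioms_def iso_def G.group_axioms D.G.group_axioms comp_def)
  note Hs = subgroup.m_closed[OF H_subgroup] subgroup.m_inv_closed[OF H_subgroup] subgroup.one_closed[OF H_subgroup]
  have "?f (D.x v) \<in> H" if v: "v \<in> Zvec n'" for v
    using v
  proof (rule Zvec_induct)
    show "?f (D.x (unit_vec n' i)) \<in> H" if "i < n'" for i using c(2) that by blast
    show "?f (D.x (0\<^sub>v n')) \<in> H" unfolding D.x_zero f.hom_one by (rule Hs(3))
    show "?f (D.x (u + w)) \<in> H" if "u \<in> Zvec n'" "w \<in> Zvec n'" "?f (D.x u) \<in> H" "?f (D.x w) \<in> H" for u w
      unfolding D.x_add[OF that(1,2)] f.hom_mult[OF D.x_closed D.x_closed] by (rule Hs(1)[OF that(3,4)])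
    show "?f (D.x (- u)) \<in> H" if "u \<in> Zvec n'" "?f (D.x u) \<in> H" for u
      unfolding D.x_uminus[OF that(1)] f.hom_inv[OF D.x_closed] by (rule Hs(2)[OF that(2)])
  qed
  then show ?thesis using c(1) by blast
qed

end

locale lm_iso = D: lm_data n A L + D': lm_data n' A' L'
  for n :: nat and A :: "rat mat" and L :: "rat vec set"
    and n' :: nat and A' :: "rat mat" and L' :: "rat vec set" +
  assumes na: "\<And>e. D.Ls e \<noteq> Zvec n" and na': "\<And>e. D'.Ls e \<noteq> Zvec n'"
begin

text \<open>A conjugated isomorphism \<open>h\<close> maps the base group into the base group, and
  its inverse \<open>k\<close> maps the other base group into the conjugate of \<open>D.H\<close> by
  \<open>d\<close>. Hence \<open>D.H\<close> lies in that conjugate, \<open>H_malnormal\<close>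
  gives \<open>d \<in> D.H\<close>, and the first inclusion becomes an equality.\<close>

lemma iso_preserving_H:
  assumes "D.G \<cong> D'.G"
  shows "\<exists>h\<in>iso D.G D'.G. h ` D.H = D'.H"
proof -
  obtain h\<^sub>0 where h0: "h\<^sub>0 \<in> iso D.G D'.G" using assms by (auto simp: is_iso_def)
  obtain c where c: "c \<in> carrier D'.G" "\<forall>v\<in>Zvec n. inv\<^bsub>D'.G\<^esub> c \<otimes>\<^bsub>D'.G\<^esub> h\<^sub>0 (D.x v) \<otimes>\<^bsub>D'.G\<^esub> c \<in> D'.H"
    using D'.iso_conj_into_H[OF na' D.lm_data_axioms h0] by blast
  define h where "h = (\<lambda>g. inv\<^bsub>D'.G\<^esub> c \<otimes>\<^bsub>D'.G\<^esub> g \<otimes>\<^bsub>D'.G\<^esub> c) \<circ> h\<^sub>0"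
  have h: "h \<in> iso D.G D'.G" unfolding h_def by (rule iso_set_trans[OF h0 D'.G.conj_aut[OF c(1)]])
  have hx: "h (D.x v) \<in> D'.H" if "v \<in> Zvec n" for v using c(2) that by (simp add: h_def)
  define k where "k = inv_into (carrier D.G) h"
  have k: "k \<in> iso D'.G D.G" unfolding k_def by (rule D.G.iso_set_sym[OF h])
  have bij: "bij_betw h (carrier D.G) (carrier D'.G)" using h by (simp add: iso_def)
  have kh: "k (h g) = g" if "g \<in> carrier D.G" for g unfolding k_def using bij that by (simp add: bij_betw_inv_into_left)
  have hk: "h (k g) = g" if "g \<in> carrier D'.G" for g unfolding k_def using bij that by (simp add: bij_betw_inv_into_right)
  obtain d where d: "d \<in> carrier D.G" "\<forall>v\<in>Zvec n'. inv\<^bsub>D.G\<^esub> d \<otimes>\<^bsub>D.G\<^esub> k (D'.x v) \<otimes>\<^bsub>D.G\<^esub> d \<in> D.H"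
    using D.iso_conj_into_H[OF na D'.lm_data_axioms k] by blast
  have "inv\<^bsub>D.G\<^esub> d \<otimes>\<^bsub>D.G\<^esub> D.x u \<otimes>\<^bsub>D.G\<^esub> d \<in> D.H" if u: "u \<in> Zvec n" for u
  proof -
    obtain w where w: "w \<in> Zvec n'" "h (D.x u) = D'.x w" using hx[OF u] by (auto simp: D'.H_def)
    then have "k (D'.x w) = D.x u" using kh[of "D.x u"] by simp
    then show ?thesis using d(2) w(1) by metis
  qed
  then have dH: "d \<in> D.H" by (rule D.H_malnormal[OF na d(1)])
  note Hs = subgroup.m_closed[OF D.H_subgroup] subgroup.m_inv_closed[OF D.H_subgroup]
  have "k (D'.x v) \<in> D.H" if v: "v \<in> Zvec n'" for v
  proof -
    let ?g = "k (D'.x v)"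
    have gc: "?g \<in> carrier D.G" using k by (auto simp: iso_def hom_def)
    have "d \<otimes>\<^bsub>D.G\<^esub> (inv\<^bsub>D.G\<^esub> d \<otimes>\<^bsub>D.G\<^esub> ?g \<otimes>\<^bsub>D.G\<^esub> d) \<otimes>\<^bsub>D.G\<^esub> inv\<^bsub>D.G\<^esub> d \<in> D.H"
      using d(2) v by (intro Hs(1)[OF Hs(1)[OF dH] Hs(2)[OF dH]]) blast
    then show ?thesis using gc d(1) by (simp add: D.G.m_assoc D.G.inv_mult_cancel)
  qed
  then have "D'.x v \<in> h ` D.H" if "v \<in> Zvec n'" for v
    using hk[OF D'.x_closed, of v] that by (metis imageI)
  then have "h ` D.H = D'.H" using hx by (auto simp: D.H_def D'.H_def)
  then show ?thesis using h by blast
qed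

lemma iso_linear_on_H:
  assumes "D.G \<cong> D'.G"
  shows "n = n' \<and> (\<exists>h\<in>iso D.G D'.G. \<exists>B\<in>GLZ n. \<forall>v\<in>Zvec n. h (D.x v) = D'.x (B *\<^sub>v v))"
proof -
  obtain h where h: "h \<in> iso D.G D'.G" "h ` D.H = D'.H" using iso_preserving_H[OF assms] by blast
  have hm: "h (g \<otimes>\<^bsub>D.G\<^esub> k) = h g \<otimes>\<^bsub>D'.G\<^esub> h k" if "g \<in> carrier D.G" "k \<in> carrier D.G" for g k
    using h(1) that by (simp add: iso_def hom_def)
  have hinj: "inj_on h (carrier D.G)" using h(1) by (simp add: iso_def bij_betw_def)
  have "\<forall>v\<in>Zvec n. \<exists>w. w \<in> Zvec n' \<and> h (D.x v) = D'.x w" using h(2) unfolding D.H_def D'.H_def by blast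
  from bchoice[OF this] obtain b where b: "\<forall>v\<in>Zvec n. b v \<in> Zvec n' \<and> h (D.x v) = D'.x (b v)" by blast
  have bZ: "b v \<in> Zvec n'" and hb: "h (D.x v) = D'.x (b v)" if "v \<in> Zvec n" for v using b that by blast+
  have "b \<in> iso (vgrp n (Zvec n)) (vgrp n' (Zvec n'))"
    unfolding iso_def hom_def bij_betw_def
  proof (simp, intro conjI ballI)
    show "b \<in> Zvec n \<rightarrow> Zvec n'" using bZ by blast
    show "b (u + v) = b u + b v" if uv: "u \<in> Zvec n" "v \<in> Zvec n" for u v
    proof (rule D'.x_inj)
      have "D'.x (b (u + v)) = h (D.x u \<otimes>\<^bsub>D.G\<^esub> D.x v)" using hb[OF vsubD(3)[OF vsub_Zvec uv]] D.x_add[OF uv] by simp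
      also have "\<dots> = D'.x (b u + b v)" using hb uv D'.x_add[OF bZ bZ] by (simp add: hm)
      finally show "D'.x (b (u + v)) = D'.x (b u + b v)" .
    qed (use bZ uv vsubD(3)[OF vsub_Zvec] in auto)
    show "inj_on b (Zvec n)"
    proof (rule inj_onI)
      fix u v assume uv: "u \<in> Zvec n" "v \<in> Zvec n" "b u = b v"
      then have "h (D.x u) = h (D.x v)" using hb by simp
      then have "D.x u = D.x v" using inj_onD[OF hinj] by simp
      then show "u = v" by (rule D.x_inj[OF uv(1,2)])
    qed
    show "b ` Zvec n = Zvec n'"
    proof
      show "b ` Zvec n \<subseteq> Zvec n'" using bZ by blast
      show "Zvec n' \<subseteq> b ` Zvec n"
      proof
        fix w assume w: "w \<in> Zvec n'"
        then obtain v where v: "v \<in> Zvec n" "D'.x w = h (D.x v)" using h(2) unfolding D.H_def D'.H_def by blast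
        then have "w = b v" using D'.x_inj[OF w bZ] hb by simp
        then show "w \<in> b ` Zvec n" using v(1) by blast
      qed
    qed
  qed
  from vgrp_iso_matrix[OF vsub_Zvec subset_refl vsub_Zvec subset_refl this]
  obtain B where B: "n = n'" "B \<in> carrier (GLQ n)" "mat_image B (Zvec n) = Zvec n'" "\<forall>u\<in>Zvec n. b u = B *\<^sub>v u"
    by blast
  then have "B \<in> GLZ n" using GLZ_iff by simp
  moreover have "\<forall>v\<in>Zvec n. h (D.x v) = D'.x (B *\<^sub>v v)" using hb B(4) by simp
  ultimately show ?thesis using B(1) h(1) by blast
qed

text \<open>Both base groups have exponent zero, so \<open>h\<close> multiplies exponents by a
  constant, which surjectivity makes \<open>1\<close> or \<open>- 1\<close>. By
  \<open>conj_x_domain\<close> an element of exponent \<open>1\<close> or \<open>- 1\<close>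
  conjugates only vectors of the corresponding edge group into the base group; used on both sides,
  this identifies the edge groups.\<close>

theorem non_ascending_iso_cases:
  assumes "D.G \<cong> D'.G"
  shows "n = n' \<and> (\<exists>B\<in>GLZ n.
    (A' = B * A * inv\<^bsub>GLQ n\<^esub> B \<and> L' = mat_image B L) \<or>
    (A' = B * inv\<^bsub>GLQ n\<^esub> A * inv\<^bsub>GLQ n\<^esub> B \<and> L' = mat_image (B * A) L))"
proof -
  obtain h B where n': "n = n'" and h: "h \<in> iso D.G D'.G" and B: "B \<in> GLZ n"
    and hB: "\<forall>v\<in>Zvec n. h (D.x v) = D'.x (B *\<^sub>v v)" using iso_linear_on_H[OF assms] by blast
  let ?C = "inv\<^bsub>GLQ n\<^esub> B"
  note Bd = GLZ_D[OF B]
  note c = Bd(2) GLQ_inv[OF Bd(1)] GLQ_carrier_mat[OF D.A]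
  have A': "A' \<in> carrier (GLQ n)" using D'.A n' by simp
  interpret h: group_hom D.G D'.G h
    using h by (simp add: group_hom_def group_hom_axioms_def iso_def D.G.group_axioms D'.G.group_axioms)
  have bij: "bij_betw h (carrier D.G) (carrier D'.G)" using h by (simp add: iso_def)
  let ?\<epsilon> = "D'.expo (h D.t)"
  have exp: "D'.expo (h g) = ?\<epsilon> * D.expo g" if g: "g \<in> carrier D.G" for g
  proof (rule D.homs_eqI[OF group_zgrp _ _ _ _ g])
    show "(\<lambda>g. D'.expo (h g)) \<in> hom D.G zgrp" by (auto simp: hom_def)
    show "(\<lambda>g. ?\<epsilon> * D.expo g) \<in> hom D.G zgrp" by (auto simp: hom_def algebra_simps)
    show "D'.expo (h (D.x v)) = ?\<epsilon> * D.expo (D.x v)" if v: "v \<in> Zvec n" for v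
    proof -
      have "B *\<^sub>v v \<in> Zvec n'" using Bd(3)[OF v] unfolding n' .
      from D'.expo_x[OF this] have "D'.expo (h (D.x v)) = 0" unfolding bspec[OF hB v] .
      then show ?thesis using D.expo_x[OF v] by (simp only: mult_zero_right)
    qed
  qed (simp add: D.expo_t)
  \<comment> \<open>A preimage of the stable letter of the target makes the argument available in
    the opposite direction.\<close>
  obtain s where s: "s \<in> carrier D.G" "h s = D'.t"
    using bij D'.t_closed unfolding bij_betw_def by (metis imageE)
  have \<epsilon>s: "?\<epsilon> * D.expo s = 1" using exp[OF s(1)] s(2) D'.expo_t by simp
  then obtain e where e: "?\<epsilon> = (if e then 1 else - 1)" using zmult_eq_1_iff[of ?\<epsilon> "D.expo s"] by (metis (full_types))
  then have es: "D.expo s = (if e then 1 else - 1)" using \<epsilon>s by (simp split: if_splits)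
  have 1: "B *\<^sub>v v \<in> D'.Ls e \<and> B *\<^sub>v (A *\<^sub>v v) = mact n A' ?\<epsilon> (B *\<^sub>v v)" if v: "v \<in> L" for v
  proof -
    have Z: "v \<in> Zvec n" "A *\<^sub>v v \<in> Zvec n" using v D.L_Zvec D.ALZ by auto
    have "h (D.t \<otimes>\<^bsub>D.G\<^esub> D.x v) = h (D.x (A *\<^sub>v v) \<otimes>\<^bsub>D.G\<^esub> D.t)" using D.t_x[OF v] by simp
    then have eq: "h D.t \<otimes>\<^bsub>D'.G\<^esub> D'.x (B *\<^sub>v v) = D'.x (B *\<^sub>v (A *\<^sub>v v)) \<otimes>\<^bsub>D'.G\<^esub> h D.t"
      using hB Z by simp
    have hZ: "B *\<^sub>v v \<in> Zvec n'" "B *\<^sub>v (A *\<^sub>v v) \<in> Zvec n'" using Bd(3) Z n' by auto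
    show ?thesis
      using D'.conj_x_domain[OF h.hom_closed[OF D.t_closed] hZ eq e] D'.conj_x_mact[OF h.hom_closed[OF D.t_closed] hZ eq]
      unfolding n' by blast
  qed
  have 2: "?C *\<^sub>v v \<in> D.Ls e" if v: "v \<in> L'" for v
  proof -
    have Z: "v \<in> Zvec n" "A' *\<^sub>v v \<in> Zvec n" using v D'.L_Zvec D'.ALZ n' by auto
    have hC: "h (D.x (?C *\<^sub>v w)) = D'.x w" if "w \<in> Zvec n" for w
      using hB Bd(4)[OF that] GLQ_inv_cancel(1)[OF Bd(1) Zvec_carrier[OF that]] by simp
    have "h (s \<otimes>\<^bsub>D.G\<^esub> D.x (?C *\<^sub>v v)) = h (D.x (?C *\<^sub>v (A' *\<^sub>v v)) \<otimes>\<^bsub>D.G\<^esub> s)"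
      using D'.t_x[OF v] s hC[OF Z(1)] hC[OF Z(2)] by simp
    then have "s \<otimes>\<^bsub>D.G\<^esub> D.x (?C *\<^sub>v v) = D.x (?C *\<^sub>v (A' *\<^sub>v v)) \<otimes>\<^bsub>D.G\<^esub> s"
      by (rule inj_onD[OF bij_betw_imp_inj_on[OF bij] _ D.G.m_closed[OF s(1) D.x_closed] D.G.m_closed[OF D.x_closed s(1)]])
    from D.conj_x_domain[OF s(1) Bd(4)[OF Z(1)] Bd(4)[OF Z(2)] this es] show ?thesis .
  qed
  let ?P = "A' [^]\<^bsub>GLQ n\<^esub> ?\<epsilon>"
  note P = GLQ_int_pow[OF A', of ?\<epsilon>]
  have PB: "?P * B = B * A"
  proof (rule mat_eq_by_unit_vecs)
    show "?P * B \<in> carrier_mat n n" "B * A \<in> carrier_mat n n" using P c by auto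
    fix j assume "j < n"
    let ?u = "unit_vec n j :: rat vec"
    \<comment> \<open>The equation is known on \<open>L\<close> from \<open>1\<close>; a multiple of
      each unit vector lies there, and the factor is cancelled at the end.\<close>
    obtain m where m: "m \<ge> 1" "of_nat m \<cdot>\<^sub>v ?u \<in> L" using D.tor[of ?u] by auto
    have u: "?u \<in> carrier_vec n" by simp
    have "B *\<^sub>v (A *\<^sub>v (of_nat m \<cdot>\<^sub>v ?u)) = ?P *\<^sub>v (B *\<^sub>v (of_nat m \<cdot>\<^sub>v ?u))"
      using 1[OF m(2)] by (simp add: mact_def)
    moreover have "A *\<^sub>v (of_nat m \<cdot>\<^sub>v ?u) = of_nat m \<cdot>\<^sub>v (A *\<^sub>v ?u)" "B *\<^sub>v (of_nat m \<cdot>\<^sub>v ?u) = of_nat m \<cdot>\<^sub>v (B *\<^sub>v ?u)"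
      using c u by (simp_all add: mult_mat_vec)
    moreover have "B *\<^sub>v (of_nat m \<cdot>\<^sub>v (A *\<^sub>v ?u)) = of_nat m \<cdot>\<^sub>v (B *\<^sub>v (A *\<^sub>v ?u))"
      "?P *\<^sub>v (of_nat m \<cdot>\<^sub>v (B *\<^sub>v ?u)) = of_nat m \<cdot>\<^sub>v (?P *\<^sub>v (B *\<^sub>v ?u))"
      by (rule mult_mat_vec[of _ n n], use c P u in auto)+
    ultimately have "(of_nat m :: rat) \<cdot>\<^sub>v (?P *\<^sub>v (B *\<^sub>v ?u)) = of_nat m \<cdot>\<^sub>v (B *\<^sub>v (A *\<^sub>v ?u))" by simp
    then have "?P *\<^sub>v (B *\<^sub>v ?u) = B *\<^sub>v (A *\<^sub>v ?u)"
      by (rule smult_cancel[of "of_nat m" _ _ n, rotated]) (use m(1) c P in auto)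
    then show "?P * B *\<^sub>v ?u = B * A *\<^sub>v ?u"
      using assoc_mult_mat_vec[OF P(2) c(1) u] assoc_mult_mat_vec[OF c(1) c(6) u] by simp
  qed
  have "(A' = B * A * ?C \<and> L' = mat_image B L) \<or> (A' = B * inv\<^bsub>GLQ n\<^esub> A * ?C \<and> L' = mat_image (B * A) L)"
  proof (cases e)
    case True
    then have "A' = B * A * ?C" using PB e A' by (intro GLQ_conj_eqI Bd(1) D.A) (simp_all add: GLQ_int_pow_1)
    moreover have "L' = mat_image B L"
    proof
      show "mat_image B L \<subseteq> L'" using 1 True by (auto simp: D'.Ls_def mat_image_def)
      show "L' \<subseteq> mat_image B L"
      proof
        fix v assume v: "v \<in> L'"
        have "v = B *\<^sub>v (?C *\<^sub>v v)"
          using GLQ_inv_cancel(1)[OF Bd(1)] D'.L_carrier[OF v] n' by simp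
        then show "v \<in> mat_image B L" using 2[OF v] True unfolding mat_image_def D.Ls_def by auto
      qed
    qed
    ultimately show ?thesis by blast
  next
    case False
    have iB: "inv\<^bsub>GLQ n\<^esub> A' * B = B * A" using PB e False A' by (simp add: GLQ_int_pow_neg1)
    have "inv\<^bsub>GLQ n\<^esub> A' = B * A * ?C" using iB by (rule GLQ_conj_eqI[OF Bd(1) D.A GLQ_inv(1)[OF A']])
    then have "A' = inv\<^bsub>GLQ n\<^esub> (B * A * ?C)" using GLQ_inv_inv[OF A'] by simp
    also have "\<dots> = B * (inv\<^bsub>GLQ n\<^esub> A * ?C)"
      using GLQ_inv_mult[OF GLQ_mult[OF Bd(1) D.A] c(2)] GLQ_inv_mult[OF Bd(1) D.A] GLQ_inv_inv[OF Bd(1)] by simp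
    also have "\<dots> = B * inv\<^bsub>GLQ n\<^esub> A * ?C"
      by (rule assoc_mult_mat[symmetric, OF c(1) GLQ_inv(2)[OF D.A] c(3)])
    finally have "A' = B * inv\<^bsub>GLQ n\<^esub> A * ?C" .
    moreover have "L' = mat_image (B * A) L"
    proof -
      have BA: "(B * A) *\<^sub>v v = B *\<^sub>v (A *\<^sub>v v)" if "v \<in> L" for v
        by (rule assoc_mult_mat_vec[OF c(1) c(6) D.L_carrier[OF that]])
      have "(B * A) *\<^sub>v v \<in> L'" if v: "v \<in> L" for v
      proof -
        obtain w where w: "w \<in> L'" "B *\<^sub>v v = A' *\<^sub>v w" using 1[OF v] False by (auto simp: D'.Ls_def mat_image_def)
        have "B *\<^sub>v (A *\<^sub>v v) = inv\<^bsub>GLQ n\<^esub> A' *\<^sub>v (B *\<^sub>v v)" using 1[OF v] e False by (simp add: mact_neg1[OF A'])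
        also have "\<dots> = w" unfolding w(2) using GLQ_inv_cancel(2)[OF A'] D'.L_carrier[OF w(1)] n' by simp
        finally show ?thesis using w(1) BA[OF v] by simp
      qed
      moreover have "v \<in> mat_image (B * A) L" if v: "v \<in> L'" for v
      proof -
        obtain w where w: "w \<in> L" "?C *\<^sub>v v = A *\<^sub>v w" using 2[OF v] False by (auto simp: D.Ls_def mat_image_def)
        have "v = B *\<^sub>v (?C *\<^sub>v v)" using GLQ_inv_cancel(1)[OF Bd(1)] D'.L_carrier[OF v] n' by simp
        then have "v = (B * A) *\<^sub>v w" using w BA by simp
        then show ?thesis using w(1) by (auto simp: mat_image_def)
      qed
      ultimately show ?thesis by (auto simp: mat_image_def)
    qed
    ultimately show ?thesis by blast
  qed
  then show ?thesis using n' B by blast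
qed

end

section \<open>The classification\<close>

text \<open>Such a matrix maps Z^n bijectively onto itself, so either of the two equations implies
  the other.\<close>

lemma ascending_finite_index_GLZ:
  assumes "A \<in> GLZ n" "L \<subseteq> carrier_vec n" "L = Zvec n \<or> mat_image A L = Zvec n"
  shows "L = Zvec n" "mat_image A L = Zvec n"
proof -
  note Ad = GLZ_D[OF assms(1)]
  have Z: "mat_image A (Zvec n) = Zvec n" using assms(1) GLZ_iff by blast
  have "L = Zvec n" if "mat_image A L = Zvec n"
    using mat_image_inv_cancel(1)[OF Ad(1) assms(2)] mat_image_inv_cancel(1)[OF Ad(1), of "Zvec n"] Zvec_carrier that Z by auto
  then show L: "L = Zvec n" using assms(3) by blast
  then show "mat_image A L = Zvec n" using Z by simp
qed

theorem theorem1p1: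
  fixes n n' :: nat and A A' :: "rat mat" and L L' :: "rat vec set"
  assumes "A \<in> carrier (GLQ n)" and "A' \<in> carrier (GLQ n')"
    and "admissible n A L" and "admissible n' A' L'"
  shows "lm_group n A L \<cong> lm_group n' A' L' \<longleftrightarrow>
    n = n' \<and>
    ((\<exists>B\<in>GLZ n.
        (A' = B * A * inv\<^bsub>GLQ n\<^esub> B \<and> L' = mat_image B L) \<or>
        (A' = B * inv\<^bsub>GLQ n\<^esub> A * inv\<^bsub>GLQ n\<^esub> B \<and> L' = mat_image (B * A) L))
     \<or>
     ((L = Zvec n \<or> mat_image A L = Zvec n) \<and>
      (L' = Zvec n \<or> mat_image A' L' = Zvec n) \<and>
      (\<exists>B\<in>carrier (GLQ n).
        (\<exists>\<epsilon>\<in>{1, -1 :: int}. A' = B * (A [^]\<^bsub>GLQ n\<^esub> \<epsilon>) * inv\<^bsub>GLQ n\<^esub> B) \<and>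
        (\<Union>j::int. mat_image (A [^]\<^bsub>GLQ n\<^esub> j) (Zvec n)) =
        (\<Union>j::int. mat_image (A [^]\<^bsub>GLQ n\<^esub> j * inv\<^bsub>GLQ n\<^esub> B) (Zvec n))))
     \<or>
     (n \<ge> 1 \<and>
      L = Zvec n \<and> mat_image A L = Zvec n \<and> L' = Zvec n \<and> mat_image A' L' = Zvec n \<and>
      (\<exists>C\<in>GLZ (n - 1). \<exists>m::nat. m = group.ord (GLQ (n - 1)) C \<and> m > 0 \<and>
        (\<exists>u\<in>Zvec (n - 1). \<exists>q::int. gcd q (int m) = 1 \<and>
          conjugate_GLZ n A (lower_block n u C) \<and>
          conjugate_GLZ n A' (lower_block n u (C [^]\<^bsub>GLQ (n - 1)\<^esub> q))))))"
  (is "?iso \<longleftrightarrow> n = n' \<and> (?i \<or> ?ii \<or> ?iii)")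
proof -
  interpret D: lm_data n A L by (rule admissible_lm_data[OF assms(1,3)])
  interpret D': lm_data n' A' L' by (rule admissible_lm_data[OF assms(2,4)])
  let ?asc = "L = Zvec n \<or> mat_image A L = Zvec n"
  let ?asc' = "L' = Zvec n' \<or> mat_image A' L' = Zvec n'"
  show ?thesis
  proof (intro iffI)
    assume iso: ?iso
    \<comment> \<open>Being metabelian decides for both groups simultaneously whether they are
      ascending.\<close>
    have asc: "?asc \<longleftrightarrow> ?asc'"
      using metabelian_iso[OF D.G.group_axioms D'.G.group_axioms iso]
        metabelian_iso[OF D'.G.group_axioms D.G.group_axioms D.G.iso_sym[OF iso]]
        D.metabelian_iff D'.metabelian_iff by blast
    show "n = n' \<and> (?i \<or> ?ii \<or> ?iii)"
    proof (cases ?asc)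
      case True
      then have True': ?asc' using asc by blast
      have "sdp n A (lat n A) \<cong> sdp n' A' (lat n' A')"
        using D.G.iso_sym[OF D.ascending_sdp_iso[OF True]] iso D'.ascending_sdp_iso[OF True'] iso_trans by metis
      note cs = sdp_lat_iso_cases[OF D.A D'.A D.ascendingI[OF True] D'.ascendingI[OF True'] this]
      have n': "n = n'" using cs by (rule conjunct1)
      show ?thesis
        using cs[THEN conjunct2]
      proof
        assume "n \<ge> 1 \<and> A \<in> GLZ n \<and> A' \<in> GLZ n \<and>
          (\<exists>C\<in>GLZ (n - 1). \<exists>m::nat. m = group.ord (GLQ (n - 1)) C \<and> m > 0 \<and>
          (\<exists>u\<in>Zvec (n - 1). \<exists>q::int. gcd q (int m) = 1 \<and>
            conjugate_GLZ n A (lower_block n u C) \<and>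
            conjugate_GLZ n A' (lower_block n u (C [^]\<^bsub>GLQ (n - 1)\<^esub> q))))"
          (is "_ \<and> _ \<and> _ \<and> ?C")
        note z = conjunct1[OF this] conjunct1[OF conjunct2[OF this]] conjunct1[OF conjunct2[OF conjunct2[OF this]]]
          conjunct2[OF conjunct2[OF conjunct2[OF this]]]
        have "L \<subseteq> carrier_vec n" "L' \<subseteq> carrier_vec n" using D.L_carrier D'.L_carrier n' by auto
        then have "?iii"
          using z ascending_finite_index_GLZ[OF z(2) _ True] ascending_finite_index_GLZ[OF z(3) _ True'[folded n']]
          by (intro conjI) assumption+
        then show ?thesis using n' by blast
      qed (use n' True True' in blast)
    next
      case False
      then have na: "D.Ls e \<noteq> Zvec n" for e by (simp add: D.Ls_def)
      have na': "D'.Ls e \<noteq> Zvec n'" for e using False asc by (simp add: D'.Ls_def)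
      interpret lm_iso n A L n' A' L' by unfold_locales (use na na' in auto)
      show ?thesis using non_ascending_iso_cases[OF iso] by blast
    qed
  next
    assume "n = n' \<and> (?i \<or> ?ii \<or> ?iii)"
    then have n': "n = n'" and cs: "?i \<or> ?ii \<or> ?iii" by auto
    have D': "lm_data n A' L'" using D'.lm_data_axioms n' by simp
    have A': "A' \<in> carrier (GLQ n)" using assms(2) n' by simp
    have "lm_group n A L \<cong> lm_group n A' L'" using cs
    proof (elim disjE)
      assume ?i
      then show ?thesis using D.conj_iso[OF D'] D.conj_inv_iso[OF D'] by blast
    next
      assume ii: ?ii
      then have asc: ?asc "L' = Zvec n \<or> mat_image A' L' = Zvec n" by blast+
      obtain B e where B: "B \<in> carrier (GLQ n)" "e \<in> {1, -1 :: int}" "A' = B * (A [^]\<^bsub>GLQ n\<^esub> e) * inv\<^bsub>GLQ n\<^esub> B"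
        "(\<Union>j::int. mat_image (A [^]\<^bsub>GLQ n\<^esub> j) (Zvec n)) =
        (\<Union>j::int. mat_image (A [^]\<^bsub>GLQ n\<^esub> j * inv\<^bsub>GLQ n\<^esub> B) (Zvec n))" using ii by blast
      have "sdp n A (lat n A) \<cong> sdp n A' (lat n A')"
        by (rule sdp_lat_iso[OF D.A A' B(1) D.ascendingI[OF asc(1)] B(2,3,4)])
      moreover have "sdp n A' (lat n A') \<cong> lm_group n A' L'"
        using group.iso_sym[OF group_lm_group lm_data.ascending_sdp_iso[OF D' asc(2)]] .
      ultimately show ?thesis using D.ascending_sdp_iso[OF asc(1)] iso_trans by metis
    next
      assume iii: ?iii
      then have L: "L = Zvec n" "mat_image A L = Zvec n" "L' = Zvec n" "mat_image A' L' = Zvec n" "n \<ge> 1" by blast+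
      obtain k where k: "n = Suc k" using L(5) by (cases n) auto
      have AZ: "A \<in> GLZ n" "A' \<in> GLZ n" using L D.A A' GLZ_iff by auto
      obtain C m u q where "C \<in> GLZ k" "m = group.ord (GLQ k) C" "m > 0" "u \<in> Zvec k"
        "gcd q (int m) = 1" "conjugate_GLZ (Suc k) A (lower_block (Suc k) u C)"
        "conjugate_GLZ (Suc k) A' (lower_block (Suc k) u (C [^]\<^bsub>GLQ k\<^esub> q))"
        using iii unfolding k diff_Suc_1 by (elim conjE bexE exE) (rule that; assumption)
      from finite_order_iso[OF AZ[unfolded k] this] show ?thesis unfolding k L(1)[unfolded k] L(3)[unfolded k] .
    qed
    then show ?iso using n' by simp
  qed
qed

end
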